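(* For all $\kappa,L,M,\omega>0$ there exists a constant $C$, depending only on $\kappa,L,M,\omega$, such that for every $f\in\mathcal{C}(\kappa,L,M,\omega)$ and every integer $N\ge 2$, $$\inf_{\varphi\in\Sigma_N}\|f-\varphi\|_{L_2(D)}\;\le\; C\,(\log N)\,N^{-1}.$$ Here $D=(0,1)^2$, $\mathcal{C}(\kappa,L,M,\omega)$ is the class of cartoon-like functions on $D$, and $\Sigma_N$ is the union of the spaces of discontinuous piecewise affine functions over all partitions of $D$ obtained from the unit square by at most $N$ successive splits of the types (R1), (R2), (R3).
   Context: Let $D=(0,1)^2$. Cartoon class. Let $\mathcal{O}$ be the class of nonempty simply connected domains $\Omega\subset\mathbb{R}^2$ with a $C^2$-boundary. Let $\mathrm{curv}(\partial\Omega)$ denote the curvature of $\partial\Omega\cap D$ (the bound $\mathrm{curv}(\partial\Omega)\le\kappa$ means that the absolute curvature is at most $\kappa$ at every point), and let $|\partial\Omega\cap D|$ denote the length of $\partial\Omega\cap D$. For $x\in\mathbb{R}^2$ and $\zeta>0$ let $B_\zeta(x)=\{x'\in\mathbb{R}^2:|x-x'|<\zeta\}$. The separation width of $\Omega$ is $$\rho(\Omega):=\sup\{\zeta>0:\ \text{for all } x\in\partial\Omega,\ \partial\Omega\cap B_\zeta(x)\text{ contains a single connected arc of }\partial\Omega\},$$ i.e. $\partial\Omega\cap B_\zeta(x)$ consists of one connected arc. For $\kappa,L,M,\omega>0$ define $$\mathcal{C}(\kappa,L,M,\omega):=\{f_1\chi_\Omega+f_2\chi_{D\setminus\Omega}:\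 \Omega\subset D,\ \Omega\in\mathcal{O},\ |\partial\Omega\cap D|\le L,\ \partial\Omega\cap D\in C^2,\ \rho(\Omega)\ge\omega,\ \mathrm{curv}(\partial\Omega)\le\kappa,\ \|f_i^{(l)}\|_{L_\infty(D)}\le M,\ l\le 2,\ i=1,2\},$$ where $\chi_A$ is the indicator function of $A$ and $\|f_i^{(l)}\|_{L_\infty(D)}\le M$ for $l\le 2$ means that all partial derivatives of $f_i$ of order $l=0,1,2$ are bounded by $M$ on $D$. Split rules. The initial partition consists of the single cell $D$ (the unit square). A partition whose cells are triangles and quadrilaterals is refined by choosing one cell $Q$ and splitting it into two cells by a line segment according to one of the following rules: (R1) connect a vertex of $Q$ with the midpoint of an edge of $Q$ not containing that vertex; (R2) connect two vertices of $Q$ (opposite vertices of a quadrilateral); (R3) connect the midpoints of two edges of $Q$ which, when $Q$ is a quadrilateral, do not share any vertex. These rules produce only triangles and quadrilaterals. Approximants. For a partition $\mathcal{T}$, $\mathbb{P}_1(\mathcal{T})$ is the space of (in general discontinuous) functions whose restriction to each cell of $\mathcal{T}$ is a polynomial of degree at most $1$ in two variables. $\Sigma_N$ is the union of the spaces $\mathbb{P}_1(\mathcal{T})$ over all partitions $\mathcal{T}$ generated from the unit square by any combination of at most $N$ successive splits (R1)--(R3). *)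

theory Defs
  imports "HOL-Analysis.Analysis"
begin

type_synonym point = "real \<times> real"

definition unit_dom :: "point set" where
  "unit_dom = {0<..<1} \<times> {0<..<1}"


definition C2_on :: "(real \<Rightarrow> 'a::real_normed_vector) \<Rightarrow> real set \<Rightarrow> bool" where
  "C2_on g S \<longleftrightarrow>
     (\<exists>g'. (\<forall>t\<in>S. (g has_vector_derivative g' t) (at t)) \<and> g' C1_differentiable_on S)"

definition orthonormal_pair :: "point \<Rightarrow> point \<Rightarrow> bool" where
  "orthonormal_pair e n \<longleftrightarrow> norm e = 1 \<and> norm n = 1 \<and> e \<bullet> n = 0"

text \<open>In suitable Cartesian coordinates the set is locally the strict epigraph of a
  \<open>C\<^sup>2\<close> function; in particular it lies on one side of its boundary.\<close>

definition C2_boundary :: "point set \<Rightarrow> bool" where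
  "C2_boundary \<Omega> \<longleftrightarrow>
     (\<forall>p\<in>frontier \<Omega>. \<exists>r>0. \<exists>e n g. orthonormal_pair e n \<and> C2_on g UNIV \<and>
        \<Omega> \<inter> ball p r = {x \<in> ball p r. g (x \<bullet> e) < x \<bullet> n})"

definition C2_curve :: "point set \<Rightarrow> bool" where
  "C2_curve S \<longleftrightarrow>
     (\<forall>p\<in>S. \<exists>r>0. \<exists>e n g. orthonormal_pair e n \<and> C2_on g UNIV \<and>
        S \<inter> ball p r = {x \<in> ball p r. x \<bullet> n = g (x \<bullet> e)})"

definition simply_connected_C2_domains :: "point set set" where
  "simply_connected_C2_domains =
     {\<Omega>. \<Omega> \<noteq> {} \<and> open \<Omega> \<and> connected \<Omega> \<and> simply_connected \<Omega> \<and> C2_boundary \<Omega>}"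

text \<open>Length of a subset of the plane is its one-dimensional Hausdorff measure, normalised so
  that a segment has its usual length. Boundedness of the covering sets is required because
  \<^const>\<open>diameter\<close> is only meaningful for bounded sets.\<close>

definition hausdorff1_pre :: "real \<Rightarrow> point set \<Rightarrow> ennreal" where
  "hausdorff1_pre \<delta> S =
     (INF U \<in> {U :: nat \<Rightarrow> point set.
                 S \<subseteq> (\<Union>i. U i) \<and> (\<forall>i. bounded (U i) \<and> diameter (U i) \<le> \<delta>)}.
        (\<Sum>i. ennreal (diameter (U i))))"

definition curve_length :: "point set \<Rightarrow> ennreal" where
  "curve_length S = (SUP \<delta>\<in>{0<..}. hausdorff1_pre \<delta> S)"

definition abs_curvature :: "(real \<Rightarrow> point) \<Rightarrow> real \<Rightarrow> real" where
  "abs_curvature \<gamma> t =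
     (let v = vector_derivative \<gamma> (at t);
          w = vector_derivative (\<lambda>s. vector_derivative \<gamma> (at s)) (at t)
      in \<bar>fst v * snd w - snd v * fst w\<bar> / norm v ^ 3)"

text \<open>\<open>k\<close> is the absolute curvature of \<open>S\<close> at \<open>p\<close>, computed from a \<open>C\<^sup>2\<close> parametrisation
  through \<open>p\<close> that is regular there. If \<open>S\<close> is a \<open>C\<^sup>2\<close> curve, such a parametrisation exists
  at each point of \<open>S\<close> and \<open>k\<close> does not depend on its choice.\<close>

definition has_abs_curvature :: "point set \<Rightarrow> point \<Rightarrow> real \<Rightarrow> bool" where
  "has_abs_curvature S p k \<longleftrightarrow>
     (\<exists>\<gamma> a b t. a < t \<and> t < b \<and> C2_on \<gamma> {a<..<b} \<and> \<gamma> ` {a<..<b} \<subseteq> S \<and>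
        \<gamma> t = p \<and> vector_derivative \<gamma> (at t) \<noteq> 0 \<and> k = abs_curvature \<gamma> t)"

definition curvature_le :: "point set \<Rightarrow> real \<Rightarrow> bool" where
  "curvature_le S \<kappa> \<longleftrightarrow> (\<forall>p\<in>S. \<forall>k. has_abs_curvature S p k \<longrightarrow> k \<le> \<kappa>)"

text \<open>A piece of the boundary cut out by an open ball is relatively open in the boundary, so an
  arc means a homeomorphic copy of an open interval. Asking for connectedness alone would be
  void: a ball containing the whole closed boundary curve would always qualify, and the
  supremum would be infinite.\<close>

definition separation_width :: "point set \<Rightarrow> ereal" where
  "separation_width \<Omega> =
     Sup (ereal ` {\<zeta>. \<zeta> > 0 \<and>
       (\<forall>x\<in>frontier \<Omega>. (frontier \<Omega> \<inter> ball x \<zeta>) homeomorphic {0<..<1::real})})"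

text \<open>The classical partial derivatives of order at most two exist on the unit square (in both
  orders of differentiation for the mixed ones) and are bounded by \<open>M\<close>.\<close>

definition partials_bounded :: "(point \<Rightarrow> real) \<Rightarrow> real \<Rightarrow> bool" where
  "partials_bounded f M \<longleftrightarrow>
     (\<exists>f1 f2 f11 f12 f21 f22 :: point \<Rightarrow> real. \<forall>x y. (x, y) \<in> unit_dom \<longrightarrow>
        ((\<lambda>s. f (s, y)) has_real_derivative f1 (x, y)) (at x) \<and>
        ((\<lambda>s. f (x, s)) has_real_derivative f2 (x, y)) (at y) \<and>
        ((\<lambda>s. f1 (s, y)) has_real_derivative f11 (x, y)) (at x) \<and>
        ((\<lambda>s. f1 (x, s)) has_real_derivative f12 (x, y)) (at y) \<and>
        ((\<lambda>s. f2 (s, y)) has_real_derivative f21 (x, y)) (at x) \<and>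
        ((\<lambda>s. f2 (x, s)) has_real_derivative f22 (x, y)) (at y) \<and>
        (\<forall>h \<in> {f, f1, f2, f11, f12, f21, f22}. \<bar>h (x, y)\<bar> \<le> M))"

definition cartoon_class :: "real \<Rightarrow> real \<Rightarrow> real \<Rightarrow> real \<Rightarrow> (point \<Rightarrow> real) set" where
  "cartoon_class \<kappa> L M \<omega> =
     {(\<lambda>x. f1 x * indicator \<Omega> x + f2 x * indicator (unit_dom - \<Omega>) x) | f1 f2 \<Omega>.
        \<Omega> \<subseteq> unit_dom \<and> \<Omega> \<in> simply_connected_C2_domains \<and>
        curve_length (frontier \<Omega> \<inter> unit_dom) \<le> ennreal L \<and>
        C2_curve (frontier \<Omega> \<inter> unit_dom) \<and>
        separation_width \<Omega> \<ge> ereal \<omega> \<and>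
        curvature_le (frontier \<Omega> \<inter> unit_dom) \<kappa> \<and>
        partials_bounded f1 M \<and> partials_bounded f2 M}"


text \<open>A cell is given by the list of its three or four vertices in cyclic order. Rule \<open>rotate\<close>
  makes the choice of the first vertex irrelevant, so each other rule is stated for one position
  of the splitting segment only (two when a vertex of a quadrilateral is joined to a midpoint, since either of the two
  edges not containing the vertex \<open>a\<close> may be bisected).\<close>

type_synonym cell = "point list"

inductive split_cell :: "cell \<Rightarrow> cell \<Rightarrow> cell \<Rightarrow> bool" where
  vertex_midpoint_tri: "split_cell [a, b, c] [a, b, midpoint b c] [a, midpoint b c, c]"
| vertex_midpoint_quad: "split_cell [a, b, c, d] [a, b, midpoint b c] [a, midpoint b c, c, d]"
| vertex_midpoint_quad': "split_cell [a, b, c, d] [a, b, c, midpoint c d] [a, midpoint c d, d]"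
| vertex_vertex_quad: "split_cell [a, b, c, d] [a, b, c] [a, c, d]"
| midpoint_midpoint_tri: "split_cell [a, b, c]
    [a, midpoint a b, midpoint a c] [midpoint a b, b, c, midpoint a c]"
| midpoint_midpoint_quad: "split_cell [a, b, c, d]
    [a, midpoint a b, midpoint c d, d] [midpoint a b, b, c, midpoint c d]"
| rotate: "split_cell (rotate1 Q) Q1 Q2 \<Longrightarrow> split_cell Q Q1 Q2"

inductive partition_after :: "nat \<Rightarrow> cell set \<Rightarrow> bool" where
  initial: "partition_after 0 {[(0, 0), (1, 0), (1, 1), (0, 1)]}"
| split: "partition_after n \<T> \<Longrightarrow> Q \<in> \<T> \<Longrightarrow> split_cell Q Q1 Q2 \<Longrightarrow>
    partition_after (Suc n) ((\<T> - {Q}) \<union> {Q1, Q2})"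

text \<open>The approximants may jump across edges, so being affine is demanded on the open cells only;
  the values on the edges, which form a null set, are left free.\<close>

definition piecewise_affine :: "cell set \<Rightarrow> (point \<Rightarrow> real) set" where
  "piecewise_affine \<T> =
     {\<phi>. \<forall>Q\<in>\<T>. \<exists>a b c. \<forall>(x, y) \<in> interior (convex hull (set Q)). \<phi> (x, y) = a + b * x + c * y}"

definition approximants :: "nat \<Rightarrow> (point \<Rightarrow> real) set" where
  "approximants N = \<Union> {piecewise_affine \<T> | \<T> n. n \<le> N \<and> partition_after n \<T>}"

text \<open>Integration is with respect to the completed Lebesgue measure, so that values on null sets
  never affect measurability.\<close>

definition L2_norm :: "(point \<Rightarrow> real) \<Rightarrow> real" where
  "L2_norm h = sqrt (LINT x:unit_dom|lebesgue. (h x)\<^sup>2)"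

end

theory Submission imports Defs
begin

text \<open>The approximants resolve the boundary curve at two scales. Put \<open>b = 2 ^ -j\<close>. Off the boundary a
  grid of about \<open>b ^ -2\<close> squares of side \<open>b\<close> suffices, since a function with bounded second derivatives
  is affine up to \<open>O(b\<^sup>2)\<close> there. A curve with bounded curvature meets only \<open>O(1 / b)\<close> of these
  squares. Each of them is cut into \<open>1 / b\<close> slabs of width \<open>w = b\<^sup>2\<close>, and in a slab the curve stays
  within \<open>O(w\<^sup>2) = O(b ^ 4)\<close> of its tangent. So the cells of the square
  on which the function is not smooth can be confined to strips of total area \<open>O(b ^ 5)\<close>, and all crossed
  squares together contribute area \<open>O(b ^ 4)\<close>. The resulting \<open>L\<^sub>2\<close> error is \<open>O(b\<^sup>2)\<close>.

  The price is the number of splits. A strip of slope \<open>m\<close> has to be cut out of a slab with the rules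
  at hand, which can only bisect edges. Bisecting the vertical sides of the slab towards the strip
  takes \<open>O(j)\<close> splits until the remaining excess is negligible (\<open>isolate_strip\<close>); it is this binary search
  that causes the logarithm. In total there are \<open>O(j * 4 ^ j)\<close> splits, so that a budget of \<open>N\<close> splits allows
  \<open>b\<^sup>2 = O(ln N / N)\<close> (\<open>level_for_budget\<close>, \<open>piecewise_approximation\<close>).

  A complication arises inside a crossed square from slabs in which the strip leaves the square through the
  top or the bottom. There the strip is replaced by a horizontal band, whose area is proportional to the
  slope. If this happens in two slabs at distance \<open>d\<close>, then the curve has returned to the same side of the
  square, and by the curvature bound its slopes there are \<open>O(d)\<close>. Summing over
  neighbouring slabs bounds the total of the slopes by \<open>O(b)\<close>, apart from boundedly many steep slabs, which
  are subdivided further (\<open>sum_spaced\<close>, \<open>isolate_square\<close>).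

  All geometric constants must depend on the curvature bound and the separation width only. What is needed of
  the geometry is \<open>local_tangent_bound\<close>: over sets of a certain fixed size the whole boundary is a graph
  of bounded slope in one of the two coordinate directions, with second order contact with its
  tangents. The curvature bound gives this along a short piece of the boundary curve; the separation
  width has to exclude that another part of the boundary comes close. For
  this, consider a pair of points that are close in the plane but not along the curve, at minimal
  distance. The chord between them is perpendicular to the curve at both ends and misses the
  boundary otherwise, so it lies entirely inside or entirely outside the domain, which makes the
  tangents at the two points opposite (\<open>min_pair_false\<close>). Thus the curve is pinched between two antiparallel strands.
  The condition on the separation width says that balls of a fixed radius meet the boundary in an arc.
  It does not exclude a pinch at once, because a ball around one of the points may contain the whole
  piece of curve between them. The proof that it does so nevertheless (\<open>pinch_impossible\<close>) looks at the
  first and at the last point of the rest of the curve whose ball no longer contains that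
  piece. They turn out to be close together and to lie opposite to the pinch, on two strands that run
  in the other direction; the ball around a point of the strand nearer to the pinch then meets
  the curve in a disconnected set.\<close>


section \<open>Plane curves with bounded curvature\<close>

definition perp :: "point \<Rightarrow> point" where
  "perp v = (- snd v, fst v)"

lemma perp_simps [simp]: "norm (perp v) = norm v" "v \<bullet> perp v = 0" "perp v \<bullet> v = 0"
  "perp (- v) = - perp v"
  by (auto simp: perp_def norm_prod_def inner_prod_def add.commute mult.commute)

lemma norm_perp_decomp:
  assumes "norm v = 1"
  shows "(norm w)\<^sup>2 = (w \<bullet> v)\<^sup>2 + (w \<bullet> perp v)\<^sup>2"
proof -
  have 1: "(fst v)\<^sup>2 + (snd v)\<^sup>2 = 1"
    using assms by (simp add: norm_prod_def real_sqrt_eq_1_iff)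
  have "(w \<bullet> v)\<^sup>2 + (w \<bullet> perp v)\<^sup>2 = ((fst w)\<^sup>2 + (snd w)\<^sup>2) * ((fst v)\<^sup>2 + (snd v)\<^sup>2)"
    by (simp add: perp_def inner_prod_def algebra_simps power2_eq_square)
  then show ?thesis using 1 by (simp add: norm_prod_def)
qed

lemma norm_add_sq: "(norm (x + y :: 'a::real_inner))\<^sup>2 = (norm x)\<^sup>2 + 2 * (x \<bullet> y) + (norm y)\<^sup>2"
  by (simp add: power2_norm_eq_inner inner_simps inner_commute algebra_simps)

lemma norm_diff_sq: "(norm (x - y :: 'a::real_inner))\<^sup>2 = (norm x)\<^sup>2 - 2 * (x \<bullet> y) + (norm y)\<^sup>2"
  by (simp add: power2_norm_eq_inner inner_simps inner_commute algebra_simps)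

locale bounded_curvature_curve =
  fixes g g' :: "real \<Rightarrow> point" and \<kappa> :: real
  assumes deriv: "\<And>t. (g has_vector_derivative g' t) (at t)"
    and speed: "\<And>t. norm (g' t) = 1"
    and lip: "\<And>s t. norm (g' s - g' t) \<le> \<kappa> * \<bar>s - t\<bar>"
    and kappa_ge: "\<kappa> \<ge> 1"
begin

lemma cont: "continuous_on S g"
  by (meson deriv continuous_at_imp_continuous_on has_vector_derivative_continuous)

lemma cont_deriv: "continuous_on S g'"
proof -
  have "\<kappa>-lipschitz_on UNIV g'"
    using lip kappa_ge by (auto simp: lipschitz_on_def dist_norm)
  then show ?thesis using lipschitz_on_continuous_on continuous_on_subset by blast
qed

text \<open>The mean value inequality gives the constant \<open>\<kappa>\<close>, twice that of the integral form of the
  remainder.\<close>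

lemma taylor: "norm (g (t + s) - g t - s *\<^sub>R g' t) \<le> \<kappa> * s\<^sup>2"
proof -
  let ?h = "\<lambda>x. g (t + x) - x *\<^sub>R g' t"
  have d: "(?h has_vector_derivative (g' (t + x) - g' t)) (at x within S)" for x S
  proof -
    have "((\<lambda>x. g (t + x)) has_vector_derivative g' (t + x)) (at x)"
    proof -
      have "((\<lambda>x. t + x) has_vector_derivative 1) (at x)" by (auto intro!: derivative_eq_intros)
      from vector_diff_chain_at[OF this deriv] show ?thesis by (simp add: o_def)
    qed
    then have "((\<lambda>x. g (t + x)) has_vector_derivative g' (t + x)) (at x within S)"
      by (rule has_vector_derivative_at_within)
    then show ?thesis by (auto intro!: derivative_eq_intros)
  qed
  have b: "norm (g' (t + x) - g' t) \<le> \<kappa> * \<bar>s\<bar>" if "x \<in> closed_segment 0 s" for x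
  proof -
    have "\<bar>x\<bar> \<le> \<bar>s\<bar>" using that by (auto simp: closed_segment_eq_real_ivl split: if_splits)
    then have "\<kappa> * \<bar>x\<bar> \<le> \<kappa> * \<bar>s\<bar>" using kappa_ge by (intro mult_left_mono) auto
    then show ?thesis using lip[of "t+x" t] by simp
  qed
  have "norm (?h s - ?h 0) \<le> (\<kappa> * \<bar>s\<bar>) * norm (s - 0)"
  proof (rule differentiable_bound[where S = "closed_segment 0 s" and f' = "\<lambda>x u. u *\<^sub>R (g' (t + x) - g' t)"])
    show "convex (closed_segment 0 s)" by simp
    show "(?h has_derivative (\<lambda>u. u *\<^sub>R (g' (t + x) - g' t))) (at x within closed_segment 0 s)" for x
      using d by (simp add: has_vector_derivative_def)
    show "onorm (\<lambda>u. u *\<^sub>R (g' (t + x) - g' t)) \<le> \<kappa> * \<bar>s\<bar>" if "x \<in> closed_segment 0 s" for x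
    proof -
      have "onorm (\<lambda>u. u *\<^sub>R (g' (t + x) - g' t)) \<le> norm (g' (t + x) - g' t)"
        by (rule onorm_le) simp
      then show ?thesis using b[OF that] by linarith
    qed
  qed auto
  moreover have eq: "?h s - ?h 0 = g (t + s) - g t - s *\<^sub>R g' t" by (simp add: algebra_simps)
  ultimately have "norm (g (t + s) - g t - s *\<^sub>R g' t) \<le> (\<kappa> * \<bar>s\<bar>) * norm (s - 0)"
    by (simp only: eq)
  moreover have "(\<kappa> * \<bar>s\<bar>) * norm (s - 0) = \<kappa> * s\<^sup>2"
    by (simp add: power2_eq_square)
  ultimately show ?thesis by (simp only:)
qed

lemma dist_le: "norm (g s - g t) \<le> \<bar>s - t\<bar>"
proof -
  have "norm (g s - g t) \<le> 1 * norm (s - t)"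
  proof (rule differentiable_bound[where S = UNIV and f' = "\<lambda>x u. u *\<^sub>R g' x"])
    show "(g has_derivative (\<lambda>u. u *\<^sub>R g' x)) (at x within UNIV)" for x
      using deriv[of x] by (simp add: has_vector_derivative_def)
    show "onorm (\<lambda>u. u *\<^sub>R g' x) \<le> 1" for x
      by (rule onorm_le) (simp add: speed)
  qed auto
  then show ?thesis by simp
qed

text \<open>Change of the squared distance to a fixed point \<open>c\<close> along the curve, to second order; the sign of
  the radial velocity \<open>g' t \<bullet> (g t - c)\<close> decides whether the curve enters or leaves a ball around \<open>c\<close>.\<close>

lemma dist_lower:
  "(norm (g (t + s) - c))\<^sup>2 \<ge> (norm (g t - c))\<^sup>2 + 2 * s * (g' t \<bullet> (g t - c)) - 2 * \<kappa> * s\<^sup>2 * norm (g t - c)"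
proof -
  define r where "r = g (t + s) - g t - s *\<^sub>R g' t"
  have r: "norm r \<le> \<kappa> * s\<^sup>2" unfolding r_def by (rule taylor)
  have e: "g (t+s) - c = (g t - c) + (s *\<^sub>R g' t + r)" by (simp add: r_def)
  have "\<bar>r \<bullet> (g t - c)\<bar> \<le> norm r * norm (g t - c)" by (rule Cauchy_Schwarz_ineq2)
  also have "\<dots> \<le> (\<kappa> * s\<^sup>2) * norm (g t - c)" using r by (rule mult_right_mono) auto
  finally have "r \<bullet> (g t - c) \<ge> - (\<kappa> * s\<^sup>2 * norm (g t - c))" by linarith
  moreover have "(g t - c) \<bullet> (s *\<^sub>R g' t + r) = s * (g' t \<bullet> (g t - c)) + r \<bullet> (g t - c)"
    by (simp add: inner_add_right inner_commute)
  moreover have "(norm (g (t+s) - c))\<^sup>2 = (norm (g t - c))\<^sup>2 + 2 * ((g t - c) \<bullet> (s *\<^sub>R g' t + r))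
      + (norm (s *\<^sub>R g' t + r))\<^sup>2"
    unfolding e by (rule norm_add_sq)
  ultimately show ?thesis
    using zero_le_power2[of "norm (s *\<^sub>R g' t + r)"] by linarith
qed

lemma dist_upper:
  "(norm (g (t + s) - c))\<^sup>2 \<le> (norm (g t - c))\<^sup>2 + 2 * s * (g' t \<bullet> (g t - c)) + 2 * \<kappa> * s\<^sup>2 * norm (g t - c) + s\<^sup>2"
proof -
  define r where "r = g (t + s) - g t - s *\<^sub>R g' t"
  have r: "norm r \<le> \<kappa> * s\<^sup>2" unfolding r_def by (rule taylor)
  have e: "g (t+s) - c = (g t - c) + (s *\<^sub>R g' t + r)" by (simp add: r_def)
  have "\<bar>r \<bullet> (g t - c)\<bar> \<le> norm r * norm (g t - c)" by (rule Cauchy_Schwarz_ineq2)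
  also have "\<dots> \<le> (\<kappa> * s\<^sup>2) * norm (g t - c)" using r by (rule mult_right_mono) auto
  finally have 1: "r \<bullet> (g t - c) \<le> (\<kappa> * s\<^sup>2 * norm (g t - c))" by linarith
  have "norm (s *\<^sub>R g' t + r) \<le> \<bar>s\<bar>" using dist_le[of "t+s" t] by (simp add: r_def)
  then have "(norm (s *\<^sub>R g' t + r))\<^sup>2 \<le> s\<^sup>2" by (metis abs_le_square_iff abs_norm_cancel power2_abs)
  then show ?thesis using 1 unfolding e norm_add_sq[of "g t - c"]
    by (simp add: inner_simps inner_commute)
qed

text \<open>An arc on which the tangent turns from one sense of rotation about \<open>c\<close> to the other
  has a point where it moves radially, so it cannot stay in a thin annulus around \<open>c\<close>.\<close>

lemma not_in_thin_annulus:
  assumes h: "0 < h" "\<kappa> * h \<le> 1/8" "2 * h \<le> T" "h \<le> 1/4"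
    and s1: "g' 0 \<bullet> perp (g 0 - c) * (g' T \<bullet> perp (g T - c)) \<le> 0"
    and far: "\<And>t. t \<in> {0..T} \<Longrightarrow> norm (g t - c) > 1/2"
  shows "\<exists>x\<in>{0..T}. \<exists>y\<in>{0..T}. norm (g x - c) \<ge> norm (g y - c) + h / 2"
proof -
  have T: "0 \<le> T" using h by linarith
  let ?f = "\<lambda>t. g' t \<bullet> perp (g t - c)"
  have cf: "continuous_on {0..T} ?f"
    unfolding perp_def by (intro continuous_intros cont cont_deriv)
  have "\<exists>t\<in>{0..T}. ?f t = 0"
  proof (cases "?f 0 \<le> 0")
    case True
    then have "?f T \<ge> 0 \<or> ?f 0 = 0" using s1
      using True mult_neg_neg[of "?f 0" "?f T"] by linarith
    then show ?thesis
    proof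
      assume "?f T \<ge> 0"
      then obtain x where "0 \<le> x" "x \<le> T" "?f x = 0" using IVT'[of ?f 0 0 T] True cf T by blast
      then show ?thesis by auto
    next
      assume "?f 0 = 0"
      moreover have "0 \<in> {0..T}" using T by simp
      ultimately show ?thesis by blast
    qed
  next
    case False
    then have "?f T \<le> 0" using s1 mult_pos_pos[of "?f 0" "?f T"] by linarith
    then obtain x where "0 \<le> x" "x \<le> T" "?f x = 0" using IVT2'[of ?f T 0 0] False cf T by force
    then show ?thesis by auto
  qed
  \<comment> \<open>At such a time the velocity is radial. The step \<open>s\<close> is taken forwards or backwards so as to stay in \<open>{0..T}\<close>.\<close>
  then obtain t where t: "t \<in> {0..T}" "?f t = 0" by blast
  let ?D = "g t - c"
  have "(norm ?D)\<^sup>2 = (?D \<bullet> g' t)\<^sup>2 + (?D \<bullet> perp (g' t))\<^sup>2"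
    using norm_perp_decomp[OF speed] .
  moreover have "?D \<bullet> perp (g' t) = - (g' t \<bullet> perp ?D)"
    by (simp add: perp_def inner_prod_def algebra_simps)
  ultimately have D: "(g' t \<bullet> ?D)\<^sup>2 = (norm ?D)\<^sup>2" using t by (simp add: inner_commute)
  define s where "s = (if t + h \<le> T then h else - h)"
  have st: "t + s \<in> {0..T}" using t h by (auto simp: s_def)
  have s2: "s\<^sup>2 = h\<^sup>2" "\<bar>s\<bar> = h" using h by (auto simp: s_def)
  define e where "e = s *\<^sub>R g' t"
  define r where "r = g (t + s) - g t - e"
  have r: "norm r \<le> h / 8"
  proof -
    have "norm r \<le> \<kappa> * h\<^sup>2" unfolding r_def e_def using taylor[of t s] s2 by simp
    also have "\<dots> = (\<kappa> * h) * h" by (simp add: power2_eq_square)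
    also have "\<dots> \<le> 1/8 * h" using h by (intro mult_right_mono) auto
    finally show ?thesis by simp
  qed
  let ?R = "norm ?D"
  have R: "?R > 1/2" using far t by blast
  have "g' t \<bullet> ?D = ?R \<or> g' t \<bullet> ?D = - ?R" using D by (simp add: power2_eq_iff)
  then have "(norm (?D + e))\<^sup>2 = (?R + h)\<^sup>2 \<or> (norm (?D + e))\<^sup>2 = (?R - h)\<^sup>2"
  proof -
    have "(norm (?D + e))\<^sup>2 = ?R\<^sup>2 + 2 * (s * (g' t \<bullet> ?D)) + h\<^sup>2"
      unfolding norm_add_sq e_def using s2 speed[of t] by (simp add: inner_commute)
    moreover have "s * (g' t \<bullet> ?D) = h * ?R \<or> s * (g' t \<bullet> ?D) = - (h * ?R)"
      using \<open>g' t \<bullet> ?D = ?R \<or> g' t \<bullet> ?D = - ?R\<close> by (auto simp: s_def)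
    ultimately show ?thesis by (auto simp: power2_sum power2_diff algebra_simps)
  qed
  then have "norm (?D + e) = ?R + h \<or> norm (?D + e) = ?R - h"
    using R h norm_ge_zero[of "?D + e"] unfolding power2_eq_iff by linarith
  moreover have "\<bar>norm (g (t + s) - c) - norm (?D + e)\<bar> \<le> h / 8"
  proof -
    have "g (t + s) - c = (?D + e) + r" by (simp add: r_def)
    then show ?thesis using r norm_triangle_ineq3[of "(?D + e) + r" "?D + e"]
      by (simp only:) simp
  qed
  ultimately have "norm (g (t + s) - c) \<ge> ?R + h / 2 \<or> ?R \<ge> norm (g (t + s) - c) + h / 2"
    using h(1) by (elim disjE) (rule disjI1, linarith, rule disjI2, linarith)
  then show ?thesis using t st by blast
qed

end



section \<open>Curves pinched between antiparallel strands\<close>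

text \<open>A projection of a compact set of pairs.\<close>

lemma compact_far_if:
  fixes g :: "real \<Rightarrow> point"
  assumes "compact A" "compact B" "continuous_on UNIV g" "closed {q. Q (fst q) (snd q)}"
  shows "compact {x\<in>A. \<exists>z\<in>B. Q x z \<and> norm (g x - g z) \<ge> 1}"
proof -
  let ?K = "{q. norm (g (fst q) - g (snd q)) \<ge> 1}"
  have c: "continuous_on UNIV (\<lambda>q::real\<times>real. norm (g (fst q) - g (snd q)))"
    by (intro continuous_intros continuous_on_compose2[OF assms(3)]) auto
  have "closed ?K"
    using closed_Collect_le[OF continuous_on_const c] by simp
  then have "compact ((A \<times> B) \<inter> (?K \<inter> {q. Q (fst q) (snd q)}))"
    using assms by (intro compact_Int_closed compact_Times closed_Int)
  then have "compact (fst ` ((A \<times> B) \<inter> (?K \<inter> {q. Q (fst q) (snd q)})))"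
    by (intro compact_continuous_image continuous_intros)
  moreover have "fst ` ((A \<times> B) \<inter> (?K \<inter> {q. Q (fst q) (snd q)}))
      = {x\<in>A. \<exists>z\<in>B. Q x z \<and> norm (g x - g z) \<ge> 1}" (is "?l = ?r")
  proof
    show "?l \<subseteq> ?r" by auto
    show "?r \<subseteq> ?l"
    proof
      fix x assume "x \<in> ?r"
      then obtain z where "z \<in> B" "x \<in> A" "Q x z" "norm (g x - g z) \<ge> 1" by blast
      then show "x \<in> ?l" by (intro image_eqI[of _ _ "(x, z)"]) auto
    qed
  qed
  ultimately show ?thesis by simp
qed

lemma compact_far:
  fixes g :: "real \<Rightarrow> point"
  assumes "compact A" "compact B" "continuous_on UNIV g"
  shows "compact {x\<in>A. \<exists>z\<in>B. norm (g x - g z) \<ge> 1}"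
  using compact_far_if[OF assms, of "\<lambda>_ _. True"] by simp

lemma interval_not_union_of_two:
  fixes A B :: "real set"
  assumes "compact A" "compact B" "A \<inter> B = {}" "{u..v} \<subseteq> A \<union> B"
    "x \<in> A \<inter> {u..v}" "y \<in> B \<inter> {u..v}"
  shows False
  using connected_Icc[of u v] assms
  unfolding connected_closed by (metis compact_imp_closed disjoint_iff disjoint_iff_not_equal IntE)

text \<open>A simple closed curve of length \<open>l\<close> with a pinch: the parameters \<open>0\<close> and \<open>T\<close> belong to points at distance
  at most \<open>a ^ 40\<close> with opposite tangents orthogonal to the chord between them. After scaling, the balls
  in question have radius \<open>1\<close>. Assumption \<open>JC\<close> says that a ball around a point of the curve cannot separate
  two of its points on both sides, and \<open>JN\<close> that it never contains the whole curve; both hold if it meets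
  the curve in an arc. By \<open>J0\<close> the arc from \<open>0\<close> to \<open>T\<close> is the one inside the ball around \<open>g 0\<close>.

  The length scale \<open>a\<close> is a small multiple of the radius of curvature. The estimates use a
  hierarchy of powers of \<open>a\<close>: the width \<open>a ^ 40\<close> of the pinch is seen through a step of length
  \<open>a ^ 20\<close>, which determines directions up to about \<open>a ^ 19\<close>, whereas the points considered later
  lie at distances \<open>a ^ 4\<close>, \<open>a ^ 5\<close> or \<open>a\<close> along the curve, where these errors are invisible.\<close>

locale pinched_loop = bounded_curvature_curve +
  fixes l T a :: real
  assumes per: "\<And>t. g (t + l) = g t"
    and inj: "\<And>s t. s < t \<Longrightarrow> t < s + l \<Longrightarrow> g s \<noteq> g t"
    and JC: "\<And>x u v c d. u < c \<Longrightarrow> c < v \<Longrightarrow> v < d \<Longrightarrow> d < u + l \<Longrightarrow>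
        norm (g u - g x) < 1 \<Longrightarrow> norm (g v - g x) < 1 \<Longrightarrow> norm (g c - g x) < 1 \<or> norm (g d - g x) < 1"
    and JN: "\<And>x. \<exists>y. norm (g y - g x) \<ge> 1"
    and a_pos: "0 < a" and a_le: "a \<le> 1/64" and kappa_a: "\<kappa> * a = 1/64"
    and T_ge: "64 * a \<le> T" and lT_ge: "64 * a \<le> l - T"
    and anti: "g' T = - g' 0"
    and orth: "(g T - g 0) \<bullet> g' 0 = 0"
    and close: "norm (g T - g 0) \<le> a ^ 40"
    and J0: "\<And>t. 0 \<le> t \<Longrightarrow> t \<le> T \<Longrightarrow> norm (g t - g 0) < 1"
begin

lemma T_pos: "0 < T" and T_less: "T < l" and l_pos: "0 < l"
  using T_ge lT_ge a_pos by auto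

lemma per_int: "g (t + of_int k * l) = g t"
proof (induction k arbitrary: t rule: int_induct[of _ 0])
  case (step1 i)
  have "g (t + of_int (i+1) * l) = g ((t + of_int i * l) + l)" by (simp add: algebra_simps)
  then show ?case using step1 per by simp
next
  case (step2 i)
  have "g (t + of_int (i-1) * l) = g (t + of_int (i-1) * l + l)" using per by simp
  also have "\<dots> = g (t + of_int i * l)" by (simp add: algebra_simps)
  finally show ?case using step2 by simp
qed simp

lemma far_point: "\<exists>y\<in>{s..<s+l}. norm (g y - g x) \<ge> 1"
proof -
  obtain y where y: "norm (g y - g x) \<ge> 1" using JN by blast
  define k where "k = \<lfloor>(y - s) / l\<rfloor>"
  have "of_int k \<le> (y - s) / l" "(y - s) / l < of_int k + 1" unfolding k_def by linarith+
  then have "of_int k * l \<le> y - s" "y - s < (of_int k + 1) * l"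
    using l_pos by (simp_all add: field_simps)
  then have "y + of_int (-k) * l \<in> {s..<s+l}" by (auto simp: algebra_simps)
  moreover have "norm (g (y + of_int (-k) * l) - g x) \<ge> 1" unfolding per_int by (rule y)
  ultimately show ?thesis by blast
qed

text \<open>Let \<open>z\<close> run along the arc. The ball around \<open>g z\<close> contains \<open>g 0\<close>, so by \<open>JC\<close> the points outside the ball
  come all before \<open>g z\<close> or all after it. The parameters of the two kinds form disjoint closed sets, which
  cover the interval because the curve is never contained in the ball. For small \<open>z\<close> the points outside
  come later, hence always.\<close>

lemma diam_arc:
  assumes "0 \<le> y" "y \<le> z" "z \<le> T"
  shows "norm (g y - g z) < 1"
proof (rule ccontr)
  assume n: "\<not> ?thesis"
  have small: "norm (g y - g z) < 1" if "\<bar>y - z\<bar> < 1" for y z using dist_le[of y z] that by linarith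
  define z0 where "z0 = min T (1/2)"
  have z0: "0 < z0" "z0 \<le> T" "z0 < 1" using T_pos by (auto simp: z0_def)
  have zz: "z0 \<le> z" 
  proof -
    have "\<not> \<bar>y - z\<bar> < 1" using n small by blast
    then show ?thesis using assms unfolding z0_def by linarith
  qed
  let ?L = "{z\<in>{z0..T}. \<exists>y\<in>{0..T}. y \<le> z \<and> norm (g z - g y) \<ge> 1}"
  let ?R = "{z\<in>{z0..T}. \<exists>y\<in>{z0..l}. z \<le> y \<and> norm (g z - g y) \<ge> 1}"
  have "closed {q :: real \<times> real. snd q \<le> fst q}" "closed {q :: real \<times> real. fst q \<le> snd q}"
    by (intro closed_Collect_le continuous_intros)+
  then have cL: "compact ?L" and cR: "compact ?R" by (intro compact_far_if cont compact_Icc; simp)+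
  have excl: False if z: "z \<in> {z0..T}" and y: "0 \<le> y" "y \<le> z" "norm (g z - g y) \<ge> 1"
    and y': "z \<le> y'" "y' \<le> l" "norm (g z - g y') \<ge> 1" for z y y'
  proof -
    have 0: "norm (g 0 - g z) < 1" using J0[of z] z z0 by (simp add: norm_minus_commute)
    have "y \<noteq> 0" using 0 y by (auto simp: norm_minus_commute)
    moreover have "y \<noteq> z" "y' \<noteq> z" using y y' by auto
    moreover have "y' \<noteq> l" using 0 y' per[of 0] by (auto simp: norm_minus_commute)
    ultimately have "0 < y" "y < z" "z < y'" "y' < 0 + l" using y y' by auto
    from JC[OF this 0] show False using y y' by (auto simp: norm_minus_commute)
  qed
  show False
  proof (rule interval_not_union_of_two[OF cL cR])
    show "?L \<inter> ?R = {}"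
    proof (rule ccontr)
      assume "?L \<inter> ?R \<noteq> {}"
      then obtain x y y' where "x \<in> {z0..T}" "y \<in> {0..T}" "y \<le> x" "norm (g x - g y) \<ge> 1"
        "y' \<in> {z0..l}" "x \<le> y'" "norm (g x - g y') \<ge> 1" by blast
      then show False using excl[of x y y'] by simp
    qed
    show "{z0..T} \<subseteq> ?L \<union> ?R"
    proof
      fix x assume x: "x \<in> {z0..T}"
      obtain y where y: "y \<in> {0..<0+l}" "norm (g y - g x) \<ge> 1" using far_point by blast
      show "x \<in> ?L \<union> ?R"
      proof (cases "y \<le> x")
        case True
        then have "y \<in> {0..T}" "y \<le> x \<and> norm (g x - g y) \<ge> 1"
          using x y by (auto simp: norm_minus_commute)
        then have "x \<in> ?L" using x by blast
        then show ?thesis by blast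
      next
        case False
        then have "y \<in> {z0..l}" "x \<le> y \<and> norm (g x - g y) \<ge> 1"
          using x y by (auto simp: norm_minus_commute)
        then have "x \<in> ?R" using x by blast
        then show ?thesis by blast
      qed
    qed
    have "y \<in> {0..T}" "y \<le> z \<and> norm (g z - g y) \<ge> 1" using n assms by (auto simp: norm_minus_commute)
    then show "z \<in> ?L \<inter> {z0..T}" using assms zz by auto
    obtain y where y: "y \<in> {0..<0+l}" "norm (g y - g z0) \<ge> 1" using far_point by blast
    have "z0 \<le> y"
    proof (rule ccontr)
      assume "\<not> z0 \<le> y"
      then show False using small[of y z0] y z0 by auto
    qed
    then have "y \<in> {z0..l}" "z0 \<le> y \<and> norm (g z0 - g y) \<ge> 1" using y by (auto simp: norm_minus_commute)
    then show "z0 \<in> ?R \<inter> {z0..T}" using z0 by auto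
  qed
qed

text \<open>The rest of the curve leaves the common ball of the arc: \<open>xh\<close> and \<open>yh\<close> are the first and the
  last parameter of a point that does not see the whole arc within distance \<open>1\<close>.\<close>

definition opp :: "real set" where
  "opp = {x\<in>{T..l}. \<exists>z\<in>{0..T}. norm (g x - g z) \<ge> 1}"

definition xh where "xh = Inf opp"
definition yh where "yh = Sup opp"

lemma compact_opp: "compact opp"
  unfolding opp_def by (intro compact_far cont) auto

lemma oppI:
  assumes "norm (g x - g z) \<ge> 1" "0 \<le> z" "z \<le> T" "0 \<le> x" "x \<le> l"
  shows "x \<in> opp" "T < x" "x < l"
proof -
  have "\<not> x \<le> T"
  proof
    assume "x \<le> T"
    then show False
      using diam_arc[of x z] diam_arc[of z x] assms by (cases "x \<le> z") (auto simp: norm_minus_commute)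
  qed
  then show "x \<in> opp" "T < x" using assms by (auto simp: opp_def)
  have "x \<noteq> l" using assms J0[of z] per[of 0] by (auto simp: norm_minus_commute)
  then show "x < l" using assms by auto
qed

lemma far_opp: "0 \<le> z \<Longrightarrow> z \<le> T \<Longrightarrow> \<exists>x\<in>opp. norm (g x - g z) \<ge> 1"
  using far_point[of 0 z] oppI(1) by force

lemma opp_ne: "opp \<noteq> {}" using far_opp[of 0] T_pos by auto

lemma xh_opp: "xh \<in> opp" and yh_opp: "yh \<in> opp"
  and xh_le: "x \<in> opp \<Longrightarrow> xh \<le> x" and yh_ge: "x \<in> opp \<Longrightarrow> x \<le> yh"
proof -
  have b: "bdd_below opp" "bdd_above opp"
    using compact_imp_bounded[OF compact_opp] bounded_imp_bdd_below bounded_imp_bdd_above by auto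
  have c: "closed opp" using compact_opp compact_imp_closed by blast
  show "xh \<in> opp" "yh \<in> opp" unfolding xh_def yh_def
    using closed_contains_Inf[OF opp_ne b(1) c] closed_contains_Sup[OF opp_ne b(2) c] by auto
  show "x \<in> opp \<Longrightarrow> xh \<le> x" "x \<in> opp \<Longrightarrow> x \<le> yh"
    unfolding xh_def yh_def using b by (auto intro: cInf_lower cSup_upper)
qed

lemma opp_bounds: "x \<in> opp \<Longrightarrow> T < x" "x \<in> opp \<Longrightarrow> x < l"
  unfolding opp_def using oppI T_pos by fastforce+

lemma T_less_xh: "T < xh" and xh_less_l: "xh < l" and T_less_yh: "T < yh" and yh_less_l: "yh < l"
  using xh_opp yh_opp opp_bounds by auto

lemma before_xh: "T \<le> x \<Longrightarrow> x < xh \<Longrightarrow> 0 \<le> z \<Longrightarrow> z \<le> T \<Longrightarrow> norm (g x - g z) < 1"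
  using oppI(1)[of x z] xh_le[of x] xh_less_l T_pos by force

lemma dist_xh_le: assumes "0 \<le> z" "z \<le> T" shows "norm (g xh - g z) \<le> 1"
proof (rule ccontr)
  assume n: "\<not> ?thesis"
  define x where "x = max T (xh - (norm (g xh - g z) - 1))"
  have x: "T \<le> x" "x < xh" using T_less_xh n by (auto simp: x_def)
  have "norm (g xh - g z) \<le> norm (g x - g z) + \<bar>xh - x\<bar>"
    using dist_le[of xh x] norm_triangle_ineq[of "g x - g z" "g xh - g x"] by (simp add: algebra_simps)
  also have "\<dots> < 1 + (norm (g xh - g z) - 1)"
    using before_xh[OF x assms] x by (auto simp: x_def)
  finally show False by simp
qed

text \<open>If both pinch points were inside the ball around \<open>g xh\<close>, then by \<open>JC\<close> so would be the complement of
  the arc, with a positive margin. For \<open>x\<close> slightly smaller than \<open>xh\<close> nothing would then be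
  outside the ball around \<open>g x\<close>, contrary to \<open>JN\<close>.\<close>

lemma xh_sphere: "norm (g xh - g 0) = 1 \<or> norm (g xh - g T) = 1"
proof (rule ccontr)
  assume "\<not> ?thesis"
  then have n: "norm (g 0 - g xh) < 1" "norm (g T - g xh) < 1"
    using dist_xh_le[of 0] dist_xh_le[of T] T_pos by (auto simp: norm_minus_commute)
  obtain z where z: "0 \<le> z" "z \<le> T" "norm (g xh - g z) \<ge> 1" using xh_opp by (auto simp: opp_def)
  then have z': "0 < z" "z < T" using n by (auto simp: norm_minus_commute le_less)
  have far: "norm (g x - g xh) < 1" if "x \<in> {T..l}" for x
  proof (cases "x = T \<or> x = l")
    case True
    then show ?thesis using n per[of 0] by auto
  next
    case False
    then show ?thesis using JC[of 0 z T x xh] z z' n that by (auto simp: norm_minus_commute)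
  qed
  have "continuous_on {T..l} (\<lambda>x. norm (g x - g xh))" by (intro continuous_intros cont)
  then obtain m where m: "m \<in> {T..l}" "\<And>x. x \<in> {T..l} \<Longrightarrow> norm (g x - g xh) \<le> norm (g m - g xh)"
    using continuous_attains_sup[of "{T..l}" "\<lambda>x. norm (g x - g xh)"] T_less by fastforce
  define M0 where "M0 = norm (g m - g xh)"
  have M0: "M0 < 1" using far m by (auto simp: M0_def)
  define x where "x = max T (xh - (1 - M0)/2)"
  have x: "T \<le> x" "x < xh" "xh - x < 1 - M0" using T_less_xh M0 unfolding x_def max_def by (auto simp: field_simps)
  obtain y where y: "y \<in> {0..<0+l}" "norm (g y - g x) \<ge> 1" using far_point by blast
  have "T \<le> y"
  proof (rule ccontr)
    assume "\<not> T \<le> y"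
    then show False using before_xh[of x y] x y by (auto simp: norm_minus_commute)
  qed
  then have "norm (g y - g xh) \<le> M0" using m y by (auto simp: M0_def)
  then have "norm (g y - g x) < 1"
    using dist_le[of xh x] norm_triangle_ineq[of "g y - g xh" "g xh - g x"] x by simp
  then show False using y by simp
qed

lemma pow_a: "a ^ Suc n \<le> a ^ n / 64" "0 < a ^ n"
  using a_pos a_le by (auto simp: mult.commute divide_simps intro!: mult_left_mono)

lemma kappa_pow: "\<kappa> * a ^ Suc n = a ^ n / 64"
  using kappa_a by (simp add: mult.assoc[symmetric])

lemma dist_xh_ge: "norm (g xh - g 0) \<ge> 1 - a^40" "norm (g xh - g T) \<ge> 1 - a^40"
proof -
  have 1: "norm (g xh - g 0) \<le> norm (g xh - g T) + norm (g T - g 0)"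
    using norm_triangle_ineq[of "g xh - g T" "g T - g 0"] by simp
  have 2: "norm (g xh - g T) \<le> norm (g xh - g 0) + norm (g T - g 0)"
    using norm_triangle_ineq[of "g xh - g 0" "g 0 - g T"] by (simp add: norm_minus_commute)
  show "norm (g xh - g 0) \<ge> 1 - a^40" "norm (g xh - g T) \<ge> 1 - a^40"
    using 1 2 xh_sphere close pow_a(2)[of 40] by linarith+
qed

text \<open>The two strands of the arc start at \<open>g 0\<close> and at \<open>g T\<close> in the same direction
  \<open>g' 0\<close>; for negative arguments they continue backwards outside the arc.\<close>

definition strand :: "bool \<Rightarrow> real \<Rightarrow> point" where
  "strand b s = (if b then g s else g (T - s))"

definition tilt :: "point \<Rightarrow> real" where "tilt c = g' 0 \<bullet> (c - g 0)"

lemma tilt_T: "g' 0 \<bullet> (c - g T) = tilt c"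
  using orth by (simp add: tilt_def inner_simps inner_commute)

lemma strand_lower: "(norm (strand b s - c))\<^sup>2 \<ge> (norm (strand b 0 - c))\<^sup>2 - 2 * s * tilt c
    - 2 * \<kappa> * s\<^sup>2 * norm (strand b 0 - c)"
proof (cases b)
  case True
  have "g' 0 \<bullet> (g 0 - c) = - tilt c" by (simp add: tilt_def inner_diff_right)
  then show ?thesis using dist_lower[of 0 c s] True by (simp add: strand_def)
next
  case False
  have "g' T \<bullet> (g T - c) = tilt c" by (simp add: tilt_T[symmetric] anti inner_diff_right)
  then show ?thesis using dist_lower[of T c "-s"] False by (simp add: strand_def)
qed

lemma strand_upper: "(norm (strand b s - c))\<^sup>2 \<le> (norm (strand b 0 - c))\<^sup>2 - 2 * s * tilt c
    + 2 * \<kappa> * s\<^sup>2 * norm (strand b 0 - c) + s\<^sup>2"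
proof (cases b)
  case True
  have "g' 0 \<bullet> (g 0 - c) = - tilt c" by (simp add: tilt_def inner_diff_right)
  then show ?thesis using dist_upper[of 0 s c] True by (simp add: strand_def)
next
  case False
  have "g' T \<bullet> (g T - c) = tilt c" by (simp add: tilt_T[symmetric] anti inner_diff_right)
  then show ?thesis using dist_upper[of T "-s" c] False by (simp add: strand_def)
qed

lemma strand_taylor: "norm (strand b s - strand b 0 - s *\<^sub>R g' 0) \<le> \<kappa> * s\<^sup>2"
  using taylor[of 0 s] taylor[of T "-s"] by (simp add: strand_def anti)

lemma strand_lip: "norm (strand b s - strand b s') \<le> \<bar>s - s'\<bar>"
  using dist_le[of s s'] dist_le[of "T - s" "T - s'"] by (simp add: strand_def abs_minus_commute)

lemma strand_base: "norm (strand b 0 - g 0) \<le> a^40" "norm (g 0 - strand b 0) \<le> a^40"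
  using close pow_a(2)[of 40] by (auto simp: strand_def norm_minus_commute)

lemma strand_xh: "norm (strand b 0 - g xh) \<le> 1" "1 - a^40 \<le> norm (strand b 0 - g xh)"
  using dist_xh_le[of 0] dist_xh_le[of T] dist_xh_ge T_pos
  by (auto simp: strand_def norm_minus_commute)

lemma one_minus_sq: "(1 - a^40)\<^sup>2 \<ge> 1 - 2 * (a^20)\<^sup>2"
proof -
  have "(1 - a^40)\<^sup>2 = 1 - 2 * a^40 + (a^40)\<^sup>2" by (simp add: power2_diff)
  then show ?thesis by (simp flip: power_mult)
qed

lemma small1: "(1 + \<kappa>) * a^20 \<le> a^19 / 32"
  using kappa_pow[of 19] pow_a(1)[of 19] by (simp add: algebra_simps)

lemma strand_xh_sq: "(norm (strand b 0 - g xh))\<^sup>2 \<ge> 1 - 2 * (a^20)\<^sup>2" "(norm (strand b 0 - g xh))\<^sup>2 \<le> 1"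
proof -
  have "0 \<le> 1 - a^40" using a_pos a_le by (simp add: power_le_one)
  then have "(1 - a^40)\<^sup>2 \<le> (norm (strand b 0 - g xh))\<^sup>2"
    using strand_xh by (intro power_mono) auto
  then show "(norm (strand b 0 - g xh))\<^sup>2 \<ge> 1 - 2 * (a^20)\<^sup>2" using one_minus_sq by linarith
  show "(norm (strand b 0 - g xh))\<^sup>2 \<le> 1" using strand_xh(1) by (simp add: power_le_one)
qed

lemma a20: "0 < a^20" "a^20 < T" "a^20 \<le> 1/64" "a^20 + a^40 \<le> 1/2" "a^40 \<le> 1/64" "0 < a^40"
proof -
  have 1: "a^20 \<le> a" "a^40 \<le> a" using a_pos a_le by (auto intro!: power_le_one_iff[THEN iffD2] simp: power_decreasing[of 1 _ a, simplified])
  then show "0 < a^20" "a^20 < T" "a^20 \<le> 1/64" "a^20 + a^40 \<le> 1/2" "a^40 \<le> 1/64" "0 < a^40"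
    using a_pos a_le T_ge by auto
qed

text \<open>The arc starts within the unit ball around \<open>g xh\<close> and at distance almost \<open>1\<close>, so it does not
  move outwards; this bounds the tilt from one side. If the whole arc lies on the unit sphere, the other
  bound is clear. Otherwise the ball contains an inner point of the arc, and by \<open>JC\<close> the curve enters
  it already before one of the pinch points.\<close>

lemma tilt_xh: "\<bar>tilt (g xh)\<bar> \<le> a^19 / 32"
proof -
  let ?s = "a^20" and ?th = "tilt (g xh)"
  have kn: "2 * \<kappa> * ?s\<^sup>2 * norm (strand b 0 - g xh) \<le> 2 * \<kappa> * ?s\<^sup>2" for b
    using strand_xh(1)[of b] kappa_ge by (simp add: mult_left_le)
  have "norm (strand True ?s - g xh) \<le> 1"
    using dist_xh_le[of ?s] a20 by (simp add: strand_def norm_minus_commute)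
  then have "(norm (strand True ?s - g xh))\<^sup>2 \<le> 1" by (simp add: power_le_one)
  then have "0 \<le> 2 * ?s * ?th + 2 * \<kappa> * ?s\<^sup>2 + 2 * ?s\<^sup>2"
    using strand_lower[of True "g xh" ?s] strand_xh_sq[of True] kn[of True] by linarith
  also have "\<dots> = 2 * ?s * (?th + (1 + \<kappa>) * ?s)" by (simp add: algebra_simps power2_eq_square)
  finally have lo: "0 \<le> ?th + (1 + \<kappa>) * ?s" using a20(1) by (simp add: zero_le_mult_iff)
  have "0 \<le> 2 * ?s * ((1 + \<kappa>) * ?s - ?th)"
  proof (cases "\<forall>z\<in>{0..T}. norm (g xh - g z) \<ge> 1")
    case True
    moreover have "?s \<in> {0..T}" using a20 by simp
    ultimately have "norm (g xh - g ?s) \<ge> 1" by blast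
    then have "norm (strand True ?s - g xh) \<ge> 1" by (simp add: strand_def norm_minus_commute)
    then have "(norm (strand True ?s - g xh))\<^sup>2 \<ge> 1" by (simp add: one_le_power)
    then have "0 \<le> - (2 * ?s * ?th) + 2 * \<kappa> * ?s\<^sup>2 + ?s\<^sup>2"
      using strand_upper[of True ?s "g xh"] strand_xh_sq[of True] kn[of True] by linarith
    also have "\<dots> \<le> 2 * ?s * ((1 + \<kappa>) * ?s - ?th)" by (simp add: algebra_simps power2_eq_square)
    finally show ?thesis .
  next
    case False
    then obtain z where z: "0 \<le> z" "z \<le> T" "norm (g z - g xh) < 1" by (auto simp: norm_minus_commute)
    have d: "norm (g T - g xh) \<ge> 1 - a^40" "norm (g 0 - g xh) \<ge> 1 - a^40"
      using dist_xh_ge by (auto simp: norm_minus_commute)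
    have xT: "xh - T \<ge> 1 - a^40" using dist_le[of T xh] T_less_xh d by linarith
    have xl: "l - xh \<ge> 1 - a^40" using dist_le[of l xh] xh_less_l d per[of 0] by simp
    have "\<exists>b. norm (strand b (- ?s) - g xh) < 1"
      using xh_sphere
    proof
      assume p: "norm (g xh - g 0) = 1"
      then have "z \<noteq> 0" using z by (auto simp: norm_minus_commute)
      then have "norm (g (T + ?s) - g xh) < 1 \<or> norm (g l - g xh) < 1"
      proof (intro JC[of z "T + ?s" xh l])
        show "z < T + ?s" "T + ?s < xh" "xh < l" "l < z + l"
          using \<open>z \<noteq> 0\<close> z xh_less_l a20 xT by linarith+
      qed (use z in auto)
      then have "norm (strand False (- ?s) - g xh) < 1"
        using p per[of 0] by (auto simp: strand_def norm_minus_commute)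
      then show ?thesis by blast
    next
      assume q: "norm (g xh - g T) = 1"
      then have "z \<noteq> T" using z by (auto simp: norm_minus_commute)
      then have "norm (g (l - ?s) - g xh) < 1 \<or> norm (g (l + T) - g xh) < 1"
      proof (intro JC[of xh "l - ?s" "l + z" "l + T"])
        show "xh < l - ?s" "l - ?s < l + z" "l + z < l + T" "l + T < xh + l"
          using \<open>z \<noteq> T\<close> z T_less_xh a20 xl by linarith+
      qed (use z per[of z] in \<open>auto simp: add.commute\<close>)
      moreover have "g (l - ?s) = g (- ?s)" "g (l + T) = g T" using per[of "- ?s"] per[of T] by (auto simp: add.commute)
      ultimately have "norm (strand True (- ?s) - g xh) < 1"
        using q by (auto simp: strand_def norm_minus_commute)
      then show ?thesis by blast
    qed
    then obtain b where b: "norm (strand b (- ?s) - g xh) < 1" by blast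
    then have "(norm (strand b (- ?s) - g xh))\<^sup>2 < 1" by (simp add: power_less_one_iff)
    then have "0 \<le> - (2 * ?s * ?th) + 2 * \<kappa> * ?s\<^sup>2 + 2 * ?s\<^sup>2"
      using strand_lower[of b "g xh" "- ?s"] strand_xh_sq[of b] kn[of b] by simp
    also have "\<dots> = 2 * ?s * ((1 + \<kappa>) * ?s - ?th)" by (simp add: algebra_simps power2_eq_square)
    finally show ?thesis .
  qed
  then have "?th \<le> (1 + \<kappa>) * ?s" using a20(1) by (simp add: zero_le_mult_iff)
  then show ?thesis using lo small1 by linarith
qed

end



context pinched_loop
begin

text \<open>Height above the pinch: with \<open>tilt\<close> the coordinate along the tangent, this is the coordinate
  across it.\<close>

definition ht :: "point \<Rightarrow> real" where "ht c = perp (g' 0) \<bullet> (c - g 0)"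

lemma sq_decomp: "(norm (c - g 0))\<^sup>2 = (tilt c)\<^sup>2 + (ht c)\<^sup>2"
  using norm_perp_decomp[OF speed[of 0], of "c - g 0"] by (simp add: tilt_def ht_def inner_commute)

lemma small_powers:
  "0 < a^19" "a^19 \<le> 1/64" "a^20 \<le> a^19/64" "a^40 \<le> a^19/64" "(a^19)\<^sup>2 \<le> a^19/64"
  "(a^20)\<^sup>2 \<le> a^19/64" "a^19 \<le> a/64" "a^19 \<le> a^2/64" "a^40 \<le> a^2/64"
proof -
  have mono: "a^m \<le> a^n / 64" if "n < m" for m n
  proof -
    have "a^m \<le> a^Suc n" using that a_pos a_le by (intro power_decreasing) auto
    then show ?thesis using pow_a(1)[of n] by linarith
  qed
  show "0 < a^19" using a_pos by simp
  show "a^19 \<le> 1/64" using mono[of 0 19] by simp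
  show "a^20 \<le> a^19/64" "a^40 \<le> a^19/64" "a^19 \<le> a/64" "a^19 \<le> a^2/64" "a^40 \<le> a^2/64"
    using mono[of 19 20] mono[of 19 40] mono[of 1 19] mono[of 2 19] mono[of 2 40] by auto
  show "(a^19)\<^sup>2 \<le> a^19/64" "(a^20)\<^sup>2 \<le> a^19/64"
    using mono[of 19 38] mono[of 19 40] by (auto simp flip: power_mult)
qed

lemma ht_bounds:
  assumes "\<bar>tilt c\<bar> \<le> a^19 / 32" "(norm (c - g 0))\<^sup>2 \<ge> 1 - 2 * (a^20)\<^sup>2" "norm (c - g 0) \<le> 1"
  shows "\<bar>ht c\<bar> \<ge> 1 - a^19" "\<bar>ht c\<bar> \<le> 1"
proof -
  have "(tilt c)\<^sup>2 \<le> (a^19/32)\<^sup>2" using assms(1) by (rule power2_le_iff_abs_le[THEN iffD2, rotated]) (use a_pos in auto)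
  then have 1: "(tilt c)\<^sup>2 \<le> a^19/64" 
  proof -
    have "(a^19/32)\<^sup>2 = (a^19)\<^sup>2/1024" by (simp add: power_divide)
    then show ?thesis using \<open>(tilt c)\<^sup>2 \<le> (a^19/32)\<^sup>2\<close> small_powers(1,5) by linarith
  qed
  have "(ht c)\<^sup>2 \<ge> 1 - 2 * (a^20)\<^sup>2 - a^19/64" using sq_decomp[of c] assms(2) 1 by linarith
  moreover have "(1 - a^19)\<^sup>2 = 1 - 2 * a^19 + (a^19)\<^sup>2" by (simp add: power2_diff)
  ultimately have "(1 - a^19)\<^sup>2 \<le> \<bar>ht c\<bar>\<^sup>2" unfolding power2_abs using small_powers(1,5,6) by linarith
  then show "\<bar>ht c\<bar> \<ge> 1 - a^19" by (rule power2_le_imp_le) simp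
  have "(norm (c - g 0))\<^sup>2 \<le> 1" using assms(3) by (simp add: power_le_one)
  then have "(ht c)\<^sup>2 \<le> 1" using sq_decomp[of c] zero_le_power2[of "tilt c"] by linarith
  then show "\<bar>ht c\<bar> \<le> 1" by (simp add: abs_square_le_1)
qed

lemma ht_xh: "\<bar>ht (g xh)\<bar> \<ge> 1 - a^19" "\<bar>ht (g xh)\<bar> \<le> 1"
  using ht_bounds[OF tilt_xh] strand_xh_sq[of True] dist_xh_le[of 0] T_pos
  by (auto simp: strand_def norm_minus_commute)

text \<open>Reversing the curve exchanges the two pinch points, the two strands, and \<open>xh\<close> with \<open>yh\<close>. Every
  statement about \<open>xh\<close> thus has a counterpart for \<open>yh\<close>.\<close>

lemma mirror: "pinched_loop (\<lambda>t. g (T - t)) (\<lambda>t. - g' (T - t)) \<kappa> l T a"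
proof
  show "((\<lambda>t. g (T - t)) has_vector_derivative - g' (T - t)) (at t)" for t
  proof -
    have "((\<lambda>t. T - t) has_vector_derivative -1) (at t)" by (auto intro!: derivative_eq_intros)
    from vector_diff_chain_at[OF this deriv] show ?thesis by (simp add: o_def)
  qed
  show "norm (- g' (T - t)) = 1" for t by (simp add: speed)
  show "norm (- g' (T - s) - (- g' (T - t))) \<le> \<kappa> * \<bar>s - t\<bar>" for s t
    using lip[of "T - t" "T - s"] by simp
  show "1 \<le> \<kappa>" by (rule kappa_ge)
  show "g (T - (t + l)) = g (T - t)" for t using per[of "T - (t + l)"] by (simp add: algebra_simps)
  show "g (T - s) \<noteq> g (T - t)" if "s < t" "t < s + l" for s t
    using inj[of "T - t" "T - s"] that by auto
  show "norm (g (T - c) - g (T - x)) < 1 \<or> norm (g (T - d) - g (T - x)) < 1"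
    if h: "u < c" "c < v" "v < d" "d < u + l" "norm (g (T - u) - g (T - x)) < 1" "norm (g (T - v) - g (T - x)) < 1"
    for x u v c d
  proof -
    have "norm (g (T - c) - g (T - x)) < 1 \<or> norm (g (T - d + l) - g (T - x)) < 1"
      by (rule JC[of "T - v" "T - c" "T - u" "T - d + l"]) (use h in auto)
    then show ?thesis using per by simp
  qed
  show "\<exists>y. 1 \<le> norm (g (T - y) - g (T - x))" for x
    using JN[of "T - x"] by (metis diff_diff_eq2 add_diff_cancel_left')
  show "- g' (T - T) = - (- g' (T - 0))" using anti by simp
  show "(g (T - T) - g (T - 0)) \<bullet> (- g' (T - 0)) = 0" using orth anti by (simp add: inner_diff_left)
  show "norm (g (T - T) - g (T - 0)) \<le> a ^ 40" using close by (simp add: norm_minus_commute)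
  show "norm (g (T - t) - g (T - 0)) < 1" if "0 \<le> t" "t \<le> T" for t
    using diam_arc[of "T - t" T] that by simp
qed (use a_pos a_le kappa_a T_ge lT_ge in auto)

lemma mirror_xh: "pinched_loop.xh (\<lambda>t. g (T - t)) l T = T + l - yh"
  and mirror_yh: "pinched_loop.yh (\<lambda>t. g (T - t)) l T = T + l - xh"
  and mirror_tilt: "pinched_loop.tilt (\<lambda>t. g (T - t)) (\<lambda>t. - g' (T - t)) c = tilt c"
  and mirror_strand: "pinched_loop.strand (\<lambda>t. g (T - t)) T b s = strand (\<not> b) s"
proof -
  interpret m: pinched_loop "\<lambda>t. g (T - t)" "\<lambda>t. - g' (T - t)" \<kappa> l T a by (rule mirror)
  have gg: "g (T - (T + l - x)) = g x" for x using per[of "x - l"] by simp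
  have gp: "g (T + l - x) = g (T - x)" for x using per[of "T - x"] by (simp add: algebra_simps)
  have 1: "T + l - x \<in> m.opp" if x: "x \<in> opp" for x
  proof -
    from x obtain z where z: "z \<in> {0..T}" "norm (g x - g z) \<ge> 1" "x \<in> {T..l}" by (auto simp: opp_def)
    then have "T - z \<in> {0..T}" "norm (g (T - (T + l - x)) - g (T - (T - z))) \<ge> 1" using gg by auto
    then show ?thesis unfolding m.opp_def using z by (intro CollectI conjI bexI[of _ "T - z"]) auto
  qed
  have 2: "T + l - x \<in> opp" if x: "x \<in> m.opp" for x
  proof -
    from x obtain z where z: "z \<in> {0..T}" "norm (g (T - x) - g (T - z)) \<ge> 1" "x \<in> {T..l}" by (auto simp: m.opp_def)
    then have "T - z \<in> {0..T}" "norm (g (T + l - x) - g (T - z)) \<ge> 1" using gp by auto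
    then show ?thesis unfolding opp_def using z by (intro CollectI conjI bexI[of _ "T - z"]) auto
  qed
  show "m.xh = T + l - yh"
    using m.xh_le[OF 1[OF yh_opp]] yh_ge[OF 2[OF m.xh_opp]] by linarith
  show "m.yh = T + l - xh"
    using m.yh_ge[OF 1[OF xh_opp]] xh_le[OF 2[OF m.yh_opp]] by linarith
  show "m.tilt c = tilt c" unfolding m.tilt_def using tilt_T anti by simp
  show "m.strand b s = strand (\<not> b) s" by (simp add: m.strand_def strand_def)
qed

lemma yh_facts:
  shows tilt_yh: "\<bar>tilt (g yh)\<bar> \<le> a^19 / 32"
    and dist_yh_le: "0 \<le> z \<Longrightarrow> z \<le> T \<Longrightarrow> norm (g yh - g z) \<le> 1"
    and strand_yh_sq: "(norm (strand b 0 - g yh))\<^sup>2 \<ge> 1 - 2 * (a^20)\<^sup>2"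
proof -
  interpret m: pinched_loop "\<lambda>t. g (T - t)" "\<lambda>t. - g' (T - t)" \<kappa> l T a by (rule mirror)
  have gg: "g (T - m.xh) = g yh" unfolding mirror_xh using per[of "yh - l"] by simp
  show "\<bar>tilt (g yh)\<bar> \<le> a^19 / 32" using m.tilt_xh unfolding mirror_tilt gg .
  show "norm (g yh - g z) \<le> 1" if "0 \<le> z" "z \<le> T" for z using m.dist_xh_le[of "T - z"] that gg by simp
  show "(norm (strand b 0 - g yh))\<^sup>2 \<ge> 1 - 2 * (a^20)\<^sup>2"
    using m.strand_xh_sq(1)[of "\<not> b"] unfolding mirror_strand gg by simp
qed

lemma ht_yh: "\<bar>ht (g yh)\<bar> \<ge> 1 - a^19" "\<bar>ht (g yh)\<bar> \<le> 1"
  using ht_bounds[OF tilt_yh] strand_yh_sq[of True] dist_yh_le[of 0] T_pos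
  by (auto simp: strand_def norm_minus_commute)

text \<open>The arc lies in the unit discs around both \<open>g xh\<close> and \<open>g yh\<close>. If these points were on
  opposite sides of the pinch, the discs would intersect in a thin lens of diameter less than \<open>a / 2\<close>,
  but the point \<open>g a\<close> of the arc has distance at least \<open>a / 2\<close> from \<open>g 0\<close>.\<close>

lemma same_side: "ht (g xh) * ht (g yh) > 0"
proof -
  define w where "w = g a - g 0"
  define X where "X = w \<bullet> g' 0"
  define Y where "Y = w \<bullet> perp (g' 0)"
  have aT: "0 \<le> a" "a \<le> T" using T_ge a_pos by auto
  have wn: "norm w \<ge> a / 2"
  proof -
    have "norm (g (0 + a) - g 0 - a *\<^sub>R g' 0) \<le> \<kappa> * a\<^sup>2" by (rule taylor)
    moreover have "\<kappa> * a\<^sup>2 = a / 64" using kappa_pow[of 1] by (simp add: numeral_2_eq_2)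
    moreover have "norm (a *\<^sub>R g' 0) = a" using a_pos by (simp add: speed)
    ultimately have "a \<le> norm w + a / 64"
      using norm_triangle_ineq4[of w "w - a *\<^sub>R g' 0"] by (simp add: w_def)
    then show ?thesis using a_pos by linarith
  qed
  then have w2: "(norm w)\<^sup>2 \<ge> a\<^sup>2 / 4" using power_mono[OF wn, of 2] a_pos by (simp add: power_divide)
  have X: "\<bar>X\<bar> \<le> a"
  proof -
    have "\<bar>X\<bar> \<le> norm w * norm (g' 0)" unfolding X_def by (rule Cauchy_Schwarz_ineq2)
    also have "\<dots> \<le> a" using dist_le[of a 0] a_pos by (simp add: speed w_def)
    finally show ?thesis .
  qed
  have key: "Y * ht c > 0"
    if c: "\<bar>tilt c\<bar> \<le> a^19 / 32" "(norm (c - g 0))\<^sup>2 \<ge> 1 - 2 * (a^20)\<^sup>2" "norm (c - g a) \<le> 1" for c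
  proof -
    have e: "c - g a = (c - g 0) - w" by (simp add: w_def)
    have "(norm (c - g a))\<^sup>2 \<le> 1" using c(3) by (simp add: power_le_one)
    then have 1: "2 * ((c - g 0) \<bullet> w) \<ge> a\<^sup>2/4 - 2 * (a^20)\<^sup>2"
      unfolding e norm_diff_sq[of "c - g 0" w] using w2 c(2) by linarith
    have "(c - g 0) \<bullet> w = X * tilt c + Y * ht c"
    proof -
      have t2: "(fst (g' 0))\<^sup>2 + (snd (g' 0))\<^sup>2 = 1"
        using speed[of 0] by (simp add: norm_prod_def real_sqrt_eq_1_iff)
      have "X * tilt c + Y * ht c = ((c - g 0) \<bullet> w) * ((fst (g' 0))\<^sup>2 + (snd (g' 0))\<^sup>2)"
        unfolding X_def Y_def tilt_def ht_def perp_def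
        by (simp add: inner_prod_def algebra_simps power2_eq_square)
      then show ?thesis using t2 by simp
    qed
    moreover have "\<bar>X * tilt c\<bar> \<le> a * (a^19/32)" unfolding abs_mult
      using X c(1) a_pos by (intro mult_mono) auto
    moreover have "a * (a^19/32) \<le> a\<^sup>2/64"
      using small_powers(7) a_pos mult_left_mono[of "a^19" "a/64" a] by (simp add: power2_eq_square)
    moreover have "(a^20)\<^sup>2 \<le> a\<^sup>2/64" using small_powers(9) by (simp flip: power_mult)
    moreover have "0 < a\<^sup>2" using a_pos by simp
    ultimately show ?thesis using 1 by linarith
  qed
  have "Y * ht (g xh) > 0" "Y * ht (g yh) > 0"
    using key[OF tilt_xh] key[OF tilt_yh] strand_xh_sq(1)[of True] strand_yh_sq[of True]
      dist_xh_le[OF aT] dist_yh_le[OF aT] by (auto simp: strand_def norm_minus_commute)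
  then show ?thesis unfolding zero_less_mult_iff by auto
qed

text \<open>Both points are at distance almost \<open>1\<close> from the pinch, in almost the same direction.\<close>

lemma xh_yh_close: "norm (g xh - g yh) \<le> 2 * a^19"
proof -
  have "\<bar>ht (g xh) - ht (g yh)\<bar> \<le> a^19"
    using same_side ht_xh ht_yh unfolding zero_less_mult_iff by linarith
  moreover have "\<bar>tilt (g xh) - tilt (g yh)\<bar> \<le> a^19" using tilt_xh tilt_yh small_powers(1) by linarith
  ultimately have "(ht (g xh) - ht (g yh))\<^sup>2 + (tilt (g xh) - tilt (g yh))\<^sup>2 \<le> (a^19)\<^sup>2 + (a^19)\<^sup>2"
    using a_pos by (intro add_mono power2_le_iff_abs_le[THEN iffD2]) auto
  also have "\<dots> \<le> (2 * a^19)\<^sup>2" by (simp add: power_mult_distrib)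
  finally have 1: "(ht (g xh) - ht (g yh))\<^sup>2 + (tilt (g xh) - tilt (g yh))\<^sup>2 \<le> (2 * a^19)\<^sup>2" .
  have "(norm (g xh - g yh))\<^sup>2 = (ht (g xh) - ht (g yh))\<^sup>2 + (tilt (g xh) - tilt (g yh))\<^sup>2"
    using norm_perp_decomp[OF speed[of 0], of "g xh - g yh"]
    by (simp add: tilt_def ht_def inner_diff_right inner_diff_left inner_commute)
  then show ?thesis using 1 power2_le_imp_le[of "norm (g xh - g yh)" "2 * a^19"] a_pos by simp
qed

text \<open>The arc starts and ends near the unit sphere around \<open>g xh\<close>, with opposite senses of rotation.
  So it moves radially somewhere, and by the bounded curvature it reaches depth of order \<open>a\<close>.\<close>

lemma deep_point: "\<exists>z\<in>{0..T}. norm (g z - g xh) \<le> 1 - 4 * a"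
proof (cases "\<forall>t\<in>{0..T}. norm (g t - g xh) > 1/2")
  case False
  then show ?thesis using a_le by force
next
  case True
  let ?A = "g' 0 \<bullet> perp (g 0 - g xh)" and ?B = "g' 0 \<bullet> perp (g T - g 0)"
  have A: "?A = ht (g xh)" by (simp add: ht_def perp_def inner_prod_def algebra_simps)
  have "\<bar>?B\<bar> \<le> norm (g' 0) * norm (perp (g T - g 0))" by (rule Cauchy_Schwarz_ineq2)
  then have B: "\<bar>?B\<bar> \<le> a^40" using close by (simp add: speed)
  have C: "g' T \<bullet> perp (g T - g xh) = - (?A + ?B)"
    by (simp add: anti perp_def inner_prod_def algebra_simps)
  have "\<bar>?B\<bar> \<le> \<bar>?A\<bar>" unfolding A using B ht_xh a20 small_powers by linarith
  then have "\<bar>?A\<bar> * \<bar>?B\<bar> \<le> \<bar>?A\<bar> * \<bar>?A\<bar>" by (rule mult_left_mono) simp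
  then have "\<bar>?A * ?B\<bar> \<le> ?A * ?A" by (simp only: abs_mult abs_mult_self_eq)
  then have "?A * (g' T \<bullet> perp (g T - g xh)) \<le> 0"
    unfolding C by (simp add: right_diff_distrib)
  then obtain x y where xy: "x\<in>{0..T}" "y\<in>{0..T}" "norm (g x - g xh) \<ge> norm (g y - g xh) + (8 * a) / 2"
    using not_in_thin_annulus[of "8 * a" T "g xh"] True a_pos a_le kappa_a T_ge by force
  then show ?thesis using dist_xh_le[of x] by (intro bexI[of _ y]) (auto simp: norm_minus_commute)
qed

text \<open>A point of the curve that is far from the deep point is also at distance of order \<open>a\<close> from \<open>g xh\<close>
  and \<open>g yh\<close>, which nearly coincide. Hence the parameters \<open>xh\<close> and \<open>yh\<close> are far apart although the points
  are close: the curve has a second pinch here.\<close>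

lemma opp_long: "xh + 6 * a \<le> yh"
proof -
  obtain z where z: "z \<in> {0..T}" "norm (g z - g xh) \<le> 1 - 4 * a" using deep_point by blast
  obtain y where y: "y \<in> opp" "norm (g y - g z) \<ge> 1" using far_opp[of z] z by auto
  have "norm (g y - g z) \<le> norm (g y - g xh) + norm (g z - g xh)"
    using norm_triangle_ineq4[of "g y - g xh" "g z - g xh"] by simp
  then have 1: "norm (g y - g xh) \<ge> 4 * a" using y z by linarith
  moreover have "norm (g y - g xh) \<le> norm (g y - g yh) + norm (g xh - g yh)"
    using norm_triangle_ineq4[of "g y - g yh" "g xh - g yh"] by simp
  ultimately have "norm (g y - g yh) \<ge> 2 * a" using xh_yh_close small_powers(7) a_pos by linarith
  then show ?thesis using 1 dist_le[of y xh] dist_le[of y yh] xh_le[OF y(1)] yh_ge[OF y(1)] by linarith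
qed

text \<open>Otherwise the ball around \<open>g y\<close> contains the arc, and each point of the arc has its far points on
  one side of \<open>y\<close> only, by \<open>JC\<close>. Both sides occur and are closed conditions, so the arc would be
  disconnected.\<close>

lemma far_cover:
  assumes "xh \<le> y" "y \<le> yh"
  shows "\<exists>z\<in>{0..T}. norm (g y - g z) \<ge> 1"
proof (rule ccontr)
  assume n: "\<not> ?thesis"
  then have yy: "xh < y" "y < yh"
    using xh_opp yh_opp assms unfolding opp_def by (auto simp: le_less)
  let ?U = "{z\<in>{0..T}. \<exists>r\<in>{T..y}. norm (g z - g r) \<ge> 1}"
  let ?V = "{z\<in>{0..T}. \<exists>r\<in>{y..l}. norm (g z - g r) \<ge> 1}"
  obtain z1 where z1: "z1 \<in> {0..T}" "norm (g xh - g z1) \<ge> 1" using xh_opp by (auto simp: opp_def)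
  obtain z2 where z2: "z2 \<in> {0..T}" "norm (g yh - g z2) \<ge> 1" using yh_opp by (auto simp: opp_def)
  show False
  proof (rule interval_not_union_of_two[of ?U ?V 0 T z1 z2])
    show "compact ?U" "compact ?V" by (intro compact_far cont compact_Icc)+
    show "?U \<inter> ?V = {}"
    proof (rule ccontr)
      assume "?U \<inter> ?V \<noteq> {}"
      then obtain z r1 r2 where h: "z \<in> {0..T}" "r1 \<in> {T..y}" "norm (g z - g r1) \<ge> 1"
        "r2 \<in> {y..l}" "norm (g z - g r2) \<ge> 1" by blast
      have ny: "norm (g y - g z) < 1" using n h by (meson not_le)
      have "r1 \<noteq> y" "r2 \<noteq> y" using h ny by (auto simp: norm_minus_commute)
      moreover have "T < r1" "r2 < l" using oppI[of r1 z] oppI[of r2 z] h yy T_pos T_less_xh yh_less_l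
        by (auto simp: norm_minus_commute)
      ultimately have "z < r1" "r1 < y" "y < r2" "r2 < z + l" using h by auto
      from JC[OF this, of z] ny h show False by (auto simp: norm_minus_commute)
    qed
    show "{0..T} \<subseteq> ?U \<union> ?V"
    proof
      fix z assume z: "z \<in> {0..T}"
      obtain r where r: "r \<in> opp" "norm (g r - g z) \<ge> 1" using far_opp[of z] z by auto
      then have "r \<in> {T..y} \<or> r \<in> {y..l}" using opp_bounds[of r] by auto
      then show "z \<in> ?U \<union> ?V" using z r by (auto simp: norm_minus_commute)
    qed
    show "z1 \<in> ?U \<inter> {0..T}" using z1 yy T_less_xh
      by (auto simp: norm_minus_commute intro!: bexI[of _ xh])
    show "z2 \<in> ?V \<inter> {0..T}" using z2 yy yh_less_l
      by (auto simp: norm_minus_commute intro!: bexI[of _ yh])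
  qed
qed

text \<open>The deep point is in the ball around \<open>g y\<close>. If both pinch points were outside, they would
  separate it from \<open>g y\<close>.\<close>

lemma near_pinch:
  assumes y: "xh \<le> y" "y \<le> xh + 2 * a"
  shows "norm (g y - g 0) < 1 \<or> norm (g y - g T) < 1"
proof (rule ccontr)
  assume n: "\<not> ?thesis"
  have yl: "y < yh" "y < l" "T < y" using y opp_long a_pos yh_less_l T_less_xh by auto
  obtain z where z: "z \<in> {0..T}" "norm (g z - g xh) \<le> 1 - 4 * a" using deep_point by blast
  have "norm (g z - g y) < 1"
    using norm_triangle_ineq4[of "g z - g xh" "g y - g xh"] dist_le[of y xh] z y a_pos by simp
  moreover from this have "z \<noteq> 0" "z \<noteq> T" using n by (auto simp: norm_minus_commute)
  ultimately show False
    using JC[of z T y l y] n z yl per[of 0] by (auto simp: norm_minus_commute)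
qed

lemma near_pinch_le:
  assumes "xh \<le> y" "y \<le> xh + 2 * a"
  shows "norm (g y - strand b 0) < 1 + a^40"
proof -
  have 1: "norm (g y - g 0) \<le> norm (g y - g T) + norm (g T - g 0)"
    using norm_triangle_ineq[of "g y - g T" "g T - g 0"] by simp
  have 2: "norm (g y - g T) \<le> norm (g y - g 0) + norm (g T - g 0)"
    using norm_triangle_ineq[of "g y - g 0" "g 0 - g T"] by (simp add: norm_minus_commute)
  show ?thesis using near_pinch[OF assms] 1 2 close a20 by (auto simp: strand_def)
qed

end



lemma inner_decomp:
  fixes x y :: point
  assumes "norm v = 1"
  shows "x \<bullet> y = (v \<bullet> x) * (v \<bullet> y) + (perp v \<bullet> x) * (perp v \<bullet> y)"
proof -
  have t2: "(fst v)\<^sup>2 + (snd v)\<^sup>2 = 1"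
    using assms by (simp add: norm_prod_def real_sqrt_eq_1_iff)
  have "(v \<bullet> x) * (v \<bullet> y) + (perp v \<bullet> x) * (perp v \<bullet> y) = (x \<bullet> y) * ((fst v)\<^sup>2 + (snd v)\<^sup>2)"
    unfolding perp_def by (simp add: inner_prod_def algebra_simps power2_eq_square)
  then show ?thesis using t2 by simp
qed

context pinched_loop
begin

lemma pow_le: "n < m \<Longrightarrow> a^m \<le> a^n / 64"
proof -
  assume "n < m"
  then have "a^m \<le> a^Suc n" using a_pos a_le by (intro power_decreasing) auto
  then show ?thesis using pow_a(1)[of n] by linarith
qed

lemma sq40: "(a^40)\<^sup>2 \<le> a^40" and sq20: "(a^20)\<^sup>2 = a^40"
  using mult_left_mono[of "a^40" 1 "a^40"] a20(5,6)
  by (auto simp: power2_eq_square simp del: power_mult_distrib simp flip: power_add)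

lemma kappa_pows: "\<kappa> * a^20 = a^19/64" "\<kappa> * a^4 = a^3/64" "\<kappa> * (a^4)\<^sup>2 = a^7/64" "\<kappa> * (a^5)\<^sup>2 = a^9/64"
  using kappa_pow[of 19] kappa_pow[of 3] kappa_pow[of 7] kappa_pow[of 9] by (auto simp flip: power_mult)

lemma xh_gaps: "xh - T \<ge> 1 - a^40" "l - xh \<ge> 1 - a^40"
  using dist_xh_ge dist_le[of xh T] dist_le[of xh l] per[of 0] T_less_xh xh_less_l by auto

text \<open>The curve passes \<open>g xh\<close> almost tangentially to the sphere around the pinch: both shortly before and
  shortly after \<open>xh\<close> it is within distance \<open>1 + a ^ 40\<close> of \<open>g 0\<close>.\<close>

lemma dir_xh_perp: "\<bar>g' xh \<bullet> (g xh - g 0)\<bar> \<le> a^19 / 16"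
proof -
  let ?s = "a^20" and ?X = "g' xh \<bullet> (g xh - g 0)"
  have n: "norm (g xh - g 0) \<le> 1" "(norm (g xh - g 0))\<^sup>2 \<ge> 1 - 2 * ?s\<^sup>2"
    using dist_xh_le[of 0] strand_xh_sq(1)[of True] T_pos by (auto simp: strand_def norm_minus_commute)
  have kn: "2 * \<kappa> * ?s\<^sup>2 * norm (g xh - g 0) \<le> 2 * \<kappa> * ?s\<^sup>2"
    using n(1) kappa_ge by (simp add: mult_left_le)
  have s: "0 < ?s" "?s \<le> a / 64" using a_pos pow_le[of 1 20] by auto
  have e: "(1 + a^40)\<^sup>2 \<le> 1 + 3 * ?s\<^sup>2"
    unfolding sq20 power2_sum using sq40 by simp
  have up: "r * ?X \<le> (5/2 + \<kappa>) * ?s" if r: "r = 1 \<or> r = -1" "norm (g (xh + r * ?s) - g 0) < 1 + a^40" for r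
  proof -
    have "(norm (g (xh + r * ?s) - g 0))\<^sup>2 \<le> (1 + a^40)\<^sup>2" using r(2) by (intro power_mono) auto
    moreover have rs: "(r * ?s)\<^sup>2 = ?s\<^sup>2" "2 * (r * ?s) * ?X = 2 * ?s * (r * ?X)" using r by auto
    ultimately have "2 * ?s * (r * ?X) \<le> 5 * ?s\<^sup>2 + 2 * \<kappa> * ?s\<^sup>2"
      using dist_lower[of xh "g 0" "r * ?s"] n(2) kn e unfolding rs by linarith
    also have "\<dots> = 2 * ?s * ((5/2 + \<kappa>) * ?s)" by (simp add: power2_eq_square algebra_simps)
    finally show ?thesis by (rule mult_left_le_imp_le) (use s in simp)
  qed
  have "norm (g (xh + 1 * ?s) - g 0) < 1 + a^40"
    using near_pinch_le[of "xh + ?s" True] s a_pos by (simp add: strand_def)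
  note up1 = up[OF _ this]
  have "norm (g (xh - ?s) - g 0) < 1"
    by (rule before_xh) (use s xh_gaps a20 T_pos in linarith)+
  then have "norm (g (xh - ?s) - g 0) < 1 + a^40" using a20(6) by linarith
  moreover have "xh + (-1) * ?s = xh - ?s" by simp
  ultimately have "norm (g (xh + (-1) * ?s) - g 0) < 1 + a^40" by (simp only:)
  note up2 = up[OF _ this]
  have "(5/2 + \<kappa>) * ?s \<le> a^19 / 16"
    unfolding distrib_right kappa_pows(1) using pow_le[of 19 20] small_powers(1) by linarith
  then show ?thesis using up1 up2 by auto
qed

lemma dir_xh: "\<bar>perp (g' 0) \<bullet> g' xh\<bar> \<le> a^19" "\<bar>g' 0 \<bullet> g' xh\<bar> \<ge> 1/2"
proof -
  let ?p = "perp (g' 0) \<bullet> g' xh" and ?q = "g' 0 \<bullet> g' xh"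
  have sq: "?q\<^sup>2 + ?p\<^sup>2 = 1"
    using norm_perp_decomp[OF speed[of 0], of "g' xh"] speed by (simp add: inner_commute)
  then have q1: "\<bar>?q\<bar> \<le> 1" by (metis abs_square_le_1 le_add_same_cancel1 zero_le_power2)
  have "g' xh \<bullet> (g xh - g 0) = ?q * tilt (g xh) + ?p * ht (g xh)"
    unfolding tilt_def ht_def by (rule inner_decomp[OF speed])
  moreover have "\<bar>?q * tilt (g xh)\<bar> \<le> 1 * (a^19/32)"
    unfolding abs_mult using q1 tilt_xh by (intro mult_mono) auto
  ultimately have "\<bar>?p * ht (g xh)\<bar> \<le> a^19 / 8" using dir_xh_perp small_powers(1) by linarith
  moreover have "\<bar>?p\<bar> * (1/2) \<le> \<bar>?p * ht (g xh)\<bar>"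
    unfolding abs_mult using ht_xh small_powers(2) by (intro mult_left_mono) auto
  ultimately show p: "\<bar>?p\<bar> \<le> a^19" using small_powers(1) by linarith
  have "?p\<^sup>2 \<le> (a^19)\<^sup>2" using p a_pos by (intro power2_le_iff_abs_le[THEN iffD2]) auto
  then have "(1/2)\<^sup>2 \<le> \<bar>?q\<bar>\<^sup>2" unfolding power2_abs
    using sq small_powers(2,5) by (simp add: power_divide)
  then show "\<bar>?q\<bar> \<ge> 1/2" by (rule power2_le_imp_le) simp
qed

text \<open>As the point \<open>g (xh + v)\<close> moves away from \<open>g xh\<close>, the part of the arc that is far from it
  grows continuously out of one end of the arc, so it cannot jump over parameters.\<close>

lemma sweep:
  assumes t: "0 \<le> t" "t \<le> 2 * a" and z: "z \<in> {0..T}" "norm (g z - g (xh + t)) \<ge> 1"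
  shows "(\<forall>w\<in>{0<..z}. \<exists>v\<in>{0..t}. norm (g w - g (xh + v)) \<ge> 1) \<or>
    (\<forall>w\<in>{z..<T}. \<exists>v\<in>{0..t}. norm (g w - g (xh + v)) \<ge> 1)"
proof (rule ccontr)
  assume "\<not> ?thesis"
  then obtain w w' where w: "w \<in> {0<..z}" "w' \<in> {z..<T}"
    and n: "\<And>v. v \<in> {0..t} \<Longrightarrow> norm (g w - g (xh + v)) < 1"
      "\<And>v. v \<in> {0..t} \<Longrightarrow> norm (g w' - g (xh + v)) < 1" by (meson not_le)
  have zz: "w < z" "z < w'" using w z n(1)[of t] n(2)[of t] t by (auto simp: le_less)
  let ?U = "{y\<in>{xh..xh+t}. \<exists>r\<in>{w..w'}. norm (g y - g r) \<ge> 1}"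
  let ?V = "{y\<in>{xh..xh+t}. \<exists>r\<in>{w'..w+l}. norm (g y - g r) \<ge> 1}"
  show False
  proof (rule interval_not_union_of_two[of ?U ?V xh "xh + t" "xh + t" xh])
    show "compact ?U" "compact ?V" by (intro compact_far cont compact_Icc)+
    show "?U \<inter> ?V = {}"
    proof (rule ccontr)
      assume "?U \<inter> ?V \<noteq> {}"
      then obtain y r1 r2 where h: "y \<in> {xh..xh+t}" "r1 \<in> {w..w'}" "norm (g y - g r1) \<ge> 1"
        "r2 \<in> {w'..w+l}" "norm (g y - g r2) \<ge> 1" by blast
      have ny: "norm (g w - g y) < 1" "norm (g w' - g y) < 1" using n[of "y - xh"] h by auto
      moreover have "r1 \<noteq> w" "r1 \<noteq> w'" "r2 \<noteq> w'" "r2 \<noteq> w + l"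
        using h ny per by (auto simp: norm_minus_commute)
      ultimately show False using JC[of w r1 w' r2 y] h by (auto simp: norm_minus_commute)
    qed
    show "{xh..xh+t} \<subseteq> ?U \<union> ?V"
    proof
      fix y assume y: "y \<in> {xh..xh+t}"
      obtain r where r: "r \<in> {w..<w+l}" "norm (g r - g y) \<ge> 1" using far_point by blast
      then have "r \<in> {w..w'} \<or> r \<in> {w'..w+l}" by auto
      then show "y \<in> ?U \<union> ?V" using y r by (auto simp: norm_minus_commute)
    qed
    show "xh + t \<in> ?U \<inter> {xh..xh+t}" using z zz t
      by (auto simp: norm_minus_commute intro!: bexI[of _ z])
    have "T \<in> {w'..w+l}" "l \<in> {w'..w+l}" using w zz z T_less T_pos by auto
    moreover have "norm (g xh - g l) = 1 \<or> norm (g xh - g T) = 1" using xh_sphere per[of 0] by simp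
    ultimately have "\<exists>r\<in>{w'..w+l}. norm (g xh - g r) \<ge> 1" by (metis order_refl)
    then show "xh \<in> ?V \<inter> {xh..xh+t}" using t by simp
  qed
qed

text \<open>In the time \<open>t\<close> either the swept part of the arc or the point on the opposite strand advances by
  \<open>t\<close>; this is the alternative \<open>s = t \<or> v = t\<close>.\<close>

lemma sweep_strand:
  assumes t: "0 < t" "t \<le> 2 * a"
  obtains b s v where "0 \<le> s" "s \<le> t" "0 \<le> v" "v \<le> t" "s = t \<or> v = t"
    "norm (strand b s - g (xh + v)) \<ge> 1"
proof -
  have tT: "t < T" using t T_ge a_pos by linarith
  obtain z where z: "z \<in> {0..T}" "norm (g (xh + t) - g z) \<ge> 1"
    using far_cover[of "xh + t"] t opp_long a_pos by force
  then have z': "norm (g z - g (xh + t)) \<ge> 1" by (simp add: norm_minus_commute)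
  from sweep[OF _ t(2) z(1) z'] t(1) consider
    (1) "\<forall>w\<in>{0<..z}. \<exists>v\<in>{0..t}. norm (g w - g (xh + v)) \<ge> 1"
    | (2) "\<forall>w\<in>{z..<T}. \<exists>v\<in>{0..t}. norm (g w - g (xh + v)) \<ge> 1" by auto
  then show thesis
  proof cases
    case 1
    show thesis
    proof (cases "t \<le> z")
      case True
      then obtain v where "v \<in> {0..t}" "norm (g t - g (xh + v)) \<ge> 1" using 1 t by fastforce
      then show thesis using that[of t v True] t by (auto simp: strand_def)
    next
      case False
      then show thesis using that[of z t True] t z z' by (auto simp: strand_def)
    qed
  next
    case 2
    show thesis
    proof (cases "t \<le> T - z")
      case True
      then have "T - t \<in> {z..<T}" using t by auto
      then obtain v where "v \<in> {0..t}" "norm (g (T - t) - g (xh + v)) \<ge> 1" using 2 by blast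
      then show thesis using that[of t v False] t by (auto simp: strand_def)
    next
      case False
      then show thesis using that[of "T - z" t False] t z z' by (auto simp: strand_def)
    qed
  qed
qed

lemma strand_in_arc:
  assumes "0 \<le> s" "s \<le> T"
  shows "\<exists>z\<in>{0..T}. strand b s = g z"
  using assms by (cases b) (auto simp: strand_def)

text \<open>The point at \<open>s\<close> is within distance \<open>1\<close> of \<open>g xh\<close> but not of \<open>g (xh + v)\<close>, whereas the pinch has
  distance at least \<open>1 - a ^ 40\<close> from the former and at most \<open>1 + a ^ 40\<close> from the latter. Expanding the
  squares compares the two displacements.\<close>

lemma product_upper:
  assumes "norm (strand b s - g (xh + v)) \<ge> 1" "0 \<le> s" "s \<le> T" "0 \<le> v" "v \<le> 2 * a"
  shows "(strand b s - strand b 0) \<bullet> (g (xh + v) - g xh) \<le> 2 * a^40"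
proof -
  define B where "B = strand b s - strand b 0"
  define Y where "Y = g (xh + v) - strand b 0"
  define X where "X = g xh - strand b 0"
  have "(norm (B - Y))\<^sup>2 \<ge> 1" using assms(1) by (simp add: B_def Y_def one_le_power)
  moreover obtain z where "z \<in> {0..T}" "strand b s = g z" using strand_in_arc assms by blast
  then have "norm (B - X) \<le> 1" using dist_xh_le[of z] by (simp add: B_def X_def norm_minus_commute)
  then have "(norm (B - X))\<^sup>2 \<le> 1" by (simp add: power_le_one)
  ultimately have 1: "2 * (B \<bullet> Y) - 2 * (B \<bullet> X) \<le> (norm Y)\<^sup>2 - (norm X)\<^sup>2"
    unfolding norm_diff_sq by linarith
  have "(norm Y)\<^sup>2 \<le> (1 + a^40)\<^sup>2"
    using near_pinch_le[of "xh + v" b] assms by (intro power_mono) (auto simp: Y_def)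
  moreover have "(1 - a^40)\<^sup>2 \<le> (norm X)\<^sup>2"
    using strand_xh(2)[of b] a20(5) by (intro power_mono) (auto simp: X_def norm_minus_commute)
  moreover have "(1 + a^40)\<^sup>2 - (1 - a^40)\<^sup>2 = 4 * a^40" by (simp add: power2_sum power2_diff)
  ultimately have "B \<bullet> Y - B \<bullet> X \<le> 2 * a^40" using 1 by linarith
  moreover have "B \<bullet> (g (xh + v) - g xh) = B \<bullet> Y - B \<bullet> X"
    by (simp add: Y_def X_def inner_diff_right)
  ultimately show ?thesis by (simp add: B_def)
qed

lemma product_lower:
  assumes "0 \<le> s" "0 \<le> v"
  shows "(strand b s - strand b 0) \<bullet> (g (xh + v) - g xh)
    \<ge> s * v * (g' 0 \<bullet> g' xh - \<kappa> * v - \<kappa> * s - (\<kappa> * s) * (\<kappa> * v))"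
proof -
  define r where "r = strand b s - strand b 0 - s *\<^sub>R g' 0"
  define q where "q = g (xh + v) - g xh - v *\<^sub>R g' xh"
  have r: "norm r \<le> \<kappa> * s\<^sup>2" and q: "norm q \<le> \<kappa> * v\<^sup>2"
    unfolding r_def q_def by (rule strand_taylor taylor)+
  have k: "0 \<le> \<kappa>" using kappa_ge by simp
  have "\<bar>g' 0 \<bullet> q\<bar> \<le> \<kappa> * v\<^sup>2" using Cauchy_Schwarz_ineq2[of "g' 0" q] q by (simp add: speed)
  then have 1: "s * (g' 0 \<bullet> q) \<ge> - (s * (\<kappa> * v\<^sup>2))" using assms(1)
    by (metis abs_le_iff minus_le_iff mult_left_mono mult_minus_right)
  have "\<bar>r \<bullet> g' xh\<bar> \<le> \<kappa> * s\<^sup>2" using Cauchy_Schwarz_ineq2[of r "g' xh"] r by (simp add: speed)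
  then have 2: "v * (r \<bullet> g' xh) \<ge> - (v * (\<kappa> * s\<^sup>2))" using assms(2)
    by (metis abs_le_iff minus_le_iff mult_left_mono mult_minus_right)
  have "\<bar>r \<bullet> q\<bar> \<le> norm r * norm q" by (rule Cauchy_Schwarz_ineq2)
  also have "\<dots> \<le> (\<kappa> * s\<^sup>2) * (\<kappa> * v\<^sup>2)" using r q k by (intro mult_mono) auto
  finally have 3: "r \<bullet> q \<ge> - ((\<kappa> * s\<^sup>2) * (\<kappa> * v\<^sup>2))" by linarith
  have "(strand b s - strand b 0) \<bullet> (g (xh + v) - g xh) = (s *\<^sub>R g' 0 + r) \<bullet> (v *\<^sub>R g' xh + q)"
    by (simp add: r_def q_def)
  also have "\<dots> = s * v * (g' 0 \<bullet> g' xh) + s * (g' 0 \<bullet> q) + v * (r \<bullet> g' xh) + r \<bullet> q"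
    by (simp add: inner_add_left inner_add_right distrib_left)
  also have "\<dots> \<ge> s * v * (g' 0 \<bullet> g' xh) - s * (\<kappa> * v\<^sup>2) - v * (\<kappa> * s\<^sup>2) - (\<kappa> * s\<^sup>2) * (\<kappa> * v\<^sup>2)"
    using 1 2 3 by linarith
  also have "s * v * (g' 0 \<bullet> g' xh) - s * (\<kappa> * v\<^sup>2) - v * (\<kappa> * s\<^sup>2) - (\<kappa> * s\<^sup>2) * (\<kappa> * v\<^sup>2)
    = s * v * (g' 0 \<bullet> g' xh - \<kappa> * v - \<kappa> * s - (\<kappa> * s) * (\<kappa> * v))"
    by (simp add: power2_eq_square algebra_simps)
  finally show ?thesis by simp
qed

lemma tilt_along: "\<bar>tilt (g (t + s)) - tilt (g t) - s * (g' 0 \<bullet> g' t)\<bar> \<le> \<kappa> * s\<^sup>2"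
proof -
  have "tilt (g (t + s)) - tilt (g t) - s * (g' 0 \<bullet> g' t) = g' 0 \<bullet> (g (t + s) - g t - s *\<^sub>R g' t)"
    by (simp add: tilt_def inner_diff_right inner_scaleR_right)
  also have "\<bar>\<dots>\<bar> \<le> norm (g' 0) * norm (g (t + s) - g t - s *\<^sub>R g' t)" by (rule Cauchy_Schwarz_ineq2)
  finally show ?thesis using taylor[of t s] by (simp add: speed)
qed

lemma sq_lower: "0 \<le> e \<Longrightarrow> e \<le> 1 \<Longrightarrow> 1 - e \<le> x \<Longrightarrow> 1 - 2 * e \<le> x\<^sup>2" for x e :: real
proof -
  assume "0 \<le> e" "e \<le> 1" "1 - e \<le> x"
  then have "(1 - e)\<^sup>2 \<le> x\<^sup>2" by (intro power_mono) auto
  moreover have "(1 - e)\<^sup>2 = 1 - 2 * e + e\<^sup>2" by (simp add: power2_diff)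
  ultimately show ?thesis using zero_le_power2[of e] by linarith
qed

text \<open>Suppose that the curve leaves \<open>g xh\<close> in the direction in which the strands leave the pinch. By the
  product estimates the two displacements \<open>s\<close> and \<open>v\<close> satisfy \<open>s * v \<le> 8 * a ^ 40\<close>, so when one of them is \<open>a ^ 4\<close>
  the other is negligible.

  If \<open>v = a ^ 4\<close>, then both strands approach \<open>Y = g (xh + v)\<close> from a distance of almost exactly
  \<open>1\<close>. So they are inside the ball around \<open>Y\<close> after the pinch and outside before it, which contradicts \<open>JC\<close>.
  If \<open>s = a ^ 4\<close>, then the point \<open>B\<close> of a strand has distance almost \<open>1\<close> from \<open>g xh\<close> and the curve
  approaches it, so that shortly before \<open>xh\<close> the distance exceeds \<open>1\<close>, contrary to the choice of \<open>xh\<close>.\<close>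

lemma dir_opposite: "g' 0 \<bullet> g' xh \<le> - 1/2"
proof (rule ccontr)
  let ?D = "g' 0 \<bullet> g' xh"
  assume "\<not> ?thesis"
  then have D: "?D \<ge> 1/2" using dir_xh(2) by linarith
  let ?t = "a^4"
  have t: "0 < ?t" "?t \<le> 2 * a" "?t \<le> a / 64" using a_pos pow_le[of 1 4] by auto
  have tT: "?t < T" using t T_ge a_pos by linarith
  obtain b s v where sv: "0 \<le> s" "s \<le> ?t" "0 \<le> v" "v \<le> ?t" "s = ?t \<or> v = ?t"
    "norm (strand b s - g (xh + v)) \<ge> 1" using sweep_strand[OF t(1,2)] by metis
  have k: "\<kappa> * ?t \<le> 1/64" "0 \<le> \<kappa>" 
  proof -
    have "a^3 \<le> 1" using a_pos a_le by (intro power_le_one) auto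
    then show "\<kappa> * ?t \<le> 1/64" using kappa_pows(2) by linarith
  qed (use kappa_ge in linarith)
  have ks: "\<kappa> * s \<le> 1/64" "\<kappa> * v \<le> 1/64" "0 \<le> \<kappa> * s" "0 \<le> \<kappa> * v"
    using mult_left_mono[OF sv(2) k(2)] mult_left_mono[OF sv(4) k(2)] k sv by auto
  have "(\<kappa> * s) * (\<kappa> * v) \<le> 1/64 * 1" using ks by (intro mult_mono) auto
  then have "1/4 \<le> ?D - \<kappa> * v - \<kappa> * s - (\<kappa> * s) * (\<kappa> * v)" using D ks by linarith
  then have "s * v * (1/4) \<le> s * v * (?D - \<kappa> * v - \<kappa> * s - (\<kappa> * s) * (\<kappa> * v))"
    using sv by (intro mult_left_mono) auto
  then have prod: "s * v \<le> 8 * a^40"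
    using product_lower[OF sv(1,3), of b] product_upper[OF sv(6,1) _ sv(3)] sv t tT by simp
  have a36: "a^40 = a^36 * ?t" by (simp flip: power_add)
  show False using sv(5)
  proof
    assume v: "v = ?t"
    have s: "s \<le> 8 * a^36" 
    proof -
      have "s * ?t \<le> (8 * a^36) * ?t" using prod unfolding v a36 by linarith
      then show ?thesis using t(1) by (rule mult_right_le_imp_le)
    qed
    define Y where "Y = g (xh + ?t)"
    have far: "norm (strand b s - Y) \<ge> 1" using sv(6) v by (simp add: Y_def)
    have n: "norm (strand b' 0 - Y) \<ge> 1 - 9 * a^36" "norm (strand b' 0 - Y) \<le> 1 + a^40" for b'
    proof -
      have "norm (strand b s - Y) \<le> norm (strand b s - strand b 0) + norm (strand b 0 - strand b' 0)
          + norm (strand b' 0 - Y)"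
        using norm_triangle_ineq[of "strand b s - strand b 0" "strand b 0 - Y"]
          norm_triangle_ineq[of "strand b 0 - strand b' 0" "strand b' 0 - Y"] by simp
      moreover have "norm (strand b 0 - strand b' 0) \<le> a^40"
        using close a20(6) by (auto simp: strand_def norm_minus_commute)
      moreover have "norm (strand b s - strand b 0) \<le> s" using strand_lip[of b s 0] sv by simp
      ultimately show "norm (strand b' 0 - Y) \<ge> 1 - 9 * a^36"
        using s far pow_le[of 36 40] pow_a(2)[of 36] by linarith
      show "norm (strand b' 0 - Y) \<le> 1 + a^40"
        using near_pinch_le[of "xh + ?t" b'] t by (simp add: Y_def norm_minus_commute)
    qed
    note k7 = kappa_pows(3)
    have "tilt Y \<ge> tilt (g xh) + ?t * ?D - a^7/64"
      using tilt_along[of xh ?t] unfolding Y_def k7 by linarith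
    moreover have "?t * ?D \<ge> ?t * (1/2)" using D t by (intro mult_left_mono) auto
    ultimately have tY: "tilt Y \<ge> ?t / 4"
      using tilt_xh pow_le[of 4 7] pow_le[of 4 19] t by linarith
    let ?s = "a^5"
    have s5: "?s * tilt Y \<ge> a^9 / 4"
      using mult_left_mono[OF tY, of ?s] a_pos by (simp flip: power_add)
    note ks5 = kappa_pows(4)
    have kn: "2 * \<kappa> * ?s\<^sup>2 * norm (strand b' 0 - Y) \<le> a^9 / 16" for b'
    proof -
      have "norm (strand b' 0 - Y) \<le> 2" using n(2)[of b'] a20(5) by linarith
      then have "(\<kappa> * ?s\<^sup>2) * norm (strand b' 0 - Y) \<le> (\<kappa> * ?s\<^sup>2) * 2"
        using k by (intro mult_left_mono) auto
      moreover have "2 * \<kappa> * ?s\<^sup>2 * norm (strand b' 0 - Y) = 2 * ((\<kappa> * ?s\<^sup>2) * norm (strand b' 0 - Y))" by simp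
      ultimately show ?thesis using ks5 by linarith
    qed
    have lft: "norm (strand b' (- ?s) - Y) \<ge> 1" for b'
    proof -
      have "(norm (strand b' 0 - Y))\<^sup>2 \<ge> 1 - 2 * (9 * a^36)"
        using n(1) pow_le[of 0 36] a_pos by (intro sq_lower) auto
      moreover have "(norm (strand b' (- ?s) - Y))\<^sup>2 \<ge> (norm (strand b' 0 - Y))\<^sup>2 + 2 * (?s * tilt Y)
          - 2 * \<kappa> * ?s\<^sup>2 * norm (strand b' 0 - Y)" using strand_lower[of b' Y "- ?s"] by simp
      ultimately have "(norm (strand b' (- ?s) - Y))\<^sup>2 \<ge> 1"
        using s5 kn[of b'] pow_le[of 9 36] pow_a(2)[of 9] by linarith
      then have "(norm (strand b' (- ?s) - Y))\<^sup>2 \<ge> 1\<^sup>2" by simp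
      then show ?thesis by (rule power2_le_imp_le) simp
    qed
    have rgt: "norm (strand b' ?s - Y) < 1" for b'
    proof -
      have "(norm (strand b' 0 - Y))\<^sup>2 \<le> (1 + a^40)\<^sup>2" using n(2) by (intro power_mono) auto
      then have "(norm (strand b' 0 - Y))\<^sup>2 \<le> 1 + 3 * a^40" using sq40 by (simp add: power2_sum)
      moreover have "?s\<^sup>2 \<le> a^9/64" using pow_le[of 9 10] by (simp flip: power_mult)
      moreover have "2 * ?s * tilt Y = 2 * (?s * tilt Y)" by simp
      ultimately have "(norm (strand b' ?s - Y))\<^sup>2 < 1"
        using strand_upper[of b' ?s Y] s5 kn[of b'] pow_le[of 9 40] pow_a(2)[of 9] by linarith
      then have "(norm (strand b' ?s - Y))\<^sup>2 < 1\<^sup>2" by simp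
      then show ?thesis by (rule power_less_imp_less_base) simp
    qed
    have ss: "0 < ?s" "?s \<le> a / 64" using a_pos pow_le[of 1 5] by auto
    have "norm (g (T + ?s) - Y) < 1 \<or> norm (g (l - ?s) - Y) < 1" unfolding Y_def
    proof (rule JC[of ?s _ "xh + ?t"])
      show "norm (g ?s - g (xh + ?t)) < 1" using rgt[of True] by (simp add: strand_def Y_def)
      show "?s < T + ?s" "T + ?s < xh + ?t" "xh + ?t < l - ?s" "l - ?s < ?s + l"
        using ss t T_pos xh_gaps a20 a_le by linarith+
    qed simp
    moreover have "g (l - ?s) = g (- ?s)" using per[of "- ?s"] by (simp add: add.commute)
    ultimately show False using lft[of True] lft[of False] by (auto simp: strand_def)
  next
    assume s: "s = ?t"
    have v: "v \<le> 8 * a^36" 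
    proof -
      have "v * ?t \<le> (8 * a^36) * ?t" using prod unfolding s a36 mult.commute[of v] by linarith
      then show ?thesis using t(1) by (rule mult_right_le_imp_le)
    qed
    define B where "B = strand b ?t"
    obtain z where z: "z \<in> {0..T}" "B = g z" using strand_in_arc[of ?t b] t tT unfolding B_def by auto
    have "norm (B - g (xh + v)) \<le> norm (B - g xh) + v"
      using norm_triangle_ineq[of "B - g xh" "g xh - g (xh + v)"] dist_le[of xh "xh + v"] sv by simp
    then have Bn: "norm (g xh - B) \<ge> 1 - 8 * a^36"
      using sv(6) v s by (simp add: B_def norm_minus_commute)
    have Bn1: "norm (g xh - B) \<le> 1" using dist_xh_le z by auto
    let ?s = "a^5"
    have ss: "0 < ?s" "?s \<le> a / 64" using a_pos pow_le[of 1 5] by auto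
    have "norm (g (xh - ?s) - B) < 1"
      unfolding z(2) by (rule before_xh) (use z ss xh_gaps a20 a_le in auto)
    then have up: "(norm (g (xh + - ?s) - B))\<^sup>2 < 1" by (simp add: power_less_one_iff)
    note k7 = kappa_pows(3)
    have "g' xh \<bullet> (B - strand b 0) \<ge> ?t / 4"
    proof -
      define r where "r = B - strand b 0 - ?t *\<^sub>R g' 0"
      have "norm r \<le> a^7/64" using strand_taylor[of b ?t] unfolding r_def B_def k7 .
      then have "\<bar>g' xh \<bullet> r\<bar> \<le> a^7/64" using Cauchy_Schwarz_ineq2[of "g' xh" r] by (simp add: speed)
      moreover have "B - strand b 0 = ?t *\<^sub>R g' 0 + r" by (simp add: r_def)
      then have "g' xh \<bullet> (B - strand b 0) = ?t * ?D + g' xh \<bullet> r"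
        by (simp add: inner_add_right inner_commute)
      moreover have "?t * ?D \<ge> ?t * (1/2)" using D t by (intro mult_left_mono) auto
      ultimately show ?thesis using pow_le[of 4 7] t(1) by linarith
    qed
    moreover have "\<bar>g' xh \<bullet> (g 0 - strand b 0)\<bar> \<le> a^40"
      using Cauchy_Schwarz_ineq2[of "g' xh" "g 0 - strand b 0"] strand_base(2)[of b] by (simp add: speed)
    moreover have "g' xh \<bullet> (g xh - B) = g' xh \<bullet> (g xh - g 0) + g' xh \<bullet> (g 0 - strand b 0) - g' xh \<bullet> (B - strand b 0)"
      by (simp add: inner_diff_right)
    ultimately have "g' xh \<bullet> (g xh - B) \<le> - (?t / 8)"
      using dir_xh_perp pow_le[of 4 19] pow_le[of 4 40] t(1) by linarith
    then have "?s * (g' xh \<bullet> (g xh - B)) \<le> ?s * (- (?t / 8))" using ss(1) by (intro mult_left_mono) auto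
    then have 1: "?s * (g' xh \<bullet> (g xh - B)) \<le> - (a^9 / 8)" by (simp flip: power_add)
    note ks5 = kappa_pows(4)
    have 2: "2 * \<kappa> * ?s\<^sup>2 * norm (g xh - B) \<le> a^9 / 32"
      using mult_left_mono[OF Bn1, of "2 * (\<kappa> * ?s\<^sup>2)"] k ks5 by (simp add: mult.assoc)
    have "(norm (g xh - B))\<^sup>2 \<ge> 1 - 2 * (8 * a^36)"
      using Bn pow_le[of 0 36] a_pos by (intro sq_lower) auto
    moreover have "(norm (g (xh + - ?s) - B))\<^sup>2 \<ge> (norm (g xh - B))\<^sup>2 - 2 * (?s * (g' xh \<bullet> (g xh - B)))
        - 2 * \<kappa> * ?s\<^sup>2 * norm (g xh - B)" using dist_lower[of xh B "- ?s"] by simp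
    ultimately show False using up 1 2 pow_le[of 10 36] pow_le[of 9 10] pow_a(2)[of 9] by linarith
  qed
qed

end



context pinched_loop
begin

lemma per_deriv: "g' (t + l) = g' t"
proof -
  have "((\<lambda>t. g (t + l)) has_vector_derivative g' (t + l)) (at t)"
  proof -
    have "((\<lambda>x. x + l) has_vector_derivative 1) (at t)" by (auto intro!: derivative_eq_intros)
    from vector_diff_chain_at[OF this deriv] show ?thesis by (simp add: o_def)
  qed
  then have "(g has_vector_derivative g' (t + l)) (at t)" using per by simp
  then show ?thesis using deriv vector_derivative_unique_at by blast
qed

lemma mirror_at: "g (T - (pinched_loop.xh (\<lambda>t. g (T - t)) l T + w)) = g (yh - w)"
  "g' (T - (pinched_loop.xh (\<lambda>t. g (T - t)) l T + w)) = g' (yh - w)"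
  "g (T - (pinched_loop.yh (\<lambda>t. g (T - t)) l T - w)) = g (xh + w)"
  unfolding mirror_xh mirror_yh
  using per[of "yh - l - w"] per_deriv[of "yh - l - w"] per[of "xh - l + w"] by (simp_all add: algebra_simps)

lemma yh_dirs: "- (g' 0 \<bullet> g' yh) \<le> - 1/2" "\<bar>g' yh \<bullet> (g yh - g T)\<bar> \<le> a^19 / 16"
proof -
  interpret m: pinched_loop "\<lambda>t. g (T - t)" "\<lambda>t. - g' (T - t)" \<kappa> l T a by (rule mirror)
  have e: "g (T - m.xh) = g yh" "g' (T - m.xh) = g' yh" using mirror_at(1,2)[of 0] by auto
  show "- (g' 0 \<bullet> g' yh) \<le> - 1/2" using m.dir_opposite e anti by simp
  show "\<bar>g' yh \<bullet> (g yh - g T)\<bar> \<le> a^19 / 16" using m.dir_xh_perp e by simp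
qed

text \<open>Over a length of \<open>6 * a\<close> the direction changes by at most \<open>6 / 64\<close>, so the strand keeps running
  against the direction of the pinch.\<close>

lemma tilt_decreasing:
  assumes "0 \<le> v" "v \<le> v'" "v' \<le> 6 * a"
  shows "tilt (g (xh + v')) \<le> tilt (g (xh + v)) - (v' - v) / 4"
proof -
  have d: "((\<lambda>x. tilt (g (xh + x)) + x / 4) has_real_derivative (g' 0 \<bullet> g' (xh + x) + 1/4)) (at x)" for x
  proof -
    have "((\<lambda>x. xh + x) has_vector_derivative 1) (at x)" by (auto intro!: derivative_eq_intros)
    from vector_diff_chain_at[OF this deriv]
    have "((\<lambda>x. g (xh + x)) has_vector_derivative g' (xh + x)) (at x)" by (simp add: o_def)
    then have "((\<lambda>x. g' 0 \<bullet> (g (xh + x) - g 0)) has_vector_derivative g' 0 \<bullet> (g' (xh + x) - 0)) (at x)"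
      by (intro bounded_linear.has_vector_derivative[OF bounded_linear_inner_right]
          has_vector_derivative_diff has_vector_derivative_const)
    then show ?thesis unfolding tilt_def
      by (auto intro!: derivative_eq_intros simp: has_real_derivative_iff_has_vector_derivative)
  qed
  have neg: "g' 0 \<bullet> g' (xh + x) + 1/4 \<le> 0" if "0 \<le> x" "x \<le> 6 * a" for x
  proof -
    have "g' 0 \<bullet> g' (xh + x) = g' 0 \<bullet> g' xh + g' 0 \<bullet> (g' (xh + x) - g' xh)" by (simp add: inner_diff_right)
    moreover have "g' 0 \<bullet> (g' (xh + x) - g' xh) \<le> norm (g' (xh + x) - g' xh)"
      using Cauchy_Schwarz_ineq2[of "g' 0" "g' (xh + x) - g' xh"] by (simp add: speed)
    moreover have "norm (g' (xh + x) - g' xh) \<le> \<kappa> * x" using lip[of "xh + x" xh] that by simp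
    moreover have "\<kappa> * x \<le> \<kappa> * (6 * a)" using that kappa_ge by (intro mult_left_mono) auto
    ultimately show ?thesis using dir_opposite kappa_a by linarith
  qed
  have "tilt (g (xh + v')) + v' / 4 \<le> tilt (g (xh + v)) + v / 4"
    by (rule DERIV_nonpos_imp_nonincreasing[OF assms(2)]) (use d neg assms in force)
  then show ?thesis by (simp add: field_simps)
qed

lemma tilt_decreasing_yh:
  assumes "0 \<le> v" "v \<le> v'" "v' \<le> 6 * a"
  shows "tilt (g (yh - v')) \<le> tilt (g (yh - v)) - (v' - v) / 4"
proof -
  interpret m: pinched_loop "\<lambda>t. g (T - t)" "\<lambda>t. - g' (T - t)" \<kappa> l T a by (rule mirror)
  show ?thesis using m.tilt_decreasing[OF assms] unfolding mirror_tilt mirror_at .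
qed

lemma tilt_lip: "\<bar>tilt (g s) - tilt (g t)\<bar> \<le> \<bar>s - t\<bar>"
proof -
  have "tilt (g s) - tilt (g t) = g' 0 \<bullet> (g s - g t)" by (simp add: tilt_def inner_diff_right)
  then show ?thesis using Cauchy_Schwarz_ineq2[of "g' 0" "g s - g t"] dist_le[of s t] by (simp add: speed)
qed

lemma continuous_tilt: "continuous_on S (\<lambda>x. tilt (g x))"
  unfolding tilt_def by (intro continuous_intros cont)

text \<open>Tilts attained on both strands of the second pinch. The upper end is kept away from \<open>0\<close> because
  \<open>g xh\<close> and \<open>g yh\<close> have tilts of size up to \<open>a ^ 19 / 32\<close>.\<close>

definition "levels = {- a / 4 .. - (a^18)}"

lemma level_xh: assumes "x \<in> levels" shows "\<exists>!v. v \<in> {0..2*a} \<and> tilt (g (xh + v)) = x"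
proof (rule ex_ex1I)
  have c: "continuous_on {0..2*a} (\<lambda>v. tilt (g (xh + v)))"
    by (intro continuous_on_compose2[OF continuous_tilt[of UNIV]] continuous_intros) auto
  have "tilt (g (xh + 2 * a)) \<le> x" "x \<le> tilt (g (xh + 0))"
    using tilt_decreasing[of 0 "2 * a"] tilt_xh assms a_pos small_powers(7) pow_le[of 18 19] unfolding levels_def by auto
  then show "\<exists>v. v \<in> {0..2*a} \<and> tilt (g (xh + v)) = x"
    using IVT2'[of "\<lambda>v. tilt (g (xh + v))" "2 * a" x 0] c a_pos by auto
  show "v = w" if "v \<in> {0..2*a} \<and> tilt (g (xh + v)) = x" "w \<in> {0..2*a} \<and> tilt (g (xh + w)) = x" for v w
    using tilt_decreasing[of v w] tilt_decreasing[of w v] that a_pos by (cases "v \<le> w") auto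
qed

lemma level_yh: assumes "x \<in> levels" shows "\<exists>!v. v \<in> {0..2*a} \<and> tilt (g (yh - v)) = x"
proof -
  interpret m: pinched_loop "\<lambda>t. g (T - t)" "\<lambda>t. - g' (T - t)" \<kappa> l T a by (rule mirror)
  show ?thesis using m.level_xh[OF assms[unfolded levels_def, folded m.levels_def]] unfolding mirror_tilt mirror_at .
qed

text \<open>The strands through \<open>g xh\<close> and \<open>g yh\<close> as graphs over their tilt.\<close>

definition "px x = (THE v. v \<in> {0..2*a} \<and> tilt (g (xh + v)) = x)"
definition "py x = (THE v. v \<in> {0..2*a} \<and> tilt (g (yh - v)) = x)"

lemma px: "x \<in> levels \<Longrightarrow> px x \<in> {0..2*a}" "x \<in> levels \<Longrightarrow> tilt (g (xh + px x)) = x"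
  and py: "x \<in> levels \<Longrightarrow> py x \<in> {0..2*a}" "x \<in> levels \<Longrightarrow> tilt (g (yh - py x)) = x"
  using theI'[OF level_xh, of x] theI'[OF level_yh, of x] unfolding px_def py_def by auto

lemma continuous_px: "continuous_on levels px" and continuous_py: "continuous_on levels py"
proof -
  have "\<bar>px x - px y\<bar> \<le> 4 * \<bar>x - y\<bar>" if "x \<in> levels" "y \<in> levels" for x y
    using tilt_decreasing[of "px x" "px y"] tilt_decreasing[of "px y" "px x"] px[of x] px[of y] that a_pos
    by (cases "px x \<le> px y") (simp_all add: abs_if field_simps)
  then have "4-lipschitz_on levels px" by (auto simp: lipschitz_on_def dist_real_def)
  then show "continuous_on levels px" by (rule lipschitz_on_continuous_on)
  have "\<bar>py x - py y\<bar> \<le> 4 * \<bar>x - y\<bar>" if "x \<in> levels" "y \<in> levels" for x y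
    using tilt_decreasing_yh[of "py x" "py y"] tilt_decreasing_yh[of "py y" "py x"] py[of x] py[of y] that a_pos
    by (cases "py x \<le> py y") (simp_all add: abs_if field_simps)
  then have "4-lipschitz_on levels py" by (auto simp: lipschitz_on_def dist_real_def)
  then show "continuous_on levels py" by (rule lipschitz_on_continuous_on)
qed

definition "gap x = perp (g' 0) \<bullet> (g (yh - py x) - g (xh + px x))"

lemma gap_nonzero: assumes "x \<in> levels" shows "gap x \<noteq> 0"
proof
  assume 0: "gap x = 0"
  let ?d = "g (yh - py x) - g (xh + px x)"
  have "g' 0 \<bullet> ?d = 0" using px[OF assms] py[OF assms] by (simp add: tilt_def inner_diff_right)
  then have "(norm ?d)\<^sup>2 = 0"
    using norm_perp_decomp[OF speed[of 0], of ?d] 0 unfolding gap_def by (simp add: inner_commute)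
  then have "g (xh + px x) = g (yh - py x)" by simp
  moreover have "xh + px x < yh - py x" "yh - py x < xh + px x + l"
    using px[OF assms] py[OF assms] opp_long a_pos T_less_xh yh_less_l T_pos by auto
  ultimately show False using inj by blast
qed

text \<open>The curve is simple, so the two graphs do not cross.\<close>

lemma gap_sign: "(\<forall>x\<in>levels. gap x > 0) \<or> (\<forall>x\<in>levels. gap x < 0)"
proof (rule ccontr)
  assume "\<not> ?thesis"
  then obtain x y where xy: "x \<in> levels" "y \<in> levels" "gap x < 0" "gap y > 0"
    using gap_nonzero by (meson linorder_neqE_linordered_idom)
  have "continuous_on levels gap" unfolding gap_def
    by (intro continuous_intros continuous_on_compose2[OF cont[of UNIV]] continuous_px continuous_py) auto
  then have "connected (gap ` levels)" unfolding levels_def by (intro connected_continuous_image) auto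
  then have "0 \<in> gap ` levels" using xy unfolding connected_iff_interval by (meson imageI less_imp_le)
  then show False using gap_nonzero by auto
qed

text \<open>By \<open>JC\<close>, the points of \<open>{xh..yh}\<close> far from \<open>g z\<close> form an interval.\<close>

lemma far_interval:
  assumes "z \<in> {0..T}" "xh \<le> u" "v \<le> yh" "norm (g u - g z) \<ge> 1" "norm (g v - g z) \<ge> 1" "u \<le> y" "y \<le> v"
  shows "norm (g y - g z) \<ge> 1"
proof (rule ccontr)
  assume n: "\<not> ?thesis"
  then have "u \<noteq> y" "y \<noteq> v" using assms by auto
  then show False using JC[of z u y v z] n assms T_less_xh yh_less_l by auto
qed

text \<open>Both strands move away from \<open>Y = g (xh + a)\<close>, which lies behind the pinch. If a point near
  the pinch has distance at least \<open>1\<close> from \<open>Y\<close>, then soon both strands are outside the ball around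
  \<open>Y\<close>. The deep point lies between them and inside, contrary to \<open>JC\<close>.\<close>

lemma no_opposite_far:
  assumes z: "z \<in> {0..T}" "norm (g z - strand b 0) \<le> a^4" "norm (g (xh + a) - g z) \<ge> 1"
  shows False
proof -
  define Y where "Y = g (xh + a)"
  have n: "norm (strand b' 0 - Y) \<ge> 1 - 2 * a^4" "norm (strand b' 0 - Y) \<le> 2" for b'
  proof -
    have "norm (Y - g z) \<le> norm (g z - strand b 0) + norm (strand b 0 - strand b' 0) + norm (strand b' 0 - Y)"
      using norm_triangle_ineq[of "g z - strand b 0" "strand b 0 - Y"]
        norm_triangle_ineq[of "strand b 0 - strand b' 0" "strand b' 0 - Y"] by (simp add: norm_minus_commute)
    moreover have "norm (strand b 0 - strand b' 0) \<le> a^40"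
      using close a20(6) by (auto simp: strand_def norm_minus_commute)
    ultimately show "norm (strand b' 0 - Y) \<ge> 1 - 2 * a^4"
      using z pow_le[of 4 40] pow_a(2)[of 4] unfolding Y_def by linarith
    have "norm (Y - strand b' 0) < 1 + a^40" using near_pinch_le[of "xh + a" b'] a_pos by (simp add: Y_def)
    then show "norm (strand b' 0 - Y) \<le> 2" using a20(5) by (simp add: norm_minus_commute)
  qed
  have tY: "tilt Y \<le> - (a / 8)"
    using tilt_decreasing[of 0 a] tilt_xh small_powers(7) a_pos by (simp add: Y_def)
  let ?s = "a\<^sup>2"
  have ss: "0 < ?s" "?s \<le> a / 64" using a_pos pow_le[of 1 2] by auto
  have kn: "2 * \<kappa> * ?s\<^sup>2 * norm (strand b' 0 - Y) \<le> a^3 / 16" for b'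
  proof -
    have "\<kappa> * ?s\<^sup>2 = a^3/64" using kappa_pows(2) by (simp flip: power_mult)
    moreover have "(\<kappa> * ?s\<^sup>2) * norm (strand b' 0 - Y) \<le> (\<kappa> * ?s\<^sup>2) * 2"
      using n(2) kappa_ge by (intro mult_left_mono) auto
    moreover have "2 * \<kappa> * ?s\<^sup>2 * norm (strand b' 0 - Y) = 2 * ((\<kappa> * ?s\<^sup>2) * norm (strand b' 0 - Y))" by simp
    ultimately show ?thesis by linarith
  qed
  have st: "?s * tilt Y \<le> - (a^3 / 8)"
  proof -
    have "?s * tilt Y \<le> ?s * (- (a / 8))" using tY by (intro mult_left_mono) auto
    also have "\<dots> = - (a^3 / 8)" by (simp add: power3_eq_cube power2_eq_square)
    finally show ?thesis .
  qed
  have rgt: "norm (strand b' ?s - Y) \<ge> 1" for b'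
  proof -
    have "(norm (strand b' 0 - Y))\<^sup>2 \<ge> 1 - 2 * (2 * a^4)"
      using n(1) pow_le[of 0 4] a_pos by (intro sq_lower) auto
    moreover have "2 * ?s * tilt Y = 2 * (?s * tilt Y)" by simp
    ultimately have "(norm (strand b' ?s - Y))\<^sup>2 \<ge> 1"
      using strand_lower[of b' Y ?s] st kn[of b'] pow_le[of 3 4] pow_a(2)[of 3] by linarith
    then have "(norm (strand b' ?s - Y))\<^sup>2 \<ge> 1\<^sup>2" by simp
    then show ?thesis by (rule power2_le_imp_le) simp
  qed
  obtain z0 where z0: "z0 \<in> {0..T}" "norm (g z0 - g xh) \<le> 1 - 4 * a" using deep_point by blast
  have Yx: "norm (Y - g xh) \<le> a" using dist_le[of "xh + a" xh] a_pos by (simp add: Y_def)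
  have "norm (g z0 - Y) < 1"
    using norm_triangle_ineq4[of "g z0 - g xh" "Y - g xh"] z0 Yx a_pos by simp
  moreover have "?s < z0"
  proof (rule ccontr)
    assume "\<not> ?s < z0"
    then have "norm (g 0 - g z0) \<le> ?s" using dist_le[of 0 z0] z0 by simp
    then show False
      using norm_triangle_ineq[of "g 0 - g z0" "g z0 - g xh"] z0 dist_xh_ge(1) ss small_powers(9) a_pos
      by (simp add: norm_minus_commute)
  qed
  moreover have "z0 < T - ?s"
  proof (rule ccontr)
    assume "\<not> z0 < T - ?s"
    then have "norm (g T - g z0) \<le> ?s" using dist_le[of T z0] z0 by simp
    then show False
      using norm_triangle_ineq[of "g T - g z0" "g z0 - g xh"] z0 dist_xh_ge(2) ss small_powers(9) a_pos
      by (simp add: norm_minus_commute)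
  qed
  ultimately have "norm (g (T - ?s) - Y) < 1 \<or> norm (g (l + ?s) - Y) < 1" unfolding Y_def
  proof (intro JC[of z0 _ "xh + a"])
    show "T - ?s < xh + a" "xh + a < l + ?s" using ss T_less_xh xh_gaps a20 a_le by linarith+
  qed (use T_pos in auto)
  moreover have "g (l + ?s) = g ?s" using per[of ?s] by (simp add: add.commute)
  ultimately show False using rgt[of True] rgt[of False] by (auto simp: strand_def)
qed

text \<open>Assume that over each level the strand through \<open>g yh\<close> is farther from the pinch than
  the strand through \<open>g xh\<close>. The sweep yields a point \<open>B\<close> near the pinch at distance at least \<open>1\<close> from
  some \<open>g (xh + v)\<close>. The point of the other strand over the same level is even farther from \<open>B\<close>. So \<open>B\<close> is far from
  points of the curve before and after \<open>xh + a\<close>, hence from \<open>g (xh + a)\<close>, which \<open>no_opposite_far\<close> excludes.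

  Levels exist only if \<open>v\<close> is not too small. When \<open>v < a ^ 17\<close>, the point \<open>B\<close> has advanced by \<open>a ^ 4\<close> and the
  two strands of the second pinch recede from it directly.\<close>

lemma loop_contradiction_if_above:
  assumes above: "\<And>x. x \<in> levels \<Longrightarrow> gap x * ht (g xh) > 0"
  shows False
proof -
  let ?t = "a^4"
  have t: "0 < ?t" "?t \<le> 2 * a" "?t \<le> a / 64" using a_pos pow_le[of 1 4] by auto
  have tT: "?t \<le> T" using t T_ge a_pos by linarith
  obtain b s v where sv: "0 \<le> s" "s \<le> ?t" "0 \<le> v" "v \<le> ?t" "s = ?t \<or> v = ?t"
    "norm (strand b s - g (xh + v)) \<ge> 1" by (rule sweep_strand[OF t(1,2)])
  define B where "B = strand b s"
  obtain z where z: "z \<in> {0..T}" "B = g z" using strand_in_arc[of s b] sv tT unfolding B_def by auto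
  have Bs: "norm (B - strand b 0) \<le> ?t" using strand_lip[of b s 0] sv unfolding B_def by simp
  have "norm (g (xh + a) - g z) \<ge> 1"
  proof (cases "v \<ge> a^17")
    case True
    define x where "x = tilt (g (xh + v))"
    have "x \<le> - (a^18)" using tilt_decreasing[of 0 v] sv t True tilt_xh pow_le[of 17 18] pow_le[of 18 19] pow_a(2)[of 18] pow_a(2)[of 17]
      unfolding x_def by simp
    moreover have "x \<ge> - a / 4" using tilt_lip[of "xh + v" xh] tilt_xh sv t small_powers(7) a_pos unfolding x_def by simp
    ultimately have x: "x \<in> levels" by (simp add: levels_def)
    have "px x = v" unfolding px_def
      by (rule the1_equality[OF level_xh[OF x]]) (use sv t x_def in auto)
    define w where "w = py x"
    have w: "0 \<le> w" "w \<le> 2 * a" "tilt (g (yh - w)) = x" using py[OF x] by (auto simp: w_def)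
    define d where "d = g (yh - w) - g (xh + v)"
    have d1: "g' 0 \<bullet> d = 0" using w x_def by (simp add: d_def tilt_def inner_diff_right)
    define k where "k = perp (g' 0) \<bullet> d"
    have k: "k * ht (g xh) > 0" using above[OF x] \<open>px x = v\<close> by (simp add: gap_def k_def d_def w_def)
    define H where "H = ht (g (xh + v))"
    have hB: "\<bar>ht B\<bar> \<le> 1/4"
    proof -
      have "\<bar>ht B\<bar> \<le> norm (B - g 0)"
        using Cauchy_Schwarz_ineq2[of "perp (g' 0)" "B - g 0"] by (simp add: ht_def speed)
      also have "\<dots> \<le> ?t + a^40" using norm_triangle_ineq[of "B - strand b 0" "strand b 0 - g 0"] Bs strand_base(1)[of b] by simp
      finally show ?thesis using t a_le a20 by linarith
    qed
    have hH: "\<bar>H - ht (g xh)\<bar> \<le> 1/4"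
    proof -
      have "H - ht (g xh) = perp (g' 0) \<bullet> (g (xh + v) - g xh)" by (simp add: H_def ht_def inner_diff_right)
      also have "\<bar>\<dots>\<bar> \<le> norm (g (xh + v) - g xh)"
        using Cauchy_Schwarz_ineq2[of "perp (g' 0)" "g (xh + v) - g xh"] by (simp add: speed)
      finally show ?thesis using dist_le[of "xh + v" xh] sv t a_le by simp
    qed
    have "k * (ht B - H) \<le> 0"
    proof (cases "ht (g xh) > 0")
      case True
      then have "k > 0" using k zero_less_mult_pos2 by blast
      moreover have "ht B - H \<le> 0" using True hB hH ht_xh small_powers(2) by linarith
      ultimately show ?thesis by (simp add: mult_nonneg_nonpos)
    next
      case False
      then have "k < 0" using k by (auto simp: zero_less_mult_iff)
      moreover have "ht B - H \<ge> 0" using False hB hH ht_xh small_powers(2) by linarith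
      ultimately show ?thesis by (simp add: mult_nonpos_nonneg)
    qed
    moreover have "(B - g (xh + v)) \<bullet> d = k * (ht B - H)"
      using inner_decomp[OF speed[of 0], of "B - g (xh + v)" d] d1
      by (simp add: k_def H_def ht_def inner_diff_right mult.commute)
    ultimately have "(norm ((B - g (xh + v)) - d))\<^sup>2 \<ge> (norm (B - g (xh + v)))\<^sup>2"
      unfolding norm_diff_sq[of "B - g (xh + v)" d] using zero_le_power2[of "norm d"] by linarith
    then have "norm (B - g (xh + v)) \<le> norm ((B - g (xh + v)) - d)" by (rule power2_le_imp_le) simp
    then have "norm (B - g (yh - w)) \<ge> 1" using sv(6) by (simp add: B_def d_def)
    then show ?thesis
      using far_interval[OF z(1), of "xh + v" "yh - w" "xh + a"] sv z w t opp_long a_pos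
      by (simp add: B_def norm_minus_commute)
  next
    case False
    then have s: "s = ?t" and v: "v < a^17" using sv pow_le[of 4 17] t by auto
    have B1: "norm (g xh - B) \<le> 1" using dist_xh_le z by auto
    have B2: "norm (g yh - B) \<le> 1" using dist_yh_le z by auto
    have "norm (B - g (xh + v)) \<le> norm (B - g xh) + v"
      using norm_triangle_ineq[of "B - g xh" "g xh - g (xh + v)"] dist_le[of xh "xh + v"] sv by simp
    then have C1: "norm (g xh - B) \<ge> 1 - 2 * a^17"
      using sv(6) v pow_a(2)[of 17] unfolding B_def norm_minus_commute[of "g xh"] by linarith
    have "norm (B - g (xh + v)) \<le> norm (B - g yh) + norm (g yh - g xh) + v"
      using norm_triangle_ineq[of "B - g yh" "g yh - g (xh + v)"]
        norm_triangle_ineq[of "g yh - g xh" "g xh - g (xh + v)"] dist_le[of xh "xh + v"] sv by simp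
    then have C2: "norm (g yh - B) \<ge> 1 - 2 * a^17"
      using sv(6) v xh_yh_close pow_le[of 17 19] pow_a(2)[of 17]
      unfolding B_def norm_minus_commute[of "g yh"] by linarith
    let ?s = "a^5"
    have ss: "0 < ?s" "?s \<le> a / 64" using a_pos pow_le[of 1 5] by auto
    define r where "r = B - strand b 0 - ?t *\<^sub>R g' 0"
    have r: "norm r \<le> a^7/64" using strand_taylor[of b ?t] unfolding r_def B_def s kappa_pows(3) .
    have key: "norm (g (y + q * ?s) - B) \<ge> 1"
      if q: "q = 1 \<or> q = -1" and y: "norm (g y - B) \<le> 1" "norm (g y - B) \<ge> 1 - 2 * a^17"
        and u: "q * (g' 0 \<bullet> g' y) \<le> - 1/2" "\<bar>g' y \<bullet> (g y - c)\<bar> \<le> a^19/16" "norm (c - strand b 0) \<le> a^40" for y q c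
    proof -
      let ?u = "q *\<^sub>R g' y"
      have un: "norm ?u = 1" using q speed by auto
      have "\<bar>?u \<bullet> r\<bar> \<le> a^7/64" using Cauchy_Schwarz_ineq2[of ?u r] r un by simp
      moreover have "B - strand b 0 = ?t *\<^sub>R g' 0 + r" by (simp add: r_def)
      then have "?u \<bullet> (B - strand b 0) = ?t * (q * (g' 0 \<bullet> g' y)) + ?u \<bullet> r"
        by (simp add: inner_add_right inner_commute algebra_simps)
      moreover have "?t * (q * (g' 0 \<bullet> g' y)) \<le> ?t * (- 1/2)" using u t by (intro mult_left_mono) auto
      ultimately have 1: "?u \<bullet> (B - strand b 0) \<le> - (?t / 4)" using pow_le[of 4 7] t(1) by linarith
      have 2: "\<bar>?u \<bullet> (c - strand b 0)\<bar> \<le> a^40"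
        using Cauchy_Schwarz_ineq2[of ?u "c - strand b 0"] u(3) un by simp
      have 3: "\<bar>?u \<bullet> (g y - c)\<bar> \<le> a^19/16" using u(2) q by auto
      have "?u \<bullet> (g y - B) = ?u \<bullet> (g y - c) + ?u \<bullet> (c - strand b 0) - ?u \<bullet> (B - strand b 0)"
        by (simp add: inner_diff_right)
      then have "?u \<bullet> (g y - B) \<ge> ?t / 8" using 1 2 3 pow_le[of 4 19] pow_le[of 4 40] t(1) by linarith
      then have "?s * (?u \<bullet> (g y - B)) \<ge> ?s * (?t / 8)" using ss by (intro mult_left_mono) auto
      then have 4: "?s * (?u \<bullet> (g y - B)) \<ge> a^9 / 8" by (simp flip: power_add)
      have "(\<kappa> * ?s\<^sup>2) * norm (g y - B) \<le> (\<kappa> * ?s\<^sup>2) * 1" using y kappa_ge by (intro mult_left_mono) auto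
      then have 5: "(\<kappa> * ?s\<^sup>2) * norm (g y - B) \<le> a^9/64" using kappa_pows(4) by linarith
      have 6: "(norm (g y - B))\<^sup>2 \<ge> 1 - 2 * (2 * a^17)" using y pow_le[of 0 17] a_pos by (intro sq_lower) auto
      have "(q * ?s)\<^sup>2 = ?s\<^sup>2" using q by auto
      then have "(norm (g (y + q * ?s) - B))\<^sup>2 \<ge> (norm (g y - B))\<^sup>2 + 2 * (?s * (?u \<bullet> (g y - B)))
          - 2 * ((\<kappa> * ?s\<^sup>2) * norm (g y - B))"
        using dist_lower[of y B "q * ?s"] by (simp add: mult_ac)
      then have "(norm (g (y + q * ?s) - B))\<^sup>2 \<ge> 1" using 4 5 6 pow_le[of 9 17] pow_a(2)[of 9] by linarith
      then have "(norm (g (y + q * ?s) - B))\<^sup>2 \<ge> 1\<^sup>2" by simp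
      then show ?thesis by (rule power2_le_imp_le) simp
    qed
    have "norm (g (xh + 1 * ?s) - B) \<ge> 1"
      by (rule key[OF _ B1 C1 _ dir_xh_perp strand_base(2)]) (use dir_opposite in auto)
    moreover have "norm (g T - strand b 0) \<le> a^40" using close a20(6) by (auto simp: strand_def)
    from key[OF _ B2 C2 _ yh_dirs(2) this, of "-1"]
    have "norm (g (yh - ?s) - B) \<ge> 1" using yh_dirs(1) by simp
    ultimately show ?thesis
      using far_interval[OF z(1), of "xh + ?s" "yh - ?s" "xh + a"] z ss opp_long a_pos by simp
  qed
  then show False using no_opposite_far[OF z(1), of b] Bs z by simp
qed

text \<open>Whichever strand of the second pinch is farther away, the curve or its reversal satisfies the
  assumption of \<open>loop_contradiction_if_above\<close>.\<close>

theorem pinch_impossible: False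
proof -
  interpret m: pinched_loop "\<lambda>t. g (T - t)" "\<lambda>t. - g' (T - t)" \<kappa> l T a by (rule mirror)
  have lv: "m.levels = levels" by (simp add: m.levels_def levels_def)
  have pm: "m.px x = py x" "m.py x = px x" for x
    unfolding m.px_def py_def m.py_def px_def mirror_tilt mirror_at by simp_all
  have gm: "m.gap x = - gap x" for x
    unfolding m.gap_def gap_def pm mirror_at using anti by (simp add: inner_diff_right)
  have hm: "m.ht (g (T - m.xh)) * ht (g xh) > 0"
  proof -
    have e: "g (T - m.xh) = g yh" using mirror_at(1)[of 0] by simp
    have "m.ht (g yh) = ht (g yh) - perp (g' 0) \<bullet> (g T - g 0)"
      by (simp add: m.ht_def ht_def anti inner_diff_right)
    moreover have "\<bar>perp (g' 0) \<bullet> (g T - g 0)\<bar> \<le> a^40"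
      using Cauchy_Schwarz_ineq2[of "perp (g' 0)" "g T - g 0"] close by (simp add: speed)
    ultimately have "m.ht (g yh) * ht (g xh) > 0"
      using same_side ht_yh small_powers(2) a20(5) unfolding zero_less_mult_iff by linarith
    then show ?thesis by (simp only: e)
  qed
  have hx: "ht (g xh) \<noteq> 0" using ht_xh small_powers(2) by auto
  show False
  proof (cases "\<forall>x\<in>levels. gap x * ht (g xh) > 0")
    case True
    then show False using loop_contradiction_if_above by blast
  next
    case False
    then have "\<forall>x\<in>levels. gap x * ht (g xh) < 0"
      using gap_sign hx by (metis linorder_neqE_linordered_idom mult_less_0_iff zero_less_mult_iff)
    then have "\<forall>x\<in>levels. m.gap x * m.ht (g (T - m.xh)) > 0"
      using hm unfolding gm by (auto simp: mult_less_0_iff zero_less_mult_iff)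
    then have "m.gap x * m.ht (g (T - m.xh)) > 0" if "x \<in> m.levels" for x using that lv by simp
    then show False by (rule m.loop_contradiction_if_above)
  qed
qed

end



section \<open>Local parametrisations of the boundary\<close>

lemma orthonormal_perp:
  assumes "orthonormal_pair e n"
  shows "n = perp e \<or> n = - perp e"
proof -
  have e: "norm e = 1" and n: "norm n = 1" and o: "e \<bullet> n = 0" using assms by (auto simp: orthonormal_pair_def)
  have "1 = (n \<bullet> e)\<^sup>2 + (n \<bullet> perp e)\<^sup>2" using norm_perp_decomp[OF e, of n] n by simp
  then have "n \<bullet> perp e = 1 \<or> n \<bullet> perp e = -1" using o by (simp add: inner_commute power2_eq_1_iff)
  moreover have "(norm (n - s *\<^sub>R perp e))\<^sup>2 = 0" if "n \<bullet> perp e = s" "s = 1 \<or> s = -1" for s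
    unfolding norm_diff_sq using that n e by auto
  ultimately have "n - 1 *\<^sub>R perp e = 0 \<or> n - (-1) *\<^sub>R perp e = 0" by (metis norm_eq_zero power2_eq_iff_nonneg zero_eq_power2)
  then show ?thesis by (auto simp: eq_neg_iff_add_eq_0)
qed

text \<open>A unit speed piece of the boundary with curvature at most \<open>\<kappa>\<close>, oriented so that \<open>\<Omega>\<close> lies to the
  left. The orientation makes parametrisations unique up to translation of the parameter.\<close>

definition boundary_arc :: "point set \<Rightarrow> real \<Rightarrow> real set \<Rightarrow> (real \<Rightarrow> point) \<Rightarrow> (real \<Rightarrow> point) \<Rightarrow> bool" where
  "boundary_arc \<Omega> \<kappa> I c c' \<longleftrightarrow> (\<forall>t\<in>I. c t \<in> frontier \<Omega> \<and> (c has_vector_derivative c' t) (at t) \<and>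
     norm (c' t) = 1 \<and> (\<exists>k. \<bar>k\<bar> \<le> \<kappa> \<and> (c' has_vector_derivative k *\<^sub>R perp (c' t)) (at t)) \<and>
     (\<forall>\<^sub>F h in at_right 0. c t + h *\<^sub>R perp (c' t) \<in> \<Omega> \<and> c t - h *\<^sub>R perp (c' t) \<notin> \<Omega>))"

text \<open>A local graph of the boundary, in coordinates with \<open>\<Omega>\<close> to the left.\<close>

locale boundary_chart =
  fixes \<Omega> :: "point set" and \<kappa> :: real and p e :: point and r :: real and f f1 f2 :: "real \<Rightarrow> real"
  assumes open_dom: "open \<Omega>" and dom_sub: "\<Omega> \<subseteq> unit_dom"
    and curv: "curvature_le (frontier \<Omega> \<inter> unit_dom) \<kappa>" and kappa_pos: "0 < \<kappa>"
    and p_front: "p \<in> frontier \<Omega>" and r_pos: "0 < r" and e_unit: "norm e = 1"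
    and f_deriv: "\<And>t. (f has_real_derivative f1 t) (at t)"
    and f1_deriv: "\<And>t. (f1 has_real_derivative f2 t) (at t)"
    and f2_cont: "continuous_on UNIV f2"
    and epigraph: "\<Omega> \<inter> ball p r = {x \<in> ball p r. f (x \<bullet> e) < x \<bullet> perp e}"
begin

lemma f_cont: "continuous_on S f" and f1_cont: "continuous_on S f1"
  using DERIV_continuous_on[of S f f1] DERIV_continuous_on[of S f1 f2] f_deriv f1_deriv
  by (auto intro: has_field_derivative_at_within)

definition X :: "real \<Rightarrow> point" where "X s = s *\<^sub>R e + f s *\<^sub>R perp e"
definition X' :: "real \<Rightarrow> point" where "X' s = e + f1 s *\<^sub>R perp e"
definition spd :: "real \<Rightarrow> real" where "spd s = sqrt (1 + (f1 s)\<^sup>2)"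

lemma coords [simp]: "e \<bullet> e = 1" "perp e \<bullet> perp e = 1"
  using e_unit perp_simps(1)[of e] by (metis norm_eq_1)+

lemma X_coords [simp]: "X s \<bullet> e = s" "X s \<bullet> perp e = f s" "X' s \<bullet> e = 1" "X' s \<bullet> perp e = f1 s"
  by (simp_all add: X_def X'_def inner_add_left)

lemma point_coords: "x = (x \<bullet> e) *\<^sub>R e + (x \<bullet> perp e) *\<^sub>R perp e"
proof -
  let ?y = "x - ((x \<bullet> e) *\<^sub>R e + (x \<bullet> perp e) *\<^sub>R perp e)"
  have "?y \<bullet> e = 0" "?y \<bullet> perp e = 0" by (simp_all add: inner_diff_left inner_add_left)
  then have "(norm ?y)\<^sup>2 = 0" using norm_perp_decomp[OF e_unit, of ?y] by simp
  then show ?thesis by simp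
qed

lemma on_graph: "x \<bullet> perp e = f (x \<bullet> e) \<Longrightarrow> x = X (x \<bullet> e)"
  using point_coords[of x] by (simp add: X_def)

lemma X_deriv: "(X has_vector_derivative X' s) (at s)"
  unfolding X_def X'_def
  by (auto intro!: derivative_eq_intros f_deriv)

lemma X_cont: "continuous_on S X"
  using X_deriv by (meson continuous_at_imp_continuous_on has_vector_derivative_continuous)

lemma X'_deriv: "(X' has_vector_derivative f2 s *\<^sub>R perp e) (at s)"
  unfolding X'_def
  by (auto intro!: derivative_eq_intros f1_deriv)

lemma spd_ge: "spd s \<ge> 1" "spd s > 0" and spd_sq: "(spd s)\<^sup>2 = 1 + (f1 s)\<^sup>2"
proof -
  show "spd s \<ge> 1" by (simp add: spd_def)
  then show "spd s > 0" by linarith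
  show "(spd s)\<^sup>2 = 1 + (f1 s)\<^sup>2" by (simp add: spd_def add_nonneg_nonneg)
qed

lemma norm_X': "norm (X' s) = spd s"
proof -
  have "(norm (X' s))\<^sup>2 = (spd s)\<^sup>2" unfolding norm_perp_decomp[OF e_unit, of "X' s"] spd_sq by simp
  then show ?thesis using spd_ge(2)[of s] by (simp add: power2_eq_iff_nonneg)
qed

lemma spd_deriv: "(spd has_real_derivative f1 s * f2 s / spd s) (at s)"
proof -
  have "1 + (f1 s)\<^sup>2 > 0" by (simp add: add_pos_nonneg)
  then show ?thesis unfolding spd_def
    by (auto intro!: derivative_eq_intros f1_deriv simp: field_simps)
qed

lemma spd_cont: "continuous_on S spd"
  by (rule DERIV_continuous_on[where D = "\<lambda>s. f1 s * f2 s / spd s"])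
     (rule has_field_derivative_at_within[OF spd_deriv])

definition F :: "point \<Rightarrow> real" where "F x = x \<bullet> perp e - f (x \<bullet> e)"

lemma F_cont: "continuous_on S F"
  unfolding F_def by (intro continuous_intros continuous_on_compose2[OF f_cont[of UNIV]]) auto

lemma dom_iff: assumes "x \<in> ball p r" shows "x \<in> \<Omega> \<longleftrightarrow> F x > 0"
proof -
  have "x \<in> \<Omega> \<longleftrightarrow> x \<in> \<Omega> \<inter> ball p r" using assms by blast
  also have "\<dots> \<longleftrightarrow> f (x \<bullet> e) < x \<bullet> perp e" unfolding epigraph using assms by blast
  finally show ?thesis by (simp add: F_def)
qed

lemma front_iff: assumes x: "x \<in> ball p r" shows "x \<in> frontier \<Omega> \<longleftrightarrow> F x = 0"
proof
  assume xf: "x \<in> frontier \<Omega>"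
  then have "x \<notin> \<Omega>" using open_dom by (auto simp: frontier_def interior_open)
  then have 1: "F x \<le> 0" using dom_iff[OF x] by auto
  have "\<not> F x < 0"
  proof
    assume "F x < 0"
    then have "x \<in> {y \<in> ball p r. F y < 0}" using x by auto
    moreover have "open {y \<in> ball p r. F y < 0}"
    proof -
      have "open (ball p r \<inter> {y. F y < 0})"
        using open_Collect_less[OF F_cont[of UNIV] continuous_on_const, of 0] by (intro open_Int) auto
      then show ?thesis by (simp only: Int_def mem_Collect_eq)
    qed
    ultimately have "\<Omega> \<inter> {y \<in> ball p r. F y < 0} \<noteq> {}"
      using xf by (auto simp: frontier_def closure_iff_nhds_not_empty)
    then show False using dom_iff by force
  qed
  then show "F x = 0" using 1 by linarith
next
  assume F0: "F x = 0"
  have "x \<in> closure \<Omega>"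
  proof (subst closure_approachable, intro allI impI)
    fix d :: real assume d: "0 < d"
    define h where "h = min (d / 2) ((r - dist p x) / 2)"
    have h: "0 < h" "h < d" "dist p x + h < r" using d x by (auto simp: h_def min_def field_simps)
    let ?y = "x + h *\<^sub>R perp e"
    have "dist ?y x = h" using h e_unit by (simp add: dist_norm)
    moreover have "?y \<in> ball p r" using h dist_triangle[of p ?y x] calculation by (simp add: dist_commute)
    moreover have "F ?y = F x + h" by (simp add: F_def inner_add_left)
    ultimately show "\<exists>y\<in>\<Omega>. dist y x < d" using dom_iff[of ?y] F0 h by (intro bexI[of _ ?y]) auto
  qed
  moreover have "x \<notin> \<Omega>" using dom_iff[OF x] F0 by auto
  ultimately show "x \<in> frontier \<Omega>" using open_dom by (auto simp: frontier_def interior_open)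
qed

lemma X_front: "X s \<in> ball p r \<Longrightarrow> X s \<in> frontier \<Omega>"
  using front_iff[of "X s"] by (simp add: F_def)

lemma front_X: "x \<in> frontier \<Omega> \<Longrightarrow> x \<in> ball p r \<Longrightarrow> x = X (x \<bullet> e)"
  using front_iff[of x] on_graph[of x] by (simp add: F_def)

lemma p_eq: "p = X (p \<bullet> e)" using front_X[OF p_front] r_pos by simp

lemma frontier_square: "frontier \<Omega> \<subseteq> {0..1} \<times> {0..1}"
proof -
  have "closure \<Omega> \<subseteq> closure unit_dom" using dom_sub by (rule closure_mono)
  also have "closure unit_dom = {0..1} \<times> {0..1}" by (simp add: unit_dom_def closure_Times)
  finally show ?thesis by (auto simp: frontier_def)
qed

lemma curvature_inside:
  assumes b: "X s \<in> ball p r" and u: "X s \<in> unit_dom"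
  shows "\<bar>f2 s\<bar> \<le> \<kappa> * spd s ^ 3"
proof -
  have "open (X -` (ball p r \<inter> unit_dom))"
    using X_cont[of UNIV] unfolding unit_dom_def by (intro open_vimage) (auto intro!: open_Times)
  then obtain d where d: "d > 0" "ball s d \<subseteq> X -` (ball p r \<inter> unit_dom)"
    using b u unfolding open_contains_ball by blast
  let ?I = "{s - d<..<s + d}"
  have I: "ball s d = ?I" by (auto simp: dist_real_def)
  have vd: "vector_derivative X (at t) = X' t" for t using X_deriv by (rule vector_derivative_at)
  have vdf: "(\<lambda>t. vector_derivative X (at t)) = X'" using vd by auto
  have "C2_on X ?I" unfolding C2_on_def C1_differentiable_on_def
    using X_deriv X'_deriv
    by (intro exI[of _ X'] conjI ballI exI[of _ "\<lambda>t. f2 t *\<^sub>R perp e"])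
       (auto intro!: continuous_intros continuous_on_subset[OF f2_cont])
  moreover have "X ` ?I \<subseteq> frontier \<Omega> \<inter> unit_dom"
  proof
    fix y assume "y \<in> X ` ?I"
    then obtain x where "x \<in> ball s d" "y = X x" using I by blast
    moreover from this have "X x \<in> ball p r \<inter> unit_dom" using d by blast
    ultimately show "y \<in> frontier \<Omega> \<inter> unit_dom" using X_front by blast
  qed
  moreover have "vector_derivative X (at s) \<noteq> 0" using norm_X'[of s] spd_ge(2)[of s] unfolding vd by auto
  ultimately have "has_abs_curvature (frontier \<Omega> \<inter> unit_dom) (X s) (abs_curvature X s)"
    unfolding has_abs_curvature_def using d(1)
    by (intro exI[of _ X] exI[of _ "s - d"] exI[of _ "s + d"] exI[of _ s]) auto
  then have le: "abs_curvature X s \<le> \<kappa>" using curv X_front[OF b] u unfolding curvature_le_def by blast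
  have "vector_derivative X' (at s) = f2 s *\<^sub>R perp e" using X'_deriv by (rule vector_derivative_at)
  then have "abs_curvature X s = \<bar>fst (X' s) * snd (f2 s *\<^sub>R perp e) - snd (X' s) * fst (f2 s *\<^sub>R perp e)\<bar> / spd s ^ 3"
    unfolding abs_curvature_def Let_def vd by (simp add: norm_X')
  also have "fst (X' s) * snd (f2 s *\<^sub>R perp e) - snd (X' s) * fst (f2 s *\<^sub>R perp e) = f2 s * (X' s \<bullet> e)"
    by (simp add: perp_def inner_prod_def algebra_simps)
  finally have "abs_curvature X s = \<bar>f2 s\<bar> / spd s ^ 3" by simp
  then show ?thesis using le spd_ge(2)[of s] by (simp add: divide_le_eq)
qed

text \<open>Where the boundary touches a side of the square, it is tangent to that side; so either
  its curvature vanishes there or nearby points lie inside the square.\<close>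

lemma curvature_bound:
  assumes b: "X s \<in> ball p r"
  shows "\<bar>f2 s\<bar> \<le> \<kappa> * spd s ^ 3"
proof (cases "X s \<in> unit_dom \<or> f2 s = 0")
  case True
  then show ?thesis using curvature_inside[OF b] kappa_pos spd_ge(2)[of s] by auto
next
  case False
  then have out: "X s \<notin> unit_dom" and f20: "f2 s \<noteq> 0" by auto
  have "open (X -` ball p r)" using X_cont[of UNIV] by (intro open_vimage) auto
  then obtain d where d0: "d > 0" "ball s d \<subseteq> X -` ball p r"
    using b unfolding open_contains_ball by blast
  have d: "d > 0" "\<And>t. \<bar>t - s\<bar> < d \<Longrightarrow> X t \<in> ball p r"
  proof -
    show "X t \<in> ball p r" if "\<bar>t - s\<bar> < d" for t
    proof -
      have "t \<in> ball s d" using that by (simp add: dist_real_def abs_minus_commute)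
      then show ?thesis using d0(2) by blast
    qed
  qed (fact d0)
  have ev_ball: "\<forall>\<^sub>F t in at s. X t \<in> ball p r"
    unfolding eventually_at using d by (auto simp: dist_real_def)
  have sq: "\<forall>\<^sub>F t in at s. X t \<in> {0..1} \<times> {0..1}"
    using ev_ball by (rule eventually_mono) (use X_front frontier_square in blast)
  have Xs: "X s \<in> {0..1} \<times> {0..1}" using X_front[OF b] frontier_square by blast
  have lin: "((\<lambda>t. u \<bullet> X t) has_real_derivative u \<bullet> X' t) (at t)"
    "((\<lambda>t. u \<bullet> X' t) has_real_derivative f2 t * (u \<bullet> perp e)) (at t)" for u t
    using bounded_linear.has_vector_derivative[OF bounded_linear_inner_right X_deriv, of u t]
      bounded_linear.has_vector_derivative[OF bounded_linear_inner_right X'_deriv, of u t]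
    by (simp_all add: has_real_derivative_iff_has_vector_derivative)
  text \<open>A linear coordinate that attains its minimum along the boundary at \<open>X s\<close> is positive nearby.\<close>
  have touch: "u \<bullet> X' s = 0 \<and> (\<forall>\<^sub>F t in at s. u \<bullet> X t > m)"
    if u: "norm u = 1" and m: "u \<bullet> X s = m" "\<forall>\<^sub>F t in at s. u \<bullet> X t \<ge> m" for u m
  proof -
    obtain d0 where d0: "d0 > 0" "\<And>t. t \<noteq> s \<Longrightarrow> \<bar>t - s\<bar> < d0 \<Longrightarrow> u \<bullet> X t \<ge> m"
      using m(2) unfolding eventually_at by (auto simp: dist_real_def)
    have d0': "u \<bullet> X s \<le> u \<bullet> X t" if "\<bar>s - t\<bar> < d0" for t using d0(2)[of t] m(1) that by (cases "t = s") auto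
    have z: "u \<bullet> X' s = 0" using DERIV_local_min[OF lin(1) d0(1)] d0' by blast
    have "u \<bullet> X' s = u \<bullet> e + f1 s * (u \<bullet> perp e)" by (simp add: X'_def inner_add_right)
    then have "u \<bullet> perp e \<noteq> 0"
      using z norm_perp_decomp[OF e_unit, of u] u by auto
    then have nz: "f2 s * (u \<bullet> perp e) \<noteq> 0" using f20 by simp
    have der: "((\<lambda>t. u \<bullet> X' t) has_real_derivative f2 s * (u \<bullet> perp e)) (at s)" by (rule lin)
    have pos: "f2 s * (u \<bullet> perp e) > 0"
    proof (rule ccontr)
      assume "\<not> ?thesis"
      then have "f2 s * (u \<bullet> perp e) < 0" using nz by linarith
      from DERIV_neg_dec_right[OF der this] obtain d1 where d1: "d1 > 0"
        "\<And>h. 0 < h \<Longrightarrow> h < d1 \<Longrightarrow> u \<bullet> X' (s + h) < u \<bullet> X' s" by blast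
      define h where "h = min d0 d1 / 2"
      have h: "0 < h" "h < d0" "h < d1" using d0(1) d1(1) by (auto simp: h_def)
      obtain t where t: "s < t" "t < s + h" "u \<bullet> X (s + h) - u \<bullet> X s = (s + h - s) * (u \<bullet> X' t)"
        using MVT2[of s "s + h" "\<lambda>t. u \<bullet> X t" "\<lambda>t. u \<bullet> X' t"] lin(1) h by auto
      have "u \<bullet> X' t < 0" using d1(2)[of "t - s"] t h z by auto
      then have "u \<bullet> X (s + h) < u \<bullet> X s" using t(3) h mult_pos_neg[of h "u \<bullet> X' t"] by auto
      then show False using d0'[of "s + h"] h by auto
    qed
    from DERIV_pos_inc_right[OF der pos] obtain d1 where d1: "d1 > 0"
      "\<And>h. 0 < h \<Longrightarrow> h < d1 \<Longrightarrow> u \<bullet> X' s < u \<bullet> X' (s + h)" by blast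
    from DERIV_pos_inc_left[OF der pos] obtain d2 where d2: "d2 > 0"
      "\<And>h. 0 < h \<Longrightarrow> h < d2 \<Longrightarrow> u \<bullet> X' (s - h) < u \<bullet> X' s" by blast
    have "u \<bullet> X t > m" if t: "t \<noteq> s" "\<bar>t - s\<bar> < min d1 d2" for t
    proof (cases "t > s")
      case True
      obtain x where x: "s < x" "x < t" "u \<bullet> X t - u \<bullet> X s = (t - s) * (u \<bullet> X' x)"
        using MVT2[of s t "\<lambda>t. u \<bullet> X t" "\<lambda>t. u \<bullet> X' t"] lin(1) True by auto
      have "u \<bullet> X' x > 0" using d1(2)[of "x - s"] x t z by auto
      then have "(t - s) * (u \<bullet> X' x) > 0" using True by simp
      then show ?thesis using x(3) m(1) by linarith
    next
      case False
      then have ts: "t < s" using t by auto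
      obtain x where x: "t < x" "x < s" "u \<bullet> X s - u \<bullet> X t = (s - t) * (u \<bullet> X' x)"
        using MVT2[of t s "\<lambda>t. u \<bullet> X t" "\<lambda>t. u \<bullet> X' t"] lin(1) ts by auto
      have "u \<bullet> X' x < 0" using d2(2)[of "s - x"] x t z by auto
      then have "(s - t) * (u \<bullet> X' x) < 0" using ts by (simp add: mult_pos_neg)
      then show ?thesis using x(3) m(1) by linarith
    qed
    then have "\<forall>\<^sub>F t in at s. u \<bullet> X t > m"
      unfolding eventually_at using d1(1) d2(1) by (intro exI[of _ "min d1 d2"]) (auto simp: dist_real_def)
    then show ?thesis using z by blast
  qed
  have Xn: "X' s \<noteq> 0" using norm_X'[of s] spd_ge(2)[of s] by auto
  have isc: "((\<lambda>t. u \<bullet> X t) \<longlongrightarrow> u \<bullet> X s) (at s)" for u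
    using DERIV_isCont[OF lin(1)] by (simp add: isCont_def)
  have away: "\<forall>\<^sub>F t in at s. u \<bullet> X t > m" if "u \<bullet> X s > m" for u m
    using order_tendstoD(1)[OF isc that] .
  have ev0: "\<forall>\<^sub>F t in at s. (1,0) \<bullet> X t \<ge> 0" "\<forall>\<^sub>F t in at s. (-1,0) \<bullet> X t \<ge> -1"
    "\<forall>\<^sub>F t in at s. (0,1) \<bullet> X t \<ge> 0" "\<forall>\<^sub>F t in at s. (0,-1) \<bullet> X t \<ge> -1"
    using sq by (auto elim!: eventually_mono simp: inner_prod_def mem_Times_iff)
  have un: "norm (1::real,0::real) = 1" "norm (-1::real,0::real) = 1" "norm (0::real,1::real) = 1" "norm (0::real,-1::real) = 1"
    by (auto simp: norm_prod_def)
  have E: "\<forall>\<^sub>F t in at s. X t \<in> unit_dom"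
  proof -
    have "\<forall>\<^sub>F t in at s. u \<bullet> X t > m"
      if "u = (1,0) \<and> m = 0 \<or> u = (-1,0) \<and> m = -1 \<or> u = (0,1) \<and> m = 0 \<or> u = (0,-1) \<and> m = -1" for u m
    proof (cases "u \<bullet> X s > m")
      case True then show ?thesis by (rule away)
    next
      case False
      have "u \<bullet> X s \<ge> m" using that Xs by (auto simp: inner_prod_def mem_Times_iff)
      then have "u \<bullet> X s = m" using False by linarith
      moreover have "norm u = 1" "\<forall>\<^sub>F t in at s. u \<bullet> X t \<ge> m" using that un ev0 by auto
      ultimately show ?thesis using touch[of u m] by blast
    qed
    from this[of "(1,0)" 0] this[of "(-1,0)" "-1"] this[of "(0,1)" 0] this[of "(0,-1)" "-1"]
    have "\<forall>\<^sub>F t in at s. (1,0) \<bullet> X t > 0" "\<forall>\<^sub>F t in at s. (-1,0) \<bullet> X t > -1"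
      "\<forall>\<^sub>F t in at s. (0,1) \<bullet> X t > 0" "\<forall>\<^sub>F t in at s. (0,-1) \<bullet> X t > -1" by auto
    then show ?thesis
      by eventually_elim (auto simp: unit_dom_def inner_prod_def mem_Times_iff)
  qed
  have "\<forall>\<^sub>F t in at s. \<bar>f2 t\<bar> \<le> \<kappa> * spd t ^ 3"
    using E ev_ball by eventually_elim (rule curvature_inside)
  moreover have "((\<lambda>t. \<bar>f2 t\<bar>) \<longlongrightarrow> \<bar>f2 s\<bar>) (at s)"
    using f2_cont by (intro tendsto_intros) (simp add: continuous_on_def)
  moreover have "((\<lambda>t. \<kappa> * spd t ^ 3) \<longlongrightarrow> \<kappa> * spd s ^ 3) (at s)"
    using spd_cont[of UNIV] by (intro tendsto_intros) (simp add: continuous_on_def)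
  ultimately show ?thesis by (intro tendsto_le[of "at s" "\<lambda>t. \<kappa> * spd t ^ 3" _ "\<lambda>t. \<bar>f2 t\<bar>"]) auto
qed

end



lemma perp_linear [simp]: "perp (x + y) = perp x + perp y" "perp (r *\<^sub>R x) = r *\<^sub>R perp x"
  "perp (perp x) = - x" "perp x \<bullet> perp y = x \<bullet> y"
  by (auto simp: perp_def inner_prod_def algebra_simps prod_eq_iff)

lemma perp_swap: "perp x \<bullet> y = - (x \<bullet> perp y)"
  by (simp add: perp_def inner_prod_def)

context boundary_chart
begin

text \<open>A direction transversal to the graph points into \<open>\<Omega>\<close> or out of it.\<close>

lemma side_deriv:
  assumes x: "x \<in> frontier \<Omega>" "x \<in> ball p r"
  defines "D v \<equiv> v \<bullet> perp e - f1 (x \<bullet> e) * (v \<bullet> e)"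
  shows "D v > 0 \<Longrightarrow> \<forall>\<^sub>F h in at_right 0. x + h *\<^sub>R v \<in> \<Omega>"
    and "D v < 0 \<Longrightarrow> \<forall>\<^sub>F h in at_right 0. x + h *\<^sub>R v \<notin> \<Omega>"
proof -
  have F0: "F x = 0" using front_iff x by blast
  have der: "((\<lambda>h. F (x + h *\<^sub>R v)) has_real_derivative D v) (at 0)"
  proof -
    have 1: "((\<lambda>h. (x + h *\<^sub>R v) \<bullet> e) has_real_derivative v \<bullet> e) (at 0)"
      "((\<lambda>h. (x + h *\<^sub>R v) \<bullet> perp e) has_real_derivative v \<bullet> perp e) (at 0)"
      unfolding inner_add_left inner_scaleR_left by (auto intro!: derivative_eq_intros)
    have "((\<lambda>h. f ((x + h *\<^sub>R v) \<bullet> e)) has_real_derivative f1 (x \<bullet> e) * (v \<bullet> e)) (at 0)"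
      using DERIV_chain2[OF _ 1(1), of f "f1 (x \<bullet> e)"] f_deriv by simp
    then show ?thesis unfolding F_def D_def using 1(2) by (rule DERIV_diff[rotated])
  qed
  have "((\<lambda>h. x + h *\<^sub>R v) \<longlongrightarrow> x + 0 *\<^sub>R v) (at_right 0)" by (intro tendsto_intros)
  then have inb: "\<forall>\<^sub>F h in at_right 0. x + h *\<^sub>R v \<in> ball p r"
    using x(2) by (intro topological_tendstoD) auto
  have pos: "\<forall>\<^sub>F h in at_right 0. F (x + h *\<^sub>R v) > 0" if D: "D v > 0"
  proof -
    obtain d where d: "d > 0" "\<And>h. 0 < h \<Longrightarrow> h < d \<Longrightarrow> F (x + 0 *\<^sub>R v) < F (x + (0 + h) *\<^sub>R v)"
      using DERIV_pos_inc_right[OF der D] by blast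
    show ?thesis unfolding eventually_at_right_field
      by (rule exI[of _ d]) (use d F0 in auto)
  qed
  have neg: "\<forall>\<^sub>F h in at_right 0. F (x + h *\<^sub>R v) < 0" if D: "D v < 0"
  proof -
    obtain d where d: "d > 0" "\<And>h. 0 < h \<Longrightarrow> h < d \<Longrightarrow> F (x + 0 *\<^sub>R v) > F (x + (0 + h) *\<^sub>R v)"
      using DERIV_neg_dec_right[OF der D] by blast
    show ?thesis unfolding eventually_at_right_field
      by (rule exI[of _ d]) (use d F0 in auto)
  qed
  show "D v > 0 \<Longrightarrow> \<forall>\<^sub>F h in at_right 0. x + h *\<^sub>R v \<in> \<Omega>"
    using eventually_conj[OF inb pos] by (auto elim!: eventually_mono simp: dom_iff)
  show "D v < 0 \<Longrightarrow> \<forall>\<^sub>F h in at_right 0. x + h *\<^sub>R v \<notin> \<Omega>"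
    using eventually_conj[OF inb neg] by (auto elim!: eventually_mono simp: dom_iff)
qed

text \<open>Unit speed parametrisation of the graph; every boundary arc that stays near \<open>p\<close> is a
  translate of it, because its first coordinate, measured in arc length, has derivative \<open>1\<close>.\<close>

lemma arclength_chart:
  "\<exists>R>0. \<exists>c c' \<rho>. 0 < \<rho> \<and> \<rho> \<le> R/2 \<and> boundary_arc \<Omega> \<kappa> {-R<..<R} c c' \<and> c 0 = p \<and> inj_on c {-R<..<R} \<and>
     frontier \<Omega> \<inter> ball p \<rho> \<subseteq> c ` {-R/2<..<R/2} \<and>
     (\<forall>I c1 c1'. open I \<longrightarrow> connected I \<longrightarrow> boundary_arc \<Omega> \<kappa> I c1 c1' \<longrightarrow> c1 ` I \<subseteq> ball p \<rho> \<longrightarrow>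
        (\<exists>d. \<forall>t\<in>I. t + d \<in> {-R/2<..<R/2} \<and> c1 t = c (t + d)))"
proof -
  define s0 where "s0 = p \<bullet> e"
  have p0: "p = X s0" using p_eq by (simp add: s0_def)
  have "open (X -` ball p r)" using X_cont[of UNIV] by (intro open_vimage) auto
  then obtain d where d: "d > 0" "ball s0 d \<subseteq> X -` ball p r"
    using p0 r_pos unfolding open_contains_ball by (metis centre_in_ball vimageI2)
  define R where "R = d / 2"
  have R: "R > 0" using d by (simp add: R_def)
  have inball: "X s \<in> ball p r" if "s \<in> {s0-R..s0+R}" for s
  proof -
    have "s \<in> ball s0 d" using that R d(1) by (auto simp: dist_real_def R_def)
    then show ?thesis using d by blast
  qed
  define A where "A s = integral {s0 - R - 1..s} spd - integral {s0 - R - 1..s0} spd" for s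
  have A_deriv: "(A has_real_derivative spd s) (at s)" if "s > s0 - R - 1" for s
  proof -
    have "((\<lambda>x. integral {s0 - R - 1..x} spd) has_real_derivative spd s) (at s within {s0-R-1..s+1})"
      by (rule integral_has_real_derivative) (use that spd_cont in auto)
    then have "((\<lambda>x. integral {s0 - R - 1..x} spd) has_real_derivative spd s) (at s)"
      using that by (simp add: at_within_Icc_at)
    then show ?thesis unfolding A_def by (auto intro!: derivative_eq_intros)
  qed
  have A0: "A s0 = 0" by (simp add: A_def)
  have A_exp: "A t - A s \<ge> t - s" if "s0 - R - 1 < s" "s \<le> t" for s t
  proof -
    have "A s - s \<le> A t - t"
    proof (rule DERIV_nonneg_imp_nondecreasing[OF that(2)])
      fix x assume "s \<le> x" "x \<le> t"
      then have "((\<lambda>x. A x - x) has_real_derivative spd x - 1) (at x)"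
        using that by (intro DERIV_diff A_deriv DERIV_ident) auto
      then show "\<exists>y. ((\<lambda>x. A x - x) has_real_derivative y) (at x) \<and> 0 \<le> y" using spd_ge(1)[of x] by force
    qed
    then show ?thesis by simp
  qed
  have A_contI: "continuous_on {s0-R..s0+R} A"
    by (rule DERIV_continuous_on[where D = spd]) (auto intro!: has_field_derivative_at_within A_deriv)
  have ex: "\<exists>s. s \<in> {s0-R..s0+R} \<and> A s = y" if "y \<in> {-R..R}" for y
  proof -
    have "A (s0 - R) \<le> y" "y \<le> A (s0 + R)" "s0 - R \<le> s0 + R"
      using A_exp[of "s0-R" s0] A_exp[of s0 "s0+R"] A0 that R by auto
    from IVT'[OF this A_contI] show ?thesis by auto
  qed
  define \<phi> where "\<phi> y = (SOME s. s \<in> {s0-R..s0+R} \<and> A s = y)" for y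
  have phi: "\<phi> y \<in> {s0-R..s0+R}" "A (\<phi> y) = y" if "y \<in> {-R..R}" for y
    using someI_ex[OF ex[OF that]] unfolding \<phi>_def by auto
  have A_inj: "s = t" if "A s = A t" "s0 - R - 1 < s" "s0 - R - 1 < t" for s t
    using A_exp[of s t] A_exp[of t s] that by linarith
  have phi_A: "\<phi> (A s) = s" if "s \<in> {s0-R..s0+R}" "A s \<in> {-R..R}" for s
    using A_inj[of "\<phi> (A s)" s] phi[of "A s"] that by auto
  have phi_lip: "\<bar>\<phi> x - \<phi> y\<bar> \<le> \<bar>x - y\<bar>" if "x \<in> {-R..R}" "y \<in> {-R..R}" for x y
    using A_exp[of "\<phi> x" "\<phi> y"] A_exp[of "\<phi> y" "\<phi> x"] phi[OF that(1)] phi[OF that(2)]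
    by (cases "\<phi> x \<le> \<phi> y") auto
  have phi_cont: "isCont \<phi> y" if "y \<in> {-R<..<R}" for y
  proof -
    have "1-lipschitz_on {-R<..<R} \<phi>" using phi_lip by (auto simp: lipschitz_on_def dist_real_def)
    then have "continuous_on {-R<..<R} \<phi>" by (rule lipschitz_on_continuous_on)
    then show ?thesis using that by (simp add: continuous_on_eq_continuous_at)
  qed
  have phi_deriv: "(\<phi> has_real_derivative inverse (spd (\<phi> y))) (at y)" if y: "y \<in> {-R<..<R}" for y
  proof (rule DERIV_inverse_function[where f = A and a = "-R" and b = R])
    show "(A has_real_derivative spd (\<phi> y)) (at (\<phi> y))" using phi(1)[of y] y by (intro A_deriv) auto
    show "spd (\<phi> y) \<noteq> 0" using spd_ge(2)[of "\<phi> y"] by simp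
  qed (use y phi phi_cont in auto)
  define c where "c y = X (\<phi> y)" for y
  define U where "U s = inverse (spd s) *\<^sub>R X' s" for s
  define c' where "c' y = U (\<phi> y)" for y
  have U_norm: "norm (U s) = 1" for s using spd_ge(2)[of s] by (simp add: U_def norm_X')
  have U_deriv: "(U has_vector_derivative (f2 s / (spd s)\<^sup>2) *\<^sub>R perp (U s)) (at s)" for s
  proof -
    have sp: "spd s > 0" by (rule spd_ge)
    have "((\<lambda>s. inverse (spd s)) has_real_derivative - (f1 s * f2 s / spd s) / (spd s)\<^sup>2) (at s)"
      using DERIV_inverse_fun[OF spd_deriv, of s] sp by (simp add: divide_inverse power2_eq_square)
    from has_vector_derivative_scaleR[OF this X'_deriv[of s]]
    have "(U has_vector_derivative inverse (spd s) *\<^sub>R (f2 s *\<^sub>R perp e) +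
        (- (f1 s * f2 s / spd s) / (spd s)\<^sup>2) *\<^sub>R X' s) (at s)" unfolding U_def .
    moreover have "inverse (spd s) *\<^sub>R (f2 s *\<^sub>R perp e) + (- (f1 s * f2 s / spd s) / (spd s)\<^sup>2) *\<^sub>R X' s
      = (f2 s / (spd s)\<^sup>2) *\<^sub>R perp (U s)" (is "?l = ?r")
    proof -
      have "?l = (f2 s / spd s ^ 3) *\<^sub>R ((spd s)\<^sup>2 *\<^sub>R perp e - f1 s *\<^sub>R X' s)"
        using sp by (simp add: scaleR_diff_right power2_eq_square power3_eq_cube divide_simps)
      also have "(spd s)\<^sup>2 *\<^sub>R perp e - f1 s *\<^sub>R X' s = perp (X' s)"
        unfolding spd_sq by (simp add: X'_def scaleR_add_left scaleR_add_right power2_eq_square)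
      also have "(f2 s / spd s ^ 3) *\<^sub>R perp (X' s) = ?r"
        using sp by (simp add: U_def power2_eq_square power3_eq_cube divide_simps)
      finally show ?thesis .
    qed
    ultimately show ?thesis by simp
  qed
  have arc: "boundary_arc \<Omega> \<kappa> {-R<..<R} c c'"
    unfolding boundary_arc_def
  proof (intro ballI conjI)
    fix y assume y: "y \<in> {-R<..<R}"
    let ?s = "\<phi> y"
    have b: "X ?s \<in> ball p r" using inball phi(1)[of y] y by auto
    show fr: "c y \<in> frontier \<Omega>" unfolding c_def using b by (rule X_front)
    have pd: "(\<phi> has_vector_derivative inverse (spd ?s)) (at y)"
      using phi_deriv[OF y] by (simp add: has_real_derivative_iff_has_vector_derivative)
    show "(c has_vector_derivative c' y) (at y)"
      using vector_diff_chain_at[OF pd X_deriv] by (simp add: c_def[abs_def] c'_def U_def o_def)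
    show "norm (c' y) = 1" by (simp add: c'_def U_norm)
    show "\<exists>k. \<bar>k\<bar> \<le> \<kappa> \<and> (c' has_vector_derivative k *\<^sub>R perp (c' y)) (at y)"
    proof (intro exI conjI)
      have sp: "spd ?s > 0" by (rule spd_ge)
      have "\<bar>f2 ?s\<bar> \<le> \<kappa> * spd ?s ^ 3" using b by (rule curvature_bound)
      then show "\<bar>f2 ?s / spd ?s ^ 3\<bar> \<le> \<kappa>" using sp by (simp add: divide_le_eq)
      have "((U \<circ> \<phi>) has_vector_derivative inverse (spd ?s) *\<^sub>R ((f2 ?s / (spd ?s)\<^sup>2) *\<^sub>R perp (U ?s))) (at y)"
        by (rule vector_diff_chain_at[OF pd U_deriv])
      moreover have "inverse (spd ?s) *\<^sub>R ((f2 ?s / (spd ?s)\<^sup>2) *\<^sub>R perp (U ?s)) = (f2 ?s / spd ?s ^ 3) *\<^sub>R perp (c' y)"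
        using sp by (simp add: c'_def power2_eq_square power3_eq_cube divide_simps)
      moreover have "U \<circ> \<phi> = c'" by (auto simp: c'_def)
      ultimately show "(c' has_vector_derivative (f2 ?s / spd ?s ^ 3) *\<^sub>R perp (c' y)) (at y)"
        by (simp only:)
    qed
    have D: "perp (c' y) \<bullet> perp e - f1 (c y \<bullet> e) * (perp (c' y) \<bullet> e) = spd ?s"
    proof -
      have "perp (c' y) \<bullet> perp e - f1 (c y \<bullet> e) * (perp (c' y) \<bullet> e) = inverse (spd ?s) * (1 + (f1 ?s)\<^sup>2)"
        by (simp add: c'_def c_def U_def perp_swap algebra_simps power2_eq_square)
      also have "\<dots> = spd ?s" using spd_ge(2)[of ?s] unfolding spd_sq[symmetric] by (simp add: power2_eq_square)
      finally show ?thesis .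
    qed
    have cb: "c y \<in> ball p r" using b by (simp add: c_def)
    have "\<forall>\<^sub>F h in at_right 0. c y + h *\<^sub>R perp (c' y) \<in> \<Omega>"
      using side_deriv(1)[OF fr cb, of "perp (c' y)"] D spd_ge(2)[of ?s] by simp
    moreover have "\<forall>\<^sub>F h in at_right 0. c y + h *\<^sub>R (- perp (c' y)) \<notin> \<Omega>"
      using side_deriv(2)[OF fr cb, of "- perp (c' y)"] D spd_ge(2)[of ?s] by simp
    ultimately show "\<forall>\<^sub>F h in at_right 0. c y + h *\<^sub>R perp (c' y) \<in> \<Omega> \<and> c y - h *\<^sub>R perp (c' y) \<notin> \<Omega>"
      by eventually_elim simp
  qed
  have "isCont A s0" using A_deriv[of s0] R DERIV_isCont by auto
  then obtain \<eta> where eta: "\<eta> > 0" "\<And>s. \<bar>s - s0\<bar> < \<eta> \<Longrightarrow> \<bar>A s\<bar> < R/2"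
    using R A0 unfolding isCont_def LIM_def by (metis dist_real_def diff_zero half_gt_zero abs_zero diff_self)
  define \<rho> where "\<rho> = min r (min \<eta> (R/2))"
  have rho: "0 < \<rho>" "\<rho> \<le> R/2" "\<rho> \<le> r" "\<rho> \<le> \<eta>" using r_pos eta R by (auto simp: \<rho>_def)
  have near: "x \<bullet> e \<in> {s0-R..s0+R}" "\<bar>A (x \<bullet> e)\<bar> < R/2" if "x \<in> ball p \<rho>" for x
  proof -
    have "\<bar>x \<bullet> e - s0\<bar> = \<bar>(x - p) \<bullet> e\<bar>" by (simp add: s0_def inner_diff_left)
    also have "\<dots> \<le> norm (x - p)" using Cauchy_Schwarz_ineq2[of "x - p" e] e_unit by simp
    finally have "\<bar>x \<bullet> e - s0\<bar> < \<rho>" using that by (simp add: dist_norm norm_minus_commute)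
    then show "x \<bullet> e \<in> {s0-R..s0+R}" "\<bar>A (x \<bullet> e)\<bar> < R/2" using rho R eta(2)[of "x \<bullet> e"] by auto
  qed
  have front_c: "x = c (A (x \<bullet> e))" if "x \<in> frontier \<Omega>" "x \<in> ball p \<rho>" for x
  proof -
    have "x = X (x \<bullet> e)" using front_X[of x] that rho by auto
    moreover have "\<phi> (A (x \<bullet> e)) = x \<bullet> e" using near[OF that(2)] R by (intro phi_A) auto
    ultimately show ?thesis by (simp add: c_def)
  qed
  have sub: "frontier \<Omega> \<inter> ball p \<rho> \<subseteq> c ` {-R/2<..<R/2}"
  proof
    fix x assume x: "x \<in> frontier \<Omega> \<inter> ball p \<rho>"
    then have "x = c (A (x \<bullet> e))" using front_c by blast
    moreover have "A (x \<bullet> e) \<in> {-R/2<..<R/2}" using near(2)[of x] x by auto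
    ultimately show "x \<in> c ` {-R/2<..<R/2}" by blast
  qed
  have uni: "\<exists>d. \<forall>t\<in>I. t + d \<in> {-R/2<..<R/2} \<and> c1 t = c (t + d)"
    if I: "open I" "connected I" and a: "boundary_arc \<Omega> \<kappa> I c1 c1'" and b: "c1 ` I \<subseteq> ball p \<rho>" for I c1 c1'
  proof -
    define \<theta> where "\<theta> t = A (c1 t \<bullet> e)" for t
    have th: "(\<theta> has_real_derivative 1) (at t)" if t: "t \<in> I" for t
    proof -
      have fr: "c1 t \<in> frontier \<Omega>" and d1: "(c1 has_vector_derivative c1' t) (at t)" and n1: "norm (c1' t) = 1"
        and ev: "\<forall>\<^sub>F h in at_right 0. c1 t + h *\<^sub>R perp (c1' t) \<in> \<Omega> \<and> c1 t - h *\<^sub>R perp (c1' t) \<notin> \<Omega>"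
        using a t unfolding boundary_arc_def by auto
      have cb: "c1 t \<in> ball p \<rho>" using b t by auto
      then have cr: "c1 t \<in> ball p r" using rho by auto
      let ?s = "c1 t \<bullet> e" and ?k = "c1' t \<bullet> e"
      have de: "((\<lambda>t. c1 t \<bullet> v) has_real_derivative c1' t \<bullet> v) (at t)" for v
        using bounded_linear.has_vector_derivative[OF bounded_linear_inner_left d1, of v]
        by (simp add: has_real_derivative_iff_has_vector_derivative)
      have "((\<lambda>t. c1 t \<bullet> perp e) has_real_derivative f1 ?s * ?k) (at t)"
      proof (rule has_field_derivative_transform_within_open[OF _ I(1) t])
        show "((\<lambda>t. f (c1 t \<bullet> e)) has_real_derivative f1 ?s * ?k) (at t)"
          by (rule DERIV_chain2[OF f_deriv de])
        show "f (c1 x \<bullet> e) = c1 x \<bullet> perp e" if "x \<in> I" for x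
        proof -
          have "c1 x \<in> frontier \<Omega>" "c1 x \<in> ball p r"
            using a b rho that unfolding boundary_arc_def by force+
          from front_X[OF this] show ?thesis using X_coords by metis
        qed
      qed
      then have k2: "c1' t \<bullet> perp e = f1 ?s * ?k" using de DERIV_unique by blast
      have "1 = ?k\<^sup>2 + (f1 ?s * ?k)\<^sup>2" using norm_perp_decomp[OF e_unit, of "c1' t"] n1 k2 by simp
      then have ks: "?k\<^sup>2 * (spd ?s)\<^sup>2 = 1" by (simp add: spd_sq algebra_simps power_mult_distrib)
      have "?k > 0"
      proof (rule ccontr)
        assume "\<not> ?k > 0"
        then have "?k < 0" using ks by (cases "?k = 0") auto
        moreover have "perp (c1' t) \<bullet> perp e - f1 ?s * (perp (c1' t) \<bullet> e) = ?k * (1 + (f1 ?s)\<^sup>2)"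
          using k2 by (simp add: perp_swap algebra_simps power2_eq_square)
        moreover have "1 + (f1 ?s)\<^sup>2 > 0" by (simp add: add_pos_nonneg)
        ultimately have "perp (c1' t) \<bullet> perp e - f1 ?s * (perp (c1' t) \<bullet> e) < 0" by (simp add: mult_neg_pos)
        from side_deriv(2)[OF fr cr this] ev
        have "\<forall>\<^sub>F h in at_right (0::real). False" by eventually_elim blast
        then show False by simp
      qed
      have "(?k * spd ?s)\<^sup>2 = 1" using ks by (simp add: power_mult_distrib)
      moreover have "?k * spd ?s > 0" using \<open>?k > 0\<close> spd_ge(2)[of ?s] by simp
      ultimately have "spd ?s * ?k = 1" by (simp add: power2_eq_1_iff mult.commute)
      moreover have "(\<theta> has_real_derivative spd ?s * ?k) (at t)" unfolding \<theta>_def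
        using near(1)[OF cb] by (intro DERIV_chain2[OF A_deriv de]) auto
      ultimately show ?thesis by simp
    qed
    have "\<exists>k. \<forall>t\<in>I. \<theta> t - t = k"
    proof -
      have "((\<lambda>t. \<theta> t - t) has_derivative (\<lambda>_. 0)) (at t within I)" if "t \<in> I" for t
      proof -
        have "((\<lambda>t. \<theta> t - t) has_real_derivative 0) (at t)"
          using th[OF that] by (auto intro!: derivative_eq_intros)
        moreover have "(*) (0::real) = (\<lambda>_. 0)" by auto
        ultimately have "((\<lambda>t. \<theta> t - t) has_derivative (\<lambda>_. 0)) (at t)"
          unfolding has_field_derivative_def by (simp only:)
        then show ?thesis by (rule has_derivative_at_withinI)
      qed
      moreover have "convex I" using I(2) by (simp add: is_interval_connected_1 is_interval_convex_1[symmetric])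
      ultimately show ?thesis using has_derivative_zero_constant[of I "\<lambda>t. \<theta> t - t"] by blast
    qed
    then obtain k where k: "\<And>t. t \<in> I \<Longrightarrow> \<theta> t = t + k" by (auto simp: algebra_simps)
    have "t + k \<in> {-R/2<..<R/2} \<and> c1 t = c (t + k)" if "t \<in> I" for t
    proof -
      have "c1 t \<in> frontier \<Omega>" "c1 t \<in> ball p \<rho>" using a b that unfolding boundary_arc_def by auto
      then have "c1 t = c (\<theta> t)" "\<bar>\<theta> t\<bar> < R/2" using front_c[of "c1 t"] near(2)[of "c1 t"] unfolding \<theta>_def by blast+
      then show ?thesis unfolding k[OF that] greaterThanLessThan_iff by linarith
    qed
    then show ?thesis by blast
  qed
  have inj: "inj_on c {-R<..<R}"
  proof (rule inj_onI)
    fix x y assume h: "x \<in> {-R<..<R}" "y \<in> {-R<..<R}" "c x = c y"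
    then have 1: "\<phi> x = \<phi> y" unfolding c_def using X_coords(1) by metis
    have mem: "x \<in> {-R..R}" "y \<in> {-R..R}" using h(1,2) by auto
    have 2: "A (\<phi> x) = x" by (rule phi(2)[OF mem(1)])
    have 3: "A (\<phi> y) = y" by (rule phi(2)[OF mem(2)])
    show "x = y" by (rule trans[OF 2[symmetric] trans[OF arg_cong[OF 1, of A] 3]])
  qed
  have c0: "c 0 = p" using phi_A[of s0] A0 R p0 by (simp add: c_def)
  show ?thesis
  proof (rule exI[of _ R], rule conjI[OF R], rule exI[of _ c], rule exI[of _ c'], rule exI[of _ \<rho>],
      intro conjI allI impI)
    show "0 < \<rho>" "\<rho> \<le> R/2" by (fact rho)+
    show "boundary_arc \<Omega> \<kappa> {-R<..<R} c c'" "c 0 = p" "inj_on c {-R<..<R}"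
      "frontier \<Omega> \<inter> ball p \<rho> \<subseteq> c ` {-R/2<..<R/2}" by (fact arc c0 inj sub)+
  qed (rule uni)
qed

end



section \<open>From local arcs to boundary curves\<close>

lemma boundary_arc_local:
  assumes "\<And>t. t \<in> I \<Longrightarrow> \<exists>J c1 c1'. open J \<and> t \<in> J \<and> boundary_arc \<Omega> \<kappa> J c1 c1' \<and> (\<forall>s\<in>J. c s = c1 s \<and> c' s = c1' s)"
  shows "boundary_arc \<Omega> \<kappa> I c c'"
  unfolding boundary_arc_def
proof (intro ballI)
  fix t assume "t \<in> I"
  from assms[OF this] obtain J c1 c1' where J: "open J" "t \<in> J" "boundary_arc \<Omega> \<kappa> J c1 c1'"
    and eq: "\<And>s. s \<in> J \<Longrightarrow> c s = c1 s" "\<And>s. s \<in> J \<Longrightarrow> c' s = c1' s" by blast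
  from J(2,3) obtain k where h: "c1 t \<in> frontier \<Omega>" "(c1 has_vector_derivative c1' t) (at t)" "norm (c1' t) = 1"
    "\<bar>k\<bar> \<le> \<kappa>" "(c1' has_vector_derivative k *\<^sub>R perp (c1' t)) (at t)"
    "\<forall>\<^sub>F h in at_right 0. c1 t + h *\<^sub>R perp (c1' t) \<in> \<Omega> \<and> c1 t - h *\<^sub>R perp (c1' t) \<notin> \<Omega>"
    unfolding boundary_arc_def by blast
  have "(c has_vector_derivative c1' t) (at t)"
    by (rule has_vector_derivative_transform_within_open[OF h(2) J(1,2)]) (use eq in auto)
  moreover have "(c' has_vector_derivative k *\<^sub>R perp (c1' t)) (at t)"
    by (rule has_vector_derivative_transform_within_open[OF h(5) J(1,2)]) (use eq in auto)
  ultimately show "c t \<in> frontier \<Omega> \<and> (c has_vector_derivative c' t) (at t) \<and> norm (c' t) = 1 \<and>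
     (\<exists>k. \<bar>k\<bar> \<le> \<kappa> \<and> (c' has_vector_derivative k *\<^sub>R perp (c' t)) (at t)) \<and>
     (\<forall>\<^sub>F h in at_right 0. c t + h *\<^sub>R perp (c' t) \<in> \<Omega> \<and> c t - h *\<^sub>R perp (c' t) \<notin> \<Omega>)"
    using h eq[OF J(2)] by auto
qed

lemma boundary_arc_subset: "boundary_arc \<Omega> \<kappa> I c c' \<Longrightarrow> J \<subseteq> I \<Longrightarrow> boundary_arc \<Omega> \<kappa> J c c'"
  unfolding boundary_arc_def by blast

lemma boundary_arc_cont: "boundary_arc \<Omega> \<kappa> I c c' \<Longrightarrow> continuous_on I c"
  unfolding boundary_arc_def
  by (meson continuous_at_imp_continuous_on has_vector_derivative_continuous)

lemma boundary_arc_deriv_unique: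
  assumes "boundary_arc \<Omega> \<kappa> I c c'" "boundary_arc \<Omega> \<kappa> I d d'" "open I" "\<And>t. t \<in> I \<Longrightarrow> c t = d t" "t \<in> I"
  shows "c' t = d' t"
proof -
  have "(c has_vector_derivative c' t) (at t)" "(d has_vector_derivative d' t) (at t)"
    using assms unfolding boundary_arc_def by auto
  moreover from this(2) have "(c has_vector_derivative d' t) (at t)"
    by (rule has_vector_derivative_transform_within_open[OF _ assms(3,5)]) (use assms(4) in auto)
  ultimately show ?thesis using vector_derivative_unique_at by blast
qed

lemma has_vector_derivative_shift:
  assumes "(c has_vector_derivative v) (at (t + d))"
  shows "((\<lambda>t. c (t + d)) has_vector_derivative v) (at t)"
proof -
  have "((\<lambda>x. x + d) has_vector_derivative 1) (at t)" by (auto intro!: derivative_eq_intros)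
  from vector_diff_chain_at[OF this assms] show ?thesis by (simp add: o_def)
qed

lemma boundary_arc_shift:
  assumes "boundary_arc \<Omega> \<kappa> I c c'" "\<And>t. t \<in> J \<Longrightarrow> t + d \<in> I"
  shows "boundary_arc \<Omega> \<kappa> J (\<lambda>t. c (t + d)) (\<lambda>t. c' (t + d))"
  unfolding boundary_arc_def
proof (intro ballI)
  fix t assume "t \<in> J"
  then have "t + d \<in> I" by (rule assms(2))
  with assms(1) obtain k where h: "c (t + d) \<in> frontier \<Omega>" "(c has_vector_derivative c' (t + d)) (at (t + d))"
    "norm (c' (t + d)) = 1" "\<bar>k\<bar> \<le> \<kappa>" "(c' has_vector_derivative k *\<^sub>R perp (c' (t + d))) (at (t + d))"
    "\<forall>\<^sub>F h in at_right 0. c (t + d) + h *\<^sub>R perp (c' (t + d)) \<in> \<Omega> \<and> c (t + d) - h *\<^sub>R perp (c' (t + d)) \<notin> \<Omega>"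
    unfolding boundary_arc_def by blast
  show "c (t + d) \<in> frontier \<Omega> \<and> ((\<lambda>t. c (t + d)) has_vector_derivative c' (t + d)) (at t) \<and> norm (c' (t + d)) = 1 \<and>
     (\<exists>k. \<bar>k\<bar> \<le> \<kappa> \<and> ((\<lambda>t. c' (t + d)) has_vector_derivative k *\<^sub>R perp (c' (t + d))) (at t)) \<and>
     (\<forall>\<^sub>F h in at_right 0. c (t + d) + h *\<^sub>R perp (c' (t + d)) \<in> \<Omega> \<and> c (t + d) - h *\<^sub>R perp (c' (t + d)) \<notin> \<Omega>)"
  proof -
    have "\<exists>k. \<bar>k\<bar> \<le> \<kappa> \<and> ((\<lambda>t. c' (t + d)) has_vector_derivative k *\<^sub>R perp (c' (t + d))) (at t)"
      by (rule exI[of _ k]) (rule conjI[OF h(4) has_vector_derivative_shift[OF h(5)]])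
    then show ?thesis using h(1,3,6) has_vector_derivative_shift[OF h(2)] by (intro conjI)
  qed
qed

locale smooth_domain =
  fixes \<Omega> :: "point set" and \<kappa> :: real
  assumes open_dom: "open \<Omega>" and dom_sub: "\<Omega> \<subseteq> unit_dom"
    and curv: "curvature_le (frontier \<Omega> \<inter> unit_dom) \<kappa>" and kappa_pos: "0 < \<kappa>"
    and smooth: "C2_boundary \<Omega>"
begin

lemma chart_exists:
  assumes p: "p \<in> frontier \<Omega>"
  shows "\<exists>e r f f1 f2. boundary_chart \<Omega> \<kappa> p e r f f1 f2"
proof -
  obtain r e n f where r: "r > 0" and o: "orthonormal_pair e n" and f: "C2_on f UNIV"
    and ep: "\<Omega> \<inter> ball p r = {x \<in> ball p r. f (x \<bullet> e) < x \<bullet> n}"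
    using bspec[OF smooth[unfolded C2_boundary_def] p] by (elim exE conjE) (rule that)
  obtain f1 f2 where f1: "\<And>t. (f has_real_derivative f1 t) (at t)"
    and f2: "\<And>t. (f1 has_real_derivative f2 t) (at t)" and c2: "continuous_on UNIV f2"
    using f unfolding C2_on_def C1_differentiable_on_def has_real_derivative_iff_has_vector_derivative by auto
  have e: "norm e = 1" using o by (simp add: orthonormal_pair_def)
  from orthonormal_perp[OF o] show ?thesis
  proof
    assume "n = perp e"
    then have "boundary_chart \<Omega> \<kappa> p e r f f1 f2"
      using open_dom dom_sub curv kappa_pos p r e f1 f2 c2 ep by unfold_locales auto
    then show ?thesis by blast
  next
    assume n: "n = - perp e"
    have "boundary_chart \<Omega> \<kappa> p (- e) r (\<lambda>t. f (- t)) (\<lambda>t. - f1 (- t)) (\<lambda>t. f2 (- t))"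
    proof
      have m: "((\<lambda>t::real. - t) has_real_derivative - 1) (at t)" for t by (auto intro!: derivative_eq_intros)
      show "((\<lambda>t. f (- t)) has_real_derivative - f1 (- t)) (at t)" for t
        using DERIV_chain2[OF f1[of "- t"] m[of t]] by simp
      show "((\<lambda>t. - f1 (- t)) has_real_derivative f2 (- t)) (at t)" for t
        using DERIV_minus[OF DERIV_chain2[OF f2[of "- t"] m[of t]]] by simp
      show "continuous_on UNIV (\<lambda>t. f2 (- t))"
        by (intro continuous_on_compose2[OF c2] continuous_intros) auto
      show "\<Omega> \<inter> ball p r = {x \<in> ball p r. f (- (x \<bullet> - e)) < x \<bullet> perp (- e)}"
        using ep n by simp
    qed (use open_dom dom_sub curv kappa_pos p r e in auto)
    then show ?thesis by blast
  qed
qed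

lemma compact_frontier: "compact (frontier \<Omega>)"
proof -
  have "bounded unit_dom" unfolding unit_dom_def by (intro bounded_Times) auto
  then have "bounded \<Omega>" using dom_sub bounded_subset by blast
  then show ?thesis by (simp add: compact_frontier_bounded)
qed

text \<open>By compactness a Lebesgue number \<open>\<delta>\<close> of the cover by charts is a radius that works for all boundary
  points. The last clause is the uniqueness of arcs within a chart.\<close>

lemma uniform_charts:
  "\<exists>\<delta>>0. \<forall>x\<in>frontier \<Omega>. \<exists>R c c' \<sigma>. boundary_arc \<Omega> \<kappa> {-R<..<R} c c' \<and> inj_on c {-R<..<R} \<and>
     {\<sigma>-\<delta><..<\<sigma>+\<delta>} \<subseteq> {-R<..<R} \<and> \<sigma> \<in> {-R<..<R} \<and> c \<sigma> = x \<and> frontier \<Omega> \<inter> ball x \<delta> \<subseteq> c ` {-R<..<R} \<and>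
     (\<forall>I c1 c1'. open I \<longrightarrow> connected I \<longrightarrow> boundary_arc \<Omega> \<kappa> I c1 c1' \<longrightarrow> c1 ` I \<subseteq> ball x \<delta> \<longrightarrow>
        (\<exists>d. \<forall>t\<in>I. t + d \<in> {-R<..<R} \<and> c1 t = c (t + d)))"
proof -
  define Q where "Q p R c c' \<rho> \<longleftrightarrow> R > 0 \<and> 0 < \<rho> \<and> \<rho> \<le> R/2 \<and> boundary_arc \<Omega> \<kappa> {-R<..<R} c c' \<and> c 0 = p \<and> inj_on c {-R<..<R} \<and>
     frontier \<Omega> \<inter> ball p \<rho> \<subseteq> c ` {-R/2<..<R/2} \<and>
     (\<forall>I c1 c1'. open I \<longrightarrow> connected I \<longrightarrow> boundary_arc \<Omega> \<kappa> I c1 c1' \<longrightarrow> c1 ` I \<subseteq> ball p \<rho> \<longrightarrow>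
        (\<exists>d. \<forall>t\<in>I. t + d \<in> {-R/2<..<R/2} \<and> c1 t = c (t + d)))" for p R \<rho> and c c' :: "real \<Rightarrow> point"
  have ex: "\<exists>\<rho> R c c'. Q p R c c' \<rho>" if p: "p \<in> frontier \<Omega>" for p
  proof -
    obtain e r f f1 f2 where "boundary_chart \<Omega> \<kappa> p e r f f1 f2" using chart_exists[OF p] by blast
    from boundary_chart.arclength_chart[OF this] show ?thesis unfolding Q_def by blast
  qed
  then obtain \<rho> where rho: "\<And>p. p \<in> frontier \<Omega> \<Longrightarrow> \<exists>R c c'. Q p R c c' (\<rho> p)" by metis
  have cover: "frontier \<Omega> \<subseteq> \<Union> ((\<lambda>p. ball p (\<rho> p)) ` frontier \<Omega>)"
    using rho unfolding Q_def by force
  obtain \<delta> where d: "0 < \<delta>" "\<And>x. x \<in> frontier \<Omega> \<Longrightarrow> \<exists>G\<in>(\<lambda>p. ball p (\<rho> p)) ` frontier \<Omega>. ball x \<delta> \<subseteq> G"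
    using Heine_Borel_lemma[OF compact_frontier cover] by auto
  have "\<exists>R c c' \<sigma>. boundary_arc \<Omega> \<kappa> {-R<..<R} c c' \<and> inj_on c {-R<..<R} \<and>
     {\<sigma>-\<delta><..<\<sigma>+\<delta>} \<subseteq> {-R<..<R} \<and> \<sigma> \<in> {-R<..<R} \<and> c \<sigma> = x \<and> frontier \<Omega> \<inter> ball x \<delta> \<subseteq> c ` {-R<..<R} \<and>
     (\<forall>I c1 c1'. open I \<longrightarrow> connected I \<longrightarrow> boundary_arc \<Omega> \<kappa> I c1 c1' \<longrightarrow> c1 ` I \<subseteq> ball x \<delta> \<longrightarrow>
        (\<exists>d. \<forall>t\<in>I. t + d \<in> {-R<..<R} \<and> c1 t = c (t + d)))" if x: "x \<in> frontier \<Omega>" for x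
  proof -
    obtain p where p: "p \<in> frontier \<Omega>" "ball x \<delta> \<subseteq> ball p (\<rho> p)" using d(2)[OF x] by blast
    obtain R c c' where Q: "Q p R c c' (\<rho> p)" using rho[OF p(1)] by blast
    have dr: "\<delta> \<le> \<rho> p" using p(2) d(1) unfolding ball_subset_ball_iff using zero_le_dist[of x p] by linarith
    have "x \<in> ball p (\<rho> p)" using p(2) d(1) by (meson centre_in_ball subsetD)
    then have "x \<in> frontier \<Omega> \<inter> ball p (\<rho> p)" using x by blast
    then obtain \<sigma> where s: "\<sigma> \<in> {-R/2<..<R/2}" "c \<sigma> = x" using Q unfolding Q_def by blast
    have sub: "frontier \<Omega> \<inter> ball x \<delta> \<subseteq> c ` {-R<..<R}"
    proof -
      have "frontier \<Omega> \<inter> ball p (\<rho> p) \<subseteq> c ` {-R/2<..<R/2}" using Q unfolding Q_def by blast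
      also have "\<dots> \<subseteq> c ` {-R<..<R}" using Q unfolding Q_def by (intro image_mono) auto
      finally show ?thesis using p(2) by blast
    qed
    have quni: "\<forall>I c1 c1'. open I \<longrightarrow> connected I \<longrightarrow> boundary_arc \<Omega> \<kappa> I c1 c1' \<longrightarrow> c1 ` I \<subseteq> ball p (\<rho> p) \<longrightarrow>
        (\<exists>d. \<forall>t\<in>I. t + d \<in> {-R/2<..<R/2} \<and> c1 t = c (t + d))"
      using Q unfolding Q_def by (elim conjE)
    have uni: "\<exists>d. \<forall>t\<in>I. t + d \<in> {-R<..<R} \<and> c1 t = c (t + d)"
      if I: "open I" "connected I" "boundary_arc \<Omega> \<kappa> I c1 c1'" "c1 ` I \<subseteq> ball x \<delta>" for I c1 c1'
    proof -
      have "c1 ` I \<subseteq> ball p (\<rho> p)" using I(4) p(2) by blast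
      then obtain d where dd: "\<forall>t\<in>I. t + d \<in> {-R/2<..<R/2} \<and> c1 t = c (t + d)"
        using quni[rule_format, OF I(1-3)] by blast
      have "{-R/2<..<R/2} \<subseteq> {-R<..<R}" using Q unfolding Q_def by auto
      then show ?thesis using dd by blast
    qed
    have sig: "{\<sigma>-\<delta><..<\<sigma>+\<delta>} \<subseteq> {-R<..<R}" "\<sigma> \<in> {-R<..<R}" using s dr Q unfolding Q_def by auto
    have arc: "boundary_arc \<Omega> \<kappa> {-R<..<R} c c'" "inj_on c {-R<..<R}" using Q unfolding Q_def by blast+
    show ?thesis
    proof (rule exI[of _ R], rule exI[of _ c], rule exI[of _ c'], rule exI[of _ \<sigma>], intro conjI allI impI)
    qed (fact arc sig s sub | rule uni)+
  qed
  then show ?thesis using d(1) by blast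
qed

end

locale uniform_domain = smooth_domain +
  fixes \<delta> :: real
  assumes delta_pos: "0 < \<delta>" and charts: "\<And>x. x \<in> frontier \<Omega> \<Longrightarrow>
     \<exists>R c c' \<sigma>. boundary_arc \<Omega> \<kappa> {-R<..<R} c c' \<and> inj_on c {-R<..<R} \<and>
     {\<sigma>-\<delta><..<\<sigma>+\<delta>} \<subseteq> {-R<..<R} \<and> \<sigma> \<in> {-R<..<R} \<and> c \<sigma> = x \<and> frontier \<Omega> \<inter> ball x \<delta> \<subseteq> c ` {-R<..<R} \<and>
     (\<forall>I c1 c1'. open I \<longrightarrow> connected I \<longrightarrow> boundary_arc \<Omega> \<kappa> I c1 c1' \<longrightarrow> c1 ` I \<subseteq> ball x \<delta> \<longrightarrow>
        (\<exists>d. \<forall>t\<in>I. t + d \<in> {-R<..<R} \<and> c1 t = c (t + d)))"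
begin

text \<open>The parameters at which the arcs agree form an open set, by uniqueness in charts, and a closed set.\<close>

lemma arc_unique:
  assumes a: "boundary_arc \<Omega> \<kappa> I c1 c1'" "boundary_arc \<Omega> \<kappa> I c2 c2'" "open I" "connected I"
    and t0: "t0 \<in> I" "c1 t0 = c2 t0" and t: "t \<in> I"
  shows "c1 t = c2 t"
proof -
  note ct = boundary_arc_cont[OF a(1)] boundary_arc_cont[OF a(2)]
  let ?A = "{t\<in>I. c1 t = c2 t}" and ?B = "{t\<in>I. c1 t \<noteq> c2 t}"
  have "open ?A"
    unfolding open_contains_ball
  proof
    fix s assume s: "s \<in> ?A"
    define x where "x = c1 s"
    have x: "x \<in> frontier \<Omega>" "c2 s = x" using s a unfolding boundary_arc_def x_def by auto
    obtain R c c' where C: "inj_on c {-R<..<R}" "\<And>I c1 c1'. open I \<Longrightarrow> connected I \<Longrightarrow> boundary_arc \<Omega> \<kappa> I c1 c1' \<Longrightarrow>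
        c1 ` I \<subseteq> ball x \<delta> \<Longrightarrow> \<exists>d. \<forall>t\<in>I. t + d \<in> {-R<..<R} \<and> c1 t = c (t + d)"
      using charts[OF x(1)] by blast
    have "open (I \<inter> c1 -` ball x \<delta>)" "open (I \<inter> c2 -` ball x \<delta>)"
      using ct a(3) by (auto intro: continuous_open_preimage)
    then have "open ((I \<inter> c1 -` ball x \<delta>) \<inter> (I \<inter> c2 -` ball x \<delta>))" by (rule open_Int)
    moreover have "s \<in> (I \<inter> c1 -` ball x \<delta>) \<inter> (I \<inter> c2 -` ball x \<delta>)" using s x x_def delta_pos by auto
    ultimately obtain h where h: "h > 0" "ball s h \<subseteq> (I \<inter> c1 -` ball x \<delta>) \<inter> (I \<inter> c2 -` ball x \<delta>)"
      unfolding open_contains_ball by blast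
    have b: "boundary_arc \<Omega> \<kappa> (ball s h) c1 c1'" "boundary_arc \<Omega> \<kappa> (ball s h) c2 c2'"
      using a h by (auto intro: boundary_arc_subset)
    obtain d1 where d1: "\<And>t. t \<in> ball s h \<Longrightarrow> t + d1 \<in> {-R<..<R} \<and> c1 t = c (t + d1)"
      using C(2)[OF open_ball connected_ball b(1)] h by blast
    obtain d2 where d2: "\<And>t. t \<in> ball s h \<Longrightarrow> t + d2 \<in> {-R<..<R} \<and> c2 t = c (t + d2)"
      using C(2)[OF open_ball connected_ball b(2)] h by blast
    have "c (s + d1) = c (s + d2)" using d1[of s] d2[of s] h s by simp
    then have "d1 = d2" using inj_onD[OF C(1), of "s + d1" "s + d2"] d1[of s] d2[of s] h by simp
    then have "ball s h \<subseteq> ?A" using d1 d2 h by auto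
    then show "\<exists>e>0. ball s e \<subseteq> ?A" using h by blast
  qed
  moreover have "open ?B"
  proof -
    have "continuous_on I (\<lambda>t. c1 t - c2 t)" using ct by (intro continuous_intros)
    then have "open (I \<inter> (\<lambda>t. c1 t - c2 t) -` (- {0}))" using a(3) by (intro continuous_open_preimage) auto
    moreover have "I \<inter> (\<lambda>t. c1 t - c2 t) -` (- {0}) = ?B" by auto
    ultimately show ?thesis by simp
  qed
  ultimately have "?A \<inter> I = {} \<or> ?B \<inter> I = {}" by (intro connectedD[OF a(4)]) auto
  then show ?thesis using t0 t by blast
qed

text \<open>The chart around \<open>c t1\<close> prolongs the arc by a length \<open>\<delta>\<close> that does not depend on the arc.\<close>

lemma arc_extend:
  assumes a: "boundary_arc \<Omega> \<kappa> I c c'" "open I" "connected I" "t1 \<in> I"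
  shows "\<exists>d d'. boundary_arc \<Omega> \<kappa> (I \<union> {t1-\<delta><..<t1+\<delta>}) d d' \<and> (\<forall>t\<in>I. d t = c t)"
proof -
  have ct: "c t1 \<in> frontier \<Omega>" using a unfolding boundary_arc_def by auto
  obtain R e e' \<sigma> where e: "boundary_arc \<Omega> \<kappa> {-R<..<R} e e'"
    "{\<sigma>-\<delta><..<\<sigma>+\<delta>} \<subseteq> {-R<..<R}" "e \<sigma> = c t1"
    using charts[OF ct] by (elim exE conjE) (rule that)
  let ?J = "{t1-\<delta><..<t1+\<delta>}"
  define f where "f t = e (t + (\<sigma> - t1))" for t
  define f' where "f' t = e' (t + (\<sigma> - t1))" for t
  have f: "boundary_arc \<Omega> \<kappa> ?J f f'" unfolding f_def f'_def
    by (rule boundary_arc_shift[OF e(1)], rule subsetD[OF e(2)]) auto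
  have conn: "connected (I \<inter> ?J)" "open (I \<inter> ?J)"
  proof -
    have "convex I" using a(3) by (simp add: is_interval_convex_1[symmetric] is_interval_connected_1)
    then show "connected (I \<inter> ?J)" by (intro convex_connected convex_Int) auto
    show "open (I \<inter> ?J)" using a(2) by (intro open_Int) auto
  qed
  have fc: "boundary_arc \<Omega> \<kappa> (I \<inter> ?J) f f'" "boundary_arc \<Omega> \<kappa> (I \<inter> ?J) c c'"
    using f a by (auto intro: boundary_arc_subset)
  have eq: "f t = c t" if "t \<in> I \<inter> ?J" for t
    by (rule arc_unique[OF fc conn(2,1) _ _ that, of t1]) (use a e delta_pos in \<open>auto simp: f_def\<close>)
  have eq': "f' t = c' t" if "t \<in> I \<inter> ?J" for t
    using boundary_arc_deriv_unique[OF fc conn(2) eq that] .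
  define d where "d t = (if t \<in> I then c t else f t)" for t
  define d' where "d' t = (if t \<in> I then c' t else f' t)" for t
  have "boundary_arc \<Omega> \<kappa> (I \<union> ?J) d d'"
  proof (rule boundary_arc_local)
    fix t assume "t \<in> I \<union> ?J"
    then show "\<exists>J c1 c1'. open J \<and> t \<in> J \<and> boundary_arc \<Omega> \<kappa> J c1 c1' \<and> (\<forall>s\<in>J. d s = c1 s \<and> d' s = c1' s)"
    proof
      assume "t \<in> I"
      then show ?thesis using a by (intro exI[of _ I] exI[of _ c] exI[of _ c']) (auto simp: d_def d'_def)
    next
      assume "t \<in> ?J"
      then show ?thesis using f eq eq' by (intro exI[of _ ?J] exI[of _ f] exI[of _ f']) (auto simp: d_def d'_def)
    qed
  qed
  then show ?thesis by (intro exI[of _ d] exI[of _ d']) (auto simp: d_def)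
qed

lemma arc_long:
  assumes p: "p \<in> frontier \<Omega>"
  shows "\<exists>c c'. boundary_arc \<Omega> \<kappa> {-(\<delta> * (1 + real n / 2))<..<\<delta> * (1 + real n / 2)} c c' \<and> c 0 = p"
proof (induction n)
  case 0
  from charts[OF p] obtain R c c' \<sigma> where c: "boundary_arc \<Omega> \<kappa> {-R<..<R} c c'"
    "{\<sigma>-\<delta><..<\<sigma>+\<delta>} \<subseteq> {-R<..<R}" "c \<sigma> = p" by blast
  have "boundary_arc \<Omega> \<kappa> {-\<delta><..<\<delta>} (\<lambda>t. c (t + \<sigma>)) (\<lambda>t. c' (t + \<sigma>))"
    by (rule boundary_arc_shift[OF c(1)], rule subsetD[OF c(2)]) auto
  then show ?case using c(3) by auto
next
  case (Suc n)
  define r where "r = \<delta> * (1 + real n / 2)"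
  have r: "\<delta> \<le> r" using delta_pos by (simp add: r_def algebra_simps)
  have r': "\<delta> * (1 + real (Suc n) / 2) = r + \<delta>/2" by (simp add: r_def field_simps)
  obtain c c' where c: "boundary_arc \<Omega> \<kappa> {-r<..<r} c c'" "c 0 = p" using Suc r_def by blast
  obtain d d' where d: "boundary_arc \<Omega> \<kappa> ({-r<..<r} \<union> {(r-\<delta>/2)-\<delta><..<(r-\<delta>/2)+\<delta>}) d d'" "\<forall>t\<in>{-r<..<r}. d t = c t"
    using arc_extend[OF c(1), of "r - \<delta>/2"] r delta_pos by auto
  have u1: "{-r<..<r} \<union> {(r-\<delta>/2)-\<delta><..<(r-\<delta>/2)+\<delta>} = {-r<..<r+\<delta>/2}" using r delta_pos by auto
  obtain e e' where e: "boundary_arc \<Omega> \<kappa> ({-r<..<r+\<delta>/2} \<union> {(-r+\<delta>/2)-\<delta><..<(-r+\<delta>/2)+\<delta>}) e e'" "\<forall>t\<in>{-r<..<r+\<delta>/2}. e t = d t"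
    using arc_extend[OF d(1)[unfolded u1], of "-r+\<delta>/2"] r delta_pos by auto
  have u2: "{-r<..<r+\<delta>/2} \<union> {(-r+\<delta>/2)-\<delta><..<(-r+\<delta>/2)+\<delta>} = {-(r+\<delta>/2)<..<r+\<delta>/2}" using r delta_pos by auto
  have "e 0 = p" using d(2) e(2) c(2) r delta_pos by auto
  then show ?case using e(1) unfolding u2 r' by blast
qed

text \<open>Arcs of increasing length through the same point agree where both are defined, so they can be glued.\<close>

lemma global_arc:
  assumes p: "p \<in> frontier \<Omega>"
  shows "\<exists>c c'. boundary_arc \<Omega> \<kappa> UNIV c c' \<and> c 0 = p"
proof -
  define r where "r n = \<delta> * (1 + real n / 2)" for n
  obtain c c' where c: "\<And>n. boundary_arc \<Omega> \<kappa> {-r n<..<r n} (c n) (c' n)" "\<And>n. c n 0 = p"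
    using arc_long[OF p] unfolding r_def by metis
  have r_mono: "m \<le> n \<Longrightarrow> r m \<le> r n" for m n using delta_pos by (simp add: r_def)
  have r_pos: "r n > 0" for n using delta_pos by (simp add: r_def add_pos_nonneg)
  have agree: "c m t = c n t" "c' m t = c' n t" if "m \<le> n" "\<bar>t\<bar> < r m" for m n t
  proof -
    have "boundary_arc \<Omega> \<kappa> {-r m<..<r m} (c n) (c' n)"
      by (rule boundary_arc_subset[OF c(1)]) (use r_mono[OF that(1)] in auto)
    moreover from arc_unique[OF c(1) this, of 0] have eq: "c m s = c n s" if "s \<in> {-r m<..<r m}" for s
      using that r_pos c(2) by auto
    moreover have tm: "t \<in> {-r m<..<r m}" using that(2) by auto
    ultimately show "c m t = c n t" "c' m t = c' n t"
      using eq boundary_arc_deriv_unique[OF c(1) _ _ eq tm] by auto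
  qed
  have ex: "\<exists>n. \<bar>t\<bar> < r n" for t
  proof -
    obtain n where "2 * \<bar>t\<bar> / \<delta> < real n" using reals_Archimedean2 by blast
    then have "2 * \<bar>t\<bar> < real n * \<delta>" using delta_pos by (simp add: divide_less_eq)
    then show ?thesis using delta_pos by (intro exI[of _ n]) (simp add: r_def algebra_simps)
  qed
  define N where "N t = (LEAST n. \<bar>t\<bar> < r n)" for t
  have N: "\<bar>t\<bar> < r (N t)" "\<And>n. \<bar>t\<bar> < r n \<Longrightarrow> N t \<le> n" for t
    unfolding N_def using ex[of t] LeastI_ex Least_le by metis+
  have "boundary_arc \<Omega> \<kappa> UNIV (\<lambda>t. c (N t) t) (\<lambda>t. c' (N t) t)"
  proof (rule boundary_arc_local)
    fix t :: real
    have "c (N s) s = c (N t) s \<and> c' (N s) s = c' (N t) s" if "s \<in> {-r (N t)<..<r (N t)}" for s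
      using agree[of "N s" "N t" s] N(1)[of s] N(2)[of s "N t"] that by auto
    then show "\<exists>J c1 c1'. open J \<and> t \<in> J \<and> boundary_arc \<Omega> \<kappa> J c1 c1' \<and>
        (\<forall>s\<in>J. c (N s) s = c1 s \<and> c' (N s) s = c1' s)"
      using c(1)[of "N t"] N(1)[of t]
      by (intro exI[of _ "{-r (N t)<..<r (N t)}"] exI[of _ "c (N t)"] exI[of _ "c' (N t)"]) auto
  qed
  moreover have "c (N 0) 0 = p" by (rule c(2))
  ultimately show ?thesis by blast
qed

end



section \<open>Boundary curves are closed\<close>

lemma infinite_close_pair:
  fixes f :: "nat \<Rightarrow> real"
  assumes "bounded (range f)" "e > 0"
  shows "\<exists>j k. j < k \<and> \<bar>f j - f k\<bar> < e"
proof -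
  obtain l r where r: "strict_mono r" "(f \<circ> r) \<longlonglongrightarrow> l"
    using bounded_imp_convergent_subsequence[OF assms(1)] by blast
  then obtain n where n: "\<And>m. m \<ge> n \<Longrightarrow> \<bar>f (r m) - l\<bar> < e / 2"
    using assms(2) LIMSEQ_D[OF r(2), of "e/2"] by auto
  have "\<bar>f (r n) - l\<bar> < e / 2" "\<bar>f (r (Suc n)) - l\<bar> < e / 2" using n by auto
  then have "\<bar>f (r n) - f (r (Suc n))\<bar> < e" by linarith
  moreover have "r n < r (Suc n)" using r(1) by (simp add: strict_mono_Suc_iff)
  ultimately show ?thesis by blast
qed

locale boundary_curve = uniform_domain +
  fixes \<gamma> \<gamma>' :: "real \<Rightarrow> point"
  assumes arc: "boundary_arc \<Omega> \<kappa> UNIV \<gamma> \<gamma>'"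
begin

lemma gam_front: "\<gamma> t \<in> frontier \<Omega>" and gam_deriv: "(\<gamma> has_vector_derivative \<gamma>' t) (at t)"
  and gam_speed: "norm (\<gamma>' t) = 1"
  and gam_side: "\<forall>\<^sub>F h in at_right 0. \<gamma> t + h *\<^sub>R perp (\<gamma>' t) \<in> \<Omega> \<and> \<gamma> t - h *\<^sub>R perp (\<gamma>' t) \<notin> \<Omega>"
  and gam_curv: "\<exists>k. \<bar>k\<bar> \<le> \<kappa> \<and> (\<gamma>' has_vector_derivative k *\<^sub>R perp (\<gamma>' t)) (at t)"
  using arc unfolding boundary_arc_def by auto

lemma gam_lip: "norm (\<gamma>' s - \<gamma>' t) \<le> \<kappa> * \<bar>s - t\<bar>"
proof -
  obtain k where k: "\<And>t. \<bar>k t\<bar> \<le> \<kappa>" "\<And>t. (\<gamma>' has_vector_derivative k t *\<^sub>R perp (\<gamma>' t)) (at t)"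
    using gam_curv by metis
  have "norm (\<gamma>' s - \<gamma>' t) \<le> \<kappa> * norm (s - t)"
  proof (rule differentiable_bound[where S = UNIV and f' = "\<lambda>x u. u *\<^sub>R (k x *\<^sub>R perp (\<gamma>' x))"])
    show "(\<gamma>' has_derivative (\<lambda>u. u *\<^sub>R (k x *\<^sub>R perp (\<gamma>' x)))) (at x within UNIV)" for x
      using k(2)[of x] by (simp add: has_vector_derivative_def)
    show "onorm (\<lambda>u. u *\<^sub>R (k x *\<^sub>R perp (\<gamma>' x))) \<le> \<kappa>" for x
    proof (rule onorm_le)
      fix u :: real
      have "norm (u *\<^sub>R (k x *\<^sub>R perp (\<gamma>' x))) = \<bar>k x\<bar> * \<bar>u\<bar>" by (simp add: gam_speed abs_mult)
      also have "\<dots> \<le> \<kappa> * \<bar>u\<bar>" using k(1) by (intro mult_right_mono) auto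
      finally show "norm (u *\<^sub>R (k x *\<^sub>R perp (\<gamma>' x))) \<le> \<kappa> * norm u" by simp
    qed
  qed auto
  then show ?thesis by simp
qed

lemma gam_cont: "continuous_on S \<gamma>"
  using gam_deriv by (meson continuous_at_imp_continuous_on has_vector_derivative_continuous)

lemma gam_bcc: "1 \<le> K \<Longrightarrow> \<kappa> \<le> K \<Longrightarrow> bounded_curvature_curve \<gamma> \<gamma>' K"
proof
  assume K: "1 \<le> K" "\<kappa> \<le> K"
  show "norm (\<gamma>' s - \<gamma>' t) \<le> K * \<bar>s - t\<bar>" for s t
    using gam_lip[of s t] mult_right_mono[OF K(2), of "\<bar>s - t\<bar>"] by linarith
qed (use gam_deriv gam_speed in auto)

text \<open>The translated curve agrees with the original one at a parameter, hence everywhere.\<close>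

lemma gam_return: assumes "\<gamma> s = \<gamma> t" shows "\<gamma> (u + (t - s)) = \<gamma> u"
proof (rule arc_unique[OF boundary_arc_shift[OF arc, of UNIV "t - s"] arc open_UNIV connected_UNIV, of s u])
  show "\<gamma> (s + (t - s)) = \<gamma> s" using assms by simp
qed auto

text \<open>The frontier is compact, so the points \<open>\<gamma> (2 * \<delta> * k)\<close> accumulate. Infinitely many pieces of the
  curve pass through one chart, whose parameter interval is bounded; two of them overlap.\<close>

lemma gam_not_inj: "\<exists>s t. s < t \<and> \<gamma> s = \<gamma> t"
proof (rule ccontr)
  assume n: "\<not> ?thesis"
  then have inj: "\<gamma> s = \<gamma> t \<Longrightarrow> s = t" for s t by (metis linorder_neqE_linordered_idom)
  obtain x r where x: "x \<in> frontier \<Omega>" "strict_mono (r :: nat \<Rightarrow> nat)" "((\<lambda>k. \<gamma> (2 * \<delta> * real k)) \<circ> r) \<longlonglongrightarrow> x"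
    using compact_frontier gam_front unfolding compact_def by (metis (no_types, lifting))
  obtain m where m: "\<And>k. k \<ge> m \<Longrightarrow> norm (\<gamma> (2 * \<delta> * real (r k)) - x) < \<delta> / 2"
    using LIMSEQ_D[OF x(3), of "\<delta>/2"] delta_pos by auto
  define s where "s k = 2 * \<delta> * real (r (m + k))" for k
  have s: "norm (\<gamma> (s k) - x) < \<delta> / 2" for k using m[of "m + k"] by (simp add: s_def)
  obtain R c where C: "\<forall>I c1 c1'. open I \<longrightarrow> connected I \<longrightarrow> boundary_arc \<Omega> \<kappa> I c1 c1' \<longrightarrow> c1 ` I \<subseteq> ball x \<delta> \<longrightarrow>
        (\<exists>d. \<forall>t\<in>I. t + d \<in> {-R<..<R} \<and> c1 t = c (t + d))"
    using charts[OF x(1)] by (elim exE conjE) (rule that)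
  define I where "I k = {s k - \<delta>/2<..<s k + \<delta>/2}" for k
  interpret b: bounded_curvature_curve \<gamma> \<gamma>' "max 1 \<kappa>" by (rule gam_bcc) auto
  have "\<exists>d. \<forall>t\<in>I k. t + d \<in> {-R<..<R} \<and> \<gamma> t = c (t + d)" for k
  proof (rule C[rule_format])
    show "boundary_arc \<Omega> \<kappa> (I k) \<gamma> \<gamma>'" by (rule boundary_arc_subset[OF arc]) auto
    show "\<gamma> ` I k \<subseteq> ball x \<delta>"
    proof
      fix y assume "y \<in> \<gamma> ` I k"
      then obtain t where t: "t \<in> I k" "y = \<gamma> t" by blast
      have "norm (\<gamma> t - \<gamma> (s k)) < \<delta>/2" using b.dist_le[of t "s k"] t by (auto simp: I_def)
      then have "norm (y - x) < \<delta>" using s[of k] norm_triangle_ineq[of "\<gamma> t - \<gamma> (s k)" "\<gamma> (s k) - x"] t by simp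
      then show "y \<in> ball x \<delta>" by (simp add: dist_norm norm_minus_commute)
    qed
  qed (auto simp: I_def)
  then obtain d where d: "\<And>k. \<forall>t\<in>I k. t + d k \<in> {-R<..<R} \<and> \<gamma> t = c (t + d k)" by metis
  have sI: "s k \<in> I k" for k using delta_pos by (simp add: I_def)
  have "bounded (range (\<lambda>k. s k + d k))"
    by (rule bounded_subset[of "{-R<..<R}"]) (use d sI in auto)
  then obtain j k where jk: "j < k" "\<bar>(s j + d j) - (s k + d k)\<bar> < \<delta>/2"
    using infinite_close_pair[of "\<lambda>k. s k + d k" "\<delta>/2"] delta_pos by auto
  define t where "t = s j + ((s k + d k) - (s j + d j))"
  have "\<bar>t - s j\<bar> < \<delta>/2" using jk(2) unfolding t_def by linarith
  then have "t \<in> I j" unfolding I_def greaterThanLessThan_iff by linarith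
  then have "\<gamma> t = c (s k + d k)" using d[of j] by (auto simp: t_def)
  also have "\<dots> = \<gamma> (s k)" using d[of k] sI by auto
  finally have "t = s k" by (rule inj)
  moreover have "s k \<ge> s j + 2 * \<delta>"
  proof -
    have "r (m + j) < r (m + k)" using x(2) jk by (simp add: strict_mono_less)
    then have "real (r (m + j)) + 1 \<le> real (r (m + k))" by linarith
    then have "2 * \<delta> * (real (r (m + j)) + 1) \<le> 2 * \<delta> * real (r (m + k))" using delta_pos by (intro mult_left_mono) auto
    then show ?thesis by (simp add: s_def algebra_simps)
  qed
  ultimately show False using jk(2) delta_pos by (auto simp: t_def abs_less_iff)
qed

text \<open>The least period is positive because a short piece of the curve is almost straight.\<close>

lemma gam_period: "\<exists>l>0. (\<forall>t. \<gamma> (t + l) = \<gamma> t) \<and> (\<forall>s t. s < t \<longrightarrow> t < s + l \<longrightarrow> \<gamma> s \<noteq> \<gamma> t)"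
proof -
  let ?K = "max 1 \<kappa>"
  interpret b: bounded_curvature_curve \<gamma> \<gamma>' ?K by (rule gam_bcc) auto
  define P where "P = {L. 0 < L \<and> (\<forall>t. \<gamma> (t + L) = \<gamma> t)}"
  have low: "1 / ?K \<le> L" if "L \<in> P" for L
  proof -
    have L: "0 < L" "\<gamma> (0 + L) = \<gamma> 0" using that by (auto simp: P_def simp del: add_0_left)
    then have "norm (L *\<^sub>R \<gamma>' 0) \<le> ?K * L\<^sup>2" using b.taylor[of 0 L] by simp
    then have "1 \<le> ?K * L" using L gam_speed by (simp add: power2_eq_square)
    then show ?thesis by (simp add: divide_le_eq mult.commute)
  qed
  have ne: "P \<noteq> {}"
  proof -
    obtain s t where "s < t" "\<gamma> s = \<gamma> t" using gam_not_inj by blast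
    then have "t - s \<in> P" using gam_return by (auto simp: P_def)
    then show ?thesis by blast
  qed
  have bdd: "bdd_below P" using low by (rule bdd_belowI)
  have "P = {1/?K..} \<inter> {L. \<forall>t. \<gamma> (t + L) = \<gamma> t}"
  proof
    show "P \<subseteq> {1/?K..} \<inter> {L. \<forall>t. \<gamma> (t + L) = \<gamma> t}" using low by (auto simp: P_def)
    have "0 < 1/?K" by simp
    then have "0 < L" if "1/?K \<le> L" for L using that by (rule less_le_trans)
    then show "{1/?K..} \<inter> {L. \<forall>t. \<gamma> (t + L) = \<gamma> t} \<subseteq> P" unfolding P_def by blast
  qed
  moreover have "closed {L. \<forall>t. \<gamma> (t + L) = \<gamma> t}"
  proof -
    have "{L. \<forall>t. \<gamma> (t + L) = \<gamma> t} = (\<Inter>t. {L. \<gamma> (t + L) = \<gamma> t})" by auto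
    moreover have "closed {L. \<gamma> (t + L) = \<gamma> t}" for t
      by (intro closed_Collect_eq continuous_on_compose2[OF gam_cont[of UNIV]] continuous_intros) auto
    ultimately show ?thesis by auto
  qed
  ultimately have "closed P" by (auto intro: closed_Int)
  then have lP: "Inf P \<in> P" using closed_contains_Inf[OF ne bdd] by blast
  have "\<gamma> s \<noteq> \<gamma> t" if "s < t" "t < s + Inf P" for s t
  proof
    assume "\<gamma> s = \<gamma> t"
    then have "t - s \<in> P" using gam_return that by (auto simp: P_def)
    then have "Inf P \<le> t - s" using bdd by (rule cInf_lower)
    then show False using that by simp
  qed
  then show ?thesis using lP unfolding P_def by blast
qed

lemma compact_range: "compact (range \<gamma>)"
proof -
  obtain l where l: "l > 0" "\<And>t. \<gamma> (t + l) = \<gamma> t" using gam_period by blast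
  have int: "\<gamma> (t + real_of_int k * l) = \<gamma> t" for t k
  proof (induction k arbitrary: t rule: int_induct[of _ 0])
    case (step1 i) then show ?case using l(2)[of "t + of_int i * l"] by (simp add: algebra_simps)
  next
    case (step2 i) then show ?case using l(2)[of "t + of_int (i - 1) * l"] by (simp add: algebra_simps)
  qed simp
  have "range \<gamma> \<subseteq> \<gamma> ` {0..l}"
  proof
    fix y assume "y \<in> range \<gamma>"
    then obtain t where t: "y = \<gamma> t" by blast
    define k where "k = \<lfloor>t / l\<rfloor>"
    have "of_int k \<le> t / l" "t / l < of_int k + 1" unfolding k_def by linarith+
    then have "of_int k * l \<le> t" "t < (of_int k + 1) * l" using l by (simp_all add: field_simps)
    then have "t + of_int (-k) * l \<in> {0..l}" by (auto simp: algebra_simps)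
    moreover have "\<gamma> (t + of_int (-k) * l) = y" unfolding int t ..
    ultimately show "y \<in> \<gamma> ` {0..l}" by force
  qed
  then have "range \<gamma> = \<gamma> ` {0..l}" by blast
  then show ?thesis using compact_continuous_image[OF gam_cont compact_Icc] by metis
qed

text \<open>A boundary curve fills its charts, so it is relatively open in the frontier. Being compact as well, it
  contains every connected set of boundary points that it meets.\<close>

lemma range_open: assumes "x \<in> range \<gamma>" shows "frontier \<Omega> \<inter> ball x \<delta> \<subseteq> range \<gamma>"
proof -
  obtain s where s: "x = \<gamma> s" using assms by blast
  have xf: "x \<in> frontier \<Omega>" using gam_front s by simp
  obtain R c c' where c: "boundary_arc \<Omega> \<kappa> {-R<..<R} c c'" "frontier \<Omega> \<inter> ball x \<delta> \<subseteq> c ` {-R<..<R}"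
    and U: "\<forall>I c1 c1'. open I \<longrightarrow> connected I \<longrightarrow> boundary_arc \<Omega> \<kappa> I c1 c1' \<longrightarrow> c1 ` I \<subseteq> ball x \<delta> \<longrightarrow>
        (\<exists>d. \<forall>t\<in>I. t + d \<in> {-R<..<R} \<and> c1 t = c (t + d))"
    using charts[OF xf] by (elim exE conjE) (rule that)
  interpret b: bounded_curvature_curve \<gamma> \<gamma>' "max 1 \<kappa>" by (rule gam_bcc) auto
  have "\<exists>d. \<forall>t\<in>ball s \<delta>. t + d \<in> {-R<..<R} \<and> \<gamma> t = c (t + d)"
  proof (rule U[rule_format])
    show "boundary_arc \<Omega> \<kappa> (ball s \<delta>) \<gamma> \<gamma>'" by (rule boundary_arc_subset[OF arc]) auto
    show "\<gamma> ` ball s \<delta> \<subseteq> ball x \<delta>"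
    proof
      fix y assume "y \<in> \<gamma> ` ball s \<delta>"
      then obtain t where "t \<in> ball s \<delta>" "y = \<gamma> t" by blast
      then show "y \<in> ball x \<delta>" using b.dist_le[of s t] s by (simp add: dist_norm dist_real_def)
    qed
  qed auto
  then obtain d where "\<forall>t\<in>ball s \<delta>. t + d \<in> {-R<..<R} \<and> \<gamma> t = c (t + d)" by blast
  moreover have "s \<in> ball s \<delta>" using delta_pos by simp
  ultimately have d: "s + d \<in> {-R<..<R}" "\<gamma> s = c (s + d)" by blast+
  have "c u = \<gamma> (u + (- d))" if "u \<in> {-R<..<R}" for u
  proof (rule arc_unique[OF c(1) boundary_arc_shift[OF arc, of _ "- d"] _ _ _ _ that])
    show "s + d \<in> {-R<..<R}" "c (s + d) = \<gamma> (s + d + - d)" using d by auto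
  qed auto
  then show ?thesis using c(2) by auto
qed

lemma connected_in_range:
  assumes "connected S" "S \<subseteq> frontier \<Omega>" "S \<inter> range \<gamma> \<noteq> {}"
  shows "S \<subseteq> range \<gamma>"
proof -
  let ?A = "\<Union>x\<in>range \<gamma>. ball x \<delta>" and ?B = "- range \<gamma>"
  have o: "open ?A" "open ?B" using compact_imp_closed[OF compact_range] by auto
  have sub: "range \<gamma> \<subseteq> ?A" using delta_pos by auto
  have "?A \<inter> ?B \<inter> S = {}" using range_open assms(2) by blast
  moreover have "S \<subseteq> ?A \<union> ?B" using sub by auto
  ultimately have "?A \<inter> S = {} \<or> ?B \<inter> S = {}" by (rule connectedD[OF assms(1) o])
  moreover have "?A \<inter> S \<noteq> {}"
  proof -
    obtain x where "x \<in> S" "x \<in> range \<gamma>" using assms(3) by (elim IntE ex_in_conv[THEN iffD2, elim_format] exE) blast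
    moreover from this(2) have "x \<in> ?A" by (rule subsetD[OF sub])
    ultimately show ?thesis by (intro notI) (drule equals0D[of _ x], simp)
  qed
  ultimately have "?B \<inter> S = {}" by (rule_tac disjE) auto
  then show ?thesis by (auto simp: disjoint_iff)
qed

end



section \<open>Separation width and nearby boundary points\<close>

locale separated_curve = boundary_curve +
  fixes l \<zeta> :: real
  assumes l_pos: "0 < l" and per: "\<And>t. \<gamma> (t + l) = \<gamma> t"
    and inj: "\<And>s t. s < t \<Longrightarrow> t < s + l \<Longrightarrow> \<gamma> s \<noteq> \<gamma> t"
    and zeta_pos: "0 < \<zeta>"
    and sep: "\<And>x. x \<in> frontier \<Omega> \<Longrightarrow> (frontier \<Omega> \<inter> ball x \<zeta>) homeomorphic {0<..<1::real}"
begin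

lemma per_int: "\<gamma> (t + real_of_int k * l) = \<gamma> t"
proof (induction k arbitrary: t rule: int_induct[of _ 0])
  case (step1 i) then show ?case using per[of "t + of_int i * l"] by (simp add: algebra_simps)
next
  case (step2 i) then show ?case using per[of "t + of_int (i - 1) * l"] by (simp add: algebra_simps)
qed simp

lemma per_minus: "\<gamma> (t - l) = \<gamma> t"
  using per[of "t - l"] by simp

lemma reduce: "\<exists>t'. c \<le> t' \<and> t' < c + l \<and> \<gamma> t' = \<gamma> t"
proof -
  define k where "k = \<lfloor>(t - c) / l\<rfloor>"
  have "of_int k \<le> (t - c) / l" "(t - c) / l < of_int k + 1" unfolding k_def by linarith+
  then have "of_int k * l \<le> t - c" "t - c < (of_int k + 1) * l" using l_pos by (simp_all add: field_simps)
  then have "c \<le> t + of_int (-k) * l \<and> t + of_int (-k) * l < c + l" by (simp add: algebra_simps)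
  then show ?thesis using per_int[of t "-k"] by blast
qed

lemma ball_in_range: "frontier \<Omega> \<inter> ball (\<gamma> s) \<zeta> \<subseteq> range \<gamma>"
proof (rule connected_in_range)
  show "connected (frontier \<Omega> \<inter> ball (\<gamma> s) \<zeta>)"
    using homeomorphic_connectedness[OF sep[OF gam_front[of s]]] by simp
  show "frontier \<Omega> \<inter> ball (\<gamma> s) \<zeta> \<inter> range \<gamma> \<noteq> {}"
    using zeta_pos gam_front[of s] by auto
qed auto

text \<open>An open interval is not compact.\<close>

lemma leaves_ball: "\<exists>t. norm (\<gamma> t - \<gamma> s) \<ge> \<zeta>"
proof (rule ccontr)
  assume "\<not> ?thesis"
  then have "norm (\<gamma> t - \<gamma> s) < \<zeta>" for t by (meson not_le)
  then have "range \<gamma> \<subseteq> frontier \<Omega> \<inter> ball (\<gamma> s) \<zeta>"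
    using gam_front by (auto simp: dist_norm norm_minus_commute)
  then have "frontier \<Omega> \<inter> ball (\<gamma> s) \<zeta> = range \<gamma>" using ball_in_range[of s] by blast
  then have "compact {0<..<1::real}"
    using homeomorphic_compactness[OF sep[OF gam_front[of s]]] compact_range by simp
  then have "closure {0<..<1::real} = {0<..<1}" by (intro closure_closed compact_imp_closed)
  then have "{0<..<1::real} = {0..1}" by simp
  moreover have "(0::real) \<in> {0..1}" by simp
  ultimately have "(0::real) \<in> {0<..<1}" by blast
  then show False by simp
qed

text \<open>Since \<open>\<Omega>\<close> lies in the unit square, the radius of separation is bounded. This makes the constants
  below depend on a lower bound for \<open>\<zeta>\<close> only.\<close>

lemma zeta_le: "\<zeta> \<le> 2"
proof -
  have sq: "\<bar>fst (\<gamma> s)\<bar> \<le> 1 \<and> \<bar>snd (\<gamma> s)\<bar> \<le> 1 \<and> 0 \<le> fst (\<gamma> s) \<and> 0 \<le> snd (\<gamma> s)" for s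
  proof -
    have "\<gamma> s \<in> closure unit_dom"
      using gam_front[of s] closure_mono[OF dom_sub] by (auto simp: frontier_def)
    then show ?thesis by (auto simp: unit_dom_def closure_Times)
  qed
  obtain t where t: "norm (\<gamma> t - \<gamma> 0) \<ge> \<zeta>" using leaves_ball by blast
  have "norm (\<gamma> t - \<gamma> 0) \<le> \<bar>fst (\<gamma> t - \<gamma> 0)\<bar> + \<bar>snd (\<gamma> t - \<gamma> 0)\<bar>"
    unfolding norm_prod_def real_norm_def by (metis power2_abs real_sqrt_abs sqrt_sum_squares_le_sum_abs)
  moreover have "\<bar>fst (\<gamma> t - \<gamma> 0)\<bar> \<le> 1" "\<bar>snd (\<gamma> t - \<gamma> 0)\<bar> \<le> 1"
    using sq[of t] sq[of 0] unfolding fst_diff snd_diff by linarith+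
  ultimately show ?thesis using t by linarith
qed

text \<open>A ball meets the curve in a connected set, so two of its points are joined inside the ball
  by one of the two arcs between them.\<close>

lemma ball_contains_arc:
  assumes "u < c" "c < v" "v < d" "d < u + l"
    and uv: "norm (\<gamma> u - \<gamma> x) < \<zeta>" "norm (\<gamma> v - \<gamma> x) < \<zeta>"
  shows "norm (\<gamma> c - \<gamma> x) < \<zeta> \<or> norm (\<gamma> d - \<gamma> x) < \<zeta>"
proof (rule ccontr)
  assume n: "\<not> ?thesis"
  let ?J = "frontier \<Omega> \<inter> ball (\<gamma> x) \<zeta>" and ?A = "\<gamma> ` {c..d}" and ?B = "\<gamma> ` {d..c+l}"
  have J: "\<gamma> t \<in> ?J \<longleftrightarrow> norm (\<gamma> t - \<gamma> x) < \<zeta>" for t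
    using gam_front by (simp add: dist_norm norm_minus_commute)
  have con: "connected ?J" using homeomorphic_connectedness[OF sep[OF gam_front[of x]]] by simp
  have cl: "closed ?A" "closed ?B" by (auto intro!: compact_imp_closed compact_continuous_image gam_cont)
  have cov: "?J \<subseteq> ?A \<union> ?B"
  proof
    fix y assume "y \<in> ?J"
    then obtain t where "y = \<gamma> t" using ball_in_range by blast
    then obtain t' where t': "c \<le> t'" "t' < c + l" "y = \<gamma> t'" using reduce[of c t] by metis
    show "y \<in> ?A \<union> ?B" 
    proof (cases "t' \<le> d")
      case True then have "t' \<in> {c..d}" using t' by simp
      then show ?thesis using t' by blast
    next
      case False then have "t' \<in> {d..c+l}" using t' by simp
      then show ?thesis using t' by blast
    qed
  qed
  have "?A \<inter> ?B \<inter> ?J = {}"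
  proof (rule ccontr)
    assume "?A \<inter> ?B \<inter> ?J \<noteq> {}"
    then obtain t t' where t: "c \<le> t" "t \<le> d" "d \<le> t'" "t' \<le> c + l" "\<gamma> t = \<gamma> t'" "\<gamma> t \<in> ?J" by fastforce
    have "t = t' \<or> t' = t + l"
    proof (rule ccontr)
      assume "\<not> ?thesis"
      then have "t < t'" "t' < t + l" using t by linarith+
      then show False using inj t(5) by blast
    qed
    then have "t = d \<or> t = c" using t by linarith
    then show False using t(6) n unfolding J by blast
  qed
  moreover have "?A \<inter> ?J \<noteq> {}"
  proof -
    have "\<gamma> v \<in> ?A" using assms by auto
    then show ?thesis using uv(2) unfolding J[symmetric] by blast
  qed
  moreover have "?B \<inter> ?J \<noteq> {}"
  proof -
    have "\<gamma> (u + l) \<in> ?B" using assms by auto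
    then show ?thesis using uv(1) per[of u] unfolding J[symmetric] by auto
  qed
  ultimately show False using con cl cov unfolding connected_closed by blast
qed

abbreviation (input) "\<kappa>1 \<equiv> max 1 \<kappa>"
abbreviation (input) "K \<equiv> 4 * \<kappa>1"
abbreviation (input) "a \<equiv> 1 / (64 * K)"

lemma kz: "\<kappa>1 * \<zeta> \<le> K / 2"
proof -
  have "\<kappa>1 * \<zeta> \<le> \<kappa>1 * 2" using zeta_le by (intro mult_left_mono) auto
  then show ?thesis by simp
qed

lemma gam_taylor: "norm (\<gamma> (t + s) - \<gamma> t - s *\<^sub>R \<gamma>' t) \<le> \<kappa>1 * s\<^sup>2"
  by (rule bounded_curvature_curve.taylor[OF gam_bcc]) auto

lemma quad_small: assumes "\<bar>u\<bar> \<le> \<zeta> / K" shows "\<kappa>1 * u\<^sup>2 \<le> \<bar>u\<bar> / 2"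
proof -
  have "\<kappa>1 * \<bar>u\<bar> \<le> \<kappa>1 * (\<zeta> / K)" using assms by (intro mult_left_mono) auto
  also have "\<dots> \<le> 1 / 2" using zeta_le by simp
  finally have "(\<kappa>1 * \<bar>u\<bar>) * \<bar>u\<bar> \<le> 1 / 2 * \<bar>u\<bar>" by (intro mult_right_mono) auto
  then show ?thesis by (simp add: power2_eq_square)
qed

lemma local_dist: assumes "\<bar>u\<bar> \<le> \<zeta> / K" shows "norm (\<gamma> (s + u) - \<gamma> s) \<ge> \<bar>u\<bar> / 2"
proof -
  have "norm (u *\<^sub>R \<gamma>' s) \<le> norm (\<gamma> (s + u) - \<gamma> s) + norm (\<gamma> (s + u) - \<gamma> s - u *\<^sub>R \<gamma>' s)"
    using norm_triangle_sub[of "u *\<^sub>R \<gamma>' s" "\<gamma> (s + u) - \<gamma> s"] by (simp add: norm_minus_commute)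
  then have "\<bar>u\<bar> \<le> norm (\<gamma> (s + u) - \<gamma> s) + \<kappa>1 * u\<^sup>2" using gam_taylor[of s u] by (simp add: gam_speed)
  then show ?thesis using quad_small[OF assms] by linarith
qed

text \<open>The curve, rescaled by \<open>1 / \<zeta>\<close> and traversed in the direction \<open>\<sigma>\<close>, would be a pinched loop. Because of
  \<open>\<zeta> \<le> 2\<close> the rescaled curvature is at most \<open>K / 2\<close>.\<close>

lemma no_pinch:
  assumes \<sigma>: "\<sigma> = 1 \<or> \<sigma> = - 1"
    and T: "\<zeta> / K \<le> T" "\<zeta> / K \<le> l - T"
    and anti: "\<gamma>' (s + \<sigma> * T) = - \<gamma>' s" and orth: "(\<gamma> (s + \<sigma> * T) - \<gamma> s) \<bullet> \<gamma>' s = 0"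
    and close: "norm (\<gamma> (s + \<sigma> * T) - \<gamma> s) \<le> \<zeta> * a ^ 40"
    and J0: "\<And>t. 0 \<le> t \<Longrightarrow> t \<le> T \<Longrightarrow> norm (\<gamma> (s + \<sigma> * t) - \<gamma> s) < \<zeta>"
  shows False
proof -
  define g where "g t = (1/\<zeta>) *\<^sub>R \<gamma> (s + \<sigma> * \<zeta> * t)" for t
  define g' where "g' t = \<sigma> *\<^sub>R \<gamma>' (s + \<sigma> * \<zeta> * t)" for t
  have K: "2 \<le> K" "0 < K" by auto
  have gd: "norm (g t - g u) = norm (\<gamma> (s + \<sigma> * \<zeta> * t) - \<gamma> (s + \<sigma> * \<zeta> * u)) / \<zeta>" for t u
  proof -
    have "g t - g u = (1/\<zeta>) *\<^sub>R (\<gamma> (s + \<sigma> * \<zeta> * t) - \<gamma> (s + \<sigma> * \<zeta> * u))"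
      by (simp add: g_def scaleR_diff_right)
    then show ?thesis using zeta_pos by simp
  qed
  have gd1: "norm (g t - g u) < 1 \<longleftrightarrow> norm (\<gamma> (s + \<sigma> * \<zeta> * t) - \<gamma> (s + \<sigma> * \<zeta> * u)) < \<zeta>" for t u
    unfolding gd using zeta_pos by (simp add: divide_less_eq)
  have sT: "s + \<sigma> * \<zeta> * (T / \<zeta>) = s + \<sigma> * T" using zeta_pos by simp
  have ds: "\<gamma> (x + \<sigma> * l) = \<gamma> x" for x using \<sigma> per per_minus by auto
  have "pinched_loop g g' K (l / \<zeta>) (T / \<zeta>) a"
  proof
    show "(g has_vector_derivative g' t) (at t)" for t
    proof -
      have "((\<lambda>t. s + \<sigma> * \<zeta> * t) has_vector_derivative \<sigma> * \<zeta>) (at t)" by (auto intro!: derivative_eq_intros)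
      from vector_diff_chain_at[OF this gam_deriv]
      have "((\<lambda>t. \<gamma> (s + \<sigma> * \<zeta> * t)) has_vector_derivative (\<sigma> * \<zeta>) *\<^sub>R \<gamma>' (s + \<sigma> * \<zeta> * t)) (at t)"
        by (simp add: o_def)
      then have "((\<lambda>t. (1/\<zeta>) *\<^sub>R \<gamma> (s + \<sigma> * \<zeta> * t)) has_vector_derivative (1/\<zeta>) *\<^sub>R (\<sigma> * \<zeta>) *\<^sub>R \<gamma>' (s + \<sigma> * \<zeta> * t)) (at t)"
        by (rule bounded_linear.has_vector_derivative[OF bounded_linear_scaleR_right])
      then show ?thesis using zeta_pos by (simp add: g_def[abs_def] g'_def)
    qed
    show "norm (g' t) = 1" for t using \<sigma> by (auto simp: g'_def gam_speed)
    show "norm (g' u - g' t) \<le> K * \<bar>u - t\<bar>" for u t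
    proof -
      have "norm (g' u - g' t) = norm (\<gamma>' (s + \<sigma> * \<zeta> * u) - \<gamma>' (s + \<sigma> * \<zeta> * t))"
        using \<sigma> by (auto simp: g'_def norm_minus_commute)
      also have "\<dots> \<le> \<kappa>1 * \<bar>(s + \<sigma> * \<zeta> * u) - (s + \<sigma> * \<zeta> * t)\<bar>"
        by (rule order_trans[OF gam_lip mult_right_mono]) auto
      also have "(s + \<sigma> * \<zeta> * u) - (s + \<sigma> * \<zeta> * t) = \<sigma> * \<zeta> * (u - t)" by (simp add: algebra_simps)
      also have "\<bar>\<sigma> * \<zeta> * (u - t)\<bar> = \<zeta> * \<bar>u - t\<bar>" using \<sigma> zeta_pos by (auto simp: abs_mult)
      also have "\<kappa>1 * (\<zeta> * \<bar>u - t\<bar>) = (\<kappa>1 * \<zeta>) * \<bar>u - t\<bar>" by simp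
      also have "\<dots> \<le> K * \<bar>u - t\<bar>" by (rule mult_right_mono) (use kz K in linarith, simp)
      finally show ?thesis .
    qed
    show "g (t + l / \<zeta>) = g t" for t
    proof -
      have "s + \<sigma> * \<zeta> * (t + l / \<zeta>) = (s + \<sigma> * \<zeta> * t) + \<sigma> * l" using zeta_pos by (simp add: algebra_simps)
      then show ?thesis by (simp only: g_def ds)
    qed
    have mono: "x < y \<Longrightarrow> \<zeta> * x < \<zeta> * y" for x y using zeta_pos by simp
    show "g u \<noteq> g t" if ut: "u < t" "t < u + l / \<zeta>" for u t
    proof -
      have 1: "\<zeta> * u < \<zeta> * t" "\<zeta> * t < \<zeta> * u + l"
        using mono[OF ut(1)] mono[OF ut(2)] zeta_pos by (simp_all add: distrib_left)
      have "\<gamma> (s + \<sigma> * \<zeta> * u) \<noteq> \<gamma> (s + \<sigma> * \<zeta> * t)"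
        using \<sigma>
      proof
        assume "\<sigma> = 1"
        then show ?thesis using inj[of "s + \<zeta> * u" "s + \<zeta> * t"] 1 by simp
      next
        assume "\<sigma> = -1"
        then show ?thesis using inj[of "s - \<zeta> * t" "s - \<zeta> * u"] 1 by fastforce
      qed
      then show ?thesis using zeta_pos by (simp add: g_def)
    qed
    show "norm (g c - g x) < 1 \<or> norm (g d - g x) < 1"
      if o: "u < c" "c < v" "v < d" "d < u + l / \<zeta>" and n: "norm (g u - g x) < 1" "norm (g v - g x) < 1"
      for x u v c d
    proof -
      have 1: "\<zeta> * u < \<zeta> * c" "\<zeta> * c < \<zeta> * v" "\<zeta> * v < \<zeta> * d" "\<zeta> * d < \<zeta> * u + l"
        using o(1-3)[THEN mono] o(4)[THEN mono] zeta_pos by (simp_all add: distrib_left)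
      from \<sigma> show ?thesis unfolding gd1
      proof
        note n' = n[unfolded gd1]
        assume s1: "\<sigma> = 1"
        show "norm (\<gamma> (s + \<sigma> * \<zeta> * c) - \<gamma> (s + \<sigma> * \<zeta> * x)) < \<zeta> \<or> norm (\<gamma> (s + \<sigma> * \<zeta> * d) - \<gamma> (s + \<sigma> * \<zeta> * x)) < \<zeta>"
          by (rule ball_contains_arc[OF _ _ _ _ n']) (use 1 s1 in auto)
      next
        note n' = n[unfolded gd1]
        assume s1: "\<sigma> = -1"
        have "norm (\<gamma> (s + \<sigma> * \<zeta> * c) - \<gamma> (s + \<sigma> * \<zeta> * x)) < \<zeta> \<or> norm (\<gamma> (s + \<sigma> * \<zeta> * d + l) - \<gamma> (s + \<sigma> * \<zeta> * x)) < \<zeta>"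
          by (rule ball_contains_arc[OF _ _ _ _ n'(2,1)]) (use 1 s1 in auto)
        then show "norm (\<gamma> (s + \<sigma> * \<zeta> * c) - \<gamma> (s + \<sigma> * \<zeta> * x)) < \<zeta> \<or> norm (\<gamma> (s + \<sigma> * \<zeta> * d) - \<gamma> (s + \<sigma> * \<zeta> * x)) < \<zeta>"
          unfolding per .
      qed
    qed
    show "\<exists>y. norm (g y - g x) \<ge> 1" for x
    proof -
      obtain t where t: "norm (\<gamma> t - \<gamma> (s + \<sigma> * \<zeta> * x)) \<ge> \<zeta>" using leaves_ball by blast
      have "s + \<sigma> * \<zeta> * (\<sigma> * (t - s) / \<zeta>) = t" using zeta_pos \<sigma> by auto
      then have "\<not> norm (g (\<sigma> * (t - s) / \<zeta>) - g x) < 1" using t unfolding gd1 by simp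
      then show ?thesis by (meson not_le)
    qed
    show "0 < a" using K by simp
    show "a \<le> 1/64" using K by (simp add: field_simps)
    show "K * a = 1/64" using K by simp
    have a64: "64 * a = (\<zeta> / K) / \<zeta>" using zeta_pos K by (simp add: field_simps)
    show "64 * a \<le> T / \<zeta>" unfolding a64 using T(1) zeta_pos by (intro divide_right_mono) auto
    have "l / \<zeta> - T / \<zeta> = (l - T) / \<zeta>" by (simp add: diff_divide_distrib)
    then show "64 * a \<le> l / \<zeta> - T / \<zeta>" unfolding a64 using T(2) zeta_pos by (metis divide_right_mono less_imp_le)
    show "g' (T / \<zeta>) = - g' 0" unfolding g'_def sT anti by simp
    have "g (T / \<zeta>) - g 0 = (1/\<zeta>) *\<^sub>R (\<gamma> (s + \<sigma> * T) - \<gamma> s)"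
      unfolding g_def sT by (simp add: scaleR_diff_right)
    then show "(g (T / \<zeta>) - g 0) \<bullet> g' 0 = 0" using orth by (simp add: g'_def)
    show "norm (g (T / \<zeta>) - g 0) \<le> a ^ 40"
      unfolding gd sT using close zeta_pos by (simp add: divide_le_eq mult.commute)
    show "norm (g t - g 0) < 1" if "0 \<le> t" "t \<le> T / \<zeta>" for t
    proof -
      have "0 \<le> \<zeta> * t" "\<zeta> * t \<le> T" using that zeta_pos by (simp_all add: field_simps)
      from J0[OF this] show ?thesis unfolding gd1 by (simp add: mult.assoc)
    qed
  qed (auto simp: max_def)
  then show False by (rule pinched_loop.pinch_impossible)
qed


text \<open>Two boundary points that are close in the plane but not along the curve: a closest such pair
  spans a chord perpendicular to the curve at both ends, with the domain on matching sides, so the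
  tangents are opposite and the curve would be pinched.\<close>

lemma min_pair_false:
  assumes u: "\<zeta> / K \<le> u" "u \<le> l - \<zeta> / K"
    and close: "norm (\<gamma> (s + u) - \<gamma> s) \<le> \<zeta> * a ^ 40"
    and min: "\<And>s' u'. \<zeta> / K \<le> u' \<Longrightarrow> u' \<le> l - \<zeta> / K \<Longrightarrow> norm (\<gamma> (s + u) - \<gamma> s) \<le> norm (\<gamma> (s' + u') - \<gamma> s')"
  shows False
proof -
  define p where "p = \<gamma> s" define q where "q = \<gamma> (s + u)"
  define \<epsilon> where "\<epsilon> = norm (q - p)"
  have zK: "0 < \<zeta> / K" using zeta_pos by simp
  have e0: "0 < \<epsilon>" using inj[of s "s + u"] u zK by (simp add: \<epsilon>_def p_def q_def)
  have a1: "0 < a" "a \<le> 1" by (auto simp: divide_le_eq)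
  have a40: "a ^ 40 \<le> a" using power_decreasing[of 1 40 a] a1 by simp
  have ez0: "\<epsilon> \<le> \<zeta> * a"
    using close mult_left_mono[OF a40, of \<zeta>] zeta_pos by (simp add: \<epsilon>_def p_def q_def)
  define z where "z = \<zeta> / K"
  have za: "\<zeta> * a = (\<zeta> / K) / 64" by simp
  have ez: "\<epsilon> < (\<zeta> / K) / 2" using ez0 zK unfolding za z_def[symmetric] by linarith
  have "\<zeta> / K \<le> \<zeta>" using zeta_pos by (simp add: divide_le_eq)
  then have e_less: "\<epsilon> < \<zeta>" using ez zK unfolding z_def[symmetric] by linarith
  \<comment> \<open>At the ends of the range for \<open>u\<close> the curve is still almost straight, so the distance is not small.\<close>
  have strict: "\<zeta> / K < u" "u < l - \<zeta> / K"
  proof -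
    have "u \<noteq> z"
    proof
      assume "u = z"
      then have "\<bar>u\<bar> \<le> \<zeta> / K" "\<bar>u\<bar> = z" using zK unfolding z_def by linarith+
      from local_dist[OF this(1), of s] this(2) show False
        using ez unfolding \<epsilon>_def p_def q_def z_def[symmetric] by linarith
    qed
    moreover have "u \<noteq> l - \<zeta> / K"
    proof
      assume ul: "u = l - \<zeta> / K"
      have "\<gamma> (s + u) = \<gamma> (s + - (\<zeta> / K))" using per[of "s - \<zeta> / K"] by (simp add: ul algebra_simps)
      then have "norm (q - p) \<ge> \<bar>- (\<zeta> / K)\<bar> / 2" using local_dist[of "- (\<zeta> / K)" s] zK unfolding p_def q_def by simp
      then show False using ez zK unfolding \<epsilon>_def by linarith
    qed
    ultimately show "\<zeta> / K < u" "u < l - \<zeta> / K" using u unfolding z_def[symmetric] by linarith+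
  qed
  define \<eta> where "\<eta> = min (u - \<zeta> / K) (l - \<zeta> / K - u)"
  have eta: "0 < \<eta>" using strict by (auto simp: \<eta>_def)
  have lmin: "\<epsilon> \<le> norm (\<gamma> y - \<gamma> x)" if "\<zeta> / K \<le> y - x" "y - x \<le> l - \<zeta> / K" for x y
    using min[of "y - x" x] that by (simp add: \<epsilon>_def p_def q_def)
  \<comment> \<open>First order condition at an interior minimum of the distance, used at both ends of the chord.\<close>
  have crit: "(\<gamma> t - z) \<bullet> \<gamma>' t = 0" if m: "\<And>x. \<bar>t - x\<bar> < \<eta> \<Longrightarrow> norm (\<gamma> t - z) \<le> norm (\<gamma> x - z)" for t z
  proof -
    have D: "((\<lambda>x. \<gamma> x - z) has_derivative (\<lambda>h. h *\<^sub>R \<gamma>' t)) (at t)"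
      using gam_deriv[of t] unfolding has_vector_derivative_def by (auto intro!: derivative_eq_intros)
    have d: "((\<lambda>x. (\<gamma> x - z) \<bullet> (\<gamma> x - z)) has_real_derivative 2 * ((\<gamma> t - z) \<bullet> \<gamma>' t)) (at t)"
      unfolding has_field_derivative_def
      by (rule has_derivative_eq_rhs[OF has_derivative_inner[OF D D]]) (auto simp: inner_commute fun_eq_iff)
    have "2 * ((\<gamma> t - z) \<bullet> \<gamma>' t) = 0"
    proof (rule DERIV_local_min[OF d eta], intro allI impI)
      fix x assume "\<bar>t - x\<bar> < \<eta>"
      from power_mono[OF m[OF this], of 2]
      show "(\<gamma> t - z) \<bullet> (\<gamma> t - z) \<le> (\<gamma> x - z) \<bullet> (\<gamma> x - z)" by (simp add: power2_norm_eq_inner)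
    qed
    then show ?thesis by simp
  qed
  have perp_p: "(q - p) \<bullet> \<gamma>' s = 0"
  proof -
    have "(\<gamma> s - q) \<bullet> \<gamma>' s = 0"
    proof (rule crit)
      fix x assume "\<bar>s - x\<bar> < \<eta>"
      then have "\<epsilon> \<le> norm (\<gamma> (s + u) - \<gamma> x)" by (intro lmin) (auto simp: \<eta>_def)
      then show "norm (\<gamma> s - q) \<le> norm (\<gamma> x - q)" by (simp add: \<epsilon>_def p_def q_def norm_minus_commute)
    qed
    then show ?thesis by (simp add: p_def inner_diff_left)
  qed
  have perp_q: "(q - p) \<bullet> \<gamma>' (s + u) = 0"
    unfolding q_def
  proof (rule crit)
    fix x assume "\<bar>s + u - x\<bar> < \<eta>"
    then have "\<epsilon> \<le> norm (\<gamma> x - \<gamma> s)" by (intro lmin) (auto simp: \<eta>_def)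
    then show "norm (\<gamma> (s + u) - p) \<le> norm (\<gamma> x - p)" by (simp add: \<epsilon>_def p_def q_def)
  qed
  \<comment> \<open>By minimality a boundary point on the chord would be close to \<open>p\<close> along the curve, but a short piece of
    the curve does not return to the normal at \<open>p\<close>.\<close>
  have chord: "p + \<tau> *\<^sub>R (q - p) \<notin> frontier \<Omega>" if \<tau>: "0 < \<tau>" "\<tau> < 1" for \<tau>
  proof
    assume f: "p + \<tau> *\<^sub>R (q - p) \<in> frontier \<Omega>"
    have nrm: "norm ((p + \<tau> *\<^sub>R (q - p)) - p) = \<tau> * \<epsilon>" using \<tau> by (simp add: \<epsilon>_def)
    have lt: "\<tau> * \<epsilon> < \<epsilon>" using \<tau> e0 by simp
    then have "dist p (p + \<tau> *\<^sub>R (q - p)) < \<zeta>" using nrm e_less by (simp add: dist_norm norm_minus_commute)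
    then have "p + \<tau> *\<^sub>R (q - p) \<in> range \<gamma>" using f ball_in_range[of s] unfolding p_def by auto
    then obtain t where "p + \<tau> *\<^sub>R (q - p) = \<gamma> t" by blast
    then obtain t where t: "s - \<zeta> / K \<le> t" "t < s - \<zeta> / K + l" "p + \<tau> *\<^sub>R (q - p) = \<gamma> t" using reduce[of "s - \<zeta> / K" t] by metis
    have "t - s < \<zeta> / K"
    proof (rule ccontr)
      assume "\<not> ?thesis"
      then have "\<epsilon> \<le> norm (\<gamma> t - \<gamma> s)" using t by (intro lmin) auto
      moreover have "norm (\<gamma> t - \<gamma> s) = \<tau> * \<epsilon>" using nrm[unfolded t(3)] unfolding p_def .
      ultimately show False using lt by linarith
    qed
    then have sm: "\<bar>t - s\<bar> \<le> \<zeta> / K" using t by linarith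
    have "norm (\<gamma> (s + (t - s)) - \<gamma> s - (t - s) *\<^sub>R \<gamma>' s) \<le> \<bar>t - s\<bar> / 2"
      using gam_taylor[of s "t - s"] quad_small[OF sm] by linarith
    moreover have "\<gamma> (s + (t - s)) - \<gamma> s = \<tau> *\<^sub>R (q - p)" using t(3)[symmetric] by (simp add: p_def)
    ultimately have n: "norm (\<tau> *\<^sub>R (q - p) - (t - s) *\<^sub>R \<gamma>' s) \<le> \<bar>t - s\<bar> / 2" by simp
    have "\<bar>(\<tau> *\<^sub>R (q - p) - (t - s) *\<^sub>R \<gamma>' s) \<bullet> \<gamma>' s\<bar> \<le> \<bar>t - s\<bar> / 2"
      using Cauchy_Schwarz_ineq2[of "\<tau> *\<^sub>R (q - p) - (t - s) *\<^sub>R \<gamma>' s" "\<gamma>' s"] n by (simp add: gam_speed)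
    moreover have "\<gamma>' s \<bullet> \<gamma>' s = 1" using gam_speed[of s] by (simp add: norm_eq_1)
    ultimately have "\<bar>t - s\<bar> \<le> \<bar>t - s\<bar> / 2" using perp_p by (simp add: inner_diff_left abs_minus_commute)
    then have "\<bar>t - s\<bar> = 0" using abs_ge_zero[of "t - s"] by argo
    then have "t = s" by simp
    then have "\<tau> *\<^sub>R (q - p) = 0" using t(3) by (simp add: p_def)
    then show False using \<tau> e0 by (simp add: \<epsilon>_def)
  qed
  \<comment> \<open>The chord lies on one side of the boundary, which forces the two normals to be opposite.\<close>
  define S where "S = (\<lambda>\<tau>. p + \<tau> *\<^sub>R (q - p)) ` {0<..<1}"
  have "connected S" unfolding S_def by (intro connected_continuous_image continuous_intros) auto
  moreover have "S \<inter> frontier \<Omega> = {}" using chord by (auto simp: S_def)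
  ultimately have S: "S \<inter> \<Omega> = {} \<or> S - \<Omega> = {}" using connected_Int_frontier[of S \<Omega>] by blast
  define n where "n = (1/\<epsilon>) *\<^sub>R (q - p)"
  have nn: "norm n = 1" using e0 unfolding n_def by (simp add: \<epsilon>_def)
  have par: "v = n \<or> v = - n" if "norm w = 1" "(q - p) \<bullet> w = 0" "v = perp w" for v w
  proof -
    have "orthonormal_pair w n" using that(1,2) nn by (simp add: orthonormal_pair_def) (simp add: n_def inner_commute)
    then show ?thesis using orthonormal_perp that(3) by fastforce
  qed
  define v where "v = perp (\<gamma>' s)" define w where "w = perp (\<gamma>' (s + u))"
  have v: "v = n \<or> v = - n" using par[OF gam_speed perp_p] v_def by blast
  have w: "w = n \<or> w = - n" using par[OF gam_speed perp_q] w_def by blast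
  have in_S: "p + h *\<^sub>R n \<in> S" "q - h *\<^sub>R n \<in> S" if "0 < h" "h < \<epsilon>" for h
  proof -
    have "p + h *\<^sub>R n = p + (h / \<epsilon>) *\<^sub>R (q - p)" by (simp add: n_def)
    then show "p + h *\<^sub>R n \<in> S" unfolding S_def using that by (auto intro!: rev_image_eqI[of "h / \<epsilon>"])
    have "q - h *\<^sub>R n = p + (1 - h / \<epsilon>) *\<^sub>R (q - p)" by (simp add: n_def algebra_simps)
    then show "q - h *\<^sub>R n \<in> S" unfolding S_def using that by (auto intro!: rev_image_eqI[of "1 - h / \<epsilon>"])
  qed
  have "w = - v"
  proof -
    have "\<forall>\<^sub>F h in at_right 0. 0 < h \<and> h < \<epsilon>"
      using e0 by (auto simp: eventually_at_right intro!: exI[of _ \<epsilon>])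
    with gam_side[of s] gam_side[of "s + u"]
    have "\<forall>\<^sub>F h in at_right 0. (0 < h \<and> h < \<epsilon>) \<and> (p + h *\<^sub>R v \<in> \<Omega> \<and> p - h *\<^sub>R v \<notin> \<Omega>) \<and> (q + h *\<^sub>R w \<in> \<Omega> \<and> q - h *\<^sub>R w \<notin> \<Omega>)"
      unfolding p_def q_def v_def w_def by eventually_elim blast
    then obtain h where h: "0 < h" "h < \<epsilon>" "p + h *\<^sub>R v \<in> \<Omega>" "p - h *\<^sub>R v \<notin> \<Omega>" "q + h *\<^sub>R w \<in> \<Omega>" "q - h *\<^sub>R w \<notin> \<Omega>"
      using eventually_happens'[OF trivial_limit_at_right_real] by blast
    note m = in_S[OF h(1,2)]
    from v w show ?thesis
    proof (elim disjE)
      assume vw: "v = n" "w = n"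
      have "p + h *\<^sub>R n \<in> S \<inter> \<Omega>" "q - h *\<^sub>R n \<in> S - \<Omega>" using m h vw by auto
      then show ?thesis using S by blast
    next
      assume vw: "v = - n" "w = - n"
      have "p + h *\<^sub>R n \<in> S - \<Omega>" "q - h *\<^sub>R n \<in> S \<inter> \<Omega>" using m h vw by auto
      then show ?thesis using S by blast
    qed auto
  qed
  then have anti: "\<gamma>' (s + u) = - \<gamma>' s" by (simp add: v_def w_def perp_def prod_eq_iff)
  have close': "norm (\<gamma> (s + u) - \<gamma> s) \<le> \<zeta> * a ^ 40" by (rule close)
  have qp: "norm (\<gamma> (s + u) - \<gamma> s) < \<zeta>" using e_less by (simp add: \<epsilon>_def p_def q_def)
  \<comment> \<open>One of the two arcs between the points lies in the ball around the first one; the direction of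
    traversal is chosen accordingly.\<close>
  show False
  proof (cases "\<forall>t. 0 \<le> t \<longrightarrow> t \<le> u \<longrightarrow> norm (\<gamma> (s + t) - \<gamma> s) < \<zeta>")
    case True
    show False
      by (rule no_pinch[of 1 u s]) (use u anti perp_p close True in \<open>auto simp: p_def q_def\<close>)
  next
    case False
    then obtain t1 where t1: "0 \<le> t1" "t1 \<le> u" "\<not> norm (\<gamma> (s + t1) - \<gamma> s) < \<zeta>" by blast
    have t1': "0 < t1" "t1 < u"
    proof -
      have "t1 \<noteq> 0" using t1(3) zeta_pos by auto
      moreover have "t1 \<noteq> u" using t1(3) qp by auto
      ultimately show "0 < t1" "t1 < u" using t1 by linarith+
    qed
    have eq: "\<gamma> (s + (-1) * (l - u)) = \<gamma> (s + u)" using per_minus[of "s + u"] by (simp add: algebra_simps)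
    have J: "norm (\<gamma> (s + (-1) * t) - \<gamma> s) < \<zeta>" if t: "0 \<le> t" "t \<le> l - u" for t
    proof (cases "t = 0 \<or> t = l - u")
      case True then show ?thesis
      proof
        assume "t = l - u" then show ?thesis using qp eq by metis
      qed (use zeta_pos in simp)
    next
      case False
      then have "norm (\<gamma> (s + t1) - \<gamma> s) < \<zeta> \<or> norm (\<gamma> (s + l - t) - \<gamma> s) < \<zeta>"
        by (intro ball_contains_arc[of s "s + t1" "s + u" "s + l - t" s]) (use t t1' qp zeta_pos in auto)
      then show ?thesis using t1(3) per[of "s - t"] by (simp add: algebra_simps)
    qed
    have anti': "\<gamma>' (s + (-1) * (l - u)) = - \<gamma>' s"
    proof -
      have "\<gamma>' (s + u - l) = \<gamma>' (s + u)"
      proof -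
        have "((\<lambda>t. \<gamma> (t + l)) has_vector_derivative \<gamma>' (s + u - l + l)) (at (s + u - l))"
          by (rule has_vector_derivative_shift) (rule gam_deriv)
        then have "(\<gamma> has_vector_derivative \<gamma>' (s + u)) (at (s + u - l))" unfolding per by simp
        then show ?thesis using gam_deriv vector_derivative_unique_at by blast
      qed
      then show ?thesis using anti by (simp add: algebra_simps)
    qed
    show False
      by (rule no_pinch[of "-1" "l - u" s])
        (use u anti' perp_p close J eq in \<open>auto simp: p_def q_def\<close>)
  qed
qed

text \<open>The minimum over all pairs exists by compactness and periodicity.\<close>

lemma nonlocal_far:
  assumes u: "\<zeta> / K \<le> u" "u \<le> l - \<zeta> / K"
  shows "\<zeta> * a ^ 40 < norm (\<gamma> (s + u) - \<gamma> s)"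
proof (rule ccontr)
  assume n: "\<not> ?thesis"
  let ?S = "{0..l} \<times> {\<zeta> / K..l - \<zeta> / K}" and ?\<phi> = "\<lambda>x. norm (\<gamma> (fst x + snd x) - \<gamma> (fst x))"
  have "compact ?S" by (intro compact_Times) auto
  moreover have "?S \<noteq> {}" using u l_pos by auto
  moreover have "continuous_on ?S ?\<phi>"
    by (intro continuous_intros continuous_on_compose2[OF gam_cont[of UNIV]]) auto
  ultimately have "\<exists>x\<in>?S. \<forall>y\<in>?S. ?\<phi> x \<le> ?\<phi> y" by (rule continuous_attains_inf)
  then obtain x where x: "x \<in> ?S" "\<And>y. y \<in> ?S \<Longrightarrow> ?\<phi> x \<le> ?\<phi> y" by blast
  have min: "?\<phi> x \<le> norm (\<gamma> (s' + u') - \<gamma> s')" if "\<zeta> / K \<le> u'" "u' \<le> l - \<zeta> / K" for s' u'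
  proof -
    define k where "k = \<lfloor>s' / l\<rfloor>"
    have "of_int k \<le> s' / l" "s' / l < of_int k + 1" unfolding k_def by linarith+
    then have "of_int k * l \<le> s'" "s' < (of_int k + 1) * l" using l_pos by (simp_all add: field_simps)
    then have "0 \<le> s' + of_int (-k) * l" "s' + of_int (-k) * l \<le> l" by (simp_all add: algebra_simps)
    then have "(s' + of_int (-k) * l, u') \<in> ?S" using that by simp
    from x(2)[OF this] have "?\<phi> x \<le> norm (\<gamma> ((s' + of_int (-k) * l) + u') - \<gamma> (s' + of_int (-k) * l))" by simp
    moreover have "(s' + of_int (-k) * l) + u' = (s' + u') + of_int (-k) * l" by simp
    ultimately show ?thesis by (simp only: per_int)
  qed
  show False
  proof (rule min_pair_false[of "snd x" "fst x"])
    show "?\<phi> x \<le> \<zeta> * a ^ 40" using min[OF u, of s] n by linarith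
  qed (use x(1) min in \<open>auto simp: mem_Times_iff\<close>)
qed

text \<open>A boundary point in the ball of radius \<open>\<zeta>\<close> lies on the same curve, and \<open>nonlocal_far\<close> leaves only
  parameters near \<open>s\<close>.\<close>

lemma near_parameter:
  assumes q: "q \<in> frontier \<Omega>" and d: "norm (q - \<gamma> s) \<le> \<zeta> * a ^ 40"
  shows "\<exists>t. q = \<gamma> t \<and> \<bar>t - s\<bar> \<le> 2 * norm (q - \<gamma> s)"
proof -
  have a1: "0 < a" "a < 1" by (auto simp: divide_less_eq)
  have "a ^ 40 < 1" using a1 by (intro power_less_one_iff[THEN iffD2]) auto
  then have "\<zeta> * a ^ 40 < \<zeta>" using zeta_pos by simp
  then have "q \<in> frontier \<Omega> \<inter> ball (\<gamma> s) \<zeta>" using q d by (simp add: dist_norm norm_minus_commute)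
  then obtain t where "q = \<gamma> t" using ball_in_range by blast
  then obtain t where t: "s - \<zeta> / K \<le> t" "t < s - \<zeta> / K + l" "q = \<gamma> t" using reduce[of "s - \<zeta> / K" t] by metis
  have "t - s < \<zeta> / K"
  proof (rule ccontr)
    assume "\<not> ?thesis"
    then show False using nonlocal_far[of "t - s" s] t d by simp
  qed
  then have "\<bar>t - s\<bar> \<le> \<zeta> / K" using t by linarith
  from local_dist[OF this, of s] show ?thesis using t(3) by (intro exI[of _ t]) simp
qed

end



section \<open>Second order contact with tangents\<close>

text \<open>Over a small set the boundary is, in one of the two coordinate directions, a graph of slope
  at most \<open>2\<close> that its tangents approximate to second order.\<close>

definition tangent_bound :: "point set \<Rightarrow> real \<Rightarrow> bool" where
  "tangent_bound S c \<longleftrightarrow> (\<forall>p\<in>S. \<exists>m. \<bar>m\<bar> \<le> 2 \<and> (\<forall>q\<in>S. \<bar>snd q - snd p - m * (fst q - fst p)\<bar> \<le> c * (fst q - fst p)\<^sup>2))"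

lemma abs_fst_snd_le: "\<bar>fst (z::point)\<bar> \<le> norm z" "\<bar>snd z\<bar> \<le> norm z"
  using norm_fst_le[of "fst z" "snd z"] norm_snd_le[of "snd z" "fst z"] by simp_all

context smooth_domain
begin

text \<open>All points of the set lie on one short piece of one boundary curve, along which the tangent hardly
  turns. The direction for the graph is the one in which the tangent has the larger component.\<close>

lemma local_tangent_bound:
  assumes z: "0 < \<zeta>" and sep: "\<And>x. x \<in> frontier \<Omega> \<Longrightarrow> (frontier \<Omega> \<inter> ball x \<zeta>) homeomorphic {0<..<1::real}"
    and w: "\<omega> \<le> \<zeta>" and r: "r \<le> \<omega> * (1 / (256 * max 1 \<kappa>)) ^ 40" "r \<le> 1 / (64 * max 1 \<kappa>)"
    and B: "\<And>p q. p \<in> B \<Longrightarrow> q \<in> B \<Longrightarrow> norm (q - p) \<le> r"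
  shows "tangent_bound (frontier \<Omega> \<inter> B) (27 * max 1 \<kappa>) \<or>
         tangent_bound (prod.swap ` (frontier \<Omega> \<inter> B)) (27 * max 1 \<kappa>)"
proof (cases "frontier \<Omega> \<inter> B = {}")
  case True
  then show ?thesis by (simp add: tangent_bound_def)
next
  case False
  then obtain p0 where p0: "p0 \<in> frontier \<Omega>" "p0 \<in> B" by blast
  obtain \<delta> where d: "uniform_domain \<Omega> \<kappa> \<delta>"
  proof -
    have "\<exists>\<delta>. uniform_domain_axioms \<Omega> \<kappa> \<delta>"
      using uniform_charts unfolding uniform_domain_axioms_def Ball_def .
    then show ?thesis using smooth_domain_axioms that uniform_domain.intro by blast
  qed
  obtain \<gamma> \<gamma>' where g: "boundary_arc \<Omega> \<kappa> UNIV \<gamma> \<gamma>'" "\<gamma> 0 = p0"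
    using uniform_domain.global_arc[OF d p0(1)] by blast
  have bc: "boundary_curve \<Omega> \<kappa> \<delta> \<gamma> \<gamma>'"
    using d g(1) by (simp add: boundary_curve_def boundary_curve_axioms_def)
  obtain l where l: "0 < l" "\<And>t. \<gamma> (t + l) = \<gamma> t" "\<And>s t. s < t \<Longrightarrow> t < s + l \<Longrightarrow> \<gamma> s \<noteq> \<gamma> t"
    using boundary_curve.gam_period[OF bc] by blast
  interpret separated_curve \<Omega> \<kappa> \<delta> \<gamma> \<gamma>' l \<zeta>
    using bc l z sep by (simp add: separated_curve_def separated_curve_axioms_def)
  let ?k = "max 1 \<kappa>"
  have k1: "1 \<le> ?k" by simp
  define P where "P = (1 / (256 * ?k)) ^ 40"
  have "0 \<le> P" by (simp add: P_def)
  then have r1: "r \<le> \<zeta> * (1 / (64 * (4 * ?k))) ^ 40"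
    using r(1) mult_right_mono[OF w, of P] by (simp add: P_def)
  have r0: "0 \<le> r" using B[OF p0(2) p0(2)] by simp
  have par: "\<exists>t. q = \<gamma> t \<and> \<bar>t - s\<bar> \<le> 2 * norm (q - \<gamma> s)" if "q \<in> frontier \<Omega> \<inter> B" "\<gamma> s \<in> B" for q s
    using near_parameter[of q s] B[of "\<gamma> s" q] that r1 by force
  have kr: "?k * r \<le> 1 / 64" using mult_left_mono[OF r(2), of ?k] by simp
  have tan: "\<bar>fst (\<gamma>' s) - fst (\<gamma>' 0)\<bar> \<le> 1/16 \<and> \<bar>snd (\<gamma>' s) - snd (\<gamma>' 0)\<bar> \<le> 1/16" if s: "\<bar>s\<bar> \<le> 2 * r" for s
  proof -
    have "norm (\<gamma>' s - \<gamma>' 0) \<le> \<kappa> * \<bar>s\<bar>" using gam_lip[of s 0] by simp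
    also have "\<dots> \<le> ?k * (2 * r)" using s kappa_pos by (intro mult_mono) auto
    finally have n: "norm (\<gamma>' s - \<gamma>' 0) \<le> 1/16" using kr by linarith
    have "\<bar>fst (\<gamma>' s - \<gamma>' 0)\<bar> \<le> norm (\<gamma>' s - \<gamma>' 0)" "\<bar>snd (\<gamma>' s - \<gamma>' 0)\<bar> \<le> norm (\<gamma>' s - \<gamma>' 0)"
      by (rule abs_fst_snd_le)+
    then show ?thesis using n by simp
  qed
  have tay: "\<bar>fst (\<gamma> t) - fst (\<gamma> s) - (t - s) * fst (\<gamma>' s)\<bar> \<le> ?k * (t - s)\<^sup>2 \<and>
     \<bar>snd (\<gamma> t) - snd (\<gamma> s) - (t - s) * snd (\<gamma>' s)\<bar> \<le> ?k * (t - s)\<^sup>2" for s t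
  proof -
    let ?R = "\<gamma> (s + (t - s)) - \<gamma> s - (t - s) *\<^sub>R \<gamma>' s"
    have "\<bar>fst ?R\<bar> \<le> norm ?R" "\<bar>snd ?R\<bar> \<le> norm ?R"
      by (rule abs_fst_snd_le)+
    then show ?thesis using gam_taylor[of s "t - s"] by simp
  qed
  \<comment> \<open>One coordinate at a time, so that both directions are covered.\<close>
  have core: "\<exists>m. \<bar>m\<bar> \<le> 2 \<and> (\<forall>q\<in>frontier \<Omega> \<inter> B. \<bar>Y q - Y p - m * (X q - X p)\<bar> \<le> 27 * ?k * (X q - X p)\<^sup>2)"
    if p: "p \<in> frontier \<Omega> \<inter> B" and XY: "\<bar>Y (\<gamma>' 0)\<bar> \<le> \<bar>X (\<gamma>' 0)\<bar>"
      and one: "(X (\<gamma>' 0))\<^sup>2 + (Y (\<gamma>' 0))\<^sup>2 = 1"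
      and tan: "\<And>s. \<bar>s\<bar> \<le> 2 * r \<Longrightarrow> \<bar>X (\<gamma>' s) - X (\<gamma>' 0)\<bar> \<le> 1/16 \<and> \<bar>Y (\<gamma>' s) - Y (\<gamma>' 0)\<bar> \<le> 1/16"
      and tay: "\<And>s t. \<bar>X (\<gamma> t) - X (\<gamma> s) - (t - s) * X (\<gamma>' s)\<bar> \<le> ?k * (t - s)\<^sup>2 \<and>
     \<bar>Y (\<gamma> t) - Y (\<gamma> s) - (t - s) * Y (\<gamma>' s)\<bar> \<le> ?k * (t - s)\<^sup>2" for p and X Y :: "point \<Rightarrow> real"
  proof -
    obtain s where s: "p = \<gamma> s" "\<bar>s - 0\<bar> \<le> 2 * norm (p - \<gamma> 0)" using par[OF p, of 0] p0 g(2) by blast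
    have "norm (p - \<gamma> 0) \<le> r" using B[OF p0(2)] p g(2) by simp
    then have s2: "\<bar>s\<bar> \<le> 2 * r" using s(2) by linarith
    have X0: "\<bar>X (\<gamma>' 0)\<bar> \<ge> 2/3" "\<bar>Y (\<gamma>' 0)\<bar> \<le> 3/4"
    proof -
      have sq: "(Y (\<gamma>' 0))\<^sup>2 \<le> (X (\<gamma>' 0))\<^sup>2" using XY by (simp add: abs_le_square_iff)
      have "(2/3)\<^sup>2 \<le> (X (\<gamma>' 0))\<^sup>2" using sq one unfolding power2_eq_square by linarith
      then show "\<bar>X (\<gamma>' 0)\<bar> \<ge> 2/3" using abs_le_square_iff[of "2/3" "X (\<gamma>' 0)"] by simp
      have "(Y (\<gamma>' 0))\<^sup>2 \<le> (3/4)\<^sup>2" using sq one unfolding power2_eq_square by linarith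
      then show "\<bar>Y (\<gamma>' 0)\<bar> \<le> 3/4" using abs_le_square_iff[of "Y (\<gamma>' 0)" "3/4"] by simp
    qed
    define x where "x = X (\<gamma>' s)" define y where "y = Y (\<gamma>' s)"
    have xy: "\<bar>x\<bar> \<ge> 3/5" "\<bar>y\<bar> \<le> 7/8" using tan[OF s2] X0 unfolding x_def y_def by linarith+
    define m where "m = y / x"
    have m: "\<bar>m\<bar> \<le> 2" "m * x = y"
    proof -
      have "\<bar>y\<bar> \<le> 2 * \<bar>x\<bar>" using xy by linarith
      then show "\<bar>m\<bar> \<le> 2" using xy by (simp add: m_def divide_le_eq abs_divide)
      show "m * x = y" using xy by (auto simp: m_def)
    qed
    have "\<bar>Y q - Y p - m * (X q - X p)\<bar> \<le> 27 * ?k * (X q - X p)\<^sup>2" if q: "q \<in> frontier \<Omega> \<inter> B" for q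
    proof -
      obtain t where t: "q = \<gamma> t" "\<bar>t - s\<bar> \<le> 2 * norm (q - \<gamma> s)" using par[OF q, of s] p s(1) by blast
      have "norm (q - \<gamma> s) \<le> r" using B[of p q] p q s(1) by simp
      then have ts: "\<bar>t - s\<bar> \<le> 2 * r" using t(2) by linarith
      define D where "D = ?k * (t - s)\<^sup>2"
      have D: "D \<le> \<bar>t - s\<bar> / 32"
      proof -
        have "?k * \<bar>t - s\<bar> \<le> ?k * (2 * r)" using ts by (intro mult_left_mono) auto
        then have "?k * \<bar>t - s\<bar> \<le> 1/32" using kr by linarith
        from mult_right_mono[OF this, of "\<bar>t - s\<bar>"] show ?thesis by (simp add: D_def power2_eq_square)
      qed
      define R1 where "R1 = X q - X p - (t - s) * x" define R2 where "R2 = Y q - Y p - (t - s) * y"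
      have R: "\<bar>R1\<bar> \<le> D" "\<bar>R2\<bar> \<le> D" using tay[of t s] by (simp_all add: R1_def R2_def D_def t(1) s(1) x_def y_def)
      have "Y q - Y p - m * (X q - X p) = R2 - m * R1"
        unfolding R1_def R2_def m(2)[symmetric] by (simp add: algebra_simps)
      moreover have "\<bar>m * R1\<bar> \<le> 2 * D"
        unfolding abs_mult using m R by (intro mult_mono) auto
      ultimately have 1: "\<bar>Y q - Y p - m * (X q - X p)\<bar> \<le> 3 * D" using R by linarith
      have "3/5 * \<bar>t - s\<bar> \<le> \<bar>x\<bar> * \<bar>t - s\<bar>" using xy(1) by (intro mult_right_mono) auto
      also have "\<dots> = \<bar>(t - s) * x\<bar>" by (simp add: abs_mult)
      also have "(t - s) * x = (X q - X p) - R1" by (simp add: R1_def)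
      also have "\<bar>X q - X p - R1\<bar> \<le> \<bar>X q - X p\<bar> + \<bar>R1\<bar>" by (rule abs_triangle_ineq4)
      finally have "\<bar>t - s\<bar> \<le> 3 * \<bar>X q - X p\<bar>" using R(1) D abs_ge_zero[of "t - s"] by argo
      then have "\<bar>t - s\<bar>\<^sup>2 \<le> (3 * \<bar>X q - X p\<bar>)\<^sup>2" by (rule power_mono) simp
      then have "(t - s)\<^sup>2 \<le> 9 * (X q - X p)\<^sup>2" unfolding power_mult_distrib power2_abs by simp
      then have "?k * (t - s)\<^sup>2 \<le> ?k * (9 * (X q - X p)\<^sup>2)" by (intro mult_left_mono) auto
      then show ?thesis using 1 unfolding D_def by linarith
    qed
    then show ?thesis using m(1) by blast
  qed
  have one: "(fst (\<gamma>' 0))\<^sup>2 + (snd (\<gamma>' 0))\<^sup>2 = 1"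
    using gam_speed[of 0] by (simp add: norm_prod_def)
  show ?thesis
  proof (cases "\<bar>snd (\<gamma>' 0)\<bar> \<le> \<bar>fst (\<gamma>' 0)\<bar>")
    case True
    have "tangent_bound (frontier \<Omega> \<inter> B) (27 * ?k)"
      unfolding tangent_bound_def by (intro ballI core[of _ snd fst]) (use True one tan tay in auto)
    then show ?thesis ..
  next
    case False
    have "\<exists>m. \<bar>m\<bar> \<le> 2 \<and> (\<forall>q\<in>frontier \<Omega> \<inter> B. \<bar>fst q - fst p - m * (snd q - snd p)\<bar> \<le> 27 * ?k * (snd q - snd p)\<^sup>2)"
      if "p \<in> frontier \<Omega> \<inter> B" for p
      by (rule core[OF that, of fst snd]) (use False one tan tay in auto)
    then have "tangent_bound (prod.swap ` (frontier \<Omega> \<inter> B)) (27 * ?k)"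
      unfolding tangent_bound_def by auto
    then show ?thesis ..
  qed
qed

end



section \<open>Cells and their splits\<close>

text \<open>Twice the signed area of the triangle \<open>a\<close>, \<open>b\<close>, \<open>c\<close>; positive if \<open>c\<close> lies to the left of the line from
  \<open>a\<close> to \<open>b\<close>.\<close>

definition cr :: "point \<Rightarrow> point \<Rightarrow> point \<Rightarrow> real" where
  "cr a b c = (fst b - fst a) * (snd c - snd a) - (snd b - snd a) * (fst c - fst a)"

lemma cr_cyc: "cr b c a = cr a b c" "cr c a b = cr a b c"
  by (simp_all add: cr_def algebra_simps)

lemma cr_anti: "cr b a c = - cr a b c"
  by (simp add: cr_def algebra_simps)

lemma cr_same [simp]: "cr a a b = 0" "cr a b a = 0" "cr b a a = 0"
  by (simp_all add: cr_def)

lemma cr_midpoint: "cr (midpoint p q) b c = (cr p b c + cr q b c) / 2"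
  "cr a (midpoint p q) c = (cr a p c + cr a q c) / 2" "cr a b (midpoint p q) = (cr a b p + cr a b q) / 2"
  by (simp_all add: cr_def midpoint_def field_simps)

lemma cr_eq_inner: "cr a b z = (- (snd b - snd a), fst b - fst a) \<bullet> z - (- (snd b - snd a), fst b - fst a) \<bullet> a"
  by (simp add: cr_def inner_prod_def algebra_simps)

lemma convex_cr: "convex {z. 0 \<le> cr a b z}"
proof -
  let ?v = "(- (snd b - snd a), fst b - fst a)"
  have "{z. 0 \<le> cr a b z} = {z. ?v \<bullet> z \<ge> ?v \<bullet> a}" unfolding cr_eq_inner by auto
  then show ?thesis by (simp only: convex_halfspace_ge)
qed

text \<open>Strictly convex position, in counterclockwise order. In this case the convex hull is the
  intersection \<open>region\<close> of the half planes to the left of the edges (\<open>hull_region\<close>), which reduces covering and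
  separation properties of splits to signs of \<open>cr\<close>.\<close>

fun convex_cell :: "cell \<Rightarrow> bool" where
  "convex_cell [a, b, c] \<longleftrightarrow> cr a b c > 0"
| "convex_cell [a, b, c, d] \<longleftrightarrow> cr a b c > 0 \<and> cr b c d > 0 \<and> cr c d a > 0 \<and> cr d a b > 0"
| "convex_cell _ \<longleftrightarrow> False"

fun region :: "cell \<Rightarrow> point set" where
  "region [a, b, c] = {z. cr a b z \<ge> 0 \<and> cr b c z \<ge> 0 \<and> cr c a z \<ge> 0}"
| "region [a, b, c, d] = {z. cr a b z \<ge> 0 \<and> cr b c z \<ge> 0 \<and> cr c d z \<ge> 0 \<and> cr d a z \<ge> 0}"
| "region _ = {}"

lemma triangle_region: assumes "cr a b c > 0" shows "region [a, b, c] \<subseteq> convex hull {a, b, c}"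
proof
  fix z assume "z \<in> region [a, b, c]"
  then have z: "cr a b z \<ge> 0" "cr b c z \<ge> 0" "cr c a z \<ge> 0" by auto
  define D where "D = cr a b c"
  have D: "D > 0" using assms by (simp add: D_def)
  have sum: "cr b c z + cr c a z + cr a b z = D" by (simp add: D_def cr_def algebra_simps)
  have "D *\<^sub>R z = cr b c z *\<^sub>R a + cr c a z *\<^sub>R b + cr a b z *\<^sub>R c"
    by (simp add: D_def cr_def prod_eq_iff algebra_simps)
  then have "(1/D) *\<^sub>R (D *\<^sub>R z) = (1/D) *\<^sub>R (cr b c z *\<^sub>R a + cr c a z *\<^sub>R b + cr a b z *\<^sub>R c)" by simp
  then have "z = (cr b c z / D) *\<^sub>R a + (cr c a z / D) *\<^sub>R b + (cr a b z / D) *\<^sub>R c"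
    using D by (simp add: scaleR_add_right)
  moreover have "cr b c z / D + cr c a z / D + cr a b z / D = 1"
    using sum D by (simp add: add_divide_distrib[symmetric])
  moreover have "0 \<le> cr b c z / D" "0 \<le> cr c a z / D" "0 \<le> cr a b z / D" using z D by auto
  ultimately show "z \<in> convex hull {a, b, c}" unfolding convex_hull_3 by blast
qed

lemma convex_cell_cases:
  assumes "convex_cell Q"
  obtains a b c where "Q = [a, b, c]" "cr a b c > 0"
  | a b c d where "Q = [a, b, c, d]" "cr a b c > 0" "cr b c d > 0" "cr c d a > 0" "cr d a b > 0"
  using assms by (cases Q rule: convex_cell.cases) auto

lemma hull_region: assumes "convex_cell Q" shows "convex hull (set Q) = region Q"
proof
  show "convex hull (set Q) \<subseteq> region Q"
  proof (rule hull_minimal)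
    show "convex (region Q)"
      using convex_Int[OF convex_cr convex_Int[OF convex_cr convex_cr]]
        convex_Int[OF convex_cr convex_Int[OF convex_cr convex_Int[OF convex_cr convex_cr]]]
      by (cases Q rule: convex_cell.cases) (simp_all add: Int_def)
    show "set Q \<subseteq> region Q"
      using assms by (rule convex_cell_cases) (auto simp: cr_cyc less_imp_le)
  qed
  show "region Q \<subseteq> convex hull (set Q)"
    using assms
  proof (rule convex_cell_cases)
    fix a b c assume "Q = [a, b, c]" "cr a b c > 0"
    then show ?thesis using triangle_region[of a b c] by simp
  next
    fix a b c d assume Q: "Q = [a, b, c, d]" "cr a b c > 0" "cr b c d > 0" "cr c d a > 0" "cr d a b > 0"
    show ?thesis
    proof
      fix z assume z: "z \<in> region Q"
      show "z \<in> convex hull (set Q)"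
      proof (cases "cr a c z \<ge> 0")
        case True
        then have "z \<in> region [a, c, d]" using z Q by auto
        moreover have "cr a c d > 0" using Q(4) by (simp add: cr_cyc)
        ultimately have "z \<in> convex hull {a, c, d}" using triangle_region by blast
        moreover have "convex hull {a, c, d} \<subseteq> convex hull (set Q)" using Q by (intro hull_mono) auto
        ultimately show ?thesis by blast
      next
        case False
        then have "z \<in> region [a, b, c]" using z Q cr_anti[of c a z] by auto
        then have "z \<in> convex hull {a, b, c}" using triangle_region Q(2) by blast
        moreover have "convex hull {a, b, c} \<subseteq> convex hull (set Q)" using Q by (intro hull_mono) auto
        ultimately show ?thesis by blast
      qed
    qed
  qed
qed

lemma five_points: "\<not> convex_cell (x # y # z # u # vs @ [w])" "region (x # y # z # u # vs @ [w]) = {}"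
  by (cases vs; simp)+

lemma convex_cell_rotate [simp]: "convex_cell (rotate1 Q) = convex_cell Q"
proof (cases Q rule: convex_cell.cases)
  case (1 a b c) then show ?thesis by (simp add: cr_cyc)
next
  case (2 a b c d) then show ?thesis by auto
qed (auto simp: five_points)

lemma region_rotate [simp]: "region (rotate1 Q) = region Q"
proof (cases Q rule: convex_cell.cases)
  case (1 a b c) then show ?thesis by auto
next
  case (2 a b c d) then show ?thesis by auto
qed (auto simp: five_points)

lemma midpoint_in_hull: "x \<in> S \<Longrightarrow> y \<in> S \<Longrightarrow> midpoint x y \<in> convex hull S"
  by (meson convex_contains_segment convex_convex_hull hull_inc midpoint_in_closed_segment subsetD)

lemma split_hull: assumes "split_cell Q Q1 Q2"
  shows "convex hull (set Q1) \<subseteq> convex hull (set Q) \<and> convex hull (set Q2) \<subseteq> convex hull (set Q)"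
proof -
  have "set Q1 \<subseteq> convex hull (set Q) \<and> set Q2 \<subseteq> convex hull (set Q)"
    using assms by induction (simp_all add: hull_inc midpoint_in_hull)
  then show ?thesis by (simp add: hull_minimal)
qed

lemma midpoint_ne: "cr a b c \<noteq> 0 \<Longrightarrow> a \<noteq> midpoint b c" "cr a b c + cr a b d \<noteq> 0 \<Longrightarrow> midpoint a b \<noteq> midpoint c d"
proof -
  show "a \<noteq> midpoint b c" if "cr a b c \<noteq> 0"
    using that cr_midpoint(1)[of b c b c] by auto
  show "midpoint a b \<noteq> midpoint c d" if "cr a b c + cr a b d \<noteq> 0"
    using that cr_midpoint(3)[of a b a b] cr_midpoint(3)[of a b c d] by auto
qed

text \<open>The splitting segment runs from \<open>s\<close> to \<open>t\<close> or back; its line separates the two parts, and a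
  point of the cell belongs to the part on its side. All determinants that occur are
  averages of those of the given cell.\<close>

lemma split_convex:
  assumes "split_cell Q Q1 Q2" "convex_cell Q"
  shows "convex_cell Q1 \<and> convex_cell Q2 \<and> region Q \<subseteq> region Q1 \<union> region Q2 \<and>
    (\<exists>s t. s \<noteq> t \<and> region Q1 \<subseteq> {z. cr s t z \<le> 0} \<and> region Q2 \<subseteq> {z. cr s t z \<ge> 0})"
  using assms
proof induction
  case (vertex_midpoint_tri a b c)
  let ?m = "midpoint b c"
  have 1: "0 < cr a b c" using vertex_midpoint_tri by simp
  then have "a \<noteq> ?m" by (intro midpoint_ne) simp
  moreover have "convex_cell [a, b, ?m] \<and> convex_cell [a, ?m, c]" using 1 by (simp add: cr_midpoint)
  moreover have "region [a, b, c] \<subseteq> region [a, b, ?m] \<union> region [a, ?m, c]"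
    using cr_anti[of a ?m] by (auto simp: cr_midpoint)
  moreover have "region [a, b, ?m] \<subseteq> {z. cr a ?m z \<le> 0} \<and> region [a, ?m, c] \<subseteq> {z. cr a ?m z \<ge> 0}"
    using cr_anti[of a ?m] by auto
  ultimately show ?case by blast
next
  case (vertex_midpoint_quad a b c d)
  let ?m = "midpoint b c"
  have 1: "0 < cr a b c" "cr b c d > 0" "cr c d a > 0" "cr d a b > 0" using vertex_midpoint_quad by auto
  then have "a \<noteq> ?m" by (intro midpoint_ne) simp
  moreover have "convex_cell [a, b, ?m] \<and> convex_cell [a, ?m, c, d]"
    using 1 cr_cyc[of c d a] by (simp add: cr_midpoint)
  moreover have "region [a, b, c, d] \<subseteq> region [a, b, ?m] \<union> region [a, ?m, c, d]"
    using cr_anti[of a ?m] by (auto simp: cr_midpoint)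
  moreover have "region [a, b, ?m] \<subseteq> {z. cr a ?m z \<le> 0} \<and> region [a, ?m, c, d] \<subseteq> {z. cr a ?m z \<ge> 0}"
    using cr_anti[of a ?m] by auto
  ultimately show ?case by blast
next
  case (vertex_midpoint_quad' a b c d)
  let ?m = "midpoint c d"
  have 1: "0 < cr a b c" "cr b c d > 0" "cr c d a > 0" "cr d a b > 0" using vertex_midpoint_quad' by auto
  then have "a \<noteq> ?m" using cr_cyc[of a c d] by (intro midpoint_ne) simp
  moreover have "convex_cell [a, b, c, ?m] \<and> convex_cell [a, ?m, d]"
    using 1 cr_cyc[of d a b] cr_cyc[of c a b] cr_cyc[of c d a] by (simp add: cr_midpoint)
  moreover have "region [a, b, c, d] \<subseteq> region [a, b, c, ?m] \<union> region [a, ?m, d]"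
    using cr_anti[of a ?m] by (auto simp: cr_midpoint)
  moreover have "region [a, b, c, ?m] \<subseteq> {z. cr a ?m z \<le> 0} \<and> region [a, ?m, d] \<subseteq> {z. cr a ?m z \<ge> 0}"
    using cr_anti[of a ?m] by auto
  ultimately show ?case by blast
next
  case (vertex_vertex_quad a b c d)
  have 1: "0 < cr a b c" "cr b c d > 0" "cr c d a > 0" "cr d a b > 0" using vertex_vertex_quad by auto
  then have "a \<noteq> c" by auto
  moreover have "convex_cell [a, b, c] \<and> convex_cell [a, c, d]" using 1 cr_cyc[of a c d] by simp
  moreover have "region [a, b, c, d] \<subseteq> region [a, b, c] \<union> region [a, c, d]"
    using cr_anti[of a c] by auto
  moreover have "region [a, b, c] \<subseteq> {z. cr a c z \<le> 0} \<and> region [a, c, d] \<subseteq> {z. cr a c z \<ge> 0}"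
    using cr_anti[of a c] by auto
  ultimately show ?case by blast
next
  case (midpoint_midpoint_tri a b c)
  let ?m = "midpoint a b" and ?n = "midpoint a c"
  have 1: "0 < cr a b c" using midpoint_midpoint_tri by simp
  then have "?n \<noteq> ?m" by (auto simp: midpoint_def)
  moreover have "convex_cell [a, ?m, ?n] \<and> convex_cell [?m, b, c, ?n]"
    using 1 cr_cyc[of a b c] cr_anti[of a c b] by (simp add: cr_midpoint)
  moreover have "region [a, b, c] \<subseteq> region [a, ?m, ?n] \<union> region [?m, b, c, ?n]"
  proof
    fix z assume z: "z \<in> region [a, b, c]"
    have "cr ?n ?m z = - cr ?m ?n z" "cr a ?m z = cr a b z / 2" "cr ?n a z = cr c a z / 2"
      "cr ?m b z = cr a b z / 2" "cr c ?n z = cr c a z / 2"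
      by (rule cr_anti, simp_all add: cr_midpoint)
    then show "z \<in> region [a, ?m, ?n] \<union> region [?m, b, c, ?n]" using z by auto
  qed
  moreover have "region [a, ?m, ?n] \<subseteq> {z. cr ?n ?m z \<le> 0} \<and> region [?m, b, c, ?n] \<subseteq> {z. cr ?n ?m z \<ge> 0}"
    using cr_anti[of ?n ?m] by auto
  ultimately show ?case by blast
next
  case (midpoint_midpoint_quad a b c d)
  let ?m = "midpoint a b" and ?n = "midpoint c d"
  have 1: "0 < cr a b c" "cr b c d > 0" "cr c d a > 0" "cr d a b > 0" using midpoint_midpoint_quad by auto
  have 2: "cr a b d > 0" "cr a c d > 0" using 1 by (simp_all add: cr_cyc)
  then have "?m \<noteq> ?n" using 1 by (intro midpoint_ne) simp
  then have "?n \<noteq> ?m" by simp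
  moreover have "convex_cell [a, ?m, ?n, d] \<and> convex_cell [?m, b, c, ?n]"
    using 1 2 cr_cyc[of c d a] cr_cyc[of c d b] cr_cyc[of b c d] cr_cyc[of a b c] cr_cyc[of d a b] cr_cyc[of a c d]
    by (simp add: cr_midpoint)
  moreover have "region [a, b, c, d] \<subseteq> region [a, ?m, ?n, d] \<union> region [?m, b, c, ?n]"
  proof
    fix z assume z: "z \<in> region [a, b, c, d]"
    have "cr ?n ?m z = - cr ?m ?n z" "cr a ?m z = cr a b z / 2" "cr ?n d z = cr c d z / 2"
      "cr ?m b z = cr a b z / 2" "cr c ?n z = cr c d z / 2"
      by (rule cr_anti, simp_all add: cr_midpoint)
    then show "z \<in> region [a, ?m, ?n, d] \<union> region [?m, b, c, ?n]" using z by auto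
  qed
  moreover have "region [a, ?m, ?n, d] \<subseteq> {z. cr ?n ?m z \<le> 0} \<and> region [?m, b, c, ?n] \<subseteq> {z. cr ?n ?m z \<ge> 0}"
    using cr_anti[of ?n ?m] by auto
  ultimately show ?case by blast
qed simp



lemma interior_disjoint_of_cr:
  assumes "s \<noteq> t" "A \<subseteq> {z. cr s t z \<le> 0}" "B \<subseteq> {z. cr s t z \<ge> 0}"
  shows "interior A \<inter> interior B = {}"
proof -
  let ?v = "(- (snd t - snd s), fst t - fst s)"
  have "?v \<noteq> 0" using assms(1) by (auto simp: prod_eq_iff zero_prod_def)
  have le: "{z. cr s t z \<le> 0} = {z. ?v \<bullet> z \<le> ?v \<bullet> s}" and ge: "{z. cr s t z \<ge> 0} = {z. ?v \<bullet> z \<ge> ?v \<bullet> s}"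
    unfolding cr_eq_inner by auto
  have "interior A \<subseteq> {z. ?v \<bullet> z < ?v \<bullet> s}"
    using interior_mono[OF assms(2)] unfolding le interior_halfspace_le[OF \<open>?v \<noteq> 0\<close>] .
  moreover have "interior B \<subseteq> {z. ?v \<bullet> z > ?v \<bullet> s}"
    using interior_mono[OF assms(3)] unfolding ge interior_halfspace_ge[OF \<open>?v \<noteq> 0\<close>] .
  ultimately show ?thesis by force
qed

abbreviation hull_of :: "cell \<Rightarrow> point set" where "hull_of Q \<equiv> convex hull (set Q)"

lemma split_hulls:
  assumes "split_cell Q Q1 Q2" "convex_cell Q"
  shows "convex_cell Q1" "convex_cell Q2" "hull_of Q = hull_of Q1 \<union> hull_of Q2"
    "interior (hull_of Q1) \<inter> interior (hull_of Q2) = {}"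
proof -
  note * = split_convex[OF assms]
  show c: "convex_cell Q1" "convex_cell Q2" using * by auto
  show "hull_of Q = hull_of Q1 \<union> hull_of Q2"
    using * split_hull[OF assms(1)] unfolding hull_region[OF c(1)] hull_region[OF c(2)] hull_region[OF assms(2)] by blast
  obtain s t where "s \<noteq> t" "region Q1 \<subseteq> {z. cr s t z \<le> 0}" "region Q2 \<subseteq> {z. cr s t z \<ge> 0}" using * by blast
  then show "interior (hull_of Q1) \<inter> interior (hull_of Q2) = {}"
    unfolding hull_region[OF c(1)] hull_region[OF c(2)] by (rule interior_disjoint_of_cr)
qed

abbreviation unit_cell :: cell where "unit_cell \<equiv> [(0, 0), (1, 0), (1, 1), (0, 1)]"

text \<open>Disjoint interiors make it possible to prescribe an approximant on each cell separately.\<close>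

lemma partition_tiles:
  assumes "partition_after n \<T>"
  shows "finite \<T> \<and> (\<forall>Q\<in>\<T>. convex_cell Q) \<and> hull_of unit_cell \<subseteq> (\<Union>Q\<in>\<T>. hull_of Q) \<and>
    (\<forall>Q\<in>\<T>. \<forall>R\<in>\<T>. Q \<noteq> R \<longrightarrow> interior (hull_of Q) \<inter> interior (hull_of R) = {})"
  using assms
proof induction
  case initial
  have u: "convex_cell unit_cell" by (simp add: cr_def)
  then show ?case by (intro conjI ballI impI finite.intros) (blast, blast, metis singletonD)
next
  case (split n \<T> Q Q1 Q2)
  have Q: "convex_cell Q" using split.IH split.hyps(2) by (elim conjE) (rule bspec)
  note h = split_hulls[OF split(3) Q]
  let ?T = "(\<T> - {Q}) \<union> {Q1, Q2}"
  have sub: "interior (hull_of Q1) \<subseteq> interior (hull_of Q)" "interior (hull_of Q2) \<subseteq> interior (hull_of Q)"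
    using h(3) by (simp_all add: interior_mono)
  have dis: "interior (hull_of Q) \<inter> interior (hull_of R) = {}" if "R \<in> \<T> - {Q}" for R
    using that split by blast
  have "hull_of unit_cell \<subseteq> (\<Union>Q\<in>?T. hull_of Q)"
  proof
    fix z assume "z \<in> hull_of unit_cell"
    then obtain R where R: "R \<in> \<T>" "z \<in> hull_of R" using split by blast
    show "z \<in> (\<Union>Q\<in>?T. hull_of Q)"
    proof (cases "R = Q")
      case True
      then have "z \<in> hull_of Q1 \<union> hull_of Q2" using R h(3) by blast
      then show ?thesis by blast
    next
      case False then show ?thesis using R by blast
    qed
  qed
  moreover have "interior (hull_of A) \<inter> interior (hull_of B) = {}" if AB: "A \<in> ?T" "B \<in> ?T" "A \<noteq> B" for A B
  proof -
    consider "A \<in> \<T> - {Q}" "B \<in> \<T> - {Q}" | "A \<in> {Q1, Q2}" "B \<in> \<T> - {Q}" | "A \<in> \<T> - {Q}" "B \<in> {Q1, Q2}"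
      | "A \<in> {Q1, Q2}" "B \<in> {Q1, Q2}" using AB by blast
    then show ?thesis
    proof cases
      case 1 then show ?thesis using split AB(3) by blast
    next
      case 2 then show ?thesis using dis[of B] sub by blast
    next
      case 3 then show ?thesis using dis[of A] sub by blast
    next
      case 4 then show ?thesis using h(4) AB(3) by blast
    qed
  qed
  ultimately show ?case using split h(1,2) by auto
qed

section \<open>Isolating a set by splits\<close>

text \<open>The intended \<open>P\<close> is that a good approximation exists on the cell. The number of splits \<open>k\<close> and the area
  \<open>\<alpha>\<close> are upper bounds, which may be weakened; \<open>k\<close> is real so that estimates need no rounding.\<close>

inductive isolates :: "(point set \<Rightarrow> bool) \<Rightarrow> cell \<Rightarrow> real \<Rightarrow> real \<Rightarrow> bool" for P where
  good: "P (hull_of Q) \<Longrightarrow> 0 \<le> k \<Longrightarrow> 0 \<le> \<alpha> \<Longrightarrow> isolates P Q k \<alpha>"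
| small: "measure lebesgue (hull_of Q) \<le> \<alpha> \<Longrightarrow> 0 \<le> k \<Longrightarrow> isolates P Q k \<alpha>"
| step: "split_cell Q Q1 Q2 \<Longrightarrow> isolates P Q1 k1 \<alpha>1 \<Longrightarrow> isolates P Q2 k2 \<alpha>2 \<Longrightarrow>
    1 + k1 + k2 \<le> k \<Longrightarrow> \<alpha>1 + \<alpha>2 \<le> \<alpha> \<Longrightarrow> isolates P Q k \<alpha>"

lemma isolates_nonneg: assumes "isolates P Q k \<alpha>" shows "0 \<le> k" "0 \<le> \<alpha>"
  using assms by (induction, auto intro: order_trans[OF measure_nonneg])

lemma isolates_weaken: assumes "isolates P Q k \<alpha>" "k \<le> k'" "\<alpha> \<le> \<alpha>'" shows "isolates P Q k' \<alpha>'"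
  using assms
proof cases
  case good then show ?thesis using assms by (intro isolates.good) auto
next
  case small then show ?thesis using assms by (intro isolates.small) auto
next
  case (step Q1 Q2 k1 \<alpha>1 k2 \<alpha>2)
  then show ?thesis using assms by (intro isolates.step[of Q Q1 Q2 P k1 \<alpha>1 k2 \<alpha>2]) auto
qed

lemma isolates_rotate: assumes "isolates P (rotate1 Q) k \<alpha>" shows "isolates P Q k \<alpha>"
  using assms
proof cases
  case good then show ?thesis by (intro isolates.good) auto
next
  case small then show ?thesis by (intro isolates.small) auto
next
  case (step Q1 Q2 k1 \<alpha>1 k2 \<alpha>2)
  from split_cell.rotate[OF step(1)] step(2-5) show ?thesis by (rule isolates.step)
qed

lemma isolates_mono:
  assumes "isolates P Q k \<alpha>" and "\<And>S. P S \<Longrightarrow> S \<subseteq> hull_of Q \<Longrightarrow> P' S"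
  shows "isolates P' Q k \<alpha>"
  using assms
proof induction
  case (step Q Q1 Q2 k1 \<alpha>1 k2 \<alpha>2 k \<alpha>)
  note h = split_hull[OF step(1)]
  have "isolates P' Q1 k1 \<alpha>1" by (rule step.IH(1)) (rule step.prems, assumption, use h in blast)
  moreover have "isolates P' Q2 k2 \<alpha>2" by (rule step.IH(2)) (rule step.prems, assumption, use h in blast)
  ultimately show ?case using step.hyps(1) step.hyps(4,5) by (intro isolates.step[of Q Q1 Q2])
qed (auto intro: isolates.good isolates.small)

text \<open>Splits are defined by midpoints, so they commute with affine maps.\<close>

lemma split_cell_map:
  assumes "split_cell Q Q1 Q2" and f: "\<And>x y. f (midpoint x y) = midpoint (f x) (f y)"
  shows "split_cell (map f Q) (map f Q1) (map f Q2)"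
  using assms(1)
proof induction
  case (rotate Q Q1 Q2)
  show ?case by (rule split_cell.rotate) (use rotate.IH in \<open>simp add: rotate1_map\<close>)
qed (auto simp: f intro: split_cell.intros)

text \<open>The properties of a rigid motion that matter for cells.\<close>

definition rigid :: "(point \<Rightarrow> point) \<Rightarrow> bool" where
  "rigid f \<longleftrightarrow> (\<forall>x y. f (midpoint x y) = midpoint (f x) (f y)) \<and> (\<forall>Q. hull_of (map f Q) = f ` hull_of Q) \<and>
     (\<forall>Q. measure lebesgue (f ` hull_of Q) = measure lebesgue (hull_of Q))"

lemma isolates_rigid:
  assumes "isolates (\<lambda>S. P (f ` S)) Q k \<alpha>" and f: "rigid f"
  shows "isolates P (map f Q) k \<alpha>"
  using assms(1)
proof induction
  case (good Q k \<alpha>)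
  then show ?case using f unfolding rigid_def by (intro isolates.good) auto
next
  case (small Q \<alpha> k)
  then show ?case using f unfolding rigid_def by (intro isolates.small) auto
next
  case (step Q Q1 Q2 k1 \<alpha>1 k2 \<alpha>2 k \<alpha>)
  have "split_cell (map f Q) (map f Q1) (map f Q2)"
    using step(1) f unfolding rigid_def by (intro split_cell_map) auto
  from this step.IH step.hyps(4,5) show ?case by (rule isolates.step)
qed

text \<open>Inclusion instead of equality is enough below and allows the split cells
  to be already present.\<close>

definition refines :: "cell \<Rightarrow> real \<Rightarrow> cell set \<Rightarrow> bool" where
  "refines Q k S \<longleftrightarrow> (\<forall>n \<T>. partition_after n \<T> \<longrightarrow>
     (\<exists>n' \<T>'. partition_after n' \<T>' \<and> real n' \<le> real n + k \<and> \<T>' \<subseteq> (\<T> - {Q}) \<union> S))"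

lemma refines_step:
  assumes "split_cell Q Q1 Q2" "refines Q1 k1 S1" "refines Q2 k2 S2" "1 + k1 + k2 \<le> k" "0 \<le> k"
  shows "refines Q k (S1 \<union> S2)"
  unfolding refines_def
proof (intro allI impI)
  fix n \<T> assume p: "partition_after n \<T>"
  show "\<exists>n' \<T>'. partition_after n' \<T>' \<and> real n' \<le> real n + k \<and> \<T>' \<subseteq> (\<T> - {Q}) \<union> (S1 \<union> S2)"
  proof (cases "Q \<in> \<T>")
    case False
    then show ?thesis using p assms(5) by (intro exI[of _ n] exI[of _ \<T>]) auto
  next
    case True
    have "partition_after (Suc n) ((\<T> - {Q}) \<union> {Q1, Q2})" by (rule partition_after.split[OF p True assms(1)])
    then obtain n1 T1 where 1: "partition_after n1 T1" "real n1 \<le> real (Suc n) + k1"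
      "T1 \<subseteq> ((\<T> - {Q}) \<union> {Q1, Q2}) - {Q1} \<union> S1" using assms(2) unfolding refines_def by blast
    then obtain n2 T2 where 2: "partition_after n2 T2" "real n2 \<le> real n1 + k2"
      "T2 \<subseteq> T1 - {Q2} \<union> S2" using assms(3) unfolding refines_def by blast
    have "T2 \<subseteq> (\<T> - {Q}) \<union> (S1 \<union> S2)" using 1(3) 2(3) by blast
    moreover have "real n2 \<le> real n + k" using 1(2) 2(2) assms(4) by simp
    ultimately show ?thesis using 2(1) by blast
  qed
qed

lemma refines_none: "0 \<le> k \<Longrightarrow> refines Q k {Q}"
  unfolding refines_def
proof (intro allI impI)
  fix n \<T> assume "0 \<le> k" "partition_after n \<T>"
  then show "\<exists>n' \<T>'. partition_after n' \<T>' \<and> real n' \<le> real n + k \<and> \<T>' \<subseteq> (\<T> - {Q}) \<union> {Q}"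
    by (intro exI[of _ n] exI[of _ \<T>]) auto
qed

lemma lmeasurable_hull: "hull_of Q \<in> lmeasurable"
  by (intro lmeasurable_compact compact_convex_hull finite_imp_compact) auto

lemma isolates_imp_refines:
  assumes "isolates P Q k \<alpha>"
  shows "\<exists>S U. refines Q k S \<and> U \<in> lmeasurable \<and> measure lebesgue U \<le> \<alpha> \<and>
     (\<forall>R\<in>S. P (hull_of R) \<or> hull_of R \<subseteq> U)"
  using assms
proof induction
  case (good Q k \<alpha>)
  then show ?case by (intro exI[of _ "{Q}"] exI[of _ "{}"]) (auto simp: refines_none)
next
  case (small Q \<alpha> k)
  then show ?case using lmeasurable_hull
    by (intro exI[of _ "{Q}"] exI[of _ "hull_of Q"]) (auto simp: refines_none)
next
  case (step Q Q1 Q2 k1 \<alpha>1 k2 \<alpha>2 k \<alpha>)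
  from step.IH obtain S1 U1 S2 U2 where 1: "refines Q1 k1 S1" "U1 \<in> lmeasurable" "measure lebesgue U1 \<le> \<alpha>1"
     "\<forall>R\<in>S1. P (hull_of R) \<or> hull_of R \<subseteq> U1" and 2: "refines Q2 k2 S2" "U2 \<in> lmeasurable" "measure lebesgue U2 \<le> \<alpha>2"
     "\<forall>R\<in>S2. P (hull_of R) \<or> hull_of R \<subseteq> U2" by blast
  have "refines Q k (S1 \<union> S2)"
    using step isolates_nonneg[OF step(2)] isolates_nonneg[OF step(3)]
    by (intro refines_step[OF step(1) 1(1) 2(1)]) auto
  moreover have "measure lebesgue (U1 \<union> U2) \<le> \<alpha>"
    using measure_Un_le[of U1 lebesgue U2] 1 2 step by (auto simp: fmeasurableD)
  moreover have "U1 \<union> U2 \<in> lmeasurable" using 1 2 by auto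
  ultimately show ?case using 1(4) 2(4) by (intro exI[of _ "S1 \<union> S2"] exI[of _ "U1 \<union> U2"]) blast
qed

lemma isolates_partition:
  assumes "isolates P unit_cell k \<alpha>"
  shows "\<exists>n \<T> U. real n \<le> k \<and> partition_after n \<T> \<and> U \<in> lmeasurable \<and> measure lebesgue U \<le> \<alpha> \<and>
     (\<forall>R\<in>\<T>. P (hull_of R) \<or> hull_of R \<subseteq> U)"
proof -
  obtain S U where S: "refines unit_cell k S" "U \<in> lmeasurable" "measure lebesgue U \<le> \<alpha>"
     "\<forall>R\<in>S. P (hull_of R) \<or> hull_of R \<subseteq> U" using isolates_imp_refines[OF assms] by blast
  obtain n T where "partition_after n T" "real n \<le> real 0 + k" "T \<subseteq> ({unit_cell} - {unit_cell}) \<union> S"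
    using S(1)[unfolded refines_def, rule_format, OF partition_after.initial] by blast
  then show ?thesis using S by (intro exI[of _ n] exI[of _ T] exI[of _ U]) auto
qed



section \<open>Areas of thin cells\<close>

text \<open>By Fubini; all vertical sections have length at most \<open>h\<close>.\<close>

lemma sheared_strip:
  fixes l :: "real \<Rightarrow> real"
  assumes "continuous_on UNIV l" "x0 \<le> x1" "0 \<le> h" and S: "S \<subseteq> {(x, y). x0 \<le> x \<and> x \<le> x1 \<and> l x \<le> y \<and> y \<le> l x + h}"
  shows "measure lebesgue S \<le> (x1 - x0) * h"
proof -
  let ?T = "{z :: point. x0 \<le> fst z \<and> fst z \<le> x1 \<and> l (fst z) \<le> snd z \<and> snd z \<le> l (fst z) + h}"
  have lc: "continuous_on UNIV (\<lambda>z::point. l (fst z))"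
    by (intro continuous_on_compose2[OF assms(1)] continuous_intros) auto
  have clo: "closed ?T"
    by (intro closed_Collect_conj closed_Collect_le continuous_intros lc)
  then have bor: "?T \<in> sets borel" by simp
  have sl: "emeasure lborel (Pair x -` ?T) = indicator {x0..x1} x * ennreal h" for x
  proof -
    have "Pair x -` ?T = (if x \<in> {x0..x1} then {l x..l x + h} else {})" by auto
    then show ?thesis using assms(3) by (auto simp: indicator_def)
  qed
  have "emeasure lborel ?T = emeasure (lborel \<Otimes>\<^sub>M lborel) ?T" by (simp add: lborel_prod)
  also have "\<dots> = (\<integral>\<^sup>+x. emeasure lborel (Pair x -` ?T) \<partial>lborel)"
    by (rule lborel.emeasure_pair_measure_alt) (unfold lborel_prod sets_lborel, rule bor)
  also have "\<dots> = (\<integral>\<^sup>+x. ennreal h * indicator {x0..x1} x \<partial>lborel)" unfolding sl by (simp add: mult.commute)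
  also have "\<dots> = ennreal h * ennreal (x1 - x0)" using assms(2) by (simp add: nn_integral_cmult_indicator)
  also have "\<dots> = ennreal ((x1 - x0) * h)" using assms(2,3) by (simp add: ennreal_mult[symmetric] mult.commute)
  finally have em: "emeasure lebesgue ?T = ennreal ((x1 - x0) * h)" using bor by simp
  have "S \<subseteq> ?T" using S by auto
  show ?thesis
  proof (cases "S \<in> sets lebesgue")
    case True
    have "measure lebesgue S \<le> measure lebesgue ?T"
      using em bor \<open>S \<subseteq> ?T\<close> True by (intro measure_mono_fmeasurable) (auto simp: fmeasurable_def)
    also have "\<dots> = (x1 - x0) * h" using em assms(2,3) by (simp add: measure_def)
    finally show ?thesis .
  next
    case False
    then show ?thesis using assms by (simp add: measure_notin_sets)
  qed
qed

text \<open>A half turn exchanges the points above a line with those below it, a quarter turn graphs over one axis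
  with graphs over the other. Both keep the orientation, unlike reflections, and hence the order of
  the vertices of cells.\<close>

definition half_turn :: "real \<Rightarrow> point \<Rightarrow> point" where "half_turn u z = (u - fst z, - snd z)"
definition quarter_turn :: "point \<Rightarrow> point" where "quarter_turn z = (- snd z, fst z)"

text \<open>A bijective affine map is area preserving if the preimages of boxes have the right area.\<close>

lemma rigidI:
  fixes f g :: "point \<Rightarrow> point"
  assumes g: "linear g" "\<And>z. f z = u + g z" and inv: "\<And>z. f (k z) = z" "\<And>z. k (f z) = z" and k: "continuous_on UNIV k"
    and box: "\<And>l u. emeasure lborel (f -` box l u) = emeasure lborel (box l u)"
  shows "rigid f"
  unfolding rigid_def
proof (intro conjI allI)
  show "f (midpoint x y) = midpoint (f x) (f y)" for x y
    unfolding g(2) midpoint_def linear_cmul[OF g(1)] linear_add[OF g(1)] by (simp add: scaleR_add_right scaleR_2[symmetric] flip: scaleR_add_left)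
  show hull: "hull_of (map f Q) = f ` hull_of Q" for Q
  proof -
    have "set (map f Q) = (\<lambda>z. u + z) ` (g ` set Q)" by (auto simp: g(2))
    then have "hull_of (map f Q) = (\<lambda>z. u + z) ` (g ` hull_of Q)"
      by (simp only: convex_hull_translation convex_hull_linear_image[OF g(1)])
    also have "\<dots> = f ` hull_of Q" by (auto simp: g(2))
    finally show ?thesis .
  qed
  have fc: "continuous_on UNIV f" unfolding g(2)[abs_def] using linear_continuous_on[OF g(1)[unfolded linear_conv_bounded_linear]] by (intro continuous_intros)
  have m: "f \<in> borel_measurable lborel" using fc by (simp add: borel_measurable_continuous_onI)
  have d: "lborel = distr lborel borel f"
    by (rule lborel_eqI) (use m box in \<open>auto simp: emeasure_distr emeasure_lborel_box_eq\<close>)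
  show "measure lebesgue (f ` hull_of Q) = measure lebesgue (hull_of Q)" for Q
  proof -
    have c: "closed (hull_of R)" for R by (intro compact_imp_closed compact_convex_hull finite_imp_compact) auto
    have b: "hull_of Q \<in> sets borel" "f ` hull_of Q \<in> sets borel" using c[of Q] c[of "map f Q"] unfolding hull by simp_all
    have "f -` (f ` hull_of Q) = hull_of Q" using inv by (metis inj_on_def inj_vimage_image_eq)
    then have "emeasure (distr lborel borel f) (f ` hull_of Q) = emeasure lborel (hull_of Q)"
      using m b by (simp add: emeasure_distr)
    then have "emeasure lborel (f ` hull_of Q) = emeasure lborel (hull_of Q)" by (simp add: d[symmetric])
    then show ?thesis using b by (simp add: measure_def)
  qed
qed

lemma box_prod: "box (a, b) (c, d) = box a c \<times> box b (d::real)" for a c :: real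
  by (auto simp: box_def Basis_prod_def inner_prod_def)

lemma measure_box_prod: "emeasure lborel ({a<..<c} \<times> {b<..<d}) = emeasure lborel {a<..<c::real} * emeasure lborel {b<..<d::real}"
proof -
  have "emeasure lborel ({a<..<c} \<times> {b<..<d}) = emeasure (lborel \<Otimes>\<^sub>M lborel) ({a<..<c} \<times> {b<..<d})" by (simp add: lborel_prod)
  then show ?thesis by (simp add: lborel.emeasure_pair_measure_Times)
qed

lemma rigid_half_turn: "rigid (half_turn u)"
proof (rule rigidI[where g = "\<lambda>z. - z" and u = "(u, 0)" and k = "half_turn u"])
  fix l v :: point
  have "half_turn u -` box l v = {u - fst v<..<u - fst l} \<times> {- snd v<..<- snd l}"
    by (cases l; cases v) (auto simp: half_turn_def box_prod box_real)
  moreover have "box l v = {fst l<..<fst v} \<times> {snd l<..<snd v}"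
    by (cases l; cases v) (auto simp: box_prod box_real)
  moreover have "emeasure lborel {a - c<..<a - b} = emeasure lborel {b<..<c}" for a b c :: real
    by (cases "b \<le> c") auto
  from this[of u] this[of 0] have "emeasure lborel {u - c<..<u - b} = emeasure lborel {b<..<c}" "emeasure lborel {-c<..<-b} = emeasure lborel {b<..<c}" for b c by auto
  ultimately show "emeasure lborel (half_turn u -` box l v) = emeasure lborel (box l v)"
    by (simp add: measure_box_prod)
qed (auto simp: half_turn_def[abs_def] prod_eq_iff linear_iff intro!: continuous_intros)

lemma rigid_quarter_turn: "rigid quarter_turn"
proof (rule rigidI[where g = quarter_turn and u = 0 and k = "\<lambda>z. (snd z, - fst z)"])
  fix l v :: point
  have "quarter_turn -` box l v = {snd l<..<snd v} \<times> {- fst v<..<- fst l}"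
    by (cases l; cases v) (auto simp: quarter_turn_def box_prod box_real)
  moreover have "box l v = {fst l<..<fst v} \<times> {snd l<..<snd v}"
    by (cases l; cases v) (auto simp: box_prod box_real)
  moreover have "emeasure lborel {- c<..<- b} = emeasure lborel {b<..<c}" for b c :: real
    by (cases "b \<le> c") auto
  ultimately show "emeasure lborel (quarter_turn -` box l v) = emeasure lborel (box l v)"
    by (simp add: measure_box_prod mult.commute)
qed (auto simp: quarter_turn_def[abs_def] prod_eq_iff linear_iff zero_prod_def intro!: continuous_intros)



section \<open>Isolating a strip in a vertical slab\<close>

text \<open>Cells may touch \<open>\<Gamma>\<close> along their boundary, since approximants are prescribed in the interior only.\<close>

definition misses :: "point set \<Rightarrow> point set \<Rightarrow> bool" where
  "misses \<Gamma> S \<longleftrightarrow> interior S \<inter> \<Gamma> = {}"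

lemma misses_image:
  assumes "misses (k ` \<Gamma>) S" and f: "continuous_on UNIV f" "\<And>z. k (f z) = z" "\<And>z. f (k z) = z"
  shows "misses \<Gamma> (f ` S)"
  unfolding misses_def
proof (rule equals0I)
  fix x assume x: "x \<in> interior (f ` S) \<inter> \<Gamma>"
  have "open (f -` interior (f ` S))" using f(1) by (intro open_vimage) auto
  moreover have "f -` interior (f ` S) \<subseteq> S"
  proof
    fix y assume "y \<in> f -` interior (f ` S)"
    then have "f y \<in> f ` S" using interior_subset by blast
    then show "y \<in> S" using f(2) by (metis imageE)
  qed
  ultimately have "f -` interior (f ` S) \<subseteq> interior S" by (rule interior_maximal[rotated])
  moreover have "k x \<in> f -` interior (f ` S)" using x f(3) by simp
  ultimately show False using x assms(1) unfolding misses_def by blast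
qed

abbreviation quad :: "real \<Rightarrow> real \<Rightarrow> real \<Rightarrow> real \<Rightarrow> real \<Rightarrow> real \<Rightarrow> cell" where
  "quad x0 x1 a b c d \<equiv> [(x0, a), (x1, b), (x1, c), (x0, d)]"

lemma midpoint_vertical [simp]: "midpoint (x, b) (x, c) = (x :: real, (b + c) / 2 :: real)"
  by (simp add: midpoint_def)

text \<open>The line over \<open>{x0..x1}\<close> from height \<open>p\<close> to height \<open>q\<close>, scaled by \<open>x1 - x0\<close> to avoid division.\<close>

definition lin :: "real \<Rightarrow> real \<Rightarrow> real \<Rightarrow> real \<Rightarrow> real \<Rightarrow> real" where
  "lin x0 x1 p q x = p * (x1 - x) + q * (x - x0)"

definition below :: "point set \<Rightarrow> real \<Rightarrow> real \<Rightarrow> real \<Rightarrow> real \<Rightarrow> bool" where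
  "below \<Gamma> x0 x1 p q \<longleftrightarrow> (\<forall>(x, y)\<in>\<Gamma>. x0 \<le> x \<longrightarrow> x \<le> x1 \<longrightarrow> (x1 - x0) * y \<le> lin x0 x1 p q x)"

definition above :: "point set \<Rightarrow> real \<Rightarrow> real \<Rightarrow> real \<Rightarrow> real \<Rightarrow> bool" where
  "above \<Gamma> x0 x1 p q \<longleftrightarrow> (\<forall>(x, y)\<in>\<Gamma>. x0 \<le> x \<longrightarrow> x \<le> x1 \<longrightarrow> lin x0 x1 p q x \<le> (x1 - x0) * y)"

lemma lin_mono: "p \<le> p' \<Longrightarrow> q \<le> q' \<Longrightarrow> x0 \<le> x \<Longrightarrow> x \<le> x1 \<Longrightarrow> lin x0 x1 p q x \<le> lin x0 x1 p' q' x"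
  unfolding lin_def by (intro add_mono mult_right_mono) auto

lemma below_mono: "below \<Gamma> x0 x1 p q \<Longrightarrow> p \<le> p' \<Longrightarrow> q \<le> q' \<Longrightarrow> below \<Gamma> x0 x1 p' q'"
  unfolding below_def using lin_mono[of p p' q q' x0 _ x1] by (fastforce intro: order_trans)

lemma above_mono: "above \<Gamma> x0 x1 p q \<Longrightarrow> p' \<le> p \<Longrightarrow> q' \<le> q \<Longrightarrow> above \<Gamma> x0 x1 p' q'"
  unfolding above_def using lin_mono[of p' p q' q x0 _ x1] by (fastforce intro: order_trans)

lemma hull_in_slab:
  assumes "\<And>x y. (x, y) \<in> V \<Longrightarrow> x0 \<le> x \<and> x \<le> x1" "(x, y) \<in> convex hull (V :: point set)"
  shows "x0 \<le> x \<and> x \<le> (x1::real)"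
proof -
  have "convex hull V \<subseteq> {z. (1, 0) \<bullet> z \<ge> x0} \<inter> {z. (1, 0) \<bullet> z \<le> x1}"
    by (rule hull_minimal) (use assms(1) in \<open>force simp: inner_prod_def\<close>, intro convex_Int convex_halfspace_ge convex_halfspace_le)
  then show ?thesis using assms(2) by (auto simp: inner_prod_def)
qed

lemma lin_inner: "lin x0 x1 p q (fst z) - (x1 - x0) * snd z = (q - p, - (x1 - x0)) \<bullet> z + (p * x1 - q * x0)"
  by (simp add: lin_def inner_prod_def algebra_simps)

text \<open>A cell above the line contains points of \<open>\<Gamma>\<close> at most on its boundary.\<close>

lemma misses_above:
  assumes x: "x0 < x1" and V: "\<And>x y. (x, y) \<in> set Q \<Longrightarrow> x0 \<le> x \<and> x \<le> x1 \<and> lin x0 x1 p q x \<le> (x1 - x0) * y"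
    and b: "below \<Gamma> x0 x1 p q"
  shows "misses \<Gamma> (hull_of Q)"
proof -
  let ?v = "(q - p, - (x1 - x0))"
  have v: "?v \<noteq> 0" using x by (simp add: zero_prod_def)
  have "hull_of Q \<subseteq> {z. ?v \<bullet> z \<le> - (p * x1 - q * x0)}"
  proof (rule hull_minimal)
    show "set Q \<subseteq> {z. ?v \<bullet> z \<le> - (p * x1 - q * x0)}"
    proof
      fix z assume "z \<in> set Q"
      then have "lin x0 x1 p q (fst z) \<le> (x1 - x0) * snd z" using V[of "fst z" "snd z"] by simp
      then show "z \<in> {z. ?v \<bullet> z \<le> - (p * x1 - q * x0)}" using lin_inner[of x0 x1 p q z] by simp
    qed
  qed (rule convex_halfspace_le)
  from interior_mono[OF this] have i: "interior (hull_of Q) \<subseteq> {z. ?v \<bullet> z < - (p * x1 - q * x0)}"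
    unfolding interior_halfspace_le[OF v] .
  show ?thesis unfolding misses_def
  proof (rule equals0I)
    fix z assume z: "z \<in> interior (hull_of Q) \<inter> \<Gamma>"
    then have "(fst z, snd z) \<in> hull_of Q" using interior_subset by auto
    then have "x0 \<le> fst z \<and> fst z \<le> x1" by (rule hull_in_slab[rotated]) (use V in blast)
    moreover have "(fst z, snd z) \<in> \<Gamma>" using z by simp
    ultimately have "(x1 - x0) * snd z \<le> lin x0 x1 p q (fst z)" using b unfolding below_def by blast
    moreover have "?v \<bullet> z < - (p * x1 - q * x0)" using i z by blast
    ultimately show False using lin_inner[of x0 x1 p q z] by linarith
  qed
qed

lemma misses_below:
  assumes x: "x0 < x1" and V: "\<And>x y. (x, y) \<in> set Q \<Longrightarrow> x0 \<le> x \<and> x \<le> x1 \<and> (x1 - x0) * y \<le> lin x0 x1 p q x"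
    and b: "above \<Gamma> x0 x1 p q"
  shows "misses \<Gamma> (hull_of Q)"
proof -
  let ?v = "(q - p, - (x1 - x0))"
  have v: "?v \<noteq> 0" using x by (simp add: zero_prod_def)
  have "hull_of Q \<subseteq> {z. ?v \<bullet> z \<ge> - (p * x1 - q * x0)}"
  proof (rule hull_minimal)
    show "set Q \<subseteq> {z. ?v \<bullet> z \<ge> - (p * x1 - q * x0)}"
    proof
      fix z assume "z \<in> set Q"
      then have "(x1 - x0) * snd z \<le> lin x0 x1 p q (fst z)" using V[of "fst z" "snd z"] by simp
      then show "z \<in> {z. ?v \<bullet> z \<ge> - (p * x1 - q * x0)}" using lin_inner[of x0 x1 p q z] by simp
    qed
  qed (rule convex_halfspace_ge)
  from interior_mono[OF this] have i: "interior (hull_of Q) \<subseteq> {z. ?v \<bullet> z > - (p * x1 - q * x0)}"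
    unfolding interior_halfspace_ge[OF v] .
  show ?thesis unfolding misses_def
  proof (rule equals0I)
    fix z assume z: "z \<in> interior (hull_of Q) \<inter> \<Gamma>"
    then have "(fst z, snd z) \<in> hull_of Q" using interior_subset by auto
    then have "x0 \<le> fst z \<and> fst z \<le> x1" by (rule hull_in_slab[rotated]) (use V in blast)
    moreover have "(fst z, snd z) \<in> \<Gamma>" using z by simp
    ultimately have "lin x0 x1 p q (fst z) \<le> (x1 - x0) * snd z" using b unfolding above_def by blast
    moreover have "?v \<bullet> z > - (p * x1 - q * x0)" using i z by blast
    ultimately show False using lin_inner[of x0 x1 p q z] by linarith
  qed
qed

lemma measure_quad:
  assumes "x0 < x1" "a \<le> d" "b \<le> c" and V: "set Q \<subseteq> {(x0, a), (x1, b), (x1, c), (x0, d)}"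
  shows "measure lebesgue (hull_of Q) \<le> (x1 - x0) * ((d - a) + (c - b))"
proof (rule sheared_strip)
  define s where "s = (b - a) / (x1 - x0)"
  have s: "s * x1 - s * x0 = b - a" using assms(1) unfolding right_diff_distrib[symmetric] s_def by simp
  let ?l = "\<lambda>x. a + s * (x - x0)" and ?h = "(d - a) + (c - b)"
  let ?T = "{z. (1,0) \<bullet> z \<ge> x0} \<inter> {z. (1,0) \<bullet> z \<le> x1} \<inter> {z. (- s, 1) \<bullet> z \<ge> a - s * x0} \<inter> {z. (- s, 1) \<bullet> z \<le> a - s * x0 + ?h}"
  show "continuous_on UNIV ?l" by (intro continuous_intros)
  show "0 \<le> ?h" using assms by simp
  have T: "z \<in> ?T \<longleftrightarrow> x0 \<le> fst z \<and> fst z \<le> x1 \<and> a - s * x0 \<le> snd z - s * fst z \<and> snd z - s * fst z \<le> a - s * x0 + ?h" for z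
    by (simp add: inner_prod_def)
  have "(x0, a) \<in> ?T" "(x1, b) \<in> ?T" "(x1, c) \<in> ?T" "(x0, d) \<in> ?T"
    unfolding T fst_conv snd_conv using assms(1-3) s by linarith+
  then have "hull_of Q \<subseteq> ?T"
    by (intro hull_minimal convex_Int convex_halfspace_ge convex_halfspace_le order_trans[OF V]) blast
  then show "hull_of Q \<subseteq> {(x, y). x0 \<le> x \<and> x \<le> x1 \<and> ?l x \<le> y \<and> y \<le> ?l x + ?h}"
    unfolding subset_iff T right_diff_distrib by force
qed (use assms in simp)

lemma isolates_turn: "isolates P [b, c, d, a] k \<alpha> \<Longrightarrow> isolates P [a, b, c, d] k \<alpha>"
  using isolates_rotate[of P "[a, b, c, d]"] by simp

lemma isolates_split_quad:
  "isolates P [a, b, midpoint b c] k1 \<alpha>1 \<Longrightarrow> isolates P [a, midpoint b c, c, d] k2 \<alpha>2 \<Longrightarrow>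
    isolates P [a, b, c, d] (1 + k1 + k2) (\<alpha>1 + \<alpha>2)"
  "isolates P [d, midpoint b c, c] k1 \<alpha>1 \<Longrightarrow> isolates P [a, b, midpoint b c, d] k2 \<alpha>2 \<Longrightarrow>
    isolates P [a, b, c, d] (1 + k1 + k2) (\<alpha>1 + \<alpha>2)"
  "isolates P [a, midpoint a b, midpoint c d, d] k1 \<alpha>1 \<Longrightarrow> isolates P [midpoint a b, b, c, midpoint c d] k2 \<alpha>2 \<Longrightarrow>
    isolates P [a, b, c, d] (1 + k1 + k2) (\<alpha>1 + \<alpha>2)"
proof -
  show "isolates P [a, b, c, d] (1 + k1 + k2) (\<alpha>1 + \<alpha>2)"
    if "isolates P [a, b, midpoint b c] k1 \<alpha>1" "isolates P [a, midpoint b c, c, d] k2 \<alpha>2"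
    by (rule isolates.step[OF split_cell.vertex_midpoint_quad that]) auto
  show "isolates P [a, b, c, d] (1 + k1 + k2) (\<alpha>1 + \<alpha>2)"
    if 1: "isolates P [d, midpoint b c, c] k1 \<alpha>1" and 2: "isolates P [a, b, midpoint b c, d] k2 \<alpha>2"
    by (intro isolates_turn[of P b c d a] isolates_turn[of P c d a b] isolates_turn[of P d a b c]
        isolates.step[OF split_cell.vertex_midpoint_quad' isolates_turn[OF 2] 1]) auto
  show "isolates P [a, b, c, d] (1 + k1 + k2) (\<alpha>1 + \<alpha>2)"
    if "isolates P [a, midpoint a b, midpoint c d, d] k1 \<alpha>1" "isolates P [midpoint a b, b, c, midpoint c d] k2 \<alpha>2"
    by (rule isolates.step[OF split_cell.midpoint_midpoint_quad that]) auto
qed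

context
  fixes \<Gamma> :: "point set" and x0 x1 :: real
  assumes x01: "x0 < x1"
begin

abbreviation "isol \<equiv> isolates (misses \<Gamma>)"
abbreviation "qd \<equiv> quad x0 x1"

lemma split_right:
  "isol [(x0, a), (x1, b), (x1, (b + c) / 2)] k1 \<alpha>1 \<Longrightarrow> isol (qd a ((b + c) / 2) c d) k2 \<alpha>2 \<Longrightarrow>
    isol (qd a b c d) (1 + k1 + k2) (\<alpha>1 + \<alpha>2)"
  "isol [(x0, d), (x1, (b + c) / 2), (x1, c)] k1 \<alpha>1 \<Longrightarrow> isol (qd a b ((b + c) / 2) d) k2 \<alpha>2 \<Longrightarrow>
    isol (qd a b c d) (1 + k1 + k2) (\<alpha>1 + \<alpha>2)"
  using isolates_split_quad(1)[of _ "(x0, a)" "(x1, b)" "(x1, c)"] isolates_split_quad(2)[of _ "(x0, d)" "(x1, b)" "(x1, c)"]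
  by simp_all

lemma split_left:
  "isol [(x1, c), (x0, d), (x0, (a + d) / 2)] k1 \<alpha>1 \<Longrightarrow> isol (qd a b c ((a + d) / 2)) k2 \<alpha>2 \<Longrightarrow>
    isol (qd a b c d) (1 + k1 + k2) (\<alpha>1 + \<alpha>2)"
  "isol [(x1, b), (x0, (a + d) / 2), (x0, a)] k1 \<alpha>1 \<Longrightarrow> isol (qd ((a + d) / 2) b c d) k2 \<alpha>2 \<Longrightarrow>
    isol (qd a b c d) (1 + k1 + k2) (\<alpha>1 + \<alpha>2)"
proof -
  have ad: "(a + d) / 2 = (d + a) / 2" by simp
  show "isol (qd a b c d) (1 + k1 + k2) (\<alpha>1 + \<alpha>2)"
    if 1: "isol [(x1, c), (x0, d), (x0, (a + d) / 2)] k1 \<alpha>1" and 2: "isol (qd a b c ((a + d) / 2)) k2 \<alpha>2"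
  proof (rule isolates_turn, rule isolates_turn, rule isolates_split_quad(1)[of _ "(x1, c)" "(x0, d)" "(x0, a)"])
    show "isol [(x1, c), (x0, d), midpoint (x0, d) (x0, a)] k1 \<alpha>1" using 1 unfolding ad by simp
    show "isol [(x1, c), midpoint (x0, d) (x0, a), (x0, a), (x1, b)] k2 \<alpha>2"
      by (rule isolates_turn, rule isolates_turn) (use 2 in \<open>simp add: ad\<close>)
  qed
  show "isol (qd a b c d) (1 + k1 + k2) (\<alpha>1 + \<alpha>2)"
    if 1: "isol [(x1, b), (x0, (a + d) / 2), (x0, a)] k1 \<alpha>1" and 2: "isol (qd ((a + d) / 2) b c d) k2 \<alpha>2"
  proof (rule isolates_turn, rule isolates_turn, rule isolates_split_quad(2)[of _ "(x1, b)" "(x0, d)" "(x0, a)"])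
    show "isol [(x1, b), midpoint (x0, d) (x0, a), (x0, a)] k1 \<alpha>1" using 1 unfolding ad by simp
    show "isol [(x1, c), (x0, d), midpoint (x0, d) (x0, a), (x1, b)] k2 \<alpha>2"
      by (rule isolates_turn, rule isolates_turn) (use 2 in \<open>simp add: ad\<close>)
  qed
qed

lemma split_across:
  assumes 1: "isol (qd a b ((b + c) / 2) ((a + d) / 2)) k1 \<alpha>1" and 2: "isol (qd ((a + d) / 2) ((b + c) / 2) c d) k2 \<alpha>2"
  shows "isol (qd a b c d) (1 + k1 + k2) (\<alpha>1 + \<alpha>2)"
proof -
  have ad: "(a + d) / 2 = (d + a) / 2" by simp
  show ?thesis
  proof (rule isolates_turn, rule isolates_split_quad(3))
    show "isol [(x1, b), midpoint (x1, b) (x1, c), midpoint (x0, d) (x0, a), (x0, a)] k1 \<alpha>1"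
      by (rule isolates_turn, rule isolates_turn, rule isolates_turn) (use 1 in \<open>simp add: ad\<close>)
    show "isol [midpoint (x1, b) (x1, c), (x1, c), (x0, d), midpoint (x0, d) (x0, a)] k2 \<alpha>2"
      by (rule isolates_turn, rule isolates_turn, rule isolates_turn) (use 2 in \<open>simp add: ad\<close>)
  qed
qed

lemma small_triangle:
  "b \<le> m \<Longrightarrow> isol [(x0, a), (x1, b), (x1, m)] 0 ((x1 - x0) * (m - b))"
  "a \<le> m \<Longrightarrow> isol [(x1, b), (x0, m), (x0, a)] 0 ((x1 - x0) * (m - a))"
  using measure_quad[OF x01, of a a b m "[(x0, a), (x1, b), (x1, m)]"] measure_quad[OF x01, of a m b b "[(x1, b), (x0, m), (x0, a)]"]
  by (auto intro!: isolates.small)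

lemma telescope: "X * (m - b) + (X * (q - m) + A) = X * (q - b) + (A :: real)"
  by (simp add: algebra_simps)

text \<open>\<open>\<Gamma>\<close> reaches down to the lower side of the quadrilateral. If the midpoint of the right side is above
  the line, the triangle above it misses \<open>\<Gamma>\<close>. If it is below, the triangle
  under it becomes part of the area that is given up, and it is counted as part of \<open>q - b\<close>.\<close>

lemma reduce_right_anchored:
  assumes G: "below \<Gamma> x0 x1 p q" and p: "p \<le> d"
    and cont: "\<And>b' c'. b' \<le> q \<Longrightarrow> q \<le> c' \<Longrightarrow> c' - b' = (c - b) / 2 ^ n \<Longrightarrow> isol (qd a b' c' d) k \<alpha>"
    and q: "b \<le> q" "q \<le> c"
  shows "isol (qd a b c d) (real n + k) ((x1 - x0) * (q - b) + \<alpha>)"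
  using cont q
proof (induction n arbitrary: b c)
  case 0
  have "isol (qd a b c d) k \<alpha>" using 0 by simp
  then show ?case by (rule isolates_weaken) (use 0 x01 in auto)
next
  case (Suc n)
  let ?m = "(b + c) / 2"
  show ?case
  proof (cases "q \<le> ?m")
    case True
    have "isol (qd a b ?m d) (real n + k) ((x1 - x0) * (q - b) + \<alpha>)"
      by (rule Suc.IH[OF Suc.prems(1)]) (use True Suc.prems(2) in \<open>auto simp: field_simps\<close>)
    moreover have "isol [(x0, d), (x1, ?m), (x1, c)] 0 0"
      by (rule isolates.good, rule misses_above[OF x01, of _ p q])
        (use True Suc.prems p x01 G in \<open>auto simp: lin_def mult_right_mono\<close>)
    ultimately show ?thesis using isolates_weaken[OF split_right(2)] by fastforce
  next
    case False
    have "isol (qd a ?m c d) (real n + k) ((x1 - x0) * (q - ?m) + \<alpha>)"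
      by (rule Suc.IH[OF Suc.prems(1)]) (use False Suc.prems in \<open>auto simp: field_simps\<close>)
    then have "isol (qd a b c d) (1 + 0 + (real n + k)) ((x1 - x0) * (?m - b) + ((x1 - x0) * (q - ?m) + \<alpha>))"
      using Suc.prems by (intro split_right(1) small_triangle) auto
    then show ?thesis unfolding telescope by (rule isolates_weaken) auto
  qed
qed

lemma reduce_left_anchored:
  assumes G: "below \<Gamma> x0 x1 p q" and q: "q \<le> c"
    and cont: "\<And>a' d'. a' \<le> p \<Longrightarrow> p \<le> d' \<Longrightarrow> d' - a' = (d - a) / 2 ^ n \<Longrightarrow> isol (qd a' b c d') k \<alpha>"
    and p: "a \<le> p" "p \<le> d"
  shows "isol (qd a b c d) (real n + k) ((x1 - x0) * (p - a) + \<alpha>)"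
  using cont p
proof (induction n arbitrary: a d)
  case 0
  have "isol (qd a b c d) k \<alpha>" using 0 by simp
  then show ?case by (rule isolates_weaken) (use 0 x01 in auto)
next
  case (Suc n)
  let ?m = "(a + d) / 2"
  show ?case
  proof (cases "p \<le> ?m")
    case True
    have "isol (qd a b c ?m) (real n + k) ((x1 - x0) * (p - a) + \<alpha>)"
      by (rule Suc.IH[OF Suc.prems(1)]) (use True Suc.prems(2) in \<open>auto simp: field_simps\<close>)
    moreover have "isol [(x1, c), (x0, d), (x0, ?m)] 0 0"
      by (rule isolates.good, rule misses_above[OF x01, of _ p q])
        (use True Suc.prems q x01 G in \<open>auto simp: lin_def mult_right_mono\<close>)
    ultimately show ?thesis using isolates_weaken[OF split_left(1)] by fastforce
  next
    case False
    have "isol (qd ?m b c d) (real n + k) ((x1 - x0) * (p - ?m) + \<alpha>)"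
      by (rule Suc.IH[OF Suc.prems(1)]) (use False Suc.prems in \<open>auto simp: field_simps\<close>)
    then have "isol (qd a b c d) (1 + 0 + (real n + k)) ((x1 - x0) * (?m - a) + ((x1 - x0) * (p - ?m) + \<alpha>))"
      using Suc.prems by (intro split_left(2) small_triangle) auto
    then show ?thesis unfolding telescope by (rule isolates_weaken) auto
  qed
qed

text \<open>After \<open>n\<close> bisections of either side the remaining quadrilateral is given up as well.\<close>

lemma isolate_below:
  assumes "below \<Gamma> x0 x1 p q" "a \<le> p" "p \<le> d" "b \<le> q" "q \<le> c"
  shows "isol (qd a b c d) (2 * real n) ((x1 - x0) * ((p - a) + (q - b) + ((d - a) + (c - b)) / 2 ^ n))"
proof -
  define E where "E = ((d - a) + (c - b)) / 2 ^ n"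
  have E: "E = (d - a) / 2 ^ n + (c - b) / 2 ^ n" unfolding E_def by (rule add_divide_distrib)
  have "isol (qd a b c d) (real n + (real n + 0)) ((x1 - x0) * (q - b) +
      ((x1 - x0) * (p - a) + (x1 - x0) * E))"
  proof (rule reduce_right_anchored[OF assms(1,3) _ assms(4,5)])
    fix b' c' assume bc: "b' \<le> q" "q \<le> c'" "c' - b' = (c - b) / 2 ^ n"
    show "isol (qd a b' c' d) (real n + 0) ((x1 - x0) * (p - a) + (x1 - x0) * E)"
    proof (rule reduce_left_anchored[OF assms(1) bc(2) _ assms(2,3)])
      fix a' d' assume ad: "a' \<le> p" "p \<le> d'" "d' - a' = (d - a) / 2 ^ n"
      show "isol (qd a' b' c' d') 0 ((x1 - x0) * E)"
        unfolding E ad(3)[symmetric] bc(3)[symmetric]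
        by (rule isolates.small, rule measure_quad) (use x01 ad bc in auto)
    qed
  qed
  then show ?thesis unfolding E_def[symmetric] by (rule isolates_weaken) (simp_all add: algebra_simps)
qed

end

lemma isolate_above:
  assumes x: "x0 < x1" and "above \<Gamma> x0 x1 p q" "a \<le> p" "p \<le> d" "b \<le> q" "q \<le> c"
  shows "isolates (misses \<Gamma>) (quad x0 x1 a b c d) (2 * real n) ((x1 - x0) * ((d - p) + (c - q) + ((d - a) + (c - b)) / 2 ^ n))"
proof -
  let ?f = "half_turn (x0 + x1)"
  have f: "?f (?f z) = z" for z by (simp add: half_turn_def)
  have fc: "continuous_on UNIV ?f" unfolding half_turn_def[abs_def] by (intro continuous_intros)
  have "below (?f ` \<Gamma>) x0 x1 (- q) (- p)"
    unfolding below_def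
  proof (clarify)
    fix x y u v assume "(u, v) \<in> \<Gamma>" "(x, y) = ?f (u, v)" and xx: "x0 \<le> x" "x \<le> x1"
    moreover from this(2) have uv: "x = x0 + x1 - u" "y = - v" by (simp_all add: half_turn_def)
    ultimately have "lin x0 x1 p q u \<le> (x1 - x0) * v" using assms(2) unfolding above_def by fastforce
    then show "(x1 - x0) * y \<le> lin x0 x1 (- q) (- p) x" by (simp add: uv lin_def algebra_simps)
  qed
  then have "isolates (misses (?f ` \<Gamma>)) (quad x0 x1 (- c) (- d) (- a) (- b)) (2 * real n)
    ((x1 - x0) * ((- q - - c) + (- p - - d) + ((- b - - c) + (- a - - d)) / 2 ^ n))"
    by (rule isolate_below[OF x]) (use assms in auto)
  then have "isolates (\<lambda>S. misses \<Gamma> (?f ` S)) (quad x0 x1 (- c) (- d) (- a) (- b)) (2 * real n)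
    ((x1 - x0) * ((- q - - c) + (- p - - d) + ((- b - - c) + (- a - - d)) / 2 ^ n))"
    by (rule isolates_mono) (rule misses_image[OF _ fc f f])
  from isolates_rigid[OF this rigid_half_turn]
  have "isolates (misses \<Gamma>) [(x1, c), (x0, d), (x0, a), (x1, b)] (2 * real n)
    ((x1 - x0) * ((- q - - c) + (- p - - d) + ((- b - - c) + (- a - - d)) / 2 ^ n))"
    by (simp add: half_turn_def)
  from isolates_turn[OF isolates_turn[OF this]] show ?thesis by (rule isolates_weaken) (simp_all add: algebra_simps)
qed

context
  fixes \<Gamma> :: "point set" and x0 x1 p1 p2 q1 q2 :: real
  assumes x01: "x0 < x1" and pq: "p1 \<le> p2" "q1 \<le> q2"
    and strip: "above \<Gamma> x0 x1 p1 q1" "below \<Gamma> x0 x1 p2 q2"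
begin

abbreviation (input) "isol' \<equiv> isolates (misses \<Gamma>)"
abbreviation (input) "qd' \<equiv> quad x0 x1"

text \<open>Bisection of the right side stops when its midpoint is inside the strip. From then on the strip has
  to be treated from that point upwards and downwards separately.\<close>

lemma reduce_right:
  assumes p: "a \<le> p1" "p2 \<le> d"
    and cont: "\<And>b' c'. b' \<le> q1 \<Longrightarrow> q2 \<le> c' \<Longrightarrow> c' - b' \<le> c - b \<Longrightarrow> c' - b' \<le> (c - b) / 2 ^ n \<or> q1 \<le> (b' + c') / 2 \<and> (b' + c') / 2 \<le> q2 \<Longrightarrow>
      isol' (qd' a b' c' d) k \<alpha>"
    and q: "b \<le> q1" "q2 \<le> c"
  shows "isol' (qd' a b c d) (real n + k) \<alpha>"
  using cont q
proof (induction n arbitrary: b c)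
  case 0
  then show ?case by simp
next
  case (Suc n)
  let ?m = "(b + c) / 2"
  have bc: "b \<le> c" using Suc.prems pq by linarith
  consider "q1 \<le> ?m" "?m \<le> q2" | "q2 < ?m" | "?m < q1" by linarith
  then show ?case
  proof cases
    case 1
    have "isol' (qd' a b c d) k \<alpha>" by (rule Suc.prems(1)) (use 1 Suc.prems in auto)
    then show ?thesis by (rule isolates_weaken) auto
  next
    case 2
    have "isol' (qd' a b ?m d) (real n + k) \<alpha>"
      by (rule Suc.IH, rule Suc.prems(1)) (use 2 Suc.prems(2) bc in \<open>auto simp: field_simps\<close>)
    moreover have "isol' [(x0, d), (x1, ?m), (x1, c)] 0 0"
      by (rule isolates.good, rule misses_above[OF x01, of _ p2 q2])
        (use 2 Suc.prems p x01 strip in \<open>auto simp: lin_def mult_right_mono\<close>)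
    ultimately show ?thesis using isolates_weaken[OF split_right(2)[OF x01]] by fastforce
  next
    case 3
    have "isol' (qd' a ?m c d) (real n + k) \<alpha>"
      by (rule Suc.IH, rule Suc.prems(1)) (use 3 Suc.prems(3) bc in \<open>auto simp: field_simps\<close>)
    moreover have "isol' [(x0, a), (x1, b), (x1, ?m)] 0 0"
      by (rule isolates.good, rule misses_below[OF x01, of _ p1 q1])
        (use 3 Suc.prems p x01 strip in \<open>auto simp: lin_def mult_right_mono\<close>)
    ultimately show ?thesis using isolates_weaken[OF split_right(1)[OF x01]] by fastforce
  qed
qed

lemma reduce_left:
  assumes q: "b \<le> q1" "q2 \<le> c"
    and cont: "\<And>a' d'. a' \<le> p1 \<Longrightarrow> p2 \<le> d' \<Longrightarrow> d' - a' \<le> d - a \<Longrightarrow> d' - a' \<le> (d - a) / 2 ^ n \<or> p1 \<le> (a' + d') / 2 \<and> (a' + d') / 2 \<le> p2 \<Longrightarrow>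
      isol' (qd' a' b c d') k \<alpha>"
    and p: "a \<le> p1" "p2 \<le> d"
  shows "isol' (qd' a b c d) (real n + k) \<alpha>"
  using cont p
proof (induction n arbitrary: a d)
  case 0
  then show ?case by simp
next
  case (Suc n)
  let ?m = "(a + d) / 2"
  have ad: "a \<le> d" using Suc.prems pq by linarith
  consider "p1 \<le> ?m" "?m \<le> p2" | "p2 < ?m" | "?m < p1" by linarith
  then show ?case
  proof cases
    case 1
    have "isol' (qd' a b c d) k \<alpha>" by (rule Suc.prems(1)) (use 1 Suc.prems in auto)
    then show ?thesis by (rule isolates_weaken) auto
  next
    case 2
    have "isol' (qd' a b c ?m) (real n + k) \<alpha>"
      by (rule Suc.IH, rule Suc.prems(1)) (use 2 Suc.prems(2) ad in \<open>auto simp: field_simps\<close>)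
    moreover have "isol' [(x1, c), (x0, d), (x0, ?m)] 0 0"
      by (rule isolates.good, rule misses_above[OF x01, of _ p2 q2])
        (use 2 Suc.prems q x01 strip in \<open>auto simp: lin_def mult_right_mono\<close>)
    ultimately show ?thesis using isolates_weaken[OF split_left(1)[OF x01]] by fastforce
  next
    case 3
    have "isol' (qd' ?m b c d) (real n + k) \<alpha>"
      by (rule Suc.IH, rule Suc.prems(1)) (use 3 Suc.prems(3) ad in \<open>auto simp: field_simps\<close>)
    moreover have "isol' [(x1, b), (x0, ?m), (x0, a)] 0 0"
      by (rule isolates.good, rule misses_below[OF x01, of _ p1 q1])
        (use 3 Suc.prems q x01 strip in \<open>auto simp: lin_def mult_right_mono\<close>)
    ultimately show ?thesis using isolates_weaken[OF split_left(2)[OF x01]] by fastforce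
  qed
qed

text \<open>The segment between the two midpoints separates the strip into an upper and a lower part, each anchored
  at the segment. A side on which bisection did not stop is so short that it may be given up.\<close>

lemma isolate_halves:
  assumes "a \<le> p1" "p2 \<le> d" "b \<le> q1" "q2 \<le> c"
    and l: "d - a \<le> e1 \<or> p1 \<le> (a + d) / 2 \<and> (a + d) / 2 \<le> p2"
    and r: "c - b \<le> e2 \<or> q1 \<le> (b + c) / 2 \<and> (b + c) / 2 \<le> q2" and e: "0 \<le> e1" "0 \<le> e2"
  shows "isol' (qd' a b c d) (4 * real n + 1) ((x1 - x0) * ((p2 - p1) + (q2 - q1) + e1 + e2 + ((d - a) + (c - b)) / 2 ^ n))"
proof -
  let ?m = "(a + d) / 2" and ?n = "(b + c) / 2"
  obtain p1' p2' where p: "p1' \<le> p1" "p2 \<le> p2'" "a \<le> p1'" "p1' \<le> ?m" "?m \<le> p2'" "p2' \<le> d" "p2' - p1' \<le> (p2 - p1) + e1"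
  proof (cases "p1 \<le> ?m \<and> ?m \<le> p2")
    case True then show ?thesis using that[of p1 p2] assms(1,2) e by auto
  next
    case False then show ?thesis using that[of a d] assms(1,2) l pq by auto
  qed
  obtain q1' q2' where q: "q1' \<le> q1" "q2 \<le> q2'" "b \<le> q1'" "q1' \<le> ?n" "?n \<le> q2'" "q2' \<le> c" "q2' - q1' \<le> (q2 - q1) + e2"
  proof (cases "q1 \<le> ?n \<and> ?n \<le> q2")
    case True then show ?thesis using that[of q1 q2] assms(3,4) e by auto
  next
    case False then show ?thesis using that[of b c] assms(3,4) r pq by auto
  qed
  have "isol' (qd' ?m ?n c d) (2 * real n) ((x1 - x0) * ((p2' - ?m) + (q2' - ?n) + ((d - ?m) + (c - ?n)) / 2 ^ n))"
    by (rule isolate_below[OF x01 below_mono[OF strip(2) p(2) q(2)]]) (use p q in auto)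
  moreover have "isol' (qd' a b ?n ?m) (2 * real n) ((x1 - x0) * ((?m - p1') + (?n - q1') + ((?m - a) + (?n - b)) / 2 ^ n))"
    by (rule isolate_above[OF x01 above_mono[OF strip(1) p(1) q(1)]]) (use p q in auto)
  ultimately have *: "isol' (qd' a b c d) (1 + 2 * real n + 2 * real n)
     ((x1 - x0) * ((?m - p1') + (?n - q1') + ((?m - a) + (?n - b)) / 2 ^ n) + (x1 - x0) * ((p2' - ?m) + (q2' - ?n) + ((d - ?m) + (c - ?n)) / 2 ^ n))"
    by (intro split_across[OF x01])
  have "(x1 - x0) * ((?m - p1') + (?n - q1') + ((?m - a) + (?n - b)) / 2 ^ n) + (x1 - x0) * ((p2' - ?m) + (q2' - ?n) + ((d - ?m) + (c - ?n)) / 2 ^ n)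
    = (x1 - x0) * ((p2' - p1') + (q2' - q1') + (((?m - a) + (?n - b)) / 2 ^ n + ((d - ?m) + (c - ?n)) / 2 ^ n))"
    by (simp add: algebra_simps)
  also have "((?m - a) + (?n - b)) / 2 ^ n + ((d - ?m) + (c - ?n)) / 2 ^ n = ((d - a) + (c - b)) / 2 ^ n"
  proof -
    have "((?m - a) + (?n - b)) + ((d - ?m) + (c - ?n)) = (d - a) + (c - b)" by argo
    then show ?thesis using add_divide_distrib[of "(?m - a) + (?n - b)" "(d - ?m) + (c - ?n)" "2 ^ n"] by argo
  qed
  also have "(x1 - x0) * ((p2' - p1') + (q2' - q1') + ((d - a) + (c - b)) / 2 ^ n) \<le>
     (x1 - x0) * ((p2 - p1) + (q2 - q1) + e1 + e2 + ((d - a) + (c - b)) / 2 ^ n)"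
    using p(7) q(7) x01 by (intro mult_left_mono) linarith+
  finally show ?thesis by (intro isolates_weaken[OF *]) auto
qed

text \<open>Bisecting the two vertical sides towards the strip costs a number of splits proportional to the
  number of halvings; the area left is that of the strip up to an exponentially small error.\<close>

theorem isolate_strip:
  assumes p: "a \<le> p1" "p2 \<le> d" and q: "b \<le> q1" "q2 \<le> c"
  shows "isol' (qd' a b c d) (6 * real n + 1) ((x1 - x0) * ((p2 - p1) + (q2 - q1) + 2 * ((d - a) + (c - b)) / 2 ^ n))"
proof -
  let ?\<alpha> = "(x1 - x0) * ((p2 - p1) + (q2 - q1) + 2 * ((d - a) + (c - b)) / 2 ^ n)"
  have ad: "a \<le> d" "b \<le> c" using p q pq by linarith+
  have "isol' (qd' a b c d) (real n + (real n + (4 * real n + 1))) ?\<alpha>"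
  proof (rule reduce_right[OF p _ q])
    fix b' c' assume bc: "b' \<le> q1" "q2 \<le> c'" "c' - b' \<le> c - b" "c' - b' \<le> (c - b) / 2 ^ n \<or> q1 \<le> (b' + c') / 2 \<and> (b' + c') / 2 \<le> q2"
    show "isol' (qd' a b' c' d) (real n + (4 * real n + 1)) ?\<alpha>"
    proof (rule reduce_left[OF bc(1,2) _ p])
      fix a' d' assume da: "a' \<le> p1" "p2 \<le> d'" "d' - a' \<le> d - a" "d' - a' \<le> (d - a) / 2 ^ n \<or> p1 \<le> (a' + d') / 2 \<and> (a' + d') / 2 \<le> p2"
      have "isol' (qd' a' b' c' d') (4 * real n + 1) ((x1 - x0) * ((p2 - p1) + (q2 - q1) + (d - a) / 2 ^ n + (c - b) / 2 ^ n + ((d' - a') + (c' - b')) / 2 ^ n))"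
        by (rule isolate_halves[OF da(1,2) bc(1,2) da(4) bc(4)]) (use ad in auto)
      moreover have "(x1 - x0) * ((p2 - p1) + (q2 - q1) + (d - a) / 2 ^ n + (c - b) / 2 ^ n + ((d' - a') + (c' - b')) / 2 ^ n) \<le> ?\<alpha>"
      proof (rule mult_left_mono)
        have "((d' - a') + (c' - b')) / 2 ^ n \<le> ((d - a) + (c - b)) / 2 ^ n" using da(3) bc(3) by (intro divide_right_mono) auto
        moreover have "((d - a) + (c - b)) / 2 ^ n = (d - a) / 2 ^ n + (c - b) / 2 ^ n" by (rule add_divide_distrib)
        moreover have "2 * ((d - a) + (c - b)) / 2 ^ n = 2 * (((d - a) + (c - b)) / 2 ^ n)" by simp
        ultimately show "(p2 - p1) + (q2 - q1) + (d - a) / 2 ^ n + (c - b) / 2 ^ n + ((d' - a') + (c' - b')) / 2 ^ n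
           \<le> (p2 - p1) + (q2 - q1) + 2 * ((d - a) + (c - b)) / 2 ^ n" by linarith
      qed (use x01 in simp)
      ultimately show "isol' (qd' a' b' c' d') (4 * real n + 1) ?\<alpha>" using isolates_weaken by blast
    qed
  qed
  then show ?thesis by (rule isolates_weaken) auto
qed

end



section \<open>A square crossed by the boundary\<close>

lemma slope_strip:
  fixes S :: "point set"
  assumes w: "0 < w" and p: "p \<in> S" "x0 \<le> fst p" "fst p \<le> x0 + w"
    and m: "\<And>q. q \<in> S \<Longrightarrow> \<bar>snd q - snd p - m * (fst q - fst p)\<bar> \<le> c * (fst q - fst p)\<^sup>2" and c: "0 \<le> c"
    and H: "Y \<le> snd p - (\<bar>m\<bar> * w + c * w\<^sup>2)" "snd p + (\<bar>m\<bar> * w + c * w\<^sup>2) \<le> Y + b"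
  shows "isolates (misses S) (quad x0 (x0 + w) Y Y (Y + b) (Y + b)) (6 * real n + 1) (w * (4 * (c * w\<^sup>2) + 4 * b / 2 ^ n))"
proof -
  define \<delta> where "\<delta> = c * w\<^sup>2"
  have \<delta>: "0 \<le> \<delta>" using c by (simp add: \<delta>_def)
  define u where "u = snd p + m * (x0 - fst p)" define v where "v = snd p + m * (x0 + w - fst p)"
  have near: "\<bar>snd q - snd p - m * (fst q - fst p)\<bar> \<le> \<delta>" if "q \<in> S" "x0 \<le> fst q" "fst q \<le> x0 + w" for q
  proof -
    have "\<bar>fst q - fst p\<bar> \<le> w" using that p by linarith
    then have "(fst q - fst p)\<^sup>2 \<le> w\<^sup>2" using w by (simp add: abs_le_square_iff[symmetric])
    then have "c * (fst q - fst p)\<^sup>2 \<le> \<delta>" unfolding \<delta>_def using c by (rule mult_left_mono)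
    then show ?thesis using m[OF that(1)] by linarith
  qed
  have lin: "lin x0 (x0 + w) (u + e) (v + e) x = w * (snd p + m * (x - fst p) + e)" for e x
    by (simp add: lin_def u_def v_def algebra_simps)
  have "above S x0 (x0 + w) (u - \<delta>) (v - \<delta>)"
    unfolding above_def
  proof clarify
    fix x y assume "(x, y) \<in> S" "x0 \<le> x" "x \<le> x0 + w"
    then have "snd p + m * (x - fst p) + - \<delta> \<le> y" using near[of "(x, y)"] by simp
    then show "lin x0 (x0 + w) (u - \<delta>) (v - \<delta>) x \<le> (x0 + w - x0) * y" using lin[of "- \<delta>" x] w by simp
  qed
  moreover have "below S x0 (x0 + w) (u + \<delta>) (v + \<delta>)"
    unfolding below_def
  proof clarify
    fix x y assume "(x, y) \<in> S" "x0 \<le> x" "x \<le> x0 + w"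
    then have "y \<le> snd p + m * (x - fst p) + \<delta>" using near[of "(x, y)"] by simp
    then show "(x0 + w - x0) * y \<le> lin x0 (x0 + w) (u + \<delta>) (v + \<delta>) x" using lin[of \<delta> x] w by simp
  qed
  moreover have "\<bar>m * (x - fst p)\<bar> \<le> \<bar>m\<bar> * w" if "x0 \<le> x" "x \<le> x0 + w" for x
    unfolding abs_mult using that p by (intro mult_left_mono) auto
  from this[of x0] this[of "x0 + w"] have "\<bar>m * (x0 - fst p)\<bar> \<le> \<bar>m\<bar> * w" "\<bar>m * (x0 + w - fst p)\<bar> \<le> \<bar>m\<bar> * w"
    using w by auto
  then have "Y \<le> u - \<delta>" "Y \<le> v - \<delta>" "u + \<delta> \<le> Y + b" "v + \<delta> \<le> Y + b"
    using H unfolding u_def v_def \<delta>_def[symmetric] by linarith+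
  ultimately have "isolates (misses S) (quad x0 (x0 + w) Y Y (Y + b) (Y + b)) (6 * real n + 1)
     ((x0 + w - x0) * (((u + \<delta>) - (u - \<delta>)) + ((v + \<delta>) - (v - \<delta>)) + 2 * ((Y + b - Y) + (Y + b - Y)) / 2 ^ n))"
    using \<delta> w by (intro isolate_strip) auto
  then show ?thesis by (rule isolates_weaken) (simp_all add: \<delta>_def)
qed

text \<open>Cruder than \<open>slope_strip\<close>, but applicable also if the strip leaves the square: the band is
  clipped to the square.\<close>

lemma level_band:
  fixes S :: "point set"
  assumes w: "0 < w" and p: "p \<in> S" "x0 \<le> fst p" "fst p \<le> x0 + w"
    and m: "\<And>q. q \<in> S \<Longrightarrow> \<bar>snd q - snd p - m * (fst q - fst p)\<bar> \<le> c * (fst q - fst p)\<^sup>2" and c: "0 \<le> c"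
    and S: "\<And>q. q \<in> S \<Longrightarrow> Y \<le> snd q \<and> snd q \<le> Y + b"
  shows "isolates (misses S) (quad x0 (x0 + w) Y Y (Y + b) (Y + b)) (6 * real n + 1)
     (w * (4 * (\<bar>m\<bar> * w + c * w\<^sup>2) + 4 * b / 2 ^ n))"
proof -
  define H where "H = \<bar>m\<bar> * w + c * w\<^sup>2"
  have H0: "0 \<le> H" using c w by (simp add: H_def)
  have near: "\<bar>snd q - snd p\<bar> \<le> H" if "q \<in> S" "x0 \<le> fst q" "fst q \<le> x0 + w" for q
  proof -
    have d: "\<bar>fst q - fst p\<bar> \<le> w" using that p by linarith
    then have "(fst q - fst p)\<^sup>2 \<le> w\<^sup>2" using w by (simp add: abs_le_square_iff[symmetric])
    then have "c * (fst q - fst p)\<^sup>2 \<le> c * w\<^sup>2" using c by (rule mult_left_mono)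
    moreover have "\<bar>m * (fst q - fst p)\<bar> \<le> \<bar>m\<bar> * w" unfolding abs_mult using d by (rule mult_left_mono) simp
    ultimately show ?thesis using m[OF that(1)] unfolding H_def by linarith
  qed
  define l where "l = max Y (snd p - H)" define u where "u = min (Y + b) (snd p + H)"
  have lin: "lin x0 (x0 + w) e e x = w * e" for e x by (simp add: lin_def algebra_simps)
  have "above S x0 (x0 + w) l l"
    unfolding above_def lin
  proof clarify
    fix x y assume "(x, y) \<in> S" "x0 \<le> x" "x \<le> x0 + w"
    then have "l \<le> y" using near[of "(x, y)"] S[of "(x, y)"] unfolding l_def by (simp del: diff_le_eq)
    then show "w * l \<le> (x0 + w - x0) * y" using w by simp
  qed
  moreover have "below S x0 (x0 + w) u u"
    unfolding below_def lin
  proof clarify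
    fix x y assume "(x, y) \<in> S" "x0 \<le> x" "x \<le> x0 + w"
    then have "y \<le> u" using near[of "(x, y)"] S[of "(x, y)"] unfolding u_def by (simp del: diff_le_eq)
    then show "(x0 + w - x0) * y \<le> w * u" using w by simp
  qed
  moreover have lu: "l \<le> u" using S[OF p(1)] H0 by (auto simp: l_def u_def)
  ultimately have "isolates (misses S) (quad x0 (x0 + w) Y Y (Y + b) (Y + b)) (6 * real n + 1)
     ((x0 + w - x0) * ((u - l) + (u - l) + 2 * ((Y + b - Y) + (Y + b - Y)) / 2 ^ n))"
    using w by (intro isolate_strip) (auto simp: l_def u_def)
  moreover have "u - l \<le> 2 * H" by (simp add: l_def u_def max_def min_def)
  then have "(x0 + w - x0) * ((u - l) + (u - l) + 2 * ((Y + b - Y) + (Y + b - Y)) / 2 ^ n) \<le> w * (4 * H + 4 * b / 2 ^ n)"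
    using w by simp
  ultimately show ?thesis unfolding H_def[symmetric] using isolates_weaken by blast
qed

lemma sum_double: fixes f :: "nat \<Rightarrow> real"
  shows "(\<Sum>i<2 ^ Suc r. f i) = (\<Sum>i<2^r. f i) + (\<Sum>i<2^r. f (i + 2 ^ r))"
proof -
  have "(\<Sum>i<m + n. f i) = (\<Sum>i<m. f i) + (\<Sum>i<n. f (i + m))" for m n :: nat
    by (induction n) (simp_all add: add.commute)
  from this[of "2 ^ r" "2 ^ r"] show ?thesis by (simp add: mult_2)
qed

text \<open>Joining the midpoints of the horizontal sides halves a rectangle; \<open>r\<close> rounds yield \<open>2 ^ r\<close> columns.\<close>

lemma isolates_columns:
  assumes "\<And>i. i < 2 ^ r \<Longrightarrow> isolates P (quad (x0 + real i * w) (x0 + (real i + 1) * w) a a d d) (k i) (\<alpha> i)"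
  shows "isolates P (quad x0 (x0 + 2 ^ r * w) a a d d) (2 ^ r - 1 + (\<Sum>i<2^r. k i)) (\<Sum>i<2^r. \<alpha> i)"
  using assms
proof (induction r arbitrary: x0 k \<alpha>)
  case 0
  then show ?case using 0[of 0] by simp
next
  case (Suc r)
  let ?x = "x0 + 2 ^ r * w"
  have 1: "isolates P (quad x0 ?x a a d d) (2 ^ r - 1 + (\<Sum>i<2^r. k i)) (\<Sum>i<2^r. \<alpha> i)"
    by (rule Suc.IH) (use Suc.prems in simp)
  have 2: "isolates P (quad ?x (?x + 2 ^ r * w) a a d d) (2 ^ r - 1 + (\<Sum>i<2^r. k (i + 2 ^ r))) (\<Sum>i<2^r. \<alpha> (i + 2 ^ r))"
  proof (rule Suc.IH)
    fix i :: nat assume "i < 2 ^ r"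
    then have "i + 2 ^ r < 2 ^ Suc r" by simp
    from Suc.prems[OF this]
    show "isolates P (quad (?x + real i * w) (?x + (real i + 1) * w) a a d d) (k (i + 2 ^ r)) (\<alpha> (i + 2 ^ r))"
      by (simp add: algebra_simps)
  qed
  let ?x' = "?x + 2 ^ r * w"
  have m: "midpoint (x0, e) (?x', e) = (?x, e)" "midpoint (?x', e) (x0, e) = (?x, e)" for e :: real
    by (simp_all add: midpoint_def)
  have "isolates P (quad x0 ?x' a a d d)
     (1 + (2 ^ r - 1 + (\<Sum>i<2^r. k i)) + (2 ^ r - 1 + (\<Sum>i<2^r. k (i + 2 ^ r)))) ((\<Sum>i<2^r. \<alpha> i) + (\<Sum>i<2^r. \<alpha> (i + 2 ^ r)))"
    by (rule isolates_split_quad(3)) (unfold m, fact 1, fact 2)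
  moreover have e: "x0 + 2 ^ Suc r * w = ?x'" by simp
  ultimately show ?case unfolding e sum_double by (elim isolates_weaken) auto
qed

lemma isolates_rows:
  assumes "\<And>i. i < 2 ^ r \<Longrightarrow> isolates P (quad x0 x1 (a + real i * h) (a + real i * h) (a + (real i + 1) * h) (a + (real i + 1) * h)) (k i) (\<alpha> i)"
  shows "isolates P (quad x0 x1 a a (a + 2 ^ r * h) (a + 2 ^ r * h)) (2 ^ r - 1 + (\<Sum>i<2^r. k i)) (\<Sum>i<2^r. \<alpha> i)"
  using assms
proof (induction r arbitrary: a k \<alpha>)
  case 0
  then show ?case using 0[of 0] by simp
next
  case (Suc r)
  let ?y = "a + 2 ^ r * h"
  have 1: "isolates P (quad x0 x1 a a ?y ?y) (2 ^ r - 1 + (\<Sum>i<2^r. k i)) (\<Sum>i<2^r. \<alpha> i)"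
    by (rule Suc.IH) (use Suc.prems in simp)
  have 2: "isolates P (quad x0 x1 ?y ?y (?y + 2 ^ r * h) (?y + 2 ^ r * h)) (2 ^ r - 1 + (\<Sum>i<2^r. k (i + 2 ^ r))) (\<Sum>i<2^r. \<alpha> (i + 2 ^ r))"
  proof (rule Suc.IH)
    fix i :: nat assume "i < 2 ^ r"
    then have "i + 2 ^ r < 2 ^ Suc r" by simp
    from Suc.prems[OF this]
    show "isolates P (quad x0 x1 (?y + real i * h) (?y + real i * h) (?y + (real i + 1) * h) (?y + (real i + 1) * h)) (k (i + 2 ^ r)) (\<alpha> (i + 2 ^ r))"
      by (simp add: algebra_simps)
  qed
  let ?y' = "?y + 2 ^ r * h"
  have m: "midpoint (e, a) (e, ?y') = (e, ?y)" "midpoint (e, ?y') (e, a) = (e, ?y)" for e :: real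
    by (simp_all add: midpoint_def)
  have "isolates P [(x1, a), (x1, ?y'), (x0, ?y'), (x0, a)]
     (1 + (2 ^ r - 1 + (\<Sum>i<2^r. k i)) + (2 ^ r - 1 + (\<Sum>i<2^r. k (i + 2 ^ r)))) ((\<Sum>i<2^r. \<alpha> i) + (\<Sum>i<2^r. \<alpha> (i + 2 ^ r)))"
  proof (rule isolates_split_quad(3))
    show "isolates P [(x1, a), midpoint (x1, a) (x1, ?y'), midpoint (x0, ?y') (x0, a), (x0, a)] (2 ^ r - 1 + (\<Sum>i<2^r. k i)) (\<Sum>i<2^r. \<alpha> i)"
      unfolding m by (rule isolates_turn, rule isolates_turn, rule isolates_turn) (rule 1)
    show "isolates P [midpoint (x1, a) (x1, ?y'), (x1, ?y'), (x0, ?y'), midpoint (x0, ?y') (x0, a)] (2 ^ r - 1 + (\<Sum>i<2^r. k (i + 2 ^ r))) (\<Sum>i<2^r. \<alpha> (i + 2 ^ r))"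
      unfolding m by (rule isolates_turn, rule isolates_turn, rule isolates_turn) (rule 2)
  qed
  from isolates_turn[OF this] have "isolates P (quad x0 x1 a a ?y' ?y')
     (1 + (2 ^ r - 1 + (\<Sum>i<2^r. k i)) + (2 ^ r - 1 + (\<Sum>i<2^r. k (i + 2 ^ r)))) ((\<Sum>i<2^r. \<alpha> i) + (\<Sum>i<2^r. \<alpha> (i + 2 ^ r)))" .
  moreover have e: "a + 2 ^ Suc r * h = ?y'" by simp
  ultimately show ?case unfolding e sum_double by (elim isolates_weaken) auto
qed

text \<open>Each index is charged its gap to the preceding one; the gaps add up to at most the length of the
  range.\<close>

lemma sum_gaps:
  fixes F :: "nat \<Rightarrow> real"
  assumes "finite E" "E \<noteq> {}" and "\<And>i. i \<in> E \<Longrightarrow> F i \<le> B"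
    and "\<And>i k. i \<in> E \<Longrightarrow> k \<in> E \<Longrightarrow> i < k \<Longrightarrow> F k \<le> a * (real k - real i)" "0 \<le> a"
  shows "sum F E \<le> B + a * real (Max E)"
  using assms
proof (induction rule: finite_linorder_max_induct)
  case empty then show ?case by simp
next
  case (insert b E)
  show ?case
  proof (cases "E = {}")
    case True
    then show ?thesis using insert.prems(2)[of b] insert.prems(4) by (simp add: add_increasing2)
  next
    case False
    have "sum F E \<le> B + a * real (Max E)" by (rule insert.IH) (use False insert.prems in auto)
    moreover have "Max E \<in> E" using insert.hyps(1) False by (rule Max_in)
    then have "F b \<le> a * (real b - real (Max E))" using insert.prems(3)[of "Max E" b] insert.hyps(2) by simp
    moreover have "Max (insert b E) = b" using insert.hyps by (intro Max_eqI) auto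
    moreover have "sum F (insert b E) = F b + sum F E" using insert.hyps by (intro sum.insert) auto
    ultimately show ?thesis by (simp add: right_diff_distrib)
  qed
qed

text \<open>Within one residue class modulo \<open>5\<close> distinct indices have distance at least \<open>5\<close>.\<close>

lemma sum_spaced:
  fixes F :: "nat \<Rightarrow> real"
  assumes E: "E \<subseteq> {..<N}" and a: "0 \<le> a" and B: "\<And>i. i \<in> E \<Longrightarrow> F i \<le> a * real N"
    and gap: "\<And>i k. i \<in> E \<Longrightarrow> k \<in> E \<Longrightarrow> i + 5 \<le> k \<Longrightarrow> F k \<le> a * (real k - real i)"
  shows "sum F E \<le> 10 * (a * real N)"
proof -
  have fin: "finite E" using E finite_subset by blast
  have "sum F {i \<in> E. i mod 5 = r} \<le> 2 * (a * real N)" for r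
  proof (cases "{i \<in> E. i mod 5 = r} = {}")
    case True then show ?thesis using a by (simp only: sum.empty) simp
  next
    case False
    let ?E = "{i \<in> E. i mod 5 = r}"
    have "sum F ?E \<le> a * real N + a * real (Max ?E)"
    proof (rule sum_gaps)
      fix i k assume ik: "i \<in> ?E" "k \<in> ?E" "i < k"
      then have "i mod 5 = k mod 5" by simp
      then have "5 dvd k - i" using ik(3) mod_eq_dvd_iff_nat[of i k 5] by simp
      then have "i + 5 \<le> k" using dvd_imp_le[of 5 "k - i"] ik(3) by simp
      then show "F k \<le> a * (real k - real i)" using gap ik by simp
    qed (use fin False B a in auto)
    moreover have "Max ?E \<in> ?E" using fin False by (intro Max_in) auto
    then have "Max ?E < N" using E by auto
    then have "a * real (Max ?E) \<le> a * real N" using a by (intro mult_left_mono) auto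
    ultimately show ?thesis by linarith
  qed
  then have "(\<Sum>r\<in>{..<5}. sum F {i \<in> E. i mod 5 = r}) \<le> (\<Sum>r\<in>{..<5::nat}. 2 * (a * real N))" by (intro sum_mono)
  moreover have "(\<Sum>r\<in>{..<5}. sum F {i \<in> E. i mod 5 = r}) = sum F E" by (rule sum.group) (use fin in auto)
  ultimately show ?thesis by simp
qed



text \<open>Two points of the curve at horizontal distance \<open>d\<close>, with slopes \<open>m\<close> and \<open>m'\<close>, whose heights
  differ by no more than the oscillation of the curve in a slab of width \<open>w\<close>. Between them the curve changes
  its height by about \<open>m * d\<close>, so the slope is small.\<close>

lemma exit_slope:
  fixes d w c m m' z :: real
  assumes w: "0 < w" "4 * w \<le> d" and c: "0 \<le> c"
    and t: "\<bar>z - m * d\<bar> \<le> c * d\<^sup>2" "\<bar>- z - m' * - d\<bar> \<le> c * d\<^sup>2" and z: "\<bar>z\<bar> \<le> max \<bar>m\<bar> \<bar>m'\<bar> * w + c * w\<^sup>2"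
  shows "\<bar>m'\<bar> \<le> 2 * c * d"
proof -
  define \<mu> where "\<mu> = max \<bar>m\<bar> \<bar>m'\<bar>"
  have d: "0 < d" using w by linarith
  have md: "\<bar>m\<bar> * d = \<bar>m * d\<bar>" "\<bar>m'\<bar> * d = \<bar>m' * d\<bar>" using d by (simp_all add: abs_mult)
  have 1: "\<mu> * d \<le> \<bar>z\<bar> + c * d\<^sup>2"
  proof -
    have "\<bar>m * d\<bar> \<le> \<bar>z\<bar> + c * d\<^sup>2" "\<bar>m' * d\<bar> \<le> \<bar>z\<bar> + c * d\<^sup>2"
      using t abs_triangle_ineq2[of "m * d" z] abs_triangle_ineq2[of "m' * d" z]
        abs_minus_commute[of z "m * d"] abs_minus_commute[of z "m' * d"] by simp_all
    moreover have "\<mu> * d = \<bar>m * d\<bar> \<or> \<mu> * d = \<bar>m' * d\<bar>" unfolding md[symmetric] by (simp add: \<mu>_def max_def)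
    ultimately show ?thesis by auto
  qed
  have "w\<^sup>2 \<le> (d / 4)\<^sup>2" using w by (intro power_mono) auto
  then have "c * w\<^sup>2 \<le> c * (d\<^sup>2 / 16)" using c by (intro mult_left_mono) (auto simp: power_divide)
  moreover have "\<mu> * w \<le> \<mu> * (d / 4)" using w by (intro mult_left_mono) (auto simp: \<mu>_def)
  ultimately have "\<mu> * d \<le> \<mu> * d / 4 + c * d\<^sup>2 / 16 + c * d\<^sup>2" using 1 z unfolding \<mu>_def[symmetric] by simp
  then have "12 * (\<mu> * d) \<le> 17 * (c * d\<^sup>2)" by argo
  moreover have "0 \<le> c * d\<^sup>2" using c by simp
  ultimately have "\<mu> * d \<le> 2 * (c * d\<^sup>2)" by argo
  then have "\<mu> * d \<le> (2 * c * d) * d" by (simp add: power2_eq_square mult.assoc)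
  then have "\<mu> \<le> 2 * c * d" using d by (rule mult_right_le_imp_le)
  then show ?thesis by (simp add: \<mu>_def)
qed

lemma empty_slab:
  assumes "x0 < x1" "\<And>q. q \<in> S \<Longrightarrow> x0 \<le> fst q \<Longrightarrow> fst q \<le> x1 \<Longrightarrow> False" "0 \<le> k" "0 \<le> \<alpha>"
  shows "isolates (misses S) (quad x0 x1 a b c d) k \<alpha>"
proof (rule isolates.good)
  show "misses S (hull_of (quad x0 x1 a b c d))"
    unfolding misses_def
  proof (rule equals0I)
    fix z assume z: "z \<in> interior (hull_of (quad x0 x1 a b c d)) \<inter> S"
    then have "(fst z, snd z) \<in> hull_of (quad x0 x1 a b c d)" using interior_subset by auto
    then have "x0 \<le> fst z \<and> fst z \<le> x1" by (rule hull_in_slab[rotated]) (use assms(1) in auto)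
    then show False using assms(2) z by blast
  qed
qed fact+

locale crossed_square =
  fixes S :: "point set" and c X Y b :: real and j :: nat
  assumes c: "1 \<le> c" and tan: "tangent_bound S c"
    and S: "S \<subseteq> {X..X+b} \<times> {Y..Y+b}" and b: "b = 1 / 2 ^ j"
begin

lemma b_pos: "0 < b" and b_le: "b \<le> 1" and b_N: "2 ^ j * b = 1" and b_n: "4 * b / 2 ^ (4 * j) = 4 * b ^ 5"
proof -
  show "0 < b" "b \<le> 1" "2 ^ j * b = 1" by (simp_all add: b)
  have "(1::real) / 2 ^ (4 * j) = b ^ 4" by (simp add: b power_one_over power_mult[symmetric] mult.commute)
  then have "4 * b / 2 ^ (4 * j) = 4 * b * b ^ 4" by (simp add: divide_inverse)
  then show "4 * b / 2 ^ (4 * j) = 4 * b ^ 5" by (simp add: eval_nat_numeral)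
qed

lemma S_y: "q \<in> S \<Longrightarrow> Y \<le> snd q \<and> snd q \<le> Y + b"
  using S by auto

lemma pow_le: "i \<le> k \<Longrightarrow> b ^ k \<le> b ^ i"
  using b_pos b_le by (intro power_decreasing) auto

lemma crude_slab:
  assumes v: "0 < v"
  shows "isolates (misses S) (quad x0 (x0 + v) Y Y (Y + b) (Y + b)) (24 * real j + 1) (v * (4 * (2 * v + c * v\<^sup>2) + 4 * b ^ 5))"
proof (cases "\<exists>p\<in>S. x0 \<le> fst p \<and> fst p \<le> x0 + v")
  case True
  then obtain p where p: "p \<in> S" "x0 \<le> fst p" "fst p \<le> x0 + v" by blast
  obtain m where m: "\<bar>m\<bar> \<le> 2" "\<And>q. q \<in> S \<Longrightarrow> \<bar>snd q - snd p - m * (fst q - fst p)\<bar> \<le> c * (fst q - fst p)\<^sup>2"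
    using tan p(1) unfolding tangent_bound_def by blast
  have "isolates (misses S) (quad x0 (x0 + v) Y Y (Y + b) (Y + b)) (6 * real (4 * j) + 1)
     (v * (4 * (\<bar>m\<bar> * v + c * v\<^sup>2) + 4 * b / 2 ^ (4 * j)))"
    by (rule level_band[OF v p m(2)]) (use c S_y in auto)
  moreover have "v * (4 * (\<bar>m\<bar> * v + c * v\<^sup>2) + 4 * b / 2 ^ (4 * j)) \<le> v * (4 * (2 * v + c * v\<^sup>2) + 4 * b ^ 5)"
    unfolding b_n using m(1) v by (intro mult_left_mono add_right_mono mult_right_mono) auto
  ultimately show ?thesis by (elim isolates_weaken) auto
next
  case False
  then show ?thesis using v c b_pos by (intro empty_slab) auto
qed

text \<open>The slabs have width \<open>w = b\<^sup>2\<close>. For a slab met by \<open>S\<close>, let \<open>m i\<close> be the slope at a point \<open>p i\<close> of \<open>S\<close> in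
  it, and \<open>H i\<close> a bound for the oscillation of \<open>S\<close> there. The indices in \<open>T\<close> and \<open>B\<close> are those of slabs in which the
  strip may leave the square through the top or the bottom; only they need extra area, in
  proportion to the slope. The truncation in \<open>F i\<close> is at the largest value that the slopes can have if there
  is a second such slab at distance at least five on the same side. Steeper slabs are divided into \<open>2 ^ j\<close> columns of
  width \<open>b ^ 3\<close>, for which horizontal bands are good enough; their cost is charged to \<open>F i\<close> as well, which equals
  the truncation value there.\<close>

theorem isolate_square:
  "isolates (misses S) (quad X (X + b) Y Y (Y + b) (Y + b)) (42 * 2 ^ j * (12 * real j + 1)) (328 * c * b ^ 5)"
proof -
  define w where "w = b\<^sup>2"
  have w: "0 < w" using b_pos by (simp add: w_def)
  define xx where "xx i = X + real i * w" for i :: nat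
  define D where "D i = {p \<in> S. xx i \<le> fst p \<and> fst p \<le> xx i + w}" for i
  obtain M where M: "\<And>p. p \<in> S \<Longrightarrow> \<bar>M p\<bar> \<le> 2"
    "\<And>p q. p \<in> S \<Longrightarrow> q \<in> S \<Longrightarrow> \<bar>snd q - snd p - M p * (fst q - fst p)\<bar> \<le> c * (fst q - fst p)\<^sup>2"
    using tan unfolding tangent_bound_def by metis
  \<comment> \<open>For slabs that \<open>S\<close> does not meet the value is arbitrary.\<close>
  define p where "p i = (SOME q. q \<in> D i)" for i
  have p: "p i \<in> D i" if "D i \<noteq> {}" for i unfolding p_def using that by (simp add: some_in_eq)
  define m where "m i = M (p i)" for i
  define H where "H i = \<bar>m i\<bar> * w + c * w\<^sup>2" for i
  define T where "T = {i. i < 2 ^ j \<and> D i \<noteq> {} \<and> Y + b < snd (p i) + H i}"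
  define B where "B = {i. i < 2 ^ j \<and> D i \<noteq> {} \<and> snd (p i) - H i < Y}"
  define F where "F i = min \<bar>m i\<bar> (4 * c * b)" for i
  define e where "e i = (if i \<in> T \<union> B then F i else 0)" for i
  have F0: "0 \<le> F i" for i using c b_pos by (simp add: F_def)
  have wN: "(4 * c * w) * 2 ^ j = 4 * c * b"
  proof -
    have "(4 * c * w) * 2 ^ j = 4 * c * b * (2 ^ j * b)" by (simp add: w_def power2_eq_square)
    then show ?thesis by (simp add: b_N)
  qed
  \<comment> \<open>Slabs in which the strip leaves the square through the same side have slopes controlled by
    their distance.\<close>
  have gap: "F k \<le> (4 * c * w) * (real k - real i)"
    if ik: "i + 5 \<le> k" "D i \<noteq> {}" "D k \<noteq> {}" and z: "\<bar>snd (p k) - snd (p i)\<bar> \<le> max (H i) (H k)" for i k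
  proof -
    have pi: "p i \<in> S" "xx i \<le> fst (p i)" "fst (p i) \<le> xx i + w" using p[OF ik(2)] by (auto simp: D_def)
    have pk: "p k \<in> S" "xx k \<le> fst (p k)" "fst (p k) \<le> xx k + w" using p[OF ik(3)] by (auto simp: D_def)
    define d where "d = fst (p k) - fst (p i)"
    have ki: "real k - real i \<ge> 5" using ik(1) by linarith
    have xki: "xx k - xx i = (real k - real i) * w" by (simp add: xx_def algebra_simps)
    have kw: "5 * w \<le> (real k - real i) * w" using ki w by (intro mult_right_mono) auto
    have d: "4 * w \<le> d" "d \<le> 2 * ((real k - real i) * w)" using pi pk xki kw w unfolding d_def by linarith+
    have "\<bar>m k\<bar> \<le> 2 * c * d"
    proof (rule exit_slope[OF w d(1), of c "snd (p k) - snd (p i)" "m i"])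
      show "\<bar>snd (p k) - snd (p i) - m i * d\<bar> \<le> c * d\<^sup>2" using M(2)[OF pi(1) pk(1)] by (simp add: m_def d_def)
      have "\<bar>snd (p i) - snd (p k) - m k * - d\<bar> \<le> c * (- d)\<^sup>2" using M(2)[OF pk(1) pi(1)] by (simp add: m_def d_def)
      then show "\<bar>- (snd (p k) - snd (p i)) - m k * - d\<bar> \<le> c * d\<^sup>2" by simp
      have "max (H i) (H k) = max \<bar>m i\<bar> \<bar>m k\<bar> * w + c * w\<^sup>2"
        using w unfolding H_def by (simp add: max_def)
      then show "\<bar>snd (p k) - snd (p i)\<bar> \<le> max \<bar>m i\<bar> \<bar>m k\<bar> * w + c * w\<^sup>2" using z by simp
    qed (use c in simp)
    also have "2 * c * d \<le> 2 * c * (2 * ((real k - real i) * w))" using d(2) c by (intro mult_left_mono) auto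
    also have "\<dots> = (4 * c * w) * (real k - real i)" by simp
    finally show ?thesis by (simp add: F_def)
  qed
  have FN: "F i \<le> (4 * c * w) * real (2 ^ j)" for i
    using wN by (simp only: F_def of_nat_power of_nat_numeral min.cobounded2)
  have a0: "0 \<le> 4 * c * w" using c w by simp
  have sT: "sum F T \<le> 10 * ((4 * c * w) * real (2 ^ j))"
  proof (rule sum_spaced[OF _ a0 FN])
    fix i k assume ik: "i \<in> T" "k \<in> T" "i + 5 \<le> k"
    have "snd (p i) \<le> Y + b" "snd (p k) \<le> Y + b" using ik p S_y unfolding T_def D_def by blast+
    then have "\<bar>snd (p k) - snd (p i)\<bar> \<le> max (H i) (H k)" using ik unfolding T_def mem_Collect_eq by linarith
    then show "F k \<le> (4 * c * w) * (real k - real i)" using ik by (intro gap) (auto simp: T_def)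
  qed (auto simp: T_def)
  have sB: "sum F B \<le> 10 * ((4 * c * w) * real (2 ^ j))"
  proof (rule sum_spaced[OF _ a0 FN])
    fix i k assume ik: "i \<in> B" "k \<in> B" "i + 5 \<le> k"
    have "Y \<le> snd (p i)" "Y \<le> snd (p k)" using ik p S_y unfolding B_def D_def by blast+
    then have "\<bar>snd (p k) - snd (p i)\<bar> \<le> max (H i) (H k)" using ik unfolding B_def mem_Collect_eq by linarith
    then show "F k \<le> (4 * c * w) * (real k - real i)" using ik by (intro gap) (auto simp: B_def)
  qed (auto simp: B_def)
  have se: "(\<Sum>i<2^j. e i) \<le> 80 * (c * b)"
  proof -
    have fin: "finite T" "finite B" by (auto simp: T_def B_def)
    have "(\<Sum>i<2^j. e i) = sum F (T \<union> B)"
      unfolding e_def by (subst sum.inter_restrict[symmetric]) (auto intro!: sum.cong simp: T_def B_def)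
    also have "\<dots> \<le> sum F T + sum F B"
      using sum.union_inter[OF fin, of F] sum_nonneg[of "T \<inter> B" F] F0 by simp
    also have "\<dots> \<le> 80 * (c * b)" using sT sB wN by simp
    finally show ?thesis .
  qed
  have small: "b ^ 7 \<le> c * b ^ 6" "b ^ 8 \<le> c * b ^ 6" "c * b ^ 9 \<le> c * b ^ 6" "b ^ 6 \<le> c * b ^ 6"
  proof -
    have c6: "b ^ 6 \<le> c * b ^ 6" using mult_right_mono[OF c, of "b ^ 6"] b_pos by simp
    then show "b ^ 6 \<le> c * b ^ 6" "b ^ 7 \<le> c * b ^ 6" "b ^ 8 \<le> c * b ^ 6" using pow_le[of 6 7] pow_le[of 6 8] by auto
    show "c * b ^ 9 \<le> c * b ^ 6" using pow_le[of 6 9] c by (intro mult_left_mono) auto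
  qed
  define \<kappa> where "\<kappa> i = (24 * real j + 1) + e i / (4 * c * b) * (2 ^ j * (24 * real j + 2))" for i
  define \<alpha> where "\<alpha> i = 8 * (c * b ^ 6) + 4 * b ^ 4 * e i" for i
  have e0: "0 \<le> e i" for i using F0 by (simp add: e_def)
  have k24: "24 * real j + 1 \<le> \<kappa> i" for i using e0[of i] c b_pos by (simp add: \<kappa>_def)
  have a8: "8 * (c * b ^ 6) \<le> \<alpha> i" for i using e0[of i] b_pos by (simp add: \<alpha>_def)
  have slab: "isolates (misses S) (quad (X + real i * w) (X + (real i + 1) * w) Y Y (Y + b) (Y + b)) (\<kappa> i) (\<alpha> i)"
    if i: "i < 2 ^ j" for i
  proof -
    have x1: "X + (real i + 1) * w = xx i + w" "X + real i * w = xx i" by (simp_all add: xx_def algebra_simps)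
    have "isolates (misses S) (quad (xx i) (xx i + w) Y Y (Y + b) (Y + b)) (\<kappa> i) (\<alpha> i)"
    proof (cases "D i = {}")
      case True
      have "0 \<le> \<kappa> i" using k24[of i] by linarith
      moreover have "0 \<le> \<alpha> i" using c b_pos e0[of i] by (simp add: \<alpha>_def)
      ultimately show ?thesis using True w by (intro empty_slab) (auto simp: D_def)
    next
      case False
      then have pi: "p i \<in> S" "xx i \<le> fst (p i)" "fst (p i) \<le> xx i + w" using p[OF False] by (auto simp: D_def)
      have t: "\<bar>snd q - snd (p i) - m i * (fst q - fst (p i))\<bar> \<le> c * (fst q - fst (p i))\<^sup>2" if "q \<in> S" for q
        using M(2)[OF pi(1) that] by (simp add: m_def)
      show ?thesis
      proof (cases "i \<in> T \<union> B")
        case False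
        then have H: "Y \<le> snd (p i) - H i" "snd (p i) + H i \<le> Y + b" using i \<open>D i \<noteq> {}\<close> by (auto simp: T_def B_def)
        have *: "isolates (misses S) (quad (xx i) (xx i + w) Y Y (Y + b) (Y + b)) (6 * real (4 * j) + 1)
           (w * (4 * (c * w\<^sup>2) + 4 * b / 2 ^ (4 * j)))"
          by (rule slope_strip[OF w pi t]) (use c H in \<open>auto simp: H_def\<close>)
        have "w * (4 * (c * w\<^sup>2) + 4 * b / 2 ^ (4 * j)) = 4 * (c * b ^ 6) + 4 * b ^ 7"
          unfolding b_n w_def by (simp add: algebra_simps eval_nat_numeral)
        also have "\<dots> \<le> \<alpha> i" using a8[of i] small by linarith
        finally show ?thesis using isolates_weaken[OF *] k24[of i] by simp
      next
        case exit: True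
        then have ei: "e i = F i" by (simp add: e_def)
        show ?thesis
        proof (cases "\<bar>m i\<bar> \<le> 4 * c * b")
          case True
          have *: "isolates (misses S) (quad (xx i) (xx i + w) Y Y (Y + b) (Y + b)) (6 * real (4 * j) + 1)
             (w * (4 * (\<bar>m i\<bar> * w + c * w\<^sup>2) + 4 * b / 2 ^ (4 * j)))"
            by (rule level_band[OF w pi t]) (use c S_y in auto)
          have "w * (4 * (\<bar>m i\<bar> * w + c * w\<^sup>2) + 4 * b / 2 ^ (4 * j)) = 4 * b ^ 4 * \<bar>m i\<bar> + 4 * (c * b ^ 6) + 4 * b ^ 7"
            unfolding b_n w_def by (simp add: algebra_simps eval_nat_numeral)
          also have "\<dots> \<le> \<alpha> i" using small True by (simp add: \<alpha>_def ei F_def)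
          finally show ?thesis using isolates_weaken[OF *] k24[of i] by simp
        next
          case False
          then have Fi: "F i = 4 * c * b" by (simp add: F_def)
          let ?v = "b ^ 3" and ?\<beta> = "16 * (c * b ^ 6)"
          have v: "0 < ?v" using b_pos by simp
          have col: "isolates (misses S) (quad (xx i + real k * ?v) (xx i + (real k + 1) * ?v) Y Y (Y + b) (Y + b)) (24 * real j + 1) ?\<beta>" for k :: nat
          proof -
            have ex: "xx i + (real k + 1) * ?v = (xx i + real k * ?v) + ?v" by (simp add: algebra_simps)
            have "?v * (4 * (2 * ?v + c * ?v\<^sup>2) + 4 * b ^ 5) = 8 * b ^ 6 + 4 * (c * b ^ 9) + 4 * b ^ 8"
              by (simp add: algebra_simps eval_nat_numeral)
            also have "\<dots> \<le> ?\<beta>" using small by linarith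
            finally show ?thesis unfolding ex using isolates_weaken[OF crude_slab[OF v]] by blast
          qed
          have "isolates (misses S) (quad (xx i) (xx i + 2 ^ j * ?v) Y Y (Y + b) (Y + b))
             (2 ^ j - 1 + (\<Sum>k<(2::nat)^j. 24 * real j + 1)) (\<Sum>k<(2::nat)^j. ?\<beta>)"
            by (rule isolates_columns) (rule col)
          moreover have "2 ^ j * ?v = w"
          proof -
            have "2 ^ j * ?v = (2 ^ j * b) * b\<^sup>2" by (simp add: eval_nat_numeral)
            then show ?thesis by (simp add: b_N w_def)
          qed
          moreover have "(\<Sum>k<(2::nat)^j. ?\<beta>) \<le> \<alpha> i"
          proof -
            have "(\<Sum>k<(2::nat)^j. ?\<beta>) = 16 * c * b ^ 5 * (2 ^ j * b)" by (simp add: eval_nat_numeral)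
            also have "\<dots> = 4 * b ^ 4 * F i" by (simp add: b_N Fi eval_nat_numeral)
            finally have "(\<Sum>k<(2::nat)^j. ?\<beta>) = 4 * b ^ 4 * F i" .
            moreover have "0 \<le> 8 * (c * b ^ 6)" using c b_pos by simp
            ultimately show ?thesis unfolding \<alpha>_def ei by linarith
          qed
          moreover have "2 ^ j - 1 + (\<Sum>k<(2::nat)^j. 24 * real j + 1) \<le> \<kappa> i"
          proof -
            have "e i / (4 * c * b) = 1" unfolding ei Fi using c b_pos by simp
            then have "\<kappa> i = (24 * real j + 1) + 2 ^ j * (24 * real j + 2)"
              unfolding \<kappa>_def by (simp only: mult_1)
            then show ?thesis by (simp add: algebra_simps)
          qed
          ultimately show ?thesis by (simp only: isolates_weaken)
        qed
      qed
    qed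
    then show ?thesis by (simp only: x1)
  qed
  have *: "isolates (misses S) (quad X (X + 2 ^ j * w) Y Y (Y + b) (Y + b)) (2 ^ j - 1 + (\<Sum>i<2^j. \<kappa> i)) (\<Sum>i<2^j. \<alpha> i)"
    by (rule isolates_columns) (rule slab)
  have wb: "2 ^ j * w = b"
  proof -
    have "2 ^ j * w = (2 ^ j * b) * b" by (simp add: w_def power2_eq_square)
    then show ?thesis by (simp add: b_N)
  qed
  have "(\<Sum>i<2^j. \<alpha> i) = 8 * (c * b ^ 5) * (2 ^ j * b) + 4 * b ^ 4 * (\<Sum>i<2^j. e i)"
    by (simp add: \<alpha>_def sum.distrib sum_distrib_left eval_nat_numeral)
  also have "\<dots> \<le> 8 * (c * b ^ 5) + 4 * b ^ 4 * (80 * (c * b))"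
    using se b_pos by (intro add_mono mult_left_mono) (auto simp: b_N)
  also have "\<dots> = 328 * c * b ^ 5" by (simp add: eval_nat_numeral)
  finally have A: "(\<Sum>i<2^j. \<alpha> i) \<le> 328 * c * b ^ 5" .
  have "(\<Sum>i<2^j. \<kappa> i) = 2 ^ j * (24 * real j + 1) + (\<Sum>i<2^j. e i) / (4 * c * b) * (2 ^ j * (24 * real j + 2))"
    by (simp add: \<kappa>_def sum.distrib sum_distrib_right sum_divide_distrib)
  also have "\<dots> \<le> 2 ^ j * (24 * real j + 1) + 20 * (2 ^ j * (24 * real j + 2))"
    using se c b_pos by (intro add_mono mult_right_mono) (auto simp: divide_le_eq)
  finally have "2 ^ j - 1 + (\<Sum>i<2^j. \<kappa> i) \<le> 42 * 2 ^ j * (12 * real j + 1)" by (simp add: algebra_simps)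
  then show ?thesis using isolates_weaken[OF *[unfolded wb] _ A] by blast
qed

end



section \<open>From squares to the whole curve\<close>

lemma isolates_grid:
  assumes "\<And>i k. i < 2 ^ r \<Longrightarrow> k < 2 ^ r \<Longrightarrow> isolates P
    (quad (X + real i * b) (X + (real i + 1) * b) (Y + real k * b) (Y + real k * b) (Y + (real k + 1) * b) (Y + (real k + 1) * b)) (\<kappa> i k) (\<alpha> i k)"
  shows "isolates P (quad X (X + 2 ^ r * b) Y Y (Y + 2 ^ r * b) (Y + 2 ^ r * b)) (4 ^ r + (\<Sum>i<2^r. \<Sum>k<2^r. \<kappa> i k)) (\<Sum>i<2^r. \<Sum>k<2^r. \<alpha> i k)"
proof -
  have "isolates P (quad X (X + 2 ^ r * b) Y Y (Y + 2 ^ r * b) (Y + 2 ^ r * b))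
     (2 ^ r - 1 + (\<Sum>i<2^r. 2 ^ r - 1 + (\<Sum>k<2^r. \<kappa> i k))) (\<Sum>i<2^r. \<Sum>k<2^r. \<alpha> i k)"
    by (rule isolates_columns, rule isolates_rows, rule assms)
  moreover have "(\<Sum>i<(2::nat)^r. 2 ^ r - 1 + (\<Sum>k<2^r. \<kappa> i k)) = 2 ^ r * (2 ^ r - 1) + (\<Sum>i<2^r. \<Sum>k<2^r. \<kappa> i k)"
    by (simp add: sum.distrib)
  moreover have "(2::real) ^ r * 2 ^ r = 4 ^ r" by (simp add: power_mult_distrib[symmetric])
  ultimately show ?thesis by (elim isolates_weaken) (simp_all add: right_diff_distrib)
qed

text \<open>On such cells the function to be approximated is smooth and the cell is small, so that an affine
  approximation is accurate.\<close>

definition accurate :: "point set \<Rightarrow> real \<Rightarrow> point set \<Rightarrow> bool" where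
  "accurate \<Gamma> e S \<longleftrightarrow> misses \<Gamma> S \<and> (\<forall>x\<in>S. \<forall>y\<in>S. norm (x - y) \<le> e)"

abbreviation square :: "real \<Rightarrow> real \<Rightarrow> real \<Rightarrow> cell" where
  "square X Y b \<equiv> quad X (X + b) Y Y (Y + b) (Y + b)"

lemma hull_square: "hull_of (square X Y b) \<subseteq> {X..X + b} \<times> {Y..Y + b}" if "0 \<le> b"
  by (rule hull_minimal) (use that in \<open>auto intro: convex_Times\<close>)

lemma accurate_local:
  assumes "misses (\<Gamma> \<inter> {X..X + b} \<times> {Y..Y + b}) S" "S \<subseteq> hull_of (square X Y b)" "0 \<le> b"
  shows "accurate \<Gamma> (2 * b) S"
proof -
  have sub: "S \<subseteq> {X..X + b} \<times> {Y..Y + b}" using assms hull_square by blast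
  have "misses \<Gamma> S" using assms(1) interior_subset[of S] sub unfolding misses_def by blast
  moreover have "norm (x - y) \<le> 2 * b" if "x \<in> S" "y \<in> S" for x y
  proof -
    have "\<bar>fst x - fst y\<bar> \<le> b" "\<bar>snd x - snd y\<bar> \<le> b" using subsetD[OF sub that(1)] subsetD[OF sub that(2)] by (auto simp: abs_le_iff)
    moreover have "norm (x - y) \<le> \<bar>fst (x - y)\<bar> + \<bar>snd (x - y)\<bar>"
      unfolding norm_prod_def real_norm_def by (metis power2_abs real_sqrt_abs sqrt_sum_squares_le_sum_abs)
    ultimately show ?thesis by simp
  qed
  ultimately show ?thesis by (simp add: accurate_def)
qed

lemma card_spread:
  fixes R :: "nat set"
  assumes "finite R" "\<And>i k. i \<in> R \<Longrightarrow> k \<in> R \<Longrightarrow> i \<le> k \<Longrightarrow> real k - real i \<le> D" "0 \<le> D"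
  shows "real (card R) \<le> D + 1"
proof (cases "R = {}")
  case True then show ?thesis using assms by simp
next
  case False
  let ?m = "Min R" and ?M = "Max R"
  have "R \<subseteq> {?m..?M}" using assms(1) by auto
  then have "card R \<le> card {?m..?M}" by (intro card_mono) auto
  moreover have "?m \<le> ?M" using False assms(1) by (simp add: Min_le_iff)
  moreover have "real ?M - real ?m \<le> D" using assms False \<open>?m \<le> ?M\<close> by (intro assms(2)) auto
  ultimately show ?thesis by simp
qed

text \<open>Squares of side \<open>2 ^ -j\<close> that the graph does not meet need no further splits. A column contains at most
  \<open>5 * c\<close> others, because the slopes are bounded.\<close>

lemma isolate_graph:
  assumes c: "1 \<le> c" and tan: "tangent_bound S c" and S: "S \<subseteq> {X..X + h} \<times> {Y..Y + h}"
    and h: "h = 1 / 2 ^ J" "J \<le> j"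
  shows "isolates (accurate S (2 / 2 ^ j)) (square X Y h) (212 * c * 4 ^ j * (12 * real j + 1)) (1640 * c\<^sup>2 * (1 / 2 ^ j) ^ 4)"
proof -
  define b where "b = (1::real) / 2 ^ j" define r where "r = j - J"
  have b: "0 < b" "b \<le> 1" by (simp_all add: b_def)
  have hb: "h = 2 ^ r * b" using h(2) by (simp add: h(1) b_def r_def power_diff)
  define B where "B i k = {X + real i * b..X + real i * b + b} \<times> {Y + real k * b..Y + real k * b + b}" for i k :: nat
  define R where "R i = {k. k < 2 ^ r \<and> S \<inter> B i k \<noteq> {}}" for i
  define K where "K = 42 * 2 ^ j * (12 * real j + 1)" define A where "A = 328 * c * b ^ 5"
  have KA: "0 \<le> K" "0 \<le> A" using c b by (simp_all add: K_def A_def)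
  have sq: "isolates (accurate S (2 * b)) (square (X + real i * b) (Y + real k * b) b) (if k \<in> R i then K else 0) (if k \<in> R i then A else 0)"
    if k: "k < 2 ^ r" for i k
  proof (cases "k \<in> R i")
    case True
    interpret crossed_square "S \<inter> B i k" c "X + real i * b" "Y + real k * b" b j
    proof
      show "tangent_bound (S \<inter> B i k) c" using tan unfolding tangent_bound_def by blast
    qed (use c in \<open>auto simp: B_def b_def\<close>)
    have "isolates (accurate S (2 * b)) (square (X + real i * b) (Y + real k * b) b) K A"
      unfolding K_def A_def by (rule isolates_mono[OF isolate_square accurate_local]) (use b in \<open>auto simp: B_def\<close>)
    then show ?thesis using True by simp
  next
    case False
    then have e: "S \<inter> B i k = {}" using k by (auto simp: R_def)
    have "accurate S (2 * b) (hull_of (square (X + real i * b) (Y + real k * b) b))"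
      by (rule accurate_local) (use b e in \<open>auto simp: misses_def B_def\<close>)
    then show ?thesis using False by (auto intro!: isolates.good)
  qed
  have *: "isolates (accurate S (2 * b)) (square X Y (2 ^ r * b)) (4 ^ r + (\<Sum>i<2^r. \<Sum>k<2^r. if k \<in> R i then K else 0))
     (\<Sum>i<2^r. \<Sum>k<2^r. if k \<in> R i then A else 0)"
  proof (rule isolates_grid)
    fix i k :: nat assume "k < 2 ^ r"
    from sq[OF this] show "isolates (accurate S (2 * b)) (quad (X + real i * b) (X + (real i + 1) * b) (Y + real k * b) (Y + real k * b)
         (Y + (real k + 1) * b) (Y + (real k + 1) * b)) (if k \<in> R i then K else 0) (if k \<in> R i then A else 0)"
      by (simp add: algebra_simps)
  qed
  \<comment> \<open>Within a column the heights of points of the graph vary by at most \<open>(2 + c) * b\<close>.\<close>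
  have card: "real (card (R i)) \<le> 5 * c" for i
  proof -
    have "real (card (R i)) \<le> (3 + c) + 1"
    proof (rule card_spread)
      fix k k' assume kk: "k \<in> R i" "k' \<in> R i" "k \<le> k'"
      obtain p where p: "p \<in> S" "p \<in> B i k" using kk(1) by (auto simp: R_def)
      obtain q where q: "q \<in> S" "q \<in> B i k'" using kk(2) by (auto simp: R_def)
      obtain m where m: "\<bar>m\<bar> \<le> 2" "\<bar>snd q - snd p - m * (fst q - fst p)\<bar> \<le> c * (fst q - fst p)\<^sup>2"
        using tan p(1) q(1) unfolding tangent_bound_def by blast
      have dx: "\<bar>fst q - fst p\<bar> \<le> b" using p(2) q(2) by (auto simp: B_def abs_le_iff)
      then have "(fst q - fst p)\<^sup>2 \<le> b\<^sup>2" using b by (simp add: abs_le_square_iff[symmetric])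
      also have "\<dots> \<le> b" using b by (simp add: power2_eq_square mult_left_le)
      finally have "c * (fst q - fst p)\<^sup>2 \<le> c * b" using c by (intro mult_left_mono) auto
      moreover have "\<bar>m * (fst q - fst p)\<bar> \<le> 2 * b" unfolding abs_mult using m(1) dx by (intro mult_mono) auto
      ultimately have "snd q - snd p \<le> 2 * b + c * b" using m(2) by linarith
      moreover have "Y + real k' * b \<le> snd q" "snd p \<le> Y + real k * b + b" using p(2) q(2) by (auto simp: B_def)
      ultimately have "(real k' - real k) * b \<le> (3 + c) * b" by (simp add: algebra_simps)
      then show "real k' - real k \<le> 3 + c" using b by (simp add: mult_le_cancel_right)
    qed (use c in \<open>auto simp: R_def\<close>)
    then show ?thesis using c by linarith
  qed
  have row: "(\<Sum>k<2^r. if k \<in> R i then Z else 0) \<le> 5 * c * Z" if "0 \<le> Z" for i and Z :: real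
  proof -
    have "(\<Sum>k<2^r. if k \<in> R i then Z else 0) = (\<Sum>k\<in>{..<2^r} \<inter> R i. Z)"
      by (rule sum.inter_restrict[symmetric]) simp
    also have "{..<2^r} \<inter> R i = R i" by (auto simp: R_def)
    finally show ?thesis using mult_right_mono[OF card[of i] that] by simp
  qed
  have tot: "(\<Sum>i<(2::nat)^r. \<Sum>k<2^r. if k \<in> R i then Z else 0) \<le> 2 ^ j * (5 * c * Z)" if "0 \<le> Z" for Z :: real
  proof -
    have "(\<Sum>i<(2::nat)^r. \<Sum>k<2^r. if k \<in> R i then Z else 0) \<le> (\<Sum>i<(2::nat)^r. 5 * c * Z)"
      by (intro sum_mono row that)
    also have "\<dots> = 2 ^ r * (5 * c * Z)" by simp
    also have "\<dots> \<le> 2 ^ j * (5 * c * Z)" using that c by (intro mult_right_mono power_increasing) (auto simp: r_def)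
    finally show ?thesis .
  qed
  have four: "(2::real) ^ j * 2 ^ j = 4 ^ j" by (simp add: power_mult_distrib[symmetric])
  have "(4::real) ^ r \<le> 4 ^ j" by (intro power_increasing) (auto simp: r_def)
  also have "\<dots> \<le> 2 * c * 4 ^ j * (12 * real j + 1)"
  proof -
    have "1 * 1 \<le> (2 * c) * (12 * real j + 1)" using c by (intro mult_mono) auto
    from mult_left_mono[OF this, of "4 ^ j"] show ?thesis by (simp add: mult_ac)
  qed
  finally have "4 ^ r + (\<Sum>i<(2::nat)^r. \<Sum>k<2^r. if k \<in> R i then K else 0) \<le> 2 * c * 4 ^ j * (12 * real j + 1) + 2 ^ j * (5 * c * K)"
    using tot[OF KA(1)] by linarith
  also have "2 ^ j * (5 * c * K) = 210 * c * (2 ^ j * 2 ^ j) * (12 * real j + 1)" by (simp add: K_def)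
  finally have k: "4 ^ r + (\<Sum>i<(2::nat)^r. \<Sum>k<2^r. if k \<in> R i then K else 0) \<le> 212 * c * 4 ^ j * (12 * real j + 1)"
    unfolding four by (simp add: algebra_simps)
  have "2 ^ j * (5 * c * A) = 1640 * c\<^sup>2 * b ^ 4 * (2 ^ j * b)" by (simp add: A_def eval_nat_numeral)
  also have "\<dots> = 1640 * c\<^sup>2 * b ^ 4" by (simp add: b_def)
  finally have a: "(\<Sum>i<(2::nat)^r. \<Sum>k<2^r. if k \<in> R i then A else 0) \<le> 1640 * c\<^sup>2 * b ^ 4"
    using tot[OF KA(2)] by linarith
  have "accurate S (2 * b) = accurate S (2 / 2 ^ j)" by (simp add: b_def)
  then show ?thesis using isolates_weaken[OF * k a] unfolding hb[symmetric] by (simp add: b_def)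
qed

lemma isolate_graph_turned:
  assumes c: "1 \<le> c" and tan: "tangent_bound (prod.swap ` S) c" and S: "S \<subseteq> {X..X + h} \<times> {Y..Y + h}"
    and h: "h = 1 / 2 ^ J" "J \<le> j"
  shows "isolates (accurate S (2 / 2 ^ j)) (square X Y h) (212 * c * 4 ^ j * (12 * real j + 1)) (1640 * c\<^sup>2 * (1 / 2 ^ j) ^ 4)"
proof -
  define t :: "point \<Rightarrow> point" where "t z = (snd z, - fst z)" for z
  have "isolates (accurate (t ` S) (2 / 2 ^ j)) (square Y (- X - h) h) (212 * c * 4 ^ j * (12 * real j + 1)) (1640 * c\<^sup>2 * (1 / 2 ^ j) ^ 4)"
  proof (rule isolate_graph[OF c _ _ h])
    show "t ` S \<subseteq> {Y..Y + h} \<times> {- X - h..- X - h + h}" using S by (force simp: t_def)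
    show "tangent_bound (t ` S) c"
      unfolding tangent_bound_def
    proof
      fix p assume "p \<in> t ` S"
      then obtain u where u: "u \<in> S" "p = t u" by blast
      then obtain m where m: "\<bar>m\<bar> \<le> 2" "\<And>q. q \<in> S \<Longrightarrow> \<bar>fst q - fst u - m * (snd q - snd u)\<bar> \<le> c * (snd q - snd u)\<^sup>2"
        using tan unfolding tangent_bound_def by fastforce
      have "\<bar>snd q - snd p - (- m) * (fst q - fst p)\<bar> \<le> c * (fst q - fst p)\<^sup>2" if "q \<in> t ` S" for q
      proof -
        obtain v where v: "v \<in> S" "q = t v" using \<open>q \<in> t ` S\<close> by blast
        have "snd q - snd p - (- m) * (fst q - fst p) = - (fst v - fst u - m * (snd v - snd u))"
          by (simp add: t_def u v)
        then show ?thesis using m(2)[OF v(1)] by (simp only: abs_minus_cancel) (simp add: t_def u v)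
      qed
      then show "\<exists>m. \<bar>m\<bar> \<le> 2 \<and> (\<forall>q\<in>t ` S. \<bar>snd q - snd p - m * (fst q - fst p)\<bar> \<le> c * (fst q - fst p)\<^sup>2)"
        using m(1) by (intro exI[of _ "- m"]) auto
    qed
  qed
  then have "isolates (\<lambda>A. accurate S (2 / 2 ^ j) (quarter_turn ` A)) (square Y (- X - h) h) (212 * c * 4 ^ j * (12 * real j + 1)) (1640 * c\<^sup>2 * (1 / 2 ^ j) ^ 4)"
  proof (rule isolates_mono)
    fix A assume A: "accurate (t ` S) (2 / 2 ^ j) A"
    have "continuous_on UNIV quarter_turn" unfolding quarter_turn_def[abs_def] by (intro continuous_intros)
    then have "misses S (quarter_turn ` A)"
      using A unfolding accurate_def by (intro misses_image[of t]) (auto simp: t_def quarter_turn_def)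
    moreover have "norm (quarter_turn x - quarter_turn y) = norm (x - y)" for x y
      by (simp add: quarter_turn_def norm_prod_def add.commute power2_commute)
    ultimately show "accurate S (2 / 2 ^ j) (quarter_turn ` A)" using A unfolding accurate_def by auto
  qed
  from isolates_rigid[OF this rigid_quarter_turn]
  have "isolates (accurate S (2 / 2 ^ j)) [(X + h, Y), (X + h, Y + h), (X, Y + h), (X, Y)] (212 * c * 4 ^ j * (12 * real j + 1)) (1640 * c\<^sup>2 * (1 / 2 ^ j) ^ 4)"
    by (simp add: quarter_turn_def add.commute[of h X])
  then show ?thesis by (rule isolates_turn)
qed

text \<open>A fixed number of squares of side \<open>2 ^ -J\<close> is treated separately, in each of which the curve is a
  graph over one of the axes.\<close>

theorem isolate_curve:
  assumes c: "1 \<le> c" and J: "J \<le> j"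
    and tan: "\<And>X Y. tangent_bound (\<Gamma> \<inter> {X..X + 1 / 2 ^ J} \<times> {Y..Y + 1 / 2 ^ J}) c \<or>
       tangent_bound (prod.swap ` (\<Gamma> \<inter> {X..X + 1 / 2 ^ J} \<times> {Y..Y + 1 / 2 ^ J})) c"
  shows "isolates (accurate \<Gamma> (2 / 2 ^ j)) unit_cell (213 * 4 ^ J * c * 4 ^ j * (12 * real j + 1)) (1640 * 4 ^ J * c\<^sup>2 * (1 / 2 ^ j) ^ 4)"
proof -
  define h where "h = (1::real) / 2 ^ J"
  define K where "K = 212 * c * 4 ^ j * (12 * real j + 1)" define A where "A = 1640 * c\<^sup>2 * (1 / 2 ^ j) ^ 4"
  have sq: "isolates (accurate \<Gamma> (2 / 2 ^ j)) (square X Y h) K A" for X Y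
  proof -
    let ?B = "{X..X + h} \<times> {Y..Y + h}"
    have "isolates (accurate (\<Gamma> \<inter> ?B) (2 / 2 ^ j)) (square X Y h) K A"
      using tan[of X Y] isolate_graph[OF c, of "\<Gamma> \<inter> ?B" X h Y J j] isolate_graph_turned[OF c, of "\<Gamma> \<inter> ?B" X h Y J j] J
      unfolding K_def A_def h_def by blast
    then show ?thesis
    proof (rule isolates_mono)
      fix S assume S: "accurate (\<Gamma> \<inter> ?B) (2 / 2 ^ j) S" "S \<subseteq> hull_of (square X Y h)"
      then have "interior S \<subseteq> ?B" using hull_square[of h X Y] interior_subset[of S] by (auto simp: h_def)
      then show "accurate \<Gamma> (2 / 2 ^ j) S" using S(1) unfolding accurate_def misses_def by blast
    qed
  qed
  have "isolates (accurate \<Gamma> (2 / 2 ^ j)) (square 0 0 (2 ^ J * h)) (4 ^ J + (\<Sum>i<(2::nat)^J. \<Sum>k<(2::nat)^J. K)) (\<Sum>i<(2::nat)^J. \<Sum>k<(2::nat)^J. A)"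
  proof (rule isolates_grid)
    fix i k :: nat
    show "isolates (accurate \<Gamma> (2 / 2 ^ j)) (quad (0 + real i * h) (0 + (real i + 1) * h) (0 + real k * h) (0 + real k * h)
         (0 + (real k + 1) * h) (0 + (real k + 1) * h)) K A"
      using sq[of "real i * h" "real k * h"] by (simp add: algebra_simps)
  qed
  moreover have "2 ^ J * h = 1" by (simp add: h_def)
  moreover have four: "(2::real) ^ J * (2 ^ J * Z) = 4 ^ J * Z" for Z by (simp add: power_mult_distrib[symmetric] mult.assoc[symmetric])
  moreover have "4 ^ J + 4 ^ J * K \<le> 213 * 4 ^ J * c * 4 ^ j * (12 * real j + 1)"
  proof -
    have "1 * 1 * 1 \<le> c * 4 ^ j * (12 * real j + 1)" using c by (intro mult_mono) auto
    then have "1 + K \<le> 213 * (c * 4 ^ j * (12 * real j + 1))" by (simp add: K_def)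
    then have "4 ^ J * (1 + K) \<le> 4 ^ J * (213 * (c * 4 ^ j * (12 * real j + 1)))" by (rule mult_left_mono) simp
    then show ?thesis by (simp add: algebra_simps)
  qed
  ultimately show ?thesis by (simp only: add_0 sum_constant card_lessThan of_nat_power of_nat_numeral) (elim isolates_weaken, auto simp: A_def)
qed



section \<open>Affine approximation of the two smooth pieces\<close>

text \<open>Only the existence and boundedness of the partial derivatives is assumed, so the mean value theorem is
  applied along a path parallel to the axes; likewise below.\<close>

lemma partials_lipschitz:
  assumes h: "\<And>x y. (x, y) \<in> unit_dom \<Longrightarrow> ((\<lambda>s. h (s, y)) has_real_derivative h1 (x, y)) (at x) \<and>
      ((\<lambda>s. h (x, s)) has_real_derivative h2 (x, y)) (at y) \<and> \<bar>h1 (x, y)\<bar> \<le> M \<and> \<bar>h2 (x, y)\<bar> \<le> M"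
    and z: "z \<in> unit_dom" "w \<in> unit_dom"
  shows "\<bar>h w - h z\<bar> \<le> M * (\<bar>fst w - fst z\<bar> + \<bar>snd w - snd z\<bar>)"
proof -
  obtain x y u v where zw: "z = (x, y)" "w = (u, v)" by (cases z; cases w) auto
  have d: "x \<in> {0<..<1}" "y \<in> {0<..<1}" "u \<in> {0<..<1}" "v \<in> {0<..<1}" using z zw by (auto simp: unit_dom_def)
  have "norm (h (u, y) - h (x, y)) \<le> M * norm (u - x)"
  proof (rule field_differentiable_bound[of "{0<..<1::real}" "\<lambda>s. h (s, y)" "\<lambda>s. h1 (s, y)"])
    show "((\<lambda>s. h (s, y)) has_field_derivative h1 (s, y)) (at s within {0<..<1})" if "s \<in> {0<..<1}" for s
      using h[of s y] that d by (auto simp: unit_dom_def intro: has_field_derivative_at_within)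
  qed (use h d in \<open>auto simp: unit_dom_def\<close>)
  moreover have "norm (h (u, v) - h (u, y)) \<le> M * norm (v - y)"
  proof (rule field_differentiable_bound[of "{0<..<1::real}" "\<lambda>s. h (u, s)" "\<lambda>s. h2 (u, s)"])
    show "((\<lambda>s. h (u, s)) has_field_derivative h2 (u, s)) (at s within {0<..<1})" if "s \<in> {0<..<1}" for s
      using h[of u s] that d by (auto simp: unit_dom_def intro: has_field_derivative_at_within)
  qed (use h d in \<open>auto simp: unit_dom_def\<close>)
  ultimately show ?thesis by (simp add: zw distrib_left)
qed

lemma affine_approximation:
  assumes f: "partials_bounded f M" and z: "z \<in> unit_dom"
  shows "\<exists>a b c. \<forall>w\<in>unit_dom. \<bar>f w - (a + b * fst w + c * snd w)\<bar> \<le> 4 * M * (norm (w - z))\<^sup>2"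
proof -
  obtain f1 f2 f11 f12 f21 f22 :: "point \<Rightarrow> real" where
    D: "\<And>x y. (x, y) \<in> unit_dom \<Longrightarrow>
        ((\<lambda>s. f (s, y)) has_real_derivative f1 (x, y)) (at x) \<and>
        ((\<lambda>s. f (x, s)) has_real_derivative f2 (x, y)) (at y) \<and>
        ((\<lambda>s. f1 (s, y)) has_real_derivative f11 (x, y)) (at x) \<and>
        ((\<lambda>s. f1 (x, s)) has_real_derivative f12 (x, y)) (at y) \<and>
        ((\<lambda>s. f2 (s, y)) has_real_derivative f21 (x, y)) (at x) \<and>
        ((\<lambda>s. f2 (x, s)) has_real_derivative f22 (x, y)) (at y) \<and>
        (\<forall>h \<in> {f, f1, f2, f11, f12, f21, f22}. \<bar>h (x, y)\<bar> \<le> M)"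
    using f unfolding partials_bounded_def by (elim exE) (rule that, erule allE, erule allE, erule impE, assumption, assumption)
  define x where "x = fst z" define y where "y = snd z"
  have zz: "z = (x, y)" "x \<in> {0<..<1}" "y \<in> {0<..<1}" using z by (auto simp: x_def y_def unit_dom_def)
  have M0: "0 \<le> M" using D[of x y] z zz(1) by force
  have L1: "\<bar>f1 w' - f1 z'\<bar> \<le> M * (\<bar>fst w' - fst z'\<bar> + \<bar>snd w' - snd z'\<bar>)" if "w' \<in> unit_dom" "z' \<in> unit_dom" for w' z'
    by (rule partials_lipschitz[of f1 f11 f12 M, OF _ that(2,1)]) (use D in auto)
  have L2: "\<bar>f2 w' - f2 z'\<bar> \<le> M * (\<bar>fst w' - fst z'\<bar> + \<bar>snd w' - snd z'\<bar>)" if "w' \<in> unit_dom" "z' \<in> unit_dom" for w' z'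
    by (rule partials_lipschitz[of f2 f21 f22 M, OF _ that(2,1)]) (use D in auto)
  have "\<bar>f w - ((f z - f1 z * x - f2 z * y) + f1 z * fst w + f2 z * snd w)\<bar> \<le> 4 * M * (norm (w - z))\<^sup>2"
    if w: "w \<in> unit_dom" for w
  proof -
    define u where "u = fst w" define v where "v = snd w"
    have ww: "w = (u, v)" "u \<in> {0<..<1}" "v \<in> {0<..<1}" using w by (auto simp: u_def v_def unit_dom_def)
    define N where "N = norm (w - z)"
    have N: "\<bar>u - x\<bar> \<le> N" "\<bar>v - y\<bar> \<le> N"
      using abs_fst_snd_le[of "w - z"] by (simp_all add: N_def u_def v_def x_def y_def)
    have N0: "0 \<le> N" by (simp add: N_def)
    have 1: "norm ((f (u, y) - f1 z * u) - (f (x, y) - f1 z * x)) \<le> (M * N) * norm (u - x)"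
    proof (rule field_differentiable_bound[of "closed_segment x u" "\<lambda>s. f (s, y) - f1 z * s" "\<lambda>s. f1 (s, y) - f1 z"])
      fix s assume s: "s \<in> closed_segment x u"
      have s1: "s \<in> {0<..<1}" "\<bar>s - x\<bar> \<le> \<bar>u - x\<bar>"
        using s ww zz by (auto simp: closed_segment_eq_real_ivl split: if_splits)
      then have sd: "(s, y) \<in> unit_dom" using zz by (simp add: unit_dom_def)
      show "((\<lambda>s. f (s, y) - f1 z * s) has_field_derivative f1 (s, y) - f1 z) (at s within closed_segment x u)"
        using D[OF sd] by (auto intro!: derivative_eq_intros intro: has_field_derivative_at_within)
      have "\<bar>f1 (s, y) - f1 z\<bar> \<le> M * \<bar>s - x\<bar>" using L1[OF sd z] by (simp add: zz(1))
      also have "\<dots> \<le> M * N" using s1 N M0 by (intro mult_left_mono) auto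
      finally show "norm (f1 (s, y) - f1 z) \<le> M * N" by simp
    qed auto
    have 2: "norm ((f (u, v) - f2 z * v) - (f (u, y) - f2 z * y)) \<le> (M * (2 * N)) * norm (v - y)"
    proof (rule field_differentiable_bound[of "closed_segment y v" "\<lambda>s. f (u, s) - f2 z * s" "\<lambda>s. f2 (u, s) - f2 z"])
      fix s assume s: "s \<in> closed_segment y v"
      have s1: "s \<in> {0<..<1}" "\<bar>s - y\<bar> \<le> \<bar>v - y\<bar>"
        using s ww zz by (auto simp: closed_segment_eq_real_ivl split: if_splits)
      then have sd: "(u, s) \<in> unit_dom" using ww by (simp add: unit_dom_def)
      show "((\<lambda>s. f (u, s) - f2 z * s) has_field_derivative f2 (u, s) - f2 z) (at s within closed_segment y v)"
        using D[OF sd] by (auto intro!: derivative_eq_intros intro: has_field_derivative_at_within)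
      have "\<bar>f2 (u, s) - f2 z\<bar> \<le> M * (\<bar>u - x\<bar> + \<bar>s - y\<bar>)" using L2[OF sd z] by (simp add: zz(1))
      also have "\<dots> \<le> M * (2 * N)" using s1 N M0 by (intro mult_left_mono) auto
      finally show "norm (f2 (u, s) - f2 z) \<le> M * (2 * N)" by simp
    qed auto
    have "(M * N) * \<bar>u - x\<bar> \<le> M * N * N" "(M * (2 * N)) * \<bar>v - y\<bar> \<le> M * (2 * N) * N"
      using N N0 M0 by (intro mult_left_mono mult_nonneg_nonneg; simp)+
    then have "\<bar>f (u, v) - ((f z - f1 z * x - f2 z * y) + f1 z * u + f2 z * v)\<bar> \<le> 3 * (M * N * N)"
      using 1 2 unfolding zz(1) real_norm_def by (simp add: algebra_simps abs_le_iff)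
    also have "\<dots> \<le> 4 * M * N\<^sup>2" using M0 by (simp add: power2_eq_square)
    finally show ?thesis unfolding N_def by (simp add: ww(1))
  qed
  then show ?thesis by blast
qed

text \<open>On a cell that misses the boundary of \<open>\<Omega>\<close> only one of the two pieces is seen.\<close>

lemma interior_one_side:
  assumes "convex S" "misses (frontier \<Omega>) S"
  shows "interior S \<subseteq> \<Omega> \<or> interior S \<inter> \<Omega> = {}"
proof -
  have "connected (interior S)" using assms(1) by (intro convex_connected convex_interior)
  moreover have "interior S \<inter> frontier \<Omega> = {}" using assms(2) by (simp add: misses_def)
  ultimately show ?thesis using connected_Int_frontier[of "interior S" \<Omega>] by blast
qed

lemma cartoon_bound:
  assumes "partials_bounded f1 M" "partials_bounded f2 M" "z \<in> unit_dom"
  shows "\<bar>f1 z * indicator \<Omega> z + f2 z * indicator (unit_dom - \<Omega>) z\<bar> \<le> M"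
proof -
  have "\<bar>f1 z\<bar> \<le> M" "\<bar>f2 z\<bar> \<le> M"
    using assms unfolding partials_bounded_def by (cases z; force)+
  then show ?thesis using assms(3) by (auto simp: indicator_def)
qed

text \<open>If the square of the error is not integrable, its norm is zero by convention.\<close>

lemma L2_norm_bound:
  assumes U: "U \<in> lmeasurable" "measure lebesgue U \<le> \<alpha>" and e: "0 \<le> e" "0 \<le> M"
    and N: "negligible N" and h: "\<And>x. x \<in> unit_dom \<Longrightarrow> x \<notin> N \<Longrightarrow> \<bar>h x\<bar> \<le> e \<or> x \<in> U \<and> \<bar>h x\<bar> \<le> M"
  shows "L2_norm h \<le> sqrt (e\<^sup>2 + M\<^sup>2 * \<alpha>)"
proof -
  have ud: "unit_dom \<in> lmeasurable" "measure lebesgue unit_dom \<le> 1"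
  proof -
    have "unit_dom \<subseteq> {(x, y). 0 \<le> x \<and> x \<le> 1 \<and> 0 \<le> y \<and> y \<le> 0 + (1::real)}" by (auto simp: unit_dom_def)
    then show "measure lebesgue unit_dom \<le> 1" using sheared_strip[of "\<lambda>_. 0" 0 1 1 unit_dom] by simp
    have "bounded unit_dom" "open unit_dom" unfolding unit_dom_def by (intro bounded_Times open_Times; simp)+
    then show "unit_dom \<in> lmeasurable" by (rule lmeasurable_open)
  qed
  have a0: "0 \<le> \<alpha>" using U(2) measure_nonneg[of lebesgue U] by linarith
  have "(LINT x:unit_dom|lebesgue. (h x)\<^sup>2) \<le> e\<^sup>2 + M\<^sup>2 * \<alpha>"
  proof (cases "integrable lebesgue (\<lambda>x. indicator unit_dom x *\<^sub>R (h x)\<^sup>2)")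
    case False
    then show ?thesis using a0 by (simp add: set_lebesgue_integral_def not_integrable_integral_eq)
  next
    case True
    let ?g = "\<lambda>x. e\<^sup>2 * indicator unit_dom x + M\<^sup>2 * indicator U x :: real"
    have ig: "integrable lebesgue ?g" using ud U
      by (intro Bochner_Integration.integrable_add Bochner_Integration.integrable_mult_right integrable_real_indicator) (auto simp: fmeasurable_def)
    have "(LINT x:unit_dom|lebesgue. (h x)\<^sup>2) \<le> (LINT x|lebesgue. ?g x)"
      unfolding set_lebesgue_integral_def
    proof (rule integral_mono_AE[OF True ig])
      have "AE x in lebesgue. x \<notin> N" using N by (simp add: negligible_iff_null_sets AE_not_in)
      then show "AE x in lebesgue. indicator unit_dom x *\<^sub>R (h x)\<^sup>2 \<le> ?g x"
      proof eventually_elim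
        fix x assume x: "x \<notin> N"
        show "indicator unit_dom x *\<^sub>R (h x)\<^sup>2 \<le> ?g x"
        proof (cases "x \<in> unit_dom")
          case True
          from h[OF this x] show ?thesis
          proof
            assume "\<bar>h x\<bar> \<le> e"
            then have "\<bar>h x\<bar>\<^sup>2 \<le> e\<^sup>2" by (intro power_mono) auto
            then have "(h x)\<^sup>2 \<le> e\<^sup>2" by simp
            moreover have "0 \<le> M\<^sup>2" by simp
            ultimately have "(h x)\<^sup>2 \<le> e\<^sup>2 + M\<^sup>2" by linarith
            then show ?thesis using True \<open>(h x)\<^sup>2 \<le> e\<^sup>2\<close> by (simp add: indicator_def)
          next
            assume "x \<in> U \<and> \<bar>h x\<bar> \<le> M"
            then have "\<bar>h x\<bar>\<^sup>2 \<le> M\<^sup>2" "x \<in> U" by (blast intro: power_mono abs_ge_zero)+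
            moreover have "0 \<le> e\<^sup>2" by simp
            ultimately have "(h x)\<^sup>2 \<le> e\<^sup>2 + M\<^sup>2" by (simp add: add_increasing)
            then show ?thesis using True \<open>x \<in> U\<close> by simp
          qed
        qed (simp add: indicator_def)
      qed
    qed
    also have "(LINT x|lebesgue. ?g x) = e\<^sup>2 * measure lebesgue unit_dom + M\<^sup>2 * measure lebesgue U"
      using ud U by (subst Bochner_Integration.integral_add) (auto simp: fmeasurable_def)
    also have "\<dots> \<le> e\<^sup>2 * 1 + M\<^sup>2 * \<alpha>" using ud U by (intro add_mono mult_left_mono) auto
    finally show ?thesis by simp
  qed
  then show ?thesis unfolding L2_norm_def by (rule real_sqrt_le_mono)
qed



section \<open>The rate of approximation\<close>

lemma unit_dom_subset: "unit_dom \<subseteq> hull_of unit_cell"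
proof -
  have h: "hull_of unit_cell = region unit_cell" by (rule hull_region) (simp add: cr_def)
  show ?thesis unfolding h by (auto simp: unit_dom_def cr_def)
qed

lemma L2_norm_nonneg: "0 \<le> L2_norm h"
  unfolding L2_norm_def set_lebesgue_integral_def by (intro real_sqrt_ge_zero integral_nonneg) auto

lemma INF_approximants_le:
  assumes "\<phi> \<in> approximants N" "L2_norm (\<lambda>x. f x - \<phi> x) \<le> e"
  shows "(INF \<phi>\<in>approximants N. L2_norm (\<lambda>x. f x - \<phi> x)) \<le> e"
proof -
  have "bdd_below ((\<lambda>\<phi>. L2_norm (\<lambda>x. f x - \<phi> x)) ` approximants N)"
    by (rule bdd_belowI2[of _ 0]) (rule L2_norm_nonneg)
  from cINF_lower[OF this assms(1)] assms(2) show ?thesis by (rule order_trans)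
qed

lemma cell_affine:
  assumes p: "partials_bounded f1 M" "partials_bounded f2 M" and A: "accurate (frontier \<Omega>) e (hull_of Q)" and M: "0 \<le> M"
  shows "\<exists>a b c. \<forall>x\<in>interior (hull_of Q) \<inter> unit_dom.
     \<bar>f1 x * indicator \<Omega> x + f2 x * indicator (unit_dom - \<Omega>) x - (a + b * fst x + c * snd x)\<bar> \<le> 4 * M * e\<^sup>2"
proof (cases "interior (hull_of Q) \<inter> unit_dom = {}")
  case False
  then obtain z where z: "z \<in> interior (hull_of Q)" "z \<in> unit_dom" by blast
  have err: "4 * M * (norm (w - z))\<^sup>2 \<le> 4 * M * e\<^sup>2" if "w \<in> interior (hull_of Q)" for w
  proof -
    have "norm (w - z) \<le> e" using A that z(1) interior_subset unfolding accurate_def by blast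
    then have "(norm (w - z))\<^sup>2 \<le> e\<^sup>2" by (intro power_mono) auto
    then show ?thesis using M by (intro mult_left_mono) auto
  qed
  have side: "interior (hull_of Q) \<subseteq> \<Omega> \<or> interior (hull_of Q) \<inter> \<Omega> = {}"
    using A by (intro interior_one_side) (auto simp: accurate_def)
  obtain a b c where 1: "\<forall>w\<in>unit_dom. \<bar>f1 w - (a + b * fst w + c * snd w)\<bar> \<le> 4 * M * (norm (w - z))\<^sup>2"
    using affine_approximation[OF p(1) z(2)] by blast
  obtain a' b' c' where 2: "\<forall>w\<in>unit_dom. \<bar>f2 w - (a' + b' * fst w + c' * snd w)\<bar> \<le> 4 * M * (norm (w - z))\<^sup>2"
    using affine_approximation[OF p(2) z(2)] by blast
  from side show ?thesis
  proof
    assume s: "interior (hull_of Q) \<subseteq> \<Omega>"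
    have "\<bar>f1 x * indicator \<Omega> x + f2 x * indicator (unit_dom - \<Omega>) x - (a + b * fst x + c * snd x)\<bar> \<le> 4 * M * e\<^sup>2"
      if x: "x \<in> interior (hull_of Q)" "x \<in> unit_dom" for x
    proof -
      have "x \<in> \<Omega>" using s x by blast
      then show ?thesis using bspec[OF 1 x(2)] err[OF x(1)] by simp
    qed
    then show ?thesis by blast
  next
    assume s: "interior (hull_of Q) \<inter> \<Omega> = {}"
    have "\<bar>f1 x * indicator \<Omega> x + f2 x * indicator (unit_dom - \<Omega>) x - (a' + b' * fst x + c' * snd x)\<bar> \<le> 4 * M * e\<^sup>2"
      if x: "x \<in> interior (hull_of Q)" "x \<in> unit_dom" for x
    proof -
      have "x \<notin> \<Omega>" using s x by blast
      then show ?thesis using bspec[OF 2 x(2)] err[OF x(1)] x(2) by simp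
    qed
    then show ?thesis by blast
  qed
qed blast

text \<open>The approximant is affine with quadratic error on the cells that miss the boundary, and \<open>0\<close> on the
  others, where the error is at most \<open>M\<close> on a set of area \<open>\<alpha>\<close>. The edges of the cells are negligible.\<close>

lemma piecewise_approximation:
  assumes p: "partials_bounded f1 M" "partials_bounded f2 M"
    and iso: "isolates (accurate (frontier \<Omega>) e) unit_cell k \<alpha>" and k: "k \<le> real N" and M: "0 \<le> M"
  shows "\<exists>\<phi>\<in>approximants N. L2_norm (\<lambda>x. f1 x * indicator \<Omega> x + f2 x * indicator (unit_dom - \<Omega>) x - \<phi> x)
     \<le> sqrt ((4 * M * e\<^sup>2)\<^sup>2 + M\<^sup>2 * \<alpha>)"
proof -
  let ?f = "\<lambda>x. f1 x * indicator \<Omega> x + f2 x * indicator (unit_dom - \<Omega>) x"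
  obtain n T U where T: "real n \<le> k" "partition_after n T" "U \<in> lmeasurable" "measure lebesgue U \<le> \<alpha>"
     "\<forall>R\<in>T. accurate (frontier \<Omega>) e (hull_of R) \<or> hull_of R \<subseteq> U"
    using isolates_partition[OF iso] by blast
  have tile: "finite T" "hull_of unit_cell \<subseteq> (\<Union>Q\<in>T. hull_of Q)"
    "\<And>Q R. Q \<in> T \<Longrightarrow> R \<in> T \<Longrightarrow> Q \<noteq> R \<Longrightarrow> interior (hull_of Q) \<inter> interior (hull_of R) = {}"
    using partition_tiles[OF T(2)] by blast+
  define good where "good Q g \<longleftrightarrow> (\<exists>a b c. \<forall>x. g x = a + b * fst x + c * snd x) \<and>
     (\<forall>x\<in>interior (hull_of Q) \<inter> unit_dom. \<bar>?f x - g x\<bar> \<le> 4 * M * e\<^sup>2 \<or> x \<in> U \<and> \<bar>?f x - g x\<bar> \<le> M)"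
    for Q and g :: "point \<Rightarrow> real"
  have "\<exists>g. good Q g" if "Q \<in> T" for Q
  proof -
    from T(5) that consider "accurate (frontier \<Omega>) e (hull_of Q)" | "hull_of Q \<subseteq> U" by blast
    then show ?thesis
    proof cases
      case 1
      obtain a b c where "\<forall>x\<in>interior (hull_of Q) \<inter> unit_dom. \<bar>?f x - (a + b * fst x + c * snd x)\<bar> \<le> 4 * M * e\<^sup>2"
        using cell_affine[OF p 1 M] by blast
      then show ?thesis unfolding good_def by (intro exI[of _ "\<lambda>x. a + b * fst x + c * snd x"]) blast
    next
      case 2
      then have "interior (hull_of Q) \<subseteq> U" using interior_subset by blast
      then have "good Q (\<lambda>x. 0 + 0 * fst x + 0 * snd x)"
        unfolding good_def using cartoon_bound[OF p, of _ \<Omega>]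
        by (intro conjI exI[of _ "0 :: real"] ballI disjI2) auto
      then show ?thesis by blast
    qed
  qed
  then obtain G where G: "\<And>Q. Q \<in> T \<Longrightarrow> good Q (G Q)" by metis
  define \<phi> where "\<phi> x = G (SOME Q. Q \<in> T \<and> x \<in> interior (hull_of Q)) x" for x
  \<comment> \<open>Interiors are disjoint, so the choice is unique there.\<close>
  have phi: "\<phi> x = G Q x" if "Q \<in> T" "x \<in> interior (hull_of Q)" for Q x
  proof -
    have "(SOME Q. Q \<in> T \<and> x \<in> interior (hull_of Q)) = Q"
      by (rule some_equality) (use that tile(3) in blast)+
    then show ?thesis by (simp add: \<phi>_def)
  qed
  have "\<phi> \<in> piecewise_affine T"
    unfolding piecewise_affine_def
  proof (intro CollectI ballI)
    fix Q assume Q: "Q \<in> T"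
    obtain a b c where "\<forall>x. G Q x = a + b * fst x + c * snd x" using G[OF Q] unfolding good_def by blast
    then show "\<exists>a b c. \<forall>(x, y)\<in>interior (hull_of Q). \<phi> (x, y) = a + b * x + c * y"
      using phi[OF Q] by (intro exI[of _ a] exI[of _ b] exI[of _ c]) auto
  qed
  moreover have "n \<le> N" using T(1) k by simp
  ultimately have "\<phi> \<in> approximants N" using T(2) unfolding approximants_def by blast
  moreover have "L2_norm (\<lambda>x. ?f x - \<phi> x) \<le> sqrt ((4 * M * e\<^sup>2)\<^sup>2 + M\<^sup>2 * \<alpha>)"
  proof (rule L2_norm_bound[OF T(3,4)])
    show "negligible (\<Union>Q\<in>T. frontier (hull_of Q))"
      using tile(1) by (intro negligible_Union) (auto intro!: negligible_convex_frontier)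
    fix x assume x: "x \<in> unit_dom" "x \<notin> (\<Union>Q\<in>T. frontier (hull_of Q))"
    then obtain Q where Q: "Q \<in> T" "x \<in> hull_of Q" using unit_dom_subset tile(2) by blast
    then have "x \<in> interior (hull_of Q)" using x(2) closure_subset[of "hull_of Q"] unfolding frontier_def by blast
    then show "\<bar>?f x - \<phi> x\<bar> \<le> 4 * M * e\<^sup>2 \<or> x \<in> U \<and> \<bar>?f x - \<phi> x\<bar> \<le> M"
      using G[OF Q(1)] phi[OF Q(1)] x(1) unfolding good_def by simp
  qed (use M in auto)
  ultimately show ?thesis by blast
qed

lemma trivial_approximation:
  assumes p: "partials_bounded f1 M" "partials_bounded f2 M" and M: "0 \<le> M"
  shows "\<exists>\<phi>\<in>approximants N. L2_norm (\<lambda>x. f1 x * indicator \<Omega> x + f2 x * indicator (unit_dom - \<Omega>) x - \<phi> x) \<le> M"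
proof -
  have "(\<lambda>_. 0) \<in> piecewise_affine {unit_cell}"
    unfolding piecewise_affine_def by (auto intro!: exI[of _ 0])
  then have "(\<lambda>_. 0) \<in> approximants N" using partition_after.initial unfolding approximants_def by blast
  moreover have "L2_norm (\<lambda>x. f1 x * indicator \<Omega> x + f2 x * indicator (unit_dom - \<Omega>) x - 0) \<le> sqrt (M\<^sup>2 + M\<^sup>2 * 0)"
    by (rule L2_norm_bound[of "{}" _ _ _ "{}"]) (use cartoon_bound[OF p, of _ \<Omega>] M in auto)
  ultimately show ?thesis using M by (intro bexI[of _ "\<lambda>_. 0"]) auto
qed

text \<open>The number of cells is \<open>4 ^ j * j\<close> up to constants, the error \<open>4 powr - j\<close>; the logarithm in the
  rate is this factor \<open>j\<close>.\<close>

lemma level_for_budget: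
  assumes C: "1 \<le> C" and N: "2 \<le> N" "C * 4 ^ J * (12 * real J + 1) \<le> real N"
  shows "\<exists>j\<ge>J. C * 4 ^ j * (12 * real j + 1) \<le> real N \<and> (1 / 2 ^ j)\<^sup>2 \<le> 152 * C * (ln (real N) / real N)"
proof -
  let ?P = "\<lambda>j. C * 4 ^ j * (12 * real j + 1) \<le> real N"
  have four: "4 ^ j \<le> real N" if "?P j" for j
  proof -
    have "1 * 4 ^ j * 1 \<le> C * 4 ^ j * (12 * real j + 1)" using C by (intro mult_mono) auto
    then have "4 ^ j \<le> C * 4 ^ j * (12 * real j + 1)" by (simp only: mult_1 mult_1_right)
    then show ?thesis using that by (rule order_trans)
  qed
  have bnd: "j \<le> N" if "?P j" for j
  proof -
    have "real j \<le> 4 ^ j" using of_nat_less_two_power[of j, where 'a = real] power_mono[of 2 "4::real" j] by linarith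
    then show ?thesis using four[OF that] by linarith
  qed
  define j where "j = (GREATEST j. ?P j)"
  have j: "?P j" unfolding j_def by (rule GreatestI_nat[of ?P J N]) (use N(2) bnd in auto)
  have "J \<le> j" unfolding j_def by (rule Greatest_le_nat[of ?P J N]) (use N(2) bnd in auto)
  have "\<not> ?P (Suc j)" using Greatest_le_nat[of ?P "Suc j" N] bnd unfolding j_def by fastforce
  then have less: "real N < C * (4 * 4 ^ j) * (12 * real j + 13)" by (simp add: algebra_simps)
  have ln2: "1 / 2 \<le> ln (real N)"
  proof -
    have "1 / 2 \<le> ln (2::real)" using ln2_ge_two_thirds by linarith
    also have "\<dots> \<le> ln (real N)" using N(1) by simp
    finally show ?thesis .
  qed
  have "real j \<le> ln (real N)"
  proof -
    have "1 \<le> ln (4::real)"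
    proof -
      have "exp 1 \<le> (4::real)" using exp_le by linarith
      then show ?thesis by (simp add: ln_ge_iff)
    qed
    then have "real j * 1 \<le> real j * ln 4" by (intro mult_left_mono) auto
    also have "\<dots> = ln (4 ^ j)" by (simp add: ln_realpow)
    also have "\<dots> \<le> ln (real N)" using four[OF j] N(1) by simp
    finally show ?thesis by simp
  qed
  then have "12 * real j + 13 \<le> 38 * ln (real N)" using ln2 by linarith
  then have "C * (4 * 4 ^ j) * (12 * real j + 13) \<le> C * (4 * 4 ^ j) * (38 * ln (real N))" using C by (intro mult_left_mono) auto
  then have "real N \<le> 152 * C * ln (real N) * 4 ^ j" using less by (simp add: mult_ac)
  then have "1 / 4 ^ j \<le> 152 * C * (ln (real N) / real N)" using N(1) by (simp add: field_simps)
  moreover have "(1 / 2 ^ j)\<^sup>2 = (1::real) / 4 ^ j"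
    by (simp add: power_divide power_mult[symmetric] power2_eq_square power_mult_distrib[symmetric])
  ultimately show ?thesis using j \<open>J \<le> j\<close> by (intro exI[of _ j]) simp
qed

theorem theorem4p3:
  fixes \<kappa> L M \<omega> :: real
  assumes "\<kappa> > 0" "L > 0" "M > 0" "\<omega> > 0"
  shows "\<exists>C::real. \<forall>f \<in> cartoon_class \<kappa> L M \<omega>. \<forall>N::nat. N \<ge> 2 \<longrightarrow>
           (INF \<phi>\<in>approximants N. L2_norm (\<lambda>x. f x - \<phi> x)) \<le> C * ln (real N) * inverse (real N)"
proof -
  \<comment> \<open>\<open>\<rho>\<close> is the size of sets to which \<open>local_tangent_bound\<close> applies; squares of side \<open>2 ^ -J\<close> have
    diameter at most \<open>\<rho>\<close>.\<close>
  define c where "c = 27 * max 1 \<kappa>"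
  define \<rho> where "\<rho> = min (\<omega> / 2 * (1 / (256 * max 1 \<kappa>)) ^ 40) (1 / (64 * max 1 \<kappa>))"
  have rho: "0 < \<rho>" "\<rho> \<le> \<omega> / 2 * (1 / (256 * max 1 \<kappa>)) ^ 40" "\<rho> \<le> 1 / (64 * max 1 \<kappa>)"
  proof -
    have "0 < 1 / (256 * max 1 \<kappa>)" by simp
    then have "0 < (1 / (256 * max 1 \<kappa>)) ^ 40" by (rule zero_less_power)
    then show "0 < \<rho>" using assms(4) by (simp add: \<rho>_def)
  qed (auto simp: \<rho>_def)
  have c: "1 \<le> c" by (simp add: c_def)
  obtain J where J: "2 * (1 / 2 ^ J) \<le> \<rho>"
  proof -
    obtain J where "(1 / 2) ^ J < \<rho> / 2" using real_arch_pow_inv[of "\<rho> / 2" "1 / 2"] rho(1) by auto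
    then show ?thesis using that[of J] by (simp add: power_one_over)
  qed
  define C1 where "C1 = 213 * 4 ^ J * c" define A where "A = 1640 * 4 ^ J * c\<^sup>2"
  define N0 where "N0 = C1 * 4 ^ J * (12 * real J + 1)"
  have C1: "1 \<le> C1"
  proof -
    have "1 * 1 * 1 \<le> 213 * 4 ^ J * c" using c by (intro mult_mono) auto
    then show ?thesis by (simp add: C1_def)
  qed
  have A0: "0 \<le> A" by (simp add: A_def)
  define C where "C = M * sqrt (256 + A) * (152 * C1) + 2 * M * N0"
  have N0: "0 \<le> N0" using C1 by (simp add: N0_def)
  show ?thesis
  proof (intro exI[of _ C] ballI allI impI)
    fix f and N :: nat assume "f \<in> cartoon_class \<kappa> L M \<omega>" and N: "2 \<le> N"
    then obtain f1 f2 \<Omega> where f: "f = (\<lambda>x. f1 x * indicator \<Omega> x + f2 x * indicator (unit_dom - \<Omega>) x)"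
      and \<Omega>: "\<Omega> \<subseteq> unit_dom" "\<Omega> \<in> simply_connected_C2_domains" "separation_width \<Omega> \<ge> ereal \<omega>"
        "curvature_le (frontier \<Omega> \<inter> unit_dom) \<kappa>" and p: "partials_bounded f1 M" "partials_bounded f2 M"
      unfolding cartoon_class_def by blast
    have M0: "0 \<le> M" using assms by simp
    let ?t = "ln (real N) / real N"
    have t0: "0 \<le> ?t" using N by simp
    have N1: "1 \<le> 2 * ln (real N)"
    proof -
      have "1 / 2 \<le> ln (2::real)" using ln2_ge_two_thirds by linarith
      also have "\<dots> \<le> ln (real N)" using N by simp
      finally show ?thesis by simp
    qed
    have "\<exists>\<phi>\<in>approximants N. L2_norm (\<lambda>x. f x - \<phi> x) \<le> C * ?t"
    \<comment> \<open>For small \<open>N\<close> the approximant \<open>0\<close> will do.\<close>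
    proof (cases "N0 \<le> real N")
      case False
      have "real N * M \<le> N0 * (M * (2 * ln (real N)))"
        using False N1 N0 M0 by (intro mult_mono) (auto intro: mult_left_le_imp_le simp: mult_le_cancel_left1)
      then have "M \<le> 2 * M * N0 * ?t" using N by (simp add: field_simps)
      also have "\<dots> \<le> C * ?t" using t0 M0 C1 A0 by (intro mult_right_mono) (auto simp: C_def)
      finally show ?thesis using trivial_approximation[OF p M0, of N \<Omega>] unfolding f by (meson order_trans)
    next
      case True
      have "ereal (\<omega> / 2) < ereal \<omega>" using assms(4) by simp
      then have "ereal (\<omega> / 2) < separation_width \<Omega>" using \<Omega>(3) by (rule less_le_trans)
      \<comment> \<open>The supremum need not be attained, hence a radius above \<open>\<omega> / 2\<close>.\<close>
      then obtain \<zeta> where z: "0 < \<zeta>" "\<omega> / 2 < \<zeta>"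
        "\<And>x. x \<in> frontier \<Omega> \<Longrightarrow> (frontier \<Omega> \<inter> ball x \<zeta>) homeomorphic {0<..<1::real}"
        unfolding separation_width_def less_Sup_iff
        by (elim bexE imageE CollectE conjE) (rule that, simp_all only: ereal_less, simp_all)
      interpret smooth_domain \<Omega> \<kappa>
        using \<Omega> assms(1) by unfold_locales (auto simp: simply_connected_C2_domains_def)
      have tan: "tangent_bound (frontier \<Omega> \<inter> {X..X + 1 / 2 ^ J} \<times> {Y..Y + 1 / 2 ^ J}) c \<or>
         tangent_bound (prod.swap ` (frontier \<Omega> \<inter> {X..X + 1 / 2 ^ J} \<times> {Y..Y + 1 / 2 ^ J})) c" for X Y
        unfolding c_def
      proof (rule local_tangent_bound[OF z(1,3) less_imp_le[OF z(2)] rho(2,3)])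
        fix u v :: point assume uv: "u \<in> {X..X + 1 / 2 ^ J} \<times> {Y..Y + 1 / 2 ^ J}" "v \<in> {X..X + 1 / 2 ^ J} \<times> {Y..Y + 1 / 2 ^ J}"
        then have "\<bar>fst (v - u)\<bar> \<le> 1 / 2 ^ J" "\<bar>snd (v - u)\<bar> \<le> 1 / 2 ^ J" by (auto simp: abs_le_iff)
        moreover have "norm (v - u) \<le> \<bar>fst (v - u)\<bar> + \<bar>snd (v - u)\<bar>"
          unfolding norm_prod_def real_norm_def by (metis power2_abs real_sqrt_abs sqrt_sum_squares_le_sum_abs)
        ultimately show "norm (v - u) \<le> \<rho>" using J by linarith
      qed
      obtain j where j: "J \<le> j" "C1 * 4 ^ j * (12 * real j + 1) \<le> real N" "(1 / 2 ^ j)\<^sup>2 \<le> 152 * C1 * ?t"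
        using level_for_budget[OF C1 N] True unfolding N0_def by blast
      define b where "b = (1::real) / 2 ^ j"
      have "isolates (accurate (frontier \<Omega>) (2 / 2 ^ j)) unit_cell (C1 * 4 ^ j * (12 * real j + 1)) (A * b ^ 4)"
        using isolate_curve[OF c j(1) tan] unfolding C1_def A_def b_def .
      from piecewise_approximation[OF p this j(2) M0]
      obtain \<phi> where \<phi>: "\<phi> \<in> approximants N" "L2_norm (\<lambda>x. f x - \<phi> x) \<le> sqrt ((4 * M * (2 / 2 ^ j)\<^sup>2)\<^sup>2 + M\<^sup>2 * (A * b ^ 4))"
        unfolding f by blast
      have "(4 * M * (2 / 2 ^ j)\<^sup>2)\<^sup>2 + M\<^sup>2 * (A * b ^ 4) = (M * b\<^sup>2)\<^sup>2 * (256 + A)"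
      proof -
        have "2 / 2 ^ j = 2 * b" by (simp add: b_def)
        then show ?thesis by (simp add: power_mult_distrib algebra_simps power_mult[symmetric])
      qed
      then have "L2_norm (\<lambda>x. f x - \<phi> x) \<le> M * b\<^sup>2 * sqrt (256 + A)"
        using \<phi>(2) M0 by (simp add: real_sqrt_mult)
      also have "\<dots> \<le> M * (152 * C1 * ?t) * sqrt (256 + A)"
        using j(3) M0 A0 unfolding b_def by (intro mult_right_mono mult_left_mono) auto
      also have "\<dots> = M * sqrt (256 + A) * (152 * C1) * ?t" by simp
      also have "\<dots> \<le> C * ?t" using t0 M0 N0 by (intro mult_right_mono) (auto simp: C_def)
      finally show ?thesis using \<phi>(1) by blast
    qed
    then obtain \<phi> where \<phi>: "\<phi> \<in> approximants N" "L2_norm (\<lambda>x. f x - \<phi> x) \<le> C * ?t" by blast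
    have "C * ?t = C * ln (real N) * inverse (real N)" by (simp add: divide_inverse)
    then show "(INF \<phi>\<in>approximants N. L2_norm (\<lambda>x. f x - \<phi> x)) \<le> C * ln (real N) * inverse (real N)"
      using INF_approximants_le[OF \<phi>] by simp
  qed
qed

end
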